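(* Let $n\geq 2$, let $0<\alpha<2$ and let $f\in \dot{H}^{-\frac{\alpha}{2}}(\mathbb{R}^n)$ be a given external force. Then there exists $\theta\in \dot{H}^{\frac{\alpha}{2}}(\mathbb{R}^n)$ that satisfies in the weak sense the stationary fractional quasi-geostrophic equation $$(-\Delta)^{\frac{\alpha}{2}}\theta+\mathbb{A}_{[\theta]}\cdot\vec{\nabla}\theta-f=0,\qquad x\in\mathbb{R}^n.$$
   Context: Functions are real valued on $\mathbb{R}^n$. The operator $(-\Delta)^{\frac{s}{2}}$ is the Fourier multiplier with symbol $|\xi|^{s}$, and $\|g\|_{\dot H^{s}(\mathbb{R}^n)}=\|(-\Delta)^{\frac{s}{2}}g\|_{L^2(\mathbb{R}^n)}$. Elements of $\dot H^{\frac{\alpha}{2}}(\mathbb{R}^n)$ are identified with functions via the Sobolev embedding $\dot H^{\frac{\alpha}{2}}(\mathbb{R}^n)\subset L^{\frac{2n}{n-\alpha}}(\mathbb{R}^n)$. The vector $\mathbb{A}_{[\theta]}=[A_1(\theta),\dots,A_n(\theta)]$ is given by fixed operators $A_1,\dots,A_n$, assumed to be singular integral operators (in particular linear) such that, for all $1<p<+\infty$ and all $\theta\in L^p(\mathbb{R}^n)$, $\|\mathbb{A}_{[\theta]}\|_{L^p}\leq C_{\mathbb{A}}\|\theta\|_{L^p}$; moreover $\mathbb{A}_{[\theta]}$ is assumed to be divergence free: $\mathrm{div}(\mathbb{A}_{[\theta]})=0$. Since $\mathrm{div}(\mathbb{A}_{[\theta]})=0$, one has $\mathbb{A}_{[\theta]}\cdot\vec\nabla\theta=\mathrm{div}(\mathbb{A}_{[\theta]}\theta)$,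 and "weak sense" means that the equation $(-\Delta)^{\frac{\alpha}{2}}\theta+\mathrm{div}(\mathbb{A}_{[\theta]}\theta)-f=0$ holds when tested against every function in $\mathcal{C}^\infty_0(\mathbb{R}^n)$. *)

theory Defs
  imports "HOL-Analysis.Analysis"
begin

section \<open>Lebesgue spaces\<close>

text \<open>Elements are Borel representatives of the usual classes; identities between them are
  stated almost everywhere or under an integral.\<close>

definition Lp :: "real \<Rightarrow> ('a::euclidean_space \<Rightarrow> 'b::real_normed_vector) set" where
  "Lp p = {g. g \<in> borel_measurable borel \<and> integrable lborel (\<lambda>x. norm (g x) powr p)}"

definition Lp_norm :: "real \<Rightarrow> ('a::euclidean_space \<Rightarrow> 'b::real_normed_vector) \<Rightarrow> real" where
  "Lp_norm p g = (\<integral>x. norm (g x) powr p \<partial>lborel) powr (1 / p)"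

section \<open>Smooth functions, test functions, Schwartz functions\<close>

definition partial :: "'n::finite \<Rightarrow> (real^'n \<Rightarrow> 'b::real_normed_vector) \<Rightarrow> real^'n \<Rightarrow> 'b" where
  "partial i g x = frechet_derivative g (at x) (axis i 1)"

text \<open>Iterated partial derivatives are indexed by the list of directions of differentiation,
  rather than by multi-indices.\<close>

fun iter_partial :: "'n::finite list \<Rightarrow> (real^'n \<Rightarrow> 'b::real_normed_vector) \<Rightarrow> real^'n \<Rightarrow> 'b" where
  "iter_partial [] g = g"
| "iter_partial (i # is) g = partial i (iter_partial is g)"

definition smooth :: "(real^'n::finite \<Rightarrow> 'b::real_normed_vector) \<Rightarrow> bool" where
  "smooth g \<longleftrightarrow> (\<forall>is. iter_partial is g differentiable_on UNIV)"

definition support :: "(real^'n::finite \<Rightarrow> 'b::real_normed_vector) \<Rightarrow> (real^'n) set" where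
  "support g = closure {x. g x \<noteq> 0}"

definition test_functions :: "(real^'n::finite \<Rightarrow> real) set" where
  "test_functions = {\<phi>. smooth \<phi> \<and> compact (support \<phi>)}"

definition schwartz :: "(real^'n::finite \<Rightarrow> complex) set" where
  "schwartz = {\<phi>. smooth \<phi> \<and>
     (\<forall>is m. bounded (range (\<lambda>x. norm x ^ m * norm (iter_partial is \<phi> x))))}"

definition schwartz_seminorm :: "nat \<Rightarrow> (real^'n::finite \<Rightarrow> complex) \<Rightarrow> real" where
  "schwartz_seminorm N \<phi> =
     Sup {(1 + norm x) ^ N * norm (iter_partial is \<phi> x) | is x. length is \<le> N}"

section \<open>Tempered distributions and the Fourier transform\<close>

text \<open>A distribution is a functional on complex-valued functions, of which only the values on
  Schwartz functions matter.\<close>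

type_synonym 'n distr = "(real^'n \<Rightarrow> complex) \<Rightarrow> complex"

definition tempered :: "'n::finite distr \<Rightarrow> bool" where
  "tempered T \<longleftrightarrow>
     (\<forall>\<phi>\<in>schwartz. \<forall>\<psi>\<in>schwartz. \<forall>a b.
        T (\<lambda>x. a * \<phi> x + b * \<psi> x) = a * T \<phi> + b * T \<psi>) \<and>
     (\<exists>N C. \<forall>\<phi>\<in>schwartz. norm (T \<phi>) \<le> C * schwartz_seminorm N \<phi>)"

definition real_distr :: "'n::finite distr \<Rightarrow> bool" where
  "real_distr T \<longleftrightarrow> (\<forall>\<phi>\<in>schwartz. T (\<lambda>x. cnj (\<phi> x)) = cnj (T \<phi>))"

definition distr_of :: "(real^'n::finite \<Rightarrow> complex) \<Rightarrow> 'n distr" where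
  "distr_of g = (\<lambda>\<phi>. \<integral>x. g x * \<phi> x \<partial>lborel)"

definition fourier :: "(real^'n::finite \<Rightarrow> complex) \<Rightarrow> real^'n \<Rightarrow> complex" where
  "fourier \<phi> \<xi> = (\<integral>x. exp (- \<i> * of_real (x \<bullet> \<xi>)) * \<phi> x \<partial>lborel)"

definition inv_fourier :: "(real^'n::finite \<Rightarrow> complex) \<Rightarrow> real^'n \<Rightarrow> complex" where
  "inv_fourier \<phi> x =
     of_real (1 / (2 * pi) ^ CARD('n)) * (\<integral>\<xi>. exp (\<i> * of_real (x \<bullet> \<xi>)) * \<phi> \<xi> \<partial>lborel)"

text \<open>The distributional Fourier transform of \<open>T\<close> is the function \<open>h\<close>. Integrability against
  all Schwartz functions makes \<open>h\<close> locally integrable; \<open>h\<close> is unique up to null sets.\<close>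

definition has_fourier_function :: "'n::finite distr \<Rightarrow> (real^'n \<Rightarrow> complex) \<Rightarrow> bool" where
  "has_fourier_function T h \<longleftrightarrow>
     h \<in> borel_measurable borel \<and>
     (\<forall>\<phi>\<in>schwartz. integrable lborel (\<lambda>\<xi>. h \<xi> * \<phi> \<xi>) \<and>
                   T (fourier \<phi>) = (\<integral>\<xi>. h \<xi> * \<phi> \<xi> \<partial>lborel))"

definition fourier_function :: "'n::finite distr \<Rightarrow> real^'n \<Rightarrow> complex" where
  "fourier_function T = (SOME h. has_fourier_function T h)"

section \<open>Fractional Laplacian and homogeneous Sobolev spaces\<close>

text \<open>\<open>frac_lap s T\<close> is the Fourier multiplier with symbol \<open>|\<xi>|\<^sup>s\<close>, that is
  \<open>(-\<Delta>)\<close> to the power \<open>s/2\<close>. It is meaningful under \<open>frac_lap_defined s T\<close>: the inverse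
  transform of \<open>|\<xi>|\<^sup>s h\<close>, with \<open>h\<close> the transform of \<open>T\<close>, is computed by duality.\<close>

definition frac_lap_defined :: "real \<Rightarrow> 'n::finite distr \<Rightarrow> bool" where
  "frac_lap_defined s T \<longleftrightarrow>
     tempered T \<and> (\<exists>h. has_fourier_function T h) \<and>
     (\<forall>\<phi>\<in>schwartz. integrable lborel
        (\<lambda>\<xi>. of_real (norm \<xi> powr s) * fourier_function T \<xi> * \<phi> \<xi>))"

definition frac_lap :: "real \<Rightarrow> 'n::finite distr \<Rightarrow> 'n distr" where
  "frac_lap s T =
     (\<lambda>\<phi>. \<integral>\<xi>. of_real (norm \<xi> powr s) * fourier_function T \<xi> * inv_fourier \<phi> \<xi> \<partial>lborel)"

text \<open>Distributions \<open>T\<close> whose Fourier transform is a function and whose norm, the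
  \<open>L\<^sup>2\<close> norm of \<open>frac_lap s T\<close>, is finite; used for \<open>|s| < n/2\<close>.\<close>

definition Hdot :: "real \<Rightarrow> ('n::finite distr) set" where
  "Hdot s = {T. frac_lap_defined s T \<and>
     (\<exists>G\<in>Lp 2. \<forall>\<phi>\<in>schwartz. frac_lap s T \<phi> = distr_of G \<phi>)}"

text \<open>For \<open>0 < s < n/2\<close>, real elements of \<open>Hdot s\<close>, seen as functions through the Sobolev
  embedding into the Lebesgue space of exponent \<open>2n/(n-2s)\<close>.\<close>

definition Hdot_fun :: "real \<Rightarrow> (real^'n::finite \<Rightarrow> real) set" where
  "Hdot_fun s = {\<theta>. \<theta> \<in> Lp (2 * real CARD('n) / (real CARD('n) - 2 * s)) \<and>
     distr_of (\<lambda>x. of_real (\<theta> x)) \<in> Hdot s}"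

section \<open>Singular integral operators\<close>

definition calderon_zygmund_kernel :: "(real^'n::finite \<Rightarrow> real^'n \<Rightarrow> real) \<Rightarrow> bool" where
  "calderon_zygmund_kernel K \<longleftrightarrow>
     (\<lambda>(x, y). K x y) \<in> borel_measurable borel \<and>
     (\<exists>C \<delta>. 0 < \<delta> \<and> \<delta> \<le> 1 \<and>
       (\<forall>x y. x \<noteq> y \<longrightarrow> \<bar>K x y\<bar> \<le> C / norm (x - y) ^ CARD('n)) \<and>
       (\<forall>x x' y. x \<noteq> y \<and> x' \<noteq> y \<and>
          norm (x - x') \<le> max (norm (x - y)) (norm (x' - y)) / 2 \<longrightarrow>
          \<bar>K x y - K x' y\<bar> \<le>
            C * norm (x - x') powr \<delta> / (norm (x - y) + norm (x' - y)) powr (real CARD('n) + \<delta>)) \<and>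
       (\<forall>x y y'. x \<noteq> y \<and> x \<noteq> y' \<and>
          norm (y - y') \<le> max (norm (x - y)) (norm (x - y')) / 2 \<longrightarrow>
          \<bar>K x y - K x y'\<bar> \<le>
            C * norm (y - y') powr \<delta> / (norm (x - y) + norm (x - y')) powr (real CARD('n) + \<delta>)))"

text \<open>The kernel determines the operator only off the support of the argument, so multiples of
  the identity and principal value convolutions are both covered.\<close>

definition singular_integral_operator ::
  "((real^'n::finite \<Rightarrow> real) \<Rightarrow> real^'n \<Rightarrow> real) \<Rightarrow> bool" where
  "singular_integral_operator T \<longleftrightarrow>
     (\<forall>p>1. \<forall>g\<in>Lp p. \<forall>h\<in>Lp p. \<forall>a b.
        AE x in lborel. T (\<lambda>x. a * g x + b * h x) x = a * T g x + b * T h x) \<and>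
     (\<exists>K. calderon_zygmund_kernel K \<and>
        (\<forall>g\<in>test_functions. AE x in lborel.
           x \<notin> support g \<longrightarrow> T g x = (\<integral>y. K x y * g y \<partial>lborel)))"

definition vec_op ::
  "('n::finite \<Rightarrow> (real^'n \<Rightarrow> real) \<Rightarrow> real^'n \<Rightarrow> real) \<Rightarrow> (real^'n \<Rightarrow> real) \<Rightarrow> real^'n \<Rightarrow> real^'n" where
  "vec_op A \<theta> x = (\<chi> i. A i \<theta> x)"

section \<open>Weak formulation\<close>

text \<open>Distributional divergence of a locally integrable vector field.\<close>

definition distr_div :: "(real^'n::finite \<Rightarrow> real^'n) \<Rightarrow> (real^'n \<Rightarrow> real) \<Rightarrow> real" where
  "distr_div v \<phi> = - (\<integral>x. v x \<bullet> (\<chi> i. partial i \<phi> x) \<partial>lborel)"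

text \<open>For \<open>\<theta> \<in> Hdot_fun (\<alpha>/2)\<close> and \<open>A\<close> bounded on Lebesgue spaces, \<open>\<theta>\<close> and \<open>vec_op A \<theta>\<close>
  have the same exponent \<open>2n/(n-\<alpha>) > 2\<close>, so their product is locally integrable.\<close>

definition weak_solution ::
  "real \<Rightarrow> ('n::finite \<Rightarrow> (real^'n \<Rightarrow> real) \<Rightarrow> real^'n \<Rightarrow> real) \<Rightarrow> 'n distr \<Rightarrow>
   (real^'n \<Rightarrow> real) \<Rightarrow> bool" where
  "weak_solution \<alpha> A f \<theta> \<longleftrightarrow>
     (\<forall>\<phi>\<in>test_functions.
        frac_lap \<alpha> (distr_of (\<lambda>x. of_real (\<theta> x))) (\<lambda>x. of_real (\<phi> x))
        + of_real (distr_div (\<lambda>x. \<theta> x *\<^sub>R vec_op A \<theta> x) \<phi>)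
        - f (\<lambda>x. of_real (\<phi> x)) = 0)"

end

theory Submission
  imports Defs "HOL-Probability.Probability" "HOL-Homology.Homology" "HOL-Library.Diagonal_Subsequence"
begin

text \<open>
  Testing the equation with its own solution removes the nonlinear term: for a divergence free field,
  \<open>\<integral> \<theta> A\<^bsub>[\<theta>]\<^esub> \<cdot> \<nabla>\<theta> = 1/2 \<integral> A\<^bsub>[\<theta>]\<^esub> \<cdot> \<nabla>(\<theta>\<^sup>2) = 0\<close>, which leaves
  the a priori bound of the norm of \<open>\<theta>\<close> of order \<open>s = \<alpha>/2\<close> by the dual norm of \<open>f\<close>. The bound is obtained
  by testing with \<open>\<theta>\<close> alone, and therefore survives a Galerkin approximation. On the span of finitely many
  test functions the equation, with a small multiple of the unknown coefficients added, asks for a zero of a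
  continuous vector field that points outward on a large sphere; such a zero exists because spheres are not
  contractible (\<open>outward_field_has_zero\<close>, \<open>galerkin\<close>).

  Let \<open>\<theta>\<^sub>N\<close> be the approximate solutions, bounded in the homogeneous Sobolev norm, and pass to a weakly
  convergent subsequence. By the Rellich theorem (\<open>rellich\<close>) it converges strongly in \<open>L\<^sup>2\<close> on every ball. The
  trilinear form \<open>b(u, w, \<phi>) = \<integral> w A\<^bsub>[u]\<^esub> \<cdot> \<nabla>\<phi>\<close> sees \<open>w\<close> and \<open>A\<^bsub>[u]\<^esub>\<close> only on the
  compact support of \<open>\<phi>\<close>. As \<open>A\<close> is nonlocal, strong convergence of \<open>\<theta>\<^sub>N\<close> on balls says nothing about \<open>A\<^bsub>[\<theta>\<^sub>N]\<^esub>\<close>; but in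
  \<open>b(\<theta>\<^sub>N, \<theta>\<^sub>N, \<phi>) = b(\<theta>\<^sub>N, \<theta>\<^sub>N - \<Theta>, \<phi>) + b(\<theta>\<^sub>N, \<Theta>, \<phi>)\<close> the first term is small because its second argument is, and
  the second one is a bounded linear functional of \<open>\<theta>\<^sub>N\<close>, for which weak convergence is enough
  (\<open>bform_converges\<close>).

  The whole compactness argument takes place inside the space of test functions, with the semi-inner product
  \<open>hip\<close> computed on the Fourier side. The Hilbert space is never completed: a bounded functional
  is represented up to a small error (\<open>approximate_riesz\<close>), weak convergence means convergence under all bounded
  functionals (\<open>weakly_cauchy\<close>), and the weak limit is produced by averages \<open>\<psi>\<^sub>m\<close> of the tails of the sequence that
  form a Cauchy sequence (\<open>mazur\<close>). Only this Cauchy sequence has to be given a limit function \<open>\<Theta>\<close>, and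
  \<open>Hdot_limit\<close> does so by Sobolev's inequality and the completeness of \<open>L\<^sup>p\<close> and \<open>L\<^sup>2\<close>. A linear functional has the same
  limit along \<open>\<psi>\<^sub>m\<close> as along \<open>\<theta>\<^sub>N\<close>, which identifies all limits in the equation.

  The analysis behind these steps consists of Fourier inversion and Plancherel's inequality, both obtained by
  damping with Gaussians, and of two estimates by the Sobolev norm, one for the part of \<open>u\<close> of frequency at most \<open>R\<close> and one for the rest
  (\<open>low_bound\<close>, \<open>high_bound_hip\<close>). Sobolev's inequality and Rellich's theorem both follow from these two
  estimates. The condition \<open>\<alpha> < 2\<close> gives \<open>s \<le> 1\<close>, so that the norm of order \<open>s\<close> is controlled by the function
  and its gradient, and a countable family of test functions that is dense in \<open>C\<^sup>1\<close> is dense for \<open>hip\<close> as well.\<close>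

section \<open>Calculus of iterated partial derivatives\<close>

lemma partial_eqI:
  assumes "(g has_derivative D) (at x)"
  shows "partial i g x = D (axis i 1)"
  unfolding partial_def using frechet_derivative_at[OF assms] by simp

lemma iter_partial_append: "iter_partial (is @ js) g = iter_partial is (iter_partial js g)"
  by (induction "is") auto

text \<open>Iterated derivatives of products and of Fourier transforms have no convenient closed form. It is
  enough to exhibit a class of differentiable functions that contains \<open>g\<close> and is stable under partial derivatives.\<close>

lemma smooth_coinduct:
  assumes "g \<in> X"
    and "\<And>g. g \<in> X \<Longrightarrow> g differentiable_on UNIV"
    and "\<And>g i. g \<in> X \<Longrightarrow> partial i g \<in> X"
  shows "iter_partial is g \<in> X" "smooth g"
proof -
  show *: "iter_partial is g \<in> X" for "is"
    by (induction "is") (use assms in auto)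
  show "smooth g" unfolding smooth_def using * assms(2) by blast
qed

lemma smooth_differentiable: "smooth g \<Longrightarrow> g differentiable_on UNIV"
  unfolding smooth_def by (metis iter_partial.simps(1))

lemma smooth_partial: "smooth g \<Longrightarrow> smooth (partial i g)"
  unfolding smooth_def
  by (metis iter_partial.simps iter_partial_append)

lemma smooth_has_derivative:
  "smooth g \<Longrightarrow> (g has_derivative frechet_derivative g (at x)) (at x)"
  using smooth_differentiable[of g] unfolding differentiable_on_def
  by (simp add: frechet_derivative_works)

lemma smooth_continuous: "smooth g \<Longrightarrow> continuous_on UNIV g"
  by (simp add: differentiable_imp_continuous_on smooth_differentiable)

lemma differentiable_on_UNIV_has_derivative:
  "g differentiable_on UNIV \<Longrightarrow> (g has_derivative frechet_derivative g (at x)) (at x)"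
  unfolding differentiable_on_def by (simp add: frechet_derivative_works)

lemma partial_add:
  assumes "f differentiable_on UNIV" "g differentiable_on UNIV"
  shows "partial i (\<lambda>x. f x + g x) = (\<lambda>x. partial i f x + partial i g x)"
  by (rule ext, subst partial_eqI[OF has_derivative_add[OF
        differentiable_on_UNIV_has_derivative[OF assms(1)]
        differentiable_on_UNIV_has_derivative[OF assms(2)]]])
     (simp add: partial_def)

lemma partial_bounded_linear:
  assumes "bounded_linear L" "f differentiable_on UNIV"
  shows "partial i (\<lambda>x. L (f x)) = (\<lambda>x. L (partial i f x))"
  by (rule ext, subst partial_eqI[OF bounded_linear.has_derivative[OF assms(1)
        differentiable_on_UNIV_has_derivative[OF assms(2)]]])
     (simp add: partial_def)

lemma partial_mult:
  fixes f g :: "real^'n::finite \<Rightarrow> 'b::real_normed_algebra"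
  assumes "f differentiable_on UNIV" "g differentiable_on UNIV"
  shows "partial i (\<lambda>x. f x * g x) = (\<lambda>x. f x * partial i g x + partial i f x * g x)"
  by (rule ext, subst partial_eqI[OF has_derivative_mult[OF
        differentiable_on_UNIV_has_derivative[OF assms(1)]
        differentiable_on_UNIV_has_derivative[OF assms(2)]]])
     (simp add: partial_def)

lemma partial_const: "partial i (\<lambda>x. c) = (\<lambda>x. 0)"
  by (rule ext, subst partial_eqI[OF has_derivative_const]) simp

lemma smooth_const: "smooth (\<lambda>x. c)"
  by (rule smooth_coinduct(2)[where X="range (\<lambda>c x. c)"]) (auto simp: partial_const)

lemma iter_partial_bounded_linear:
  assumes "bounded_linear L" "smooth f"
  shows "iter_partial is (\<lambda>x. L (f x)) = (\<lambda>x. L (iter_partial is f x))"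
proof (induction "is")
  case (Cons i "is")
  then show ?case
    using assms unfolding smooth_def
    by (simp add: partial_bounded_linear)
qed simp

lemma differentiable_bounded_linear_compose:
  "bounded_linear L \<Longrightarrow> f differentiable_on UNIV \<Longrightarrow> (\<lambda>x. L (f x)) differentiable_on UNIV"
  unfolding differentiable_on_def differentiable_def
  by (auto intro: bounded_linear.has_derivative)

lemma smooth_bounded_linear:
  assumes "bounded_linear L" "smooth f"
  shows "smooth (\<lambda>x. L (f x))"
  using assms unfolding smooth_def iter_partial_bounded_linear[OF assms]
  by (simp add: differentiable_bounded_linear_compose)

text \<open>Leibniz's rule only ever produces sums of products of smooth functions; that class is
  stable under every partial derivative, as the coinduction principle requires.\<close>

inductive_set product_sums ::
  "(real^'n::finite \<Rightarrow> 'b::real_normed_algebra) set \<Rightarrow> (real^'n \<Rightarrow> 'b) set \<Rightarrow> (real^'n \<Rightarrow> 'b) set"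
  for X Y where
    prod: "f \<in> X \<Longrightarrow> g \<in> Y \<Longrightarrow> (\<lambda>x. f x * g x) \<in> product_sums X Y"
  | sum: "u \<in> product_sums X Y \<Longrightarrow> v \<in> product_sums X Y \<Longrightarrow> (\<lambda>x. u x + v x) \<in> product_sums X Y"

lemma product_sums_partial:
  assumes "\<And>f. f \<in> X \<Longrightarrow> f differentiable_on UNIV \<and> (\<forall>i. partial i f \<in> X)"
    and "\<And>f. f \<in> Y \<Longrightarrow> f differentiable_on UNIV \<and> (\<forall>i. partial i f \<in> Y)"
    and "u \<in> product_sums X Y"
  shows "u differentiable_on UNIV \<and> (\<forall>i. partial i u \<in> product_sums X Y)"
  using assms(3)
proof induction
  case (prod f g)
  have "partial i (\<lambda>x. f x * g x) \<in> product_sums X Y" for i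
    using assms prod by (subst partial_mult) (auto intro!: product_sums.intros)
  then show ?case using assms prod by (auto intro!: differentiable_on_mult)
next
  case (sum u v)
  then have "partial i (\<lambda>x. u x + v x) \<in> product_sums X Y" for i
    by (subst partial_add) (auto intro!: product_sums.intros)
  then show ?case using sum by (auto intro!: differentiable_on_add)
qed

lemma smooth_mult:
  fixes f g :: "real^'n::finite \<Rightarrow> 'b::real_normed_algebra"
  assumes "smooth f" "smooth g"
  shows "smooth (\<lambda>x. f x * g x)"
proof (rule smooth_coinduct(2)[where X="product_sums (Collect smooth) (Collect smooth)"])
  show "(\<lambda>x. f x * g x) \<in> product_sums (Collect smooth) (Collect smooth)"
    using assms by (auto intro: product_sums.prod)
next
  fix u :: "real^'n \<Rightarrow> 'b" and i
  assume "u \<in> product_sums (Collect smooth) (Collect smooth)"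
  then show "u differentiable_on UNIV" "partial i u \<in> product_sums (Collect smooth) (Collect smooth)"
    using product_sums_partial[of "Collect smooth" "Collect smooth" u]
    by (simp_all add: smooth_differentiable smooth_partial)
qed

lemma iter_partial_add:
  assumes "smooth f" "smooth g"
  shows "iter_partial is (\<lambda>x. f x + g x) = (\<lambda>x. iter_partial is f x + iter_partial is g x)"
proof (induction "is")
  case (Cons i "is")
  then show ?case
    using assms unfolding smooth_def by (simp add: partial_add)
qed simp

lemma smooth_add:
  assumes "smooth f" "smooth g"
  shows "smooth (\<lambda>x. f x + g x)"
  unfolding smooth_def
proof
  fix "is"
  show "iter_partial is (\<lambda>x. f x + g x) differentiable_on UNIV"
    unfolding iter_partial_add[OF assms]
    by (rule differentiable_on_add) (use assms in \<open>simp_all add: smooth_def\<close>)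
qed

lemma smooth_of_real:
  fixes f :: "real^'n::finite \<Rightarrow> real"
  shows "smooth f \<Longrightarrow> smooth (\<lambda>x. of_real (f x) :: complex)"
  by (rule smooth_bounded_linear[OF bounded_linear_of_real])

section \<open>Test functions\<close>

lemma closed_support [simp]: "closed (support g)"
  by (simp add: support_def)

lemma support_subset_iff: "closed S \<Longrightarrow> support g \<subseteq> S \<longleftrightarrow> (\<forall>x. x \<notin> S \<longrightarrow> g x = 0)"
  unfolding support_def using closure_minimal[of "{x. g x \<noteq> 0}" S] closure_subset[of "{x. g x \<noteq> 0}"]
  by blast

lemma not_in_support: "x \<notin> support g \<Longrightarrow> g x = 0"
  unfolding support_def using closure_subset[of "{x. g x \<noteq> 0}"] by blast

lemma partial_zero_outside_support:
  assumes "x \<notin> support g"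
  shows "partial i g x = 0"
proof -
  have o: "open (- support g)" unfolding support_def by auto
  have "(g has_derivative (\<lambda>_. 0)) (at x)"
    by (rule has_derivative_transform_within_open[OF has_derivative_const[of 0] o])
       (use assms not_in_support[of _ g] in auto)
  from partial_eqI[OF this] show ?thesis by simp
qed

lemma support_partial: "support (partial i g) \<subseteq> support g"
  by (subst support_subset_iff) (simp_all add: partial_zero_outside_support)

lemma support_iter_partial: "support (iter_partial is g) \<subseteq> support g"
  by (induction "is") (use support_partial in auto)

lemma support_add: "support (\<lambda>x. f x + g x) \<subseteq> support f \<union> support g"
  by (subst support_subset_iff) (simp_all add: closed_Un not_in_support)

lemma compact_support_mono: "support f \<subseteq> S \<Longrightarrow> compact S \<Longrightarrow> compact (support f)"
  using compact_Int_closed[of S "support f"] by (simp add: inf.absorb2 support_def)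

lemma test_add: "f \<in> test_functions \<Longrightarrow> g \<in> test_functions \<Longrightarrow> (\<lambda>x. f x + g x) \<in> test_functions"
  unfolding test_functions_def
  by (auto intro: smooth_add compact_support_mono[OF support_add])

lemma test_mult: "f \<in> test_functions \<Longrightarrow> g \<in> test_functions \<Longrightarrow> (\<lambda>x. f x * g x) \<in> test_functions"
proof -
  assume a: "f \<in> test_functions" "g \<in> test_functions"
  have "support (\<lambda>x. f x * g x) \<subseteq> support f"
    by (subst support_subset_iff) (simp_all add: not_in_support)
  then show ?thesis using a unfolding test_functions_def
    by (auto intro: smooth_mult compact_support_mono)
qed

lemma test_cmult: "f \<in> test_functions \<Longrightarrow> (\<lambda>x. c * f x) \<in> test_functions"
proof -
  assume a: "f \<in> test_functions"
  have "support (\<lambda>x. c * f x) \<subseteq> support f"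
    by (subst support_subset_iff) (simp_all add: not_in_support)
  then show ?thesis using a unfolding test_functions_def
    by (auto intro: smooth_mult[OF smooth_const] compact_support_mono)
qed

lemma test_zero: "(\<lambda>x. 0) \<in> test_functions"
  unfolding test_functions_def by (simp add: smooth_const support_def)

lemma test_lincomb:
  "f \<in> test_functions \<Longrightarrow> g \<in> test_functions \<Longrightarrow> (\<lambda>x. a * f x + b * g x) \<in> test_functions"
  by (intro test_add test_cmult)

lemma test_diff:
  "f \<in> test_functions \<Longrightarrow> g \<in> test_functions \<Longrightarrow> (\<lambda>x. f x - g x) \<in> test_functions"
  using test_lincomb[of f g 1 "-1"] by simp

lemma test_partial: "f \<in> test_functions \<Longrightarrow> partial i f \<in> test_functions"
  unfolding test_functions_def
  by (auto intro: smooth_partial compact_support_mono[OF support_partial])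

lemma test_continuous: "f \<in> test_functions \<Longrightarrow> continuous_on UNIV f"
  unfolding test_functions_def by (auto intro: smooth_continuous)

lemma compact_support_bounded:
  assumes "continuous_on UNIV f" "compact (support f)"
  shows "\<exists>B\<ge>0. \<forall>x. norm (f x) \<le> B"
proof -
  have "bounded (f ` support f)"
    using assms by (meson compact_continuous_image compact_imp_bounded continuous_on_subset subset_UNIV)
  then obtain B where B: "\<And>x. x \<in> support f \<Longrightarrow> norm (f x) \<le> B"
    unfolding bounded_iff by auto
  have "norm (f x) \<le> max B 0" for x
    using B[of x] not_in_support[of x f] by (cases "x \<in> support f") auto
  then show ?thesis by (intro exI[of _ "max B 0"]) auto
qed

lemma test_support_ball: "f \<in> test_functions \<Longrightarrow> \<exists>R::nat. support f \<subseteq> cball 0 (real R)"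
proof -
  assume "f \<in> test_functions"
  then have "bounded (support f)" by (auto simp: test_functions_def compact_imp_bounded)
  then obtain r where r: "\<And>x. x \<in> support f \<Longrightarrow> norm x \<le> r" by (auto simp: bounded_iff)
  obtain R :: nat where "r \<le> real R" using real_arch_simple by blast
  then show ?thesis using r by (intro exI[of _ R]) force
qed

section \<open>Schwartz functions\<close>

lemma schwartz_coinduct:
  assumes "g \<in> X"
    and "\<And>g. g \<in> X \<Longrightarrow> g differentiable_on UNIV"
    and "\<And>g i. g \<in> X \<Longrightarrow> partial i g \<in> X"
    and "\<And>g m. g \<in> X \<Longrightarrow> bounded (range (\<lambda>x. norm x ^ m * norm (g x)))"
  shows "g \<in> schwartz"
  unfolding schwartz_def using smooth_coinduct[OF assms(1-3)] assms(4) by blast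

lemma schwartz_smooth: "g \<in> schwartz \<Longrightarrow> smooth g"
  by (simp add: schwartz_def)

lemma schwartz_differentiable: "g \<in> schwartz \<Longrightarrow> g differentiable_on UNIV"
  by (simp add: schwartz_def smooth_differentiable)

lemma schwartz_partial: "g \<in> schwartz \<Longrightarrow> partial i g \<in> schwartz"
proof -
  assume g: "g \<in> schwartz"
  have "iter_partial is (partial i g) = iter_partial (is @ [i]) g" for "is"
    by (simp add: iter_partial_append)
  then show ?thesis using g unfolding schwartz_def by (simp add: smooth_partial)
qed

lemma schwartz_bounded: "g \<in> schwartz \<Longrightarrow> bounded (range (\<lambda>x. norm x ^ m * norm (g x)))"
  unfolding schwartz_def by (auto dest: spec[of _ "[]"])

lemma bounded_range_add:
  fixes u v :: "'a \<Rightarrow> real"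
  assumes "bounded (range u)" "bounded (range v)" "\<And>x. \<bar>w x\<bar> \<le> \<bar>u x\<bar> + \<bar>v x\<bar>"
  shows "bounded (range w)"
proof -
  obtain a b where "\<And>x. \<bar>u x\<bar> \<le> a" "\<And>x. \<bar>v x\<bar> \<le> b"
    using assms(1,2) by (auto simp: bounded_iff)
  then have "\<bar>w x\<bar> \<le> a + b" for x using assms(3)[of x] by (meson add_mono order_trans)
  then show ?thesis by (auto simp: bounded_iff)
qed

lemma schwartz_mult:
  assumes "f \<in> schwartz" "g \<in> schwartz"
  shows "(\<lambda>x. f x * g x) \<in> schwartz"
proof (rule schwartz_coinduct[where X="product_sums schwartz schwartz"])
  show "(\<lambda>x. f x * g x) \<in> product_sums schwartz schwartz"
    using assms by (auto intro: product_sums.prod)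
next
  fix u :: "real^'a \<Rightarrow> complex" and m
  assume "u \<in> product_sums schwartz schwartz"
  then show "bounded (range (\<lambda>x. norm x ^ m * norm (u x)))"
  proof induction
    case (prod f g)
    obtain a where a: "\<And>x. norm x ^ m * norm (f x) \<le> a"
      using schwartz_bounded[OF prod(1), of m] by (auto simp: bounded_iff)
    obtain b where b: "\<And>x. norm (g x) \<le> b"
      using schwartz_bounded[OF prod(2), of 0] by (auto simp: bounded_iff)
    have "norm x ^ m * norm (f x * g x) \<le> a * b" for x
      using mult_mono[OF a[of x] b[of x]] a[of x] by (simp add: norm_mult mult.assoc order_trans[rotated])
    then show ?case by (auto simp: bounded_iff norm_mult intro!: exI[of _ "a * b"])
  next
    case (sum u v)
    show ?case
      by (rule bounded_range_add[OF sum.IH])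
         (simp add: abs_mult norm_triangle_ineq mult_left_mono flip: distrib_left)
  qed
next
  fix u :: "real^'a \<Rightarrow> complex" and i
  assume "u \<in> product_sums schwartz schwartz"
  then show "u differentiable_on UNIV" "partial i u \<in> product_sums schwartz schwartz"
    using product_sums_partial[of schwartz schwartz u]
    by (simp_all add: schwartz_differentiable schwartz_partial)
qed

lemma schwartz_add:
  assumes "f \<in> schwartz" "g \<in> schwartz"
  shows "(\<lambda>x. f x + g x) \<in> schwartz"
proof (rule schwartz_coinduct[where X="{\<lambda>x. f x + g x | f g. f \<in> schwartz \<and> g \<in> schwartz}"])
  fix u :: "real^'a \<Rightarrow> complex" and i
  assume "u \<in> {\<lambda>x. f x + g x | f g. f \<in> schwartz \<and> g \<in> schwartz}"
  then obtain f g where u: "u = (\<lambda>x. f x + g x)" and s: "f \<in> schwartz" "g \<in> schwartz" by auto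
  show "partial i u \<in> {\<lambda>x. f x + g x | f g. f \<in> schwartz \<and> g \<in> schwartz}"
    unfolding u partial_add[OF s[THEN schwartz_differentiable]] using s schwartz_partial by blast
  show "u differentiable_on UNIV"
    unfolding u using s schwartz_differentiable by (auto intro!: differentiable_on_add)
  show "bounded (range (\<lambda>x. norm x ^ m * norm (u x)))" for m
    by (rule bounded_range_add[OF schwartz_bounded[OF s(1), of m] schwartz_bounded[OF s(2), of m]])
       (simp add: u abs_mult norm_triangle_ineq mult_left_mono flip: distrib_left)
qed (use assms in auto)

text \<open>Conjugation and multiplication by a scalar are both real-linear maps on the values.\<close>

lemma schwartz_bounded_linear:
  assumes L: "bounded_linear L" and f: "f \<in> schwartz"
  shows "(\<lambda>x. L (f x)) \<in> schwartz"
proof (rule schwartz_coinduct[where X="{\<lambda>x. L (f x) | f. f \<in> schwartz}"])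
  fix u :: "real^'a \<Rightarrow> complex" and i
  assume "u \<in> {\<lambda>x. L (f x) | f. f \<in> schwartz}"
  then obtain f where u: "u = (\<lambda>x. L (f x))" and s: "f \<in> schwartz" by auto
  show "partial i u \<in> {\<lambda>x. L (f x) | f. f \<in> schwartz}"
    unfolding u partial_bounded_linear[OF L s[THEN schwartz_differentiable]]
    using s schwartz_partial by blast
  show "u differentiable_on UNIV"
    unfolding u by (rule differentiable_bounded_linear_compose[OF L schwartz_differentiable[OF s]])
  show "bounded (range (\<lambda>x. norm x ^ m * norm (u x)))" for m
  proof -
    obtain K where K: "0 < K" "\<And>x. norm (L x) \<le> norm x * K"
      using bounded_linear.pos_bounded[OF L] by blast
    obtain a where a: "\<And>x. norm x ^ m * norm (f x) \<le> a"
      using schwartz_bounded[OF s, of m] by (auto simp: bounded_iff)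
    have "norm x ^ m * norm (u x) \<le> a * K" for x
    proof -
      have "norm x ^ m * norm (u x) \<le> norm x ^ m * (norm (f x) * K)"
        unfolding u by (intro mult_left_mono K) auto
      also have "\<dots> \<le> a * K" using a[of x] K by (simp add: mult.assoc[symmetric])
      finally show ?thesis .
    qed
    then show ?thesis by (auto simp: bounded_iff abs_mult intro!: exI[of _ "a * K"])
  qed
qed (use f in auto)

lemma schwartz_cmult: "f \<in> schwartz \<Longrightarrow> (\<lambda>x. c * f x) \<in> schwartz"
  by (rule schwartz_bounded_linear[OF bounded_linear_mult_right])

lemma schwartz_reflect:
  assumes f: "f \<in> schwartz"
  shows "(\<lambda>x. f (- x)) \<in> schwartz"
proof (rule schwartz_coinduct[where X="{\<lambda>x. f (- x) | f. f \<in> schwartz}"])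
  fix u :: "real^'a \<Rightarrow> complex" and i
  assume "u \<in> {\<lambda>x. f (- x) | f. f \<in> schwartz}"
  then obtain f where u: "u = (\<lambda>x. f (- x))" and s: "f \<in> schwartz" by auto
  have d: "(u has_derivative (\<lambda>h. frechet_derivative f (at (- x)) (- h))) (at x)" for x
    unfolding u
    by (rule has_derivative_compose[OF has_derivative_minus[OF has_derivative_ident]
          smooth_has_derivative[OF schwartz_smooth[OF s]]])
  have "frechet_derivative f (at y) (- h) = - frechet_derivative f (at y) h" for y h
    using smooth_has_derivative[OF schwartz_smooth[OF s], of y]
    by (simp add: has_derivative_def linear_neg bounded_linear.linear)
  then have "partial i u = (\<lambda>x. (\<lambda>y. -1 * partial i f y) (- x))"
    by (intro ext, subst partial_eqI[OF d]) (simp add: partial_def)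
  then show "partial i u \<in> {\<lambda>x. f (- x) | f. f \<in> schwartz}"
    using schwartz_cmult[OF schwartz_partial[OF s], of "-1" i]
    by (intro CollectI exI[of _ "\<lambda>y. -1 * partial i f y"] conjI)
  show "u differentiable_on UNIV"
    unfolding differentiable_on_def differentiable_def using d by blast
  show "bounded (range (\<lambda>x. norm x ^ m * norm (u x)))" for m
  proof -
    obtain a where a: "\<And>x. norm x ^ m * norm (f x) \<le> a"
      using schwartz_bounded[OF s, of m] by (auto simp: bounded_iff)
    show ?thesis using a[of "- _"] unfolding u by (auto simp: bounded_iff intro!: exI[of _ a])
  qed
qed (use f in auto)

lemma schwartz_mult_coord:
  assumes "f \<in> schwartz"
  shows "(\<lambda>x. of_real (x $ j) * f x) \<in> schwartz"
  \<comment> \<open>Differentiating \<open>x\<^sub>j\<close> leaves a multiple of \<open>f\<close> behind; the summand \<open>g\<close> absorbs it.\<close>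
proof (rule schwartz_coinduct[where
      X="{\<lambda>x. of_real (x $ j) * f x + g x | f g. f \<in> schwartz \<and> g \<in> schwartz}"])
  have "(\<lambda>x::real^'a. 0 :: complex) \<in> schwartz" using schwartz_cmult[OF assms, of 0] by simp
  then show "(\<lambda>x. of_real (x $ j) * f x)
      \<in> {\<lambda>x. of_real (x $ j) * f x + g x | f g. f \<in> schwartz \<and> g \<in> schwartz}"
    using assms by force
next
  fix u :: "real^'a \<Rightarrow> complex" and i
  assume "u \<in> {\<lambda>x. of_real (x $ j) * f x + g x | f g. f \<in> schwartz \<and> g \<in> schwartz}"
  then obtain f g where u: "u = (\<lambda>x. of_real (x $ j) * f x + g x)" and s: "f \<in> schwartz" "g \<in> schwartz"
    by auto
  have bl: "bounded_linear (\<lambda>x::real^'a. of_real (x $ j) :: complex)"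
    by (intro bounded_linear_compose[OF bounded_linear_of_real bounded_linear_vec_nth])
  have dj: "((\<lambda>x::real^'a. of_real (x $ j) :: complex) has_derivative (\<lambda>h. of_real (h $ j))) (at x)" for x
    using bounded_linear_imp_has_derivative[OF bl] by simp
  have d: "(u has_derivative (\<lambda>h. (of_real (x $ j) * frechet_derivative f (at x) h + of_real (h $ j) * f x)
      + frechet_derivative g (at x) h)) (at x)" for x
    unfolding u
    by (intro has_derivative_add has_derivative_mult dj smooth_has_derivative[OF schwartz_smooth] s)
  have "partial i u = (\<lambda>x. of_real (x $ j) * partial i f x + (of_real (axis i 1 $ j) * f x + partial i g x))"
    by (intro ext, subst partial_eqI[OF d]) (simp add: partial_def add.assoc)
  moreover have "(\<lambda>x. of_real (axis i 1 $ j) * f x + partial i g x) \<in> schwartz"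
    by (intro schwartz_add schwartz_cmult schwartz_partial s)
  ultimately show "partial i u
      \<in> {\<lambda>x. of_real (x $ j) * f x + g x | f g. f \<in> schwartz \<and> g \<in> schwartz}"
    using schwartz_partial[OF s(1), of i]
    by (intro CollectI exI[of _ "partial i f"]
        exI[of _ "\<lambda>x. of_real (axis i 1 $ j) * f x + partial i g x"] conjI)
  show "u differentiable_on UNIV"
    unfolding differentiable_on_def differentiable_def using d by blast
  show "bounded (range (\<lambda>x. norm x ^ m * norm (u x)))" for m
  proof (rule bounded_range_add[OF schwartz_bounded[OF s(1), of "Suc m"] schwartz_bounded[OF s(2), of m]])
    fix x
    have "norm (u x) \<le> norm x * norm (f x) + norm (g x)"
      unfolding u using norm_triangle_ineq[of "of_real (x $ j) * f x" "g x"]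
        mult_right_mono[OF component_le_norm_cart[of x j], of "norm (f x)"]
      by (auto simp: norm_mult)
    then have "norm x ^ m * norm (u x) \<le> norm x ^ m * (norm x * norm (f x) + norm (g x))"
      by (intro mult_left_mono) auto
    then show "\<bar>norm x ^ m * norm (u x)\<bar> \<le> \<bar>norm x ^ Suc m * norm (f x)\<bar> + \<bar>norm x ^ m * norm (g x)\<bar>"
      by (simp add: algebra_simps)
  qed
qed

lemma test_schwartz:
  assumes "f \<in> test_functions"
  shows "(\<lambda>x. of_real (f x)) \<in> schwartz"
  unfolding schwartz_def
proof (intro CollectI conjI allI)
  have s: "smooth f" and c: "compact (support f)" using assms by (auto simp: test_functions_def)
  show "smooth (\<lambda>x. of_real (f x) :: complex)" by (rule smooth_of_real[OF s])
  fix "is" m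
  let ?g = "\<lambda>x. norm x ^ m * iter_partial is f x"
  have sub: "support ?g \<subseteq> support f"
    using support_iter_partial[of "is" f]
    by (subst support_subset_iff) (auto intro!: not_in_support)
  have "continuous_on UNIV (iter_partial is f)"
    using s unfolding smooth_def by (simp add: differentiable_imp_continuous_on)
  then have "continuous_on UNIV ?g" by (intro continuous_intros)
  from compact_support_bounded[OF this compact_support_mono[OF sub c]]
  show "bounded (range (\<lambda>x. norm x ^ m * norm (iter_partial is (\<lambda>x. of_real (f x) :: complex) x)))"
    unfolding iter_partial_bounded_linear[OF bounded_linear_of_real s]
    by (auto simp: bounded_iff abs_mult)
qed

lemma schwartz_decay:
  assumes "g \<in> schwartz"
  shows "\<exists>C\<ge>0. \<forall>x. (1 + norm x) ^ m * norm (g x) \<le> C"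
proof -
  obtain a b where a: "\<And>x. norm x ^ m * norm (g x) \<le> a" and b: "\<And>x. norm (g x) \<le> b"
    using schwartz_bounded[OF assms, of m] schwartz_bounded[OF assms, of 0] by (auto simp: bounded_iff)
  have "(1 + norm x) ^ m * norm (g x) \<le> 2 ^ m * (a + b)" for x
  proof -
    have "(1 + norm x) ^ m \<le> (2 * max 1 (norm x)) ^ m" by (intro power_mono) auto
    also have "\<dots> = 2 ^ m * max 1 (norm x) ^ m" by (simp add: power_mult_distrib)
    also have "\<dots> \<le> 2 ^ m * (1 + norm x ^ m)"
      by (intro mult_left_mono) (auto simp: max_def)
    finally have "(1 + norm x) ^ m * norm (g x) \<le> 2 ^ m * (1 + norm x ^ m) * norm (g x)"
      by (intro mult_right_mono) auto
    also have "\<dots> = 2 ^ m * (norm x ^ m * norm (g x) + norm (g x))" by (simp add: algebra_simps)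
    also have "\<dots> \<le> 2 ^ m * (a + b)" using a[of x] b[of x] by (intro mult_left_mono) auto
    finally show ?thesis .
  qed
  moreover have "0 \<le> 2 ^ m * (a + b)"
    using order_trans[OF _ a[of 0]] order_trans[OF _ b[of 0]] by (intro mult_nonneg_nonneg add_nonneg_nonneg) auto
  ultimately show ?thesis by blast
qed

text \<open>The seminorm is a supremum over finitely many lists of directions, hence of a bounded set; the
  bound itself is the instance of the empty list.\<close>

lemma schwartz_seminorm_bound:
  assumes g: "g \<in> schwartz"
  shows "(1 + norm x) ^ N * norm (g x) \<le> schwartz_seminorm N g"
proof -
  let ?S = "{(1 + norm x) ^ N * norm (iter_partial is g x) | is x. length is \<le> N}"
  have fin: "finite {is :: 'a list. length is \<le> N}"
    using finite_lists_length_le[of "UNIV :: 'a set" N] by simp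
  have "iter_partial is g \<in> schwartz" for "is"
    by (induction "is") (use g schwartz_partial in auto)
  then have "\<forall>is. \<exists>C. \<forall>x. (1 + norm x) ^ N * norm (iter_partial is g x) \<le> C"
    using schwartz_decay by blast
  then obtain C where C: "\<And>is x. (1 + norm x) ^ N * norm (iter_partial is g x) \<le> C is" by metis
  have "bdd_above ?S"
  proof (rule bdd_aboveI)
    fix y assume "y \<in> ?S"
    then obtain "is" x where "y = (1 + norm x) ^ N * norm (iter_partial is g x)" "length is \<le> N" by auto
    moreover from this have "C is \<le> Max (C ` {is. length is \<le> N})"
      using fin by (intro Max_ge) auto
    ultimately show "y \<le> Max (C ` {is. length is \<le> N})"
      using C[of x "is"] by linarith
  qed
  moreover have "(1 + norm x) ^ N * norm (g x) \<in> ?S"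
    by (rule CollectI, rule exI[of _ "[]"]) auto
  ultimately show ?thesis unfolding schwartz_seminorm_def by (rule cSup_upper[rotated])
qed

section \<open>Integration on Euclidean space\<close>

lemma integral_lborel_prod:
  fixes f :: "'a::euclidean_space \<Rightarrow> real \<Rightarrow> complex"
  assumes "\<And>b. b \<in> Basis \<Longrightarrow> integrable lborel (f b)"
  shows "integrable lborel (\<lambda>x. \<Prod>b\<in>Basis. f b (x \<bullet> b))"
    and "(\<integral>x. (\<Prod>b\<in>Basis. f b (x \<bullet> b)) \<partial>lborel) = (\<Prod>b\<in>Basis. \<integral>t. f b t \<partial>lborel)"
proof -
  interpret product_sigma_finite "\<lambda>_::'a. lborel :: real measure"
    by standard
  have [measurable]: "\<And>b. b \<in> Basis \<Longrightarrow> f b \<in> borel_measurable borel"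
    using assms by (auto dest: borel_measurable_integrable)
  have m: "(\<lambda>x::'a. \<Prod>b\<in>Basis. f b (x \<bullet> b)) \<in> borel_measurable borel" by measurable
  have d: "(\<Prod>b\<in>Basis. f b ((\<Sum>c\<in>Basis. y c *\<^sub>R c) \<bullet> b)) = (\<Prod>b\<in>Basis. f b (y b))" for y
    by (intro prod.cong) (auto simp: inner_sum_left_Basis)
  have i: "integrable (\<Pi>\<^sub>M b\<in>Basis. lborel) (\<lambda>y::'a\<Rightarrow>real. \<Prod>b\<in>Basis. f b (y b))"
    by (rule product_integrable_prod) (use assms in auto)
  show "integrable lborel (\<lambda>x. \<Prod>b\<in>Basis. f b (x \<bullet> b))"
    by (subst lborel_eq, subst integrable_distr_eq) (use m i in \<open>auto simp: d\<close>)
  show "(\<integral>x. (\<Prod>b\<in>Basis. f b (x \<bullet> b)) \<partial>lborel) = (\<Prod>b\<in>Basis. \<integral>t. f b t \<partial>lborel)"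
    by (subst lborel_eq, subst integral_distr)
       (use m in \<open>auto simp: d intro!: product_integral_prod assms\<close>)
qed

lemma integral_affine:
  fixes f :: "'a::euclidean_space \<Rightarrow> 'b::{banach, second_countable_topology}"
  assumes "c \<noteq> 0" and [measurable]: "f \<in> borel_measurable borel"
  shows "integrable lborel (\<lambda>x. f (t + c *\<^sub>R x)) \<longleftrightarrow> integrable lborel f"
    and "(\<integral>x. f x \<partial>lborel) = (\<bar>c\<bar> ^ DIM('a)) *\<^sub>R (\<integral>x. f (t + c *\<^sub>R x) \<partial>lborel)"
proof -
  have p: "0 < \<bar>c\<bar> ^ DIM('a)" using assms by simp
  have "integrable lborel f \<longleftrightarrow> integrable lborel (\<lambda>x. \<bar>c\<bar> ^ DIM('a) *\<^sub>R f (t + c *\<^sub>R x))"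
    by (subst lborel_affine[OF assms(1), of t], subst integrable_density, simp, simp, simp,
        subst integrable_distr_eq) auto
  also have "\<dots> \<longleftrightarrow> integrable lborel (\<lambda>x. f (t + c *\<^sub>R x))"
  proof
    assume "integrable lborel (\<lambda>x. \<bar>c\<bar> ^ DIM('a) *\<^sub>R f (t + c *\<^sub>R x))"
    then have "integrable lborel (\<lambda>x. inverse (\<bar>c\<bar> ^ DIM('a)) *\<^sub>R (\<bar>c\<bar> ^ DIM('a) *\<^sub>R f (t + c *\<^sub>R x)))"
      by (rule integrable_scaleR_right)
    then show "integrable lborel (\<lambda>x. f (t + c *\<^sub>R x))" using p by simp
  qed (rule integrable_scaleR_right)
  finally show "integrable lborel (\<lambda>x. f (t + c *\<^sub>R x)) \<longleftrightarrow> integrable lborel f" ..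
  show "(\<integral>x. f x \<partial>lborel) = (\<bar>c\<bar> ^ DIM('a)) *\<^sub>R (\<integral>x. f (t + c *\<^sub>R x) \<partial>lborel)"
    by (subst lborel_affine[OF assms(1), of t], subst integral_density, simp, simp, simp,
        subst integral_distr) (auto)
qed

lemma integral_reflect:
  fixes f :: "'a::euclidean_space \<Rightarrow> 'b::{banach, second_countable_topology}"
  assumes "f \<in> borel_measurable borel"
  shows "integrable lborel (\<lambda>x. f (- x)) \<longleftrightarrow> integrable lborel f"
    and "(\<integral>x. f (- x) \<partial>lborel) = (\<integral>x. f x \<partial>lborel)"
  using integral_affine[OF _ assms, of "-1" 0] by auto

lemma integral_translate:
  fixes f :: "'a::euclidean_space \<Rightarrow> 'b::{banach, second_countable_topology}"
  assumes "f \<in> borel_measurable borel"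
  shows "integrable lborel (\<lambda>x. f (x + t)) \<longleftrightarrow> integrable lborel f"
    and "(\<integral>x. f (x + t) \<partial>lborel) = (\<integral>x. f x \<partial>lborel)"
  using integral_affine[OF _ assms, of 1 t] by (auto simp: add.commute)

lemma nn_integral_affine:
  fixes f :: "'a::euclidean_space \<Rightarrow> ennreal"
  assumes "c \<noteq> 0" and [measurable]: "f \<in> borel_measurable borel"
  shows "(\<integral>\<^sup>+x. f x \<partial>lborel) = ennreal (\<bar>c\<bar> ^ DIM('a)) * (\<integral>\<^sup>+x. f (t + c *\<^sub>R x) \<partial>lborel)"
  by (subst lborel_affine[OF assms(1), of t])
     (simp add: nn_integral_density nn_integral_distr nn_integral_cmult ennreal_power)

text \<open>Against a bounded kernel the product of two integrable functions dominates the double integrand.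
  The exchange formula for the Fourier transform and the superposition of Gaussians below are instances.\<close>

lemma fubini_bounded_kernel:
  fixes u :: "'a::euclidean_space \<Rightarrow> complex" and w :: "'b::euclidean_space \<Rightarrow> complex"
  assumes u: "integrable lborel u" and w: "integrable lborel w"
    and K: "(\<lambda>(x, y). K x y) \<in> borel_measurable (lborel \<Otimes>\<^sub>M lborel)"
    and B: "\<And>x y. norm (K x y) \<le> B"
  shows "integrable (lborel \<Otimes>\<^sub>M lborel) (\<lambda>(x, y). u x * K x y * w y)"
    and "(\<integral>x. u x * (\<integral>y. K x y * w y \<partial>lborel) \<partial>lborel)
       = (\<integral>y. (\<integral>x. u x * K x y \<partial>lborel) * w y \<partial>lborel)"
proof -
  note [measurable] = borel_measurable_integrable[OF u] borel_measurable_integrable[OF w] K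
  have i: "integrable (lborel \<Otimes>\<^sub>M lborel) (\<lambda>(x, y). norm (u x) * norm (w y))"
    by (rule lborel_pair.Fubini_integrable) (use u w in \<open>auto simp: integrable_mult_left\<close>)
  have B0: "0 \<le> B" using B[of undefined undefined] norm_ge_zero order_trans by blast
  show I: "integrable (lborel \<Otimes>\<^sub>M lborel) (\<lambda>(x, y). u x * K x y * w y)"
  proof (rule Bochner_Integration.integrable_bound[OF integrable_mult_right[OF i, of B]])
    show "AE z in lborel \<Otimes>\<^sub>M lborel. norm (case z of (x, y) \<Rightarrow> u x * K x y * w y)
        \<le> norm (B * (case z of (x, y) \<Rightarrow> norm (u x) * norm (w y)))"
    proof (intro AE_I2, clarify)
      fix x y
      have "norm (K x y) * (norm (u x) * norm (w y)) \<le> B * (norm (u x) * norm (w y))"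
        by (intro mult_right_mono B) auto
      then show "norm (u x * K x y * w y) \<le> norm (B * (norm (u x) * norm (w y)))"
        using B0 by (simp add: norm_mult abs_mult mult_ac)
    qed
  qed measurable
  have "(\<integral>x. (\<integral>y. u x * K x y * w y \<partial>lborel) \<partial>lborel) = (\<integral>y. (\<integral>x. u x * K x y * w y \<partial>lborel) \<partial>lborel)"
    using lborel_pair.Fubini_integral[OF I] by simp
  moreover have "(\<integral>y. u x * K x y * w y \<partial>lborel) = u x * (\<integral>y. K x y * w y \<partial>lborel)" for x
    unfolding mult.assoc by (rule integral_mult_right_zero)
  moreover have "(\<integral>x. u x * K x y * w y \<partial>lborel) = (\<integral>x. u x * K x y \<partial>lborel) * w y" for y
    by (rule integral_mult_left_zero)
  ultimately show "(\<integral>x. u x * (\<integral>y. K x y * w y \<partial>lborel) \<partial>lborel)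
       = (\<integral>y. (\<integral>x. u x * K x y \<partial>lborel) * w y \<partial>lborel)"
    by simp
qed

section \<open>The Gaussian\<close>

definition gauss :: "'a::euclidean_space \<Rightarrow> real" where
  "gauss x = exp (- (norm x)\<^sup>2 / 2)"

lemma gauss_pos: "0 < gauss x" and gauss_le_1: "gauss x \<le> 1"
  by (auto simp: gauss_def)

lemma gauss_continuous: "continuous_on UNIV gauss"
  unfolding gauss_def by (intro continuous_intros) auto

lemma gauss_measurable [measurable]: "gauss \<in> borel_measurable borel"
  by (rule borel_measurable_continuous_onI[OF gauss_continuous])

lemma gauss_prod: "gauss x = (\<Prod>b\<in>Basis. exp (- (x \<bullet> b)\<^sup>2 / 2))"
proof -
  have "- (norm x)\<^sup>2 / 2 = (\<Sum>b\<in>Basis. - (x \<bullet> b)\<^sup>2 / 2)"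
    unfolding power2_norm_eq_inner euclidean_inner[of x x]
    by (simp add: sum_divide_distrib sum_negf power2_eq_square)
  then show ?thesis by (simp add: gauss_def exp_sum)
qed

text \<open>This is the characteristic function of the standard normal distribution, up to normalisation.\<close>

lemma gauss_fourier_1d:
  fixes t :: real
  shows "integrable lborel (\<lambda>x. exp (\<i> * of_real (x * t)) * of_real (exp (- x\<^sup>2 / 2)))"
    and "(\<integral>x. exp (\<i> * of_real (x * t)) * of_real (exp (- x\<^sup>2 / 2)) \<partial>lborel)
       = complex_of_real (sqrt (2 * pi) * exp (- t\<^sup>2 / 2))"
proof -
  have i: "integrable lborel std_normal_density" by simp
  have e: "exp (\<i> * of_real (x * t)) * of_real (exp (- x\<^sup>2 / 2))
      = complex_of_real (sqrt (2 * pi)) * (std_normal_density x *\<^sub>R iexp (t * x))" for x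
    by (simp add: std_normal_density_def scaleR_conv_of_real mult_ac)
  have i2: "integrable lborel (\<lambda>x. std_normal_density x *\<^sub>R iexp (t * x))"
    by (rule Bochner_Integration.integrable_bound[OF i]) auto
  show "integrable lborel (\<lambda>x. exp (\<i> * of_real (x * t)) * of_real (exp (- x\<^sup>2 / 2)))"
    unfolding e using i2 by (rule integrable_mult_right)
  have "(\<integral>x. std_normal_density x *\<^sub>R iexp (t * x) \<partial>lborel) = char std_normal_distribution t"
    unfolding char_def by (subst integral_density) (auto simp: normal_density_nonneg)
  then show "(\<integral>x. exp (\<i> * of_real (x * t)) * of_real (exp (- x\<^sup>2 / 2)) \<partial>lborel)
       = complex_of_real (sqrt (2 * pi) * exp (- t\<^sup>2 / 2))"
    unfolding e integral_mult_right_zero by (simp add: char_std_normal_distribution)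
qed

lemma gauss_fourier:
  fixes z :: "'a::euclidean_space"
  shows "(\<integral>x. exp (\<i> * of_real (x \<bullet> z)) * of_real (gauss x) \<partial>lborel)
       = complex_of_real (sqrt (2 * pi) ^ DIM('a) * gauss z)"
    and "integrable lborel (\<lambda>x. exp (\<i> * of_real (x \<bullet> z)) * of_real (gauss x))"
proof -
  let ?f = "\<lambda>b t. exp (\<i> * of_real (t * (z \<bullet> b))) * complex_of_real (exp (- t\<^sup>2 / 2))"
  have e: "exp (\<i> * of_real (x \<bullet> z)) * of_real (gauss x) = (\<Prod>b\<in>Basis. ?f b (x \<bullet> b))" for x
  proof -
    have "\<i> * complex_of_real (x \<bullet> z) = (\<Sum>b\<in>Basis. \<i> * of_real ((x \<bullet> b) * (z \<bullet> b)))"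
      by (subst euclidean_inner) (simp add: sum_distrib_left)
    then show ?thesis by (simp add: exp_sum gauss_prod prod.distrib)
  qed
  show "(\<integral>x. exp (\<i> * of_real (x \<bullet> z)) * of_real (gauss x) \<partial>lborel)
       = complex_of_real (sqrt (2 * pi) ^ DIM('a) * gauss z)"
    unfolding e
    by (subst integral_lborel_prod(2)) (use gauss_fourier_1d in \<open>auto simp: gauss_prod prod.distrib\<close>)
  show "integrable lborel (\<lambda>x. exp (\<i> * of_real (x \<bullet> z)) * of_real (gauss x))"
    unfolding e by (rule integral_lborel_prod(1)) (rule gauss_fourier_1d(1))
qed

lemma gauss_integrable: "integrable lborel (gauss :: 'a::euclidean_space \<Rightarrow> real)"
  and gauss_integral: "(\<integral>x. gauss (x::'a) \<partial>lborel) = sqrt (2 * pi) ^ DIM('a)"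
proof -
  have "integrable lborel (\<lambda>x::'a. complex_of_real (gauss x))"
    using gauss_fourier(2)[of "0::'a"] by simp
  then show "integrable lborel (gauss :: 'a \<Rightarrow> real)" by (simp only: complex_of_real_integrable_eq)
  have "complex_of_real (\<integral>x. gauss (x::'a) \<partial>lborel) = complex_of_real (sqrt (2 * pi) ^ DIM('a))"
    using gauss_fourier(1)[of "0::'a"] by (simp add: gauss_def[of 0])
  then show "(\<integral>x. gauss (x::'a) \<partial>lborel) = sqrt (2 * pi) ^ DIM('a)"
    using of_real_eq_iff by blast
qed

section \<open>Powers of the norm\<close>

text \<open>The exponent \<open>2 DIM('a)\<close> is chosen to compare with \<open>\<Prod> 1/(1 + x\<^sub>b\<^sup>2)\<close>, which is integrable
  coordinate by coordinate.\<close>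

lemma integrable_decay:
  "integrable lborel (\<lambda>x::'a::euclidean_space. 1 / (1 + norm x) ^ (2 * DIM('a)))"
proof -
  have 1: "integrable lborel (\<lambda>t::real. complex_of_real (inverse (1 + t\<^sup>2)))"
    using integrable_inverse_1_plus_square unfolding set_integrable_def complex_of_real_integrable_eq
    by (simp add: einterval_def)
  have "integrable lborel (\<lambda>x::'a. complex_of_real (\<Prod>b\<in>Basis. inverse (1 + (x \<bullet> b)\<^sup>2)))"
    using integral_lborel_prod(1)[of "\<lambda>b::'a. \<lambda>t. complex_of_real (inverse (1 + t\<^sup>2))"] 1 by simp
  then have i: "integrable lborel (\<lambda>x::'a. \<Prod>b\<in>Basis. inverse (1 + (x \<bullet> b)\<^sup>2))"
    by (simp only: complex_of_real_integrable_eq)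
  show ?thesis
  proof (rule Bochner_Integration.integrable_bound[OF i])
    show "AE x::'a in lborel. norm (1 / (1 + norm x) ^ (2 * DIM('a)))
        \<le> norm (\<Prod>b\<in>Basis. inverse (1 + (x \<bullet> b)\<^sup>2))"
    proof (intro AE_I2)
      fix x :: 'a
      have "(\<Prod>b\<in>(Basis::'a set). 1 + (x \<bullet> b)\<^sup>2) \<le> (\<Prod>b\<in>(Basis::'a set). (1 + norm x)\<^sup>2)"
      proof (rule prod_mono)
        fix b :: 'a assume "b \<in> Basis"
        then have "\<bar>x \<bullet> b\<bar>\<^sup>2 \<le> (norm x)\<^sup>2" by (intro power_mono Basis_le_norm) auto
        moreover have "(1 + norm x)\<^sup>2 = 1 + 2 * norm x + (norm x)\<^sup>2" by (simp add: power2_eq_square algebra_simps)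
        moreover have "0 \<le> norm x" by simp
        ultimately have "1 + (x \<bullet> b)\<^sup>2 \<le> (1 + norm x)\<^sup>2" unfolding power2_abs by linarith
        then show "0 \<le> 1 + (x \<bullet> b)\<^sup>2 \<and> 1 + (x \<bullet> b)\<^sup>2 \<le> (1 + norm x)\<^sup>2" by simp
      qed
      then have le: "(\<Prod>b\<in>(Basis::'a set). 1 + (x \<bullet> b)\<^sup>2) \<le> (1 + norm x) ^ (2 * DIM('a))"
        by (simp add: power_mult)
      have pos: "0 < (\<Prod>b\<in>(Basis::'a set). 1 + (x \<bullet> b)\<^sup>2)"
        by (intro prod_pos) (simp add: add_pos_nonneg)
      have "1 / (1 + norm x) ^ (2 * DIM('a)) \<le> 1 / (\<Prod>b\<in>(Basis::'a set). 1 + (x \<bullet> b)\<^sup>2)"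
        using le pos by (intro divide_left_mono) (auto intro!: mult_pos_pos zero_less_power add_pos_nonneg)
      then show "norm (1 / (1 + norm x) ^ (2 * DIM('a))) \<le> norm (\<Prod>b\<in>Basis. inverse (1 + (x \<bullet> b)\<^sup>2))"
        using pos by (simp add: prod_inversef[symmetric] divide_inverse)
    qed
  qed measurable
qed

text \<open>With \<open>b = a / DIM('a) < 1\<close> the singularity is dominated by a product of one-dimensional ones:
  \<open>|x|\<^sup>-\<^sup>a = \<Prod> |x|\<^sup>-\<^sup>b \<le> \<Prod> |x\<^sub>c|\<^sup>-\<^sup>b\<close> away from the coordinate hyperplanes.\<close>

lemma nn_integral_norm_powr_unit_ball:
  fixes a :: real
  assumes "0 < a" "a < DIM('a)"
  shows "(\<integral>\<^sup>+(x::'a::euclidean_space). indicator (cball 0 1) x * ennreal (norm x powr (- a)) \<partial>lborel) < \<infinity>"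
proof -
  define b where "b = a / DIM('a)"
  have b: "0 < b" "b < 1" using assms by (auto simp: b_def)
  define f where "f t = ennreal (indicator {-1..1} t * \<bar>t\<bar> powr (- b))" for t :: real
  have "(\<lambda>t. t powr (- b)) integrable_on {0..1}" using integrable_on_powr_from_0[of "-b" 1] b by simp
  then have "(\<lambda>t. t powr (- b)) absolutely_integrable_on {0..1}"
    by (rule nonnegative_absolutely_integrable_1) auto
  then have h: "integrable lborel (\<lambda>t. indicator {0..1} t * t powr (- b))"
    unfolding set_integrable_def by (simp add: integrable_completion)
  have "integrable lborel (\<lambda>t. indicator {0..1} (-t) * (-t) powr (- b))"
    using h by (subst integral_reflect(1)[of "\<lambda>t. indicator {0..1} t * t powr (- b)"]) auto
  from Bochner_Integration.integrable_add[OF h this]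
  have "integrable lborel (\<lambda>t. indicator {-1..1} t * \<bar>t\<bar> powr (- b))"
    by (rule Bochner_Integration.integrable_bound) (auto simp: indicator_def)
  then have fin: "(\<integral>\<^sup>+t. f t \<partial>lborel) < \<infinity>"
    unfolding f_def integrable_iff_bounded by simp
  have ae: "AE x in lborel. \<forall>b\<in>(Basis::'a set). x \<bullet> b \<noteq> 0"
  proof (intro AE_finite_allI)
    fix c :: 'a assume c: "c \<in> Basis"
    have "negligible {x::'a. c \<bullet> x = 0}" using c nonzero_Basis by (intro negligible_hyperplane) auto
    then have "{x::'a. c \<bullet> x = 0} \<in> null_sets lebesgue" by (simp add: negligible_iff_null_sets)
    moreover have "{x::'a. c \<bullet> x = 0} \<in> sets borel" by measurable
    ultimately have "{x::'a. c \<bullet> x = 0} \<in> null_sets lborel"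
      using null_sets_completion_iff[of "{x::'a. c \<bullet> x = 0}" lborel] by simp
    then have "AE x in lborel. x \<notin> {x::'a. c \<bullet> x = 0}" by (rule AE_not_in)
    then show "AE x in lborel. x \<bullet> c \<noteq> 0" by (simp add: inner_commute)
  qed simp
  have "(\<integral>\<^sup>+(x::'a). indicator (cball 0 1) x * ennreal (norm x powr (- a)) \<partial>lborel)
      \<le> (\<integral>\<^sup>+(x::'a). (\<Prod>c\<in>Basis. f (x \<bullet> c)) \<partial>lborel)"
  proof (rule nn_integral_mono_AE, use ae in eventually_elim)
    case (elim x)
    show ?case
    proof (cases "x \<in> cball 0 1")
      case True
      have l: "\<bar>x \<bullet> c\<bar> \<le> 1" if "c \<in> Basis" for c
        using Basis_le_norm[OF that, of x] True by simp
      have nx: "0 < norm x" using elim SOME_Basis by fastforce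
      have "norm x powr (- a) = (\<Prod>c\<in>(Basis::'a set). norm x powr (- b))"
        using nx by (simp add: powr_realpow[symmetric] powr_powr b_def)
      also have "\<dots> \<le> (\<Prod>c\<in>(Basis::'a set). \<bar>x \<bullet> c\<bar> powr (- b))"
        using elim b nx by (intro prod_mono conjI powr_mono2' Basis_le_norm) auto
      also have "\<dots> = (\<Prod>c\<in>(Basis::'a set). indicator {-1..1} (x \<bullet> c) * \<bar>x \<bullet> c\<bar> powr (- b))"
        using l by (intro prod.cong) (auto simp: abs_le_iff)
      finally have "ennreal (norm x powr (- a)) \<le> (\<Prod>c\<in>Basis. f (x \<bullet> c))"
        unfolding f_def by (subst prod_ennreal) (auto intro!: ennreal_leI)
      then show ?thesis using True by simp
    qed simp
  qed
  also have "\<dots> = (\<Prod>c\<in>(Basis::'a set). \<integral>\<^sup>+t. f t \<partial>lborel)"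
    by (rule nn_integral_lborel_prod) (auto simp: f_def)
  also have "\<dots> < \<infinity>" using fin by (simp add: power_less_top_ennreal)
  finally show ?thesis .
qed

text \<open>Homogeneity: a ball of radius \<open>R\<close> is the image of the unit ball under a dilation.\<close>

lemma norm_powr_ball:
  fixes a :: real
  assumes "0 < a" "a < DIM('a)"
  shows "\<exists>C\<ge>0. \<forall>R>0. integrable lborel (\<lambda>x::'a::euclidean_space. indicator (cball 0 R) x * norm x powr (- a))
     \<and> (\<integral>(x::'a). indicator (cball 0 R) x * norm x powr (- a) \<partial>lborel) = C * R powr (DIM('a) - a)"
proof -
  let ?f = "\<lambda>R x::'a. indicator (cball 0 R) x * norm x powr (- a)"
  have m: "?f R \<in> borel_measurable borel" for R
    by (intro borel_measurable_times borel_measurable_indicator) auto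
  have i1: "integrable lborel (?f 1)"
    unfolding integrable_iff_bounded using nn_integral_norm_powr_unit_ball[OF assms] m
    by (simp add: ennreal_mult' ennreal_indicator)
  have s: "?f R (0 + R *\<^sub>R x) = R powr (- a) * ?f 1 x" if "0 < R" for R x
    using that by (auto simp: indicator_def powr_mult mult_le_cancel_left1)
  have "integrable lborel (?f R) \<and> (\<integral>x. ?f R x \<partial>lborel) = (\<integral>x. ?f 1 x \<partial>lborel) * R powr (DIM('a) - a)"
    if R: "0 < R" for R
  proof
    have "integrable lborel (\<lambda>x. ?f R (0 + R *\<^sub>R x))"
      unfolding s[OF R] by (rule integrable_mult_right[OF i1])
    then show "integrable lborel (?f R)"
      using integral_affine(1)[where c=R and t=0 and f="?f R", OF _ m] R by simp
    have "(\<integral>x. ?f R x \<partial>lborel) = R ^ DIM('a) * (\<integral>x. R powr (- a) * ?f 1 x \<partial>lborel)"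
      using integral_affine(2)[where c=R and t=0 and f="?f R", OF _ m] R unfolding s[OF R] by simp
    also have "\<dots> = (R ^ DIM('a) * R powr (- a)) * (\<integral>x. ?f 1 x \<partial>lborel)" by simp
    also have "R ^ DIM('a) * R powr (- a) = R powr (DIM('a) - a)"
      using R by (simp add: powr_realpow[symmetric] powr_add[symmetric])
    finally show "(\<integral>x. ?f R x \<partial>lborel) = (\<integral>x. ?f 1 x \<partial>lborel) * R powr (DIM('a) - a)" by simp
  qed
  moreover have "0 \<le> (\<integral>x. ?f 1 x \<partial>lborel)" by (intro integral_nonneg_AE) auto
  ultimately show ?thesis by blast
qed

section \<open>Square integrable functions and completeness of Lebesgue spaces\<close>

lemma square_integrable_mult:
  fixes f g :: "'a \<Rightarrow> 'b::{banach, second_countable_topology}"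
  assumes [measurable]: "f \<in> borel_measurable M" "g \<in> borel_measurable M"
    and f: "integrable M (\<lambda>x. (norm (f x))\<^sup>2)" and g: "integrable M (\<lambda>x. (norm (g x))\<^sup>2)"
  shows "integrable M (\<lambda>x. norm (f x) * norm (g x))"
    and "(\<integral>x. norm (f x) * norm (g x) \<partial>M)
       \<le> sqrt (\<integral>x. (norm (f x))\<^sup>2 \<partial>M) * sqrt (\<integral>x. (norm (g x))\<^sup>2 \<partial>M)"
proof -
  have 2: "norm (f x) * norm (g x) \<le> (norm (f x))\<^sup>2 + (norm (g x))\<^sup>2" for x
  proof -
    have "0 \<le> norm (f x) * norm (g x)" by simp
    then show ?thesis
      using sum_squares_bound[of "norm (f x)" "norm (g x)"] unfolding mult.assoc by linarith
  qed
  show i: "integrable M (\<lambda>x. norm (f x) * norm (g x))"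
    by (rule Bochner_Integration.integrable_bound[OF Bochner_Integration.integrable_add[OF f g]])
       (use 2 in auto)
  define F G P where "F = (\<integral>x. (norm (f x))\<^sup>2 \<partial>M)" and "G = (\<integral>x. (norm (g x))\<^sup>2 \<partial>M)"
    and "P = (\<integral>x. norm (f x) * norm (g x) \<partial>M)"
  have nn: "0 \<le> F" "0 \<le> G" "0 \<le> P" unfolding F_def G_def P_def by (auto intro!: integral_nonneg_AE)
  have q: "2 * t * P \<le> F + t\<^sup>2 * G" for t
  proof -
    have "0 \<le> (\<integral>x. (norm (f x) - t * norm (g x))\<^sup>2 \<partial>M)" by (intro integral_nonneg_AE) auto
    also have "\<dots> = (\<integral>x. (norm (f x))\<^sup>2 + t\<^sup>2 * (norm (g x))\<^sup>2 - 2 * t * (norm (f x) * norm (g x)) \<partial>M)"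
      by (intro Bochner_Integration.integral_cong) (auto simp: power2_eq_square algebra_simps)
    also have "\<dots> = F + t\<^sup>2 * G - 2 * t * P"
      unfolding F_def G_def P_def using f g i by simp
    finally show ?thesis by simp
  qed
  have "P\<^sup>2 \<le> F * G"
  proof (cases "G = 0")
    case True
    have "P = 0"
    proof (rule ccontr)
      assume "P \<noteq> 0"
      then show False using q[of "(F + 1) / (2 * P)"] True nn by simp
    qed
    then show ?thesis using nn by simp
  next
    case False
    then show ?thesis using q[of "P / G"] nn by (simp add: power2_eq_square field_simps)
  qed
  then have "sqrt (P\<^sup>2) \<le> sqrt (F * G)" by (rule real_sqrt_le_mono)
  then show "P \<le> sqrt F * sqrt G" using nn by (simp add: real_sqrt_mult)
qed

lemma square_integrable_mult_complex:
  fixes f g :: "'a \<Rightarrow> complex"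
  assumes m: "f \<in> borel_measurable M" "g \<in> borel_measurable M"
    and f: "integrable M (\<lambda>x. (norm (f x))\<^sup>2)" and g: "integrable M (\<lambda>x. (norm (g x))\<^sup>2)"
  shows "integrable M (\<lambda>x. f x * g x)"
    and "norm (\<integral>x. f x * g x \<partial>M) \<le> sqrt (\<integral>x. (norm (f x))\<^sup>2 \<partial>M) * sqrt (\<integral>x. (norm (g x))\<^sup>2 \<partial>M)"
proof -
  note i = square_integrable_mult[OF m f g]
  show "integrable M (\<lambda>x. f x * g x)"
    by (rule Bochner_Integration.integrable_bound[OF i(1)]) (use m in \<open>auto simp: norm_mult\<close>)
  have "norm (\<integral>x. f x * g x \<partial>M) \<le> (\<integral>x. norm (f x * g x) \<partial>M)" by (rule integral_norm_bound)
  then show "norm (\<integral>x. f x * g x \<partial>M) \<le> sqrt (\<integral>x. (norm (f x))\<^sup>2 \<partial>M) * sqrt (\<integral>x. (norm (g x))\<^sup>2 \<partial>M)"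
    using i(2) by (simp add: norm_mult)
qed

lemma norm_add_powr_le:
  fixes a b :: "'b::real_normed_vector"
  assumes "0 < q"
  shows "norm (a + b) powr q \<le> 2 powr q * (norm a powr q + norm b powr q)"
proof -
  have "norm (a + b) \<le> 2 * max (norm a) (norm b)" using norm_triangle_ineq[of a b] by linarith
  then have "norm (a + b) powr q \<le> (2 * max (norm a) (norm b)) powr q"
    using assms by (intro powr_mono2) auto
  also have "\<dots> = 2 powr q * max (norm a) (norm b) powr q" by (simp add: powr_mult)
  also have "\<dots> \<le> 2 powr q * (norm a powr q + norm b powr q)"
    by (intro mult_left_mono) (auto simp: max_def)
  finally show ?thesis .
qed

lemma integrable_powr_diff:
  fixes f g :: "'a \<Rightarrow> 'b::{banach, second_countable_topology}"
  assumes "0 < q" and [measurable]: "f \<in> borel_measurable M" "g \<in> borel_measurable M"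
    and "integrable M (\<lambda>x. norm (f x) powr q)" "integrable M (\<lambda>x. norm (g x) powr q)"
  shows "integrable M (\<lambda>x. norm (f x - g x) powr q)"
proof (rule Bochner_Integration.integrable_bound[
      OF integrable_mult_right[OF Bochner_Integration.integrable_add[OF assms(4,5)]]])
  show "AE x in M. norm (norm (f x - g x) powr q)
      \<le> norm (2 powr q * (norm (f x) powr q + norm (g x) powr q))"
    using norm_add_powr_le[OF assms(1), of "f _" "- g _"] by (intro AE_I2) auto
qed measurable

text \<open>Completeness of \<open>L\<^sup>q\<close>: a subsequence whose consecutive differences decay geometrically
  converges almost everywhere, and Fatou's lemma transports the Cauchy estimate to its limit.\<close>

lemma Lp_complete:
  fixes f :: "nat \<Rightarrow> 'a \<Rightarrow> 'b::{banach, second_countable_topology}"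
  assumes q: "0 < q" and m [measurable]: "\<And>k. f k \<in> borel_measurable M"
    and i: "\<And>k. integrable M (\<lambda>x. norm (f k x) powr q)"
    and cauchy: "\<And>e. 0 < e \<Longrightarrow> \<exists>N. \<forall>m\<ge>N. \<forall>k\<ge>N. (\<integral>x. norm (f m x - f k x) powr q \<partial>M) < e"
  shows "\<exists>g\<in>borel_measurable M. integrable M (\<lambda>x. norm (g x) powr q) \<and>
     (\<forall>k. integrable M (\<lambda>x. norm (f k x - g x) powr q)) \<and>
     (\<lambda>k. \<integral>x. norm (f k x - g x) powr q \<partial>M) \<longlonglongrightarrow> 0"
proof -
  have id: "integrable M (\<lambda>x. norm (f k x - f l x) powr q)" for k l
    by (rule integrable_powr_diff[OF q m m i i])
  obtain N where N: "\<And>e m k. 0 < e \<Longrightarrow> N e \<le> m \<Longrightarrow> N e \<le> k \<Longrightarrow>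
      (\<integral>x. norm (f m x - f k x) powr q \<partial>M) < e"
    using cauchy by metis
  \<comment> \<open>Along the subsequence \<open>r\<close> the \<open>q\<close>-th powers of consecutive differences have integrals at most \<open>4\<^sup>-\<^sup>j\<close>; weighting them by
    \<open>2\<^sup>j\<close> keeps their sum finite and forces geometric decay almost everywhere.\<close>
  define r where "r j = (\<Sum>i\<le>j. N ((1/4) ^ i)) + j" for j :: nat
  have rN: "N ((1/4) ^ j) \<le> r j" for j
    unfolding r_def using member_le_sum[of j "{..j}" "\<lambda>i. N ((1/4) ^ i)"] by simp
  have rS: "r j \<le> r (Suc j)" for j unfolding r_def by simp
  have rj: "j \<le> r j" for j unfolding r_def by simp
  define a where "a j x = norm (f (r (Suc j)) x - f (r j) x)" for j x
  have [measurable]: "a j \<in> borel_measurable M" for j unfolding a_def by measurable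
  have ia: "(\<integral>\<^sup>+x. ennreal (a j x powr q) \<partial>M) \<le> ennreal ((1/4) ^ j)" for j
  proof -
    have "(\<integral>\<^sup>+x. ennreal (a j x powr q) \<partial>M) = ennreal (\<integral>x. a j x powr q \<partial>M)"
      unfolding a_def by (rule nn_integral_eq_integral[OF id]) auto
    also have "\<dots> \<le> ennreal ((1/4) ^ j)"
      unfolding a_def using N[of "(1/4)^j" "r (Suc j)" "r j"] rN[of j] rS[of j]
      by (intro ennreal_leI) auto
    finally show ?thesis .
  qed
  have "(\<integral>\<^sup>+x. suminf (\<lambda>j. ennreal (2 ^ j * a j x powr q)) \<partial>M)
      = suminf (\<lambda>j. \<integral>\<^sup>+x. ennreal (2 ^ j * a j x powr q) \<partial>M)"
    by (rule nn_integral_suminf) measurable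
  also have "\<dots> = suminf (\<lambda>j. ennreal (2 ^ j) * (\<integral>\<^sup>+x. ennreal (a j x powr q) \<partial>M))"
    by (simp add: ennreal_mult nn_integral_cmult)
  also have "\<dots> \<le> suminf (\<lambda>j. ennreal (2 ^ j) * ennreal ((1/4) ^ j))"
    by (intro suminf_le mult_left_mono ia) auto
  also have "\<dots> = suminf (\<lambda>j. ennreal ((1/2) ^ j))"
    by (simp add: ennreal_mult[symmetric] power_mult_distrib[symmetric])
  also have "\<dots> < \<infinity>"
    by (subst suminf_ennreal_eq[of _ 2]) (use geometric_sums[of "1/2::real"] in auto)
  finally have "AE x in M. suminf (\<lambda>j. ennreal (2 ^ j * a j x powr q)) \<noteq> \<infinity>"
    by (intro nn_integral_PInf_AE) auto
  then have conv: "AE x in M. convergent (\<lambda>j. f (r j) x)"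
  proof eventually_elim
    case (elim x)
    have s: "summable (\<lambda>j. 2 ^ j * a j x powr q)"
      using elim by (intro summable_suminf_not_top) auto
    then have "(\<lambda>j. 2 ^ j * a j x powr q) \<longlonglongrightarrow> 0" by (rule summable_LIMSEQ_zero)
    then have ev: "eventually (\<lambda>j. 2 ^ j * a j x powr q < 1) sequentially"
      by (rule order_tendstoD) simp
    have ev: "eventually (\<lambda>j. norm (a j x) \<le> ((1/2) powr (1/q)) ^ j) sequentially"
      using ev
    proof eventually_elim
      case (elim j)
      have a0: "0 \<le> a j x" unfolding a_def by simp
      have "a j x powr q \<le> (1/2) ^ j" using elim by (simp add: power_one_over field_simps)
      then have "(a j x powr q) powr (1/q) \<le> ((1/2) ^ j) powr (1/q)"
        using q by (intro powr_mono2) auto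
      then show ?case using q a0
        by (cases "a j x = 0") (auto simp: powr_powr powr_realpow[symmetric] mult.commute)
    qed
    have "(1/2::real) powr (1/q) < 1" using q by (simp add: powr01_less_one)
    then have "summable (\<lambda>j. ((1/2::real) powr (1/q)) ^ j)" by (intro summable_geometric) auto
    from summable_comparison_test_ev[OF ev this] have "summable (\<lambda>j. norm (f (r (Suc j)) x - f (r j) x))"
      unfolding a_def .
    then have "summable (\<lambda>j. f (r (Suc j)) x - f (r j) x)" by (rule summable_norm_cancel)
    then have "convergent (\<lambda>n. f (r 0) x + (\<Sum>j<n. f (r (Suc j)) x - f (r j) x))"
      unfolding summable_iff_convergent by (intro convergent_add convergent_const)
    then show ?case using sum_lessThan_telescope[of "\<lambda>j. f (r j) x"] by simp
  qed
  define g where "g x = lim (\<lambda>j. f (r j) x)" for x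
  have gm [measurable]: "g \<in> borel_measurable M" unfolding g_def by measurable
  have lim: "AE x in M. (\<lambda>j. f (r j) x) \<longlonglongrightarrow> g x"
    using conv by eventually_elim (simp add: g_def convergent_LIMSEQ_iff)
  have fatou: "(\<integral>\<^sup>+x. ennreal (norm (f k x - g x) powr q) \<partial>M) \<le> ennreal e"
    if e: "0 < e" and k: "N e \<le> k" for e k
  proof -
    have "(\<integral>\<^sup>+x. ennreal (norm (f k x - g x) powr q) \<partial>M)
        = (\<integral>\<^sup>+x. liminf (\<lambda>j. ennreal (norm (f k x - f (r j) x) powr q)) \<partial>M)"
    proof (rule nn_integral_cong_AE, use lim in eventually_elim)
      case (elim x)
      have "(\<lambda>j. ennreal (norm (f k x - f (r j) x) powr q)) \<longlonglongrightarrow> ennreal (norm (f k x - g x) powr q)"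
        using q by (intro tendsto_ennrealI tendsto_powr' tendsto_intros elim) auto
      then show ?case by (rule lim_imp_Liminf[OF sequentially_bot, symmetric])
    qed
    also have "\<dots> \<le> liminf (\<lambda>j. \<integral>\<^sup>+x. ennreal (norm (f k x - f (r j) x) powr q) \<partial>M)"
      by (rule nn_integral_liminf) measurable
    also have "\<dots> \<le> ennreal e"
    proof (rule Liminf_le)
      show "\<forall>\<^sub>F j in sequentially. (\<integral>\<^sup>+x. ennreal (norm (f k x - f (r j) x) powr q) \<partial>M) \<le> ennreal e"
        using eventually_ge_at_top[of "N e"]
      proof eventually_elim
        case (elim j)
        have "(\<integral>\<^sup>+x. ennreal (norm (f k x - f (r j) x) powr q) \<partial>M)
            = ennreal (\<integral>x. norm (f k x - f (r j) x) powr q \<partial>M)"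
          by (rule nn_integral_eq_integral[OF id]) auto
        then show ?case using N[OF e k, of "r j"] elim rj[of j] by (auto intro!: ennreal_leI)
      qed
    qed simp
    finally show ?thesis .
  qed
  have id_g: "integrable M (\<lambda>x. norm (f k x - g x) powr q)" for k
  proof -
    have "integrable M (\<lambda>x. norm (f (N 1) x - g x) powr q)"
      unfolding integrable_iff_bounded using fatou[of 1 "N 1"] by (auto simp: le_less_trans)
    then have "integrable M (\<lambda>x. norm (- (f (N 1) x - g x)) powr q)"
      by (simp add: norm_minus_commute)
    from integrable_powr_diff[OF q _ _ id[of k "N 1"] this]
    have "integrable M (\<lambda>x. norm ((f k x - f (N 1) x) - (- (f (N 1) x - g x))) powr q)"
      by simp
    then show ?thesis by simp
  qed
  have "integrable M (\<lambda>x. norm (f 0 x - (f 0 x - g x)) powr q)"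
    by (rule integrable_powr_diff[OF q _ _ i id_g]) measurable
  then have ig: "integrable M (\<lambda>x. norm (g x) powr q)" by simp
  have "(\<lambda>k. \<integral>x. norm (f k x - g x) powr q \<partial>M) \<longlonglongrightarrow> 0"
  proof (rule LIMSEQ_I)
    fix e :: real assume e: "0 < e"
    have "norm ((\<integral>x. norm (f k x - g x) powr q \<partial>M) - 0) < e" if k: "N (e/2) \<le> k" for k
    proof -
      have "ennreal (\<integral>x. norm (f k x - g x) powr q \<partial>M) \<le> ennreal (e/2)"
        using fatou[of "e/2" k] e k nn_integral_eq_integral[OF id_g, of k] by simp
      moreover have "0 \<le> (\<integral>x. norm (f k x - g x) powr q \<partial>M)" by (intro integral_nonneg_AE) auto
      ultimately show ?thesis using e by (simp add: ennreal_le_iff)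
    qed
    then show "\<exists>no. \<forall>k\<ge>no. norm ((\<integral>x. norm (f k x - g x) powr q \<partial>M) - 0) < e" by blast
  qed
  then show ?thesis using gm ig id_g by blast
qed

section \<open>The Fourier transform of Schwartz functions\<close>

lemma gauss_isCont: "isCont gauss (x::'a::euclidean_space)"
  using gauss_continuous[where 'a='a] by (simp add: continuous_on_eq_continuous_at)

lemma abs_gauss [simp]: "\<bar>gauss x\<bar> = gauss x"
  using gauss_pos[of x] by simp

lemma schwartz_continuous: "g \<in> schwartz \<Longrightarrow> continuous_on UNIV g"
  by (simp add: schwartz_def smooth_continuous)

lemma schwartz_measurable: "g \<in> schwartz \<Longrightarrow> g \<in> borel_measurable borel"
  by (rule borel_measurable_continuous_onI[OF schwartz_continuous])

lemma schwartz_moment_integrable: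
  fixes g :: "real^'n::finite \<Rightarrow> complex"
  assumes g: "g \<in> schwartz"
  shows "integrable lborel (\<lambda>x. norm x ^ k * norm (g x))"
proof -
  note [measurable] = schwartz_measurable[OF g]
  obtain C where C: "0 \<le> C" "\<And>x. (1 + norm x) ^ (k + 2 * CARD('n)) * norm (g x) \<le> C"
    using schwartz_decay[OF g, of "k + 2 * CARD('n)"] by blast
  show ?thesis
  proof (rule Bochner_Integration.integrable_bound[OF integrable_mult_right[OF integrable_decay, of C]])
    show "AE x::real^'n in lborel. norm (norm x ^ k * norm (g x)) \<le> norm (C * (1 / (1 + norm x) ^ (2 * DIM(real^'n))))"
    proof (intro AE_I2)
      fix x :: "real^'n"
      have p: "0 < (1 + norm x) ^ (2 * CARD('n))" by (intro zero_less_power) (simp add: add_pos_nonneg)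
      have "norm x ^ k * norm (g x) * (1 + norm x) ^ (2 * CARD('n))
          \<le> (1 + norm x) ^ k * norm (g x) * (1 + norm x) ^ (2 * CARD('n))"
        by (intro mult_right_mono power_mono) auto
      also have "\<dots> \<le> C" using C(2)[of x] by (simp add: power_add mult_ac)
      finally have "norm x ^ k * norm (g x) \<le> C / (1 + norm x) ^ (2 * CARD('n))"
        using p by (simp add: pos_le_divide_eq)
      then show "norm (norm x ^ k * norm (g x)) \<le> norm (C * (1 / (1 + norm x) ^ (2 * DIM(real^'n))))"
        using C(1) p by (simp add: abs_mult)
    qed
  qed measurable
qed

lemma schwartz_integrable: "g \<in> schwartz \<Longrightarrow> integrable lborel g"
  using schwartz_moment_integrable[of g 0] schwartz_measurable[of g]
  by (simp add: integrable_norm_iff)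

lemma schwartz_norm_bounded: "g \<in> schwartz \<Longrightarrow> \<exists>B\<ge>0. \<forall>x. norm (g x) \<le> B"
  using schwartz_decay[of g 0] by simp

lemma schwartz_square_moment_integrable:
  assumes g: "g \<in> schwartz"
  shows "integrable lborel (\<lambda>x. norm x ^ k * (norm (g x))\<^sup>2)"
proof -
  note [measurable] = schwartz_measurable[OF g]
  obtain B where B: "0 \<le> B" "\<And>x. norm (g x) \<le> B" using schwartz_norm_bounded[OF g] by blast
  show ?thesis
  proof (rule Bochner_Integration.integrable_bound[OF integrable_mult_right[OF schwartz_moment_integrable[OF g, of k], of B]])
    show "AE x in lborel. norm (norm x ^ k * (norm (g x))\<^sup>2) \<le> norm (B * (norm x ^ k * norm (g x)))"
    proof (intro AE_I2)
      fix x
      have "norm (g x) * (norm x ^ k * norm (g x)) \<le> B * (norm x ^ k * norm (g x))"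
        by (intro mult_right_mono B) auto
      then show "norm (norm x ^ k * (norm (g x))\<^sup>2) \<le> norm (B * (norm x ^ k * norm (g x)))"
        using B by (simp add: abs_mult power2_eq_square mult_ac)
    qed
  qed measurable
qed

lemma schwartz_square_integrable: "g \<in> schwartz \<Longrightarrow> integrable lborel (\<lambda>x. (norm (g x))\<^sup>2)"
  using schwartz_square_moment_integrable[of g 0] by simp

lemma fourier_measurable [measurable]:
  assumes [measurable]: "u \<in> borel_measurable borel"
  shows "fourier u \<in> borel_measurable borel"
  unfolding fourier_def by measurable

lemma fourier_integrand:
  assumes "integrable lborel u"
  shows "integrable lborel (\<lambda>x. exp (- \<i> * of_real (x \<bullet> \<xi>)) * u x)"
proof -
  note [measurable] = borel_measurable_integrable[OF assms]
  show ?thesis by (rule Bochner_Integration.integrable_bound[OF assms]) (auto simp: norm_mult)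
qed

lemma norm_fourier_le: "norm (fourier u \<xi>) \<le> (\<integral>x. norm (u x) \<partial>lborel)"
proof -
  have "norm (fourier u \<xi>) \<le> (\<integral>x. norm (exp (- \<i> * of_real (x \<bullet> \<xi>)) * u x) \<partial>lborel)"
    unfolding fourier_def by (rule integral_norm_bound)
  then show ?thesis by (simp add: norm_mult)
qed

lemma fourier_lincomb:
  assumes "integrable lborel u" "integrable lborel v"
  shows "fourier (\<lambda>x. a * u x + b * v x) \<xi> = a * fourier u \<xi> + b * fourier v \<xi>"
proof -
  have "fourier (\<lambda>x. a * u x + b * v x) \<xi> = (\<integral>x. a * (exp (- \<i> * of_real (x \<bullet> \<xi>)) * u x)
      + b * (exp (- \<i> * of_real (x \<bullet> \<xi>)) * v x) \<partial>lborel)"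
    unfolding fourier_def by (intro Bochner_Integration.integral_cong) (auto simp: algebra_simps)
  also have "\<dots> = a * fourier u \<xi> + b * fourier v \<xi>"
    unfolding fourier_def
    by (subst Bochner_Integration.integral_add)
       (intro integrable_mult_right fourier_integrand assms | simp)+
  finally show ?thesis .
qed

lemma fourier_diff:
  assumes "integrable lborel u" "integrable lborel v"
  shows "fourier (\<lambda>x. u x - v x) \<xi> = fourier u \<xi> - fourier v \<xi>"
  using fourier_lincomb[OF assms, of 1 "-1"] by simp

lemma fourier_cmult: "fourier (\<lambda>x. c * u x) \<xi> = c * fourier u \<xi>"
  unfolding fourier_def by (subst integral_mult_right_zero[symmetric]) (simp add: mult_ac)

lemma fourier_real_reflect:
  "fourier (\<lambda>x. complex_of_real (u x)) (- \<xi>) = cnj (fourier (\<lambda>x. complex_of_real (u x)) \<xi>)"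
  unfolding fourier_def by (simp add: exp_cnj flip: Bochner_Integration.integral_cnj)

text \<open>The multiplication formula, on which the distributional Fourier transform rests.\<close>

lemma fourier_swap:
  fixes u w :: "real^'n::finite \<Rightarrow> complex"
  assumes u: "integrable lborel u" and w: "integrable lborel w"
  shows "(\<integral>\<xi>. fourier u \<xi> * w \<xi> \<partial>lborel) = (\<integral>x. u x * fourier w x \<partial>lborel)"
proof -
  have m: "(\<lambda>(x::real^'n, \<xi>). exp (- \<i> * complex_of_real (x \<bullet> \<xi>))) \<in> borel_measurable (lborel \<Otimes>\<^sub>M lborel)"
    by measurable
  have "(\<integral>x. u x * (\<integral>\<xi>. exp (- \<i> * of_real (x \<bullet> \<xi>)) * w \<xi> \<partial>lborel) \<partial>lborel)
      = (\<integral>\<xi>. (\<integral>x. u x * exp (- \<i> * of_real (x \<bullet> \<xi>)) \<partial>lborel) * w \<xi> \<partial>lborel)"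
    by (rule fubini_bounded_kernel(2)[OF u w m, of 1]) simp
  then show ?thesis unfolding fourier_def by (simp add: inner_commute mult.commute)
qed

lemma bounded_fourier_integrable:
  assumes "integrable lborel u" "integrable lborel w"
  shows "integrable lborel (\<lambda>\<xi>. fourier u \<xi> * w \<xi>)"
proof -
  note [measurable] = borel_measurable_integrable[OF assms(1)] borel_measurable_integrable[OF assms(2)]
  show ?thesis
  proof (rule Bochner_Integration.integrable_bound[OF integrable_mult_right[OF assms(2), of "of_real (\<integral>x. norm (u x) \<partial>lborel)"]])
    show "AE x in lborel. norm (fourier u x * w x) \<le> norm (of_real (\<integral>x. norm (u x) \<partial>lborel) * w x)"
      using norm_fourier_le[of u] by (intro AE_I2) (simp add: norm_mult mult_right_mono)
  qed measurable
qed

text \<open>Damping the inversion integral by a Gaussian turns it into an average of \<open>u\<close> against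
  a concentrated Gaussian; all convergence questions below are settled on the right-hand side.\<close>

lemma damped_inversion:
  fixes u :: "real^'n::finite \<Rightarrow> complex"
  assumes u: "integrable lborel u" and s: "0 < s"
  shows "(\<integral>\<xi>. fourier u \<xi> * (exp (\<i> * of_real (x \<bullet> \<xi>)) * of_real (gauss (s *\<^sub>R \<xi>))) \<partial>lborel)
       = of_real (sqrt (2 * pi) ^ CARD('n)) * (\<integral>z. u (x - s *\<^sub>R z) * of_real (gauss z) \<partial>lborel)"
    and "integrable lborel (\<lambda>\<xi>. exp (\<i> * of_real (x \<bullet> \<xi>)) * complex_of_real (gauss (s *\<^sub>R \<xi>)))"
proof -
  note [measurable] = borel_measurable_integrable[OF u]
  \<comment> \<open>The transform of the damped wave \<open>w\<close> is a Gaussian of width \<open>s\<close> around \<open>x\<close>.\<close>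
  define w where "w \<xi> = exp (\<i> * of_real (x \<bullet> \<xi>)) * complex_of_real (gauss (s *\<^sub>R \<xi>))" for \<xi>
  have [measurable]: "w \<in> borel_measurable borel" unfolding w_def by measurable
  have gs: "integrable lborel (\<lambda>\<xi>::real^'n. gauss (s *\<^sub>R \<xi>))"
    using integral_affine(1)[where c=s and t=0 and f="gauss::real^'n\<Rightarrow>real"] s gauss_integrable by simp
  show w: "integrable lborel (\<lambda>\<xi>. exp (\<i> * of_real (x \<bullet> \<xi>)) * complex_of_real (gauss (s *\<^sub>R \<xi>)))"
    by (rule Bochner_Integration.integrable_bound[OF gs])
       (auto simp: norm_mult)
  have fw: "fourier w y = of_real (sqrt (2 * pi) ^ CARD('n) / s ^ CARD('n) * gauss ((1/s) *\<^sub>R (x - y)))" for y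
  proof -
    let ?f = "\<lambda>\<xi>::real^'n. exp (\<i> * of_real (\<xi> \<bullet> ((1/s) *\<^sub>R (x - y)))) * complex_of_real (gauss \<xi>)"
    have "(\<integral>\<xi>. ?f \<xi> \<partial>lborel) = (s ^ CARD('n)) *\<^sub>R (\<integral>\<xi>. ?f (s *\<^sub>R \<xi>) \<partial>lborel)"
      using integral_affine(2)[where c=s and t=0 and f="?f"] s by simp
    also have "(\<integral>\<xi>. ?f (s *\<^sub>R \<xi>) \<partial>lborel) = fourier w y"
      unfolding fourier_def w_def
    proof (rule Bochner_Integration.integral_cong)
      fix \<xi>
      have "\<i> * complex_of_real ((s *\<^sub>R \<xi>) \<bullet> ((1/s) *\<^sub>R (x - y))) = - \<i> * of_real (\<xi> \<bullet> y) + \<i> * of_real (x \<bullet> \<xi>)"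
        using s by (simp add: inner_diff_right inner_commute algebra_simps)
      then show "?f (s *\<^sub>R \<xi>) = exp (- \<i> * of_real (\<xi> \<bullet> y)) * (exp (\<i> * of_real (x \<bullet> \<xi>)) * of_real (gauss (s *\<^sub>R \<xi>)))"
        by (simp only: exp_add mult.assoc)
    qed simp
    finally have "of_real (s ^ CARD('n)) * fourier w y = of_real (sqrt (2 * pi) ^ CARD('n) * gauss ((1/s) *\<^sub>R (x - y)))"
      by (simp only: gauss_fourier(1)) (simp add: scaleR_conv_of_real)
    then show ?thesis using s by (simp add: field_simps)
  qed
  have "(\<integral>\<xi>. fourier u \<xi> * w \<xi> \<partial>lborel) = (\<integral>y. u y * fourier w y \<partial>lborel)"
    by (rule fourier_swap[OF u]) (use w in \<open>simp add: w_def[abs_def]\<close>)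
  also have "\<dots> = (s ^ CARD('n)) *\<^sub>R (\<integral>z. u (x + (- s) *\<^sub>R z) * fourier w (x + (- s) *\<^sub>R z) \<partial>lborel)"
    using integral_affine(2)[where c="-s" and t=x and f="\<lambda>y. u y * fourier w y"] s by simp
  also have "(\<integral>z. u (x + (- s) *\<^sub>R z) * fourier w (x + (- s) *\<^sub>R z) \<partial>lborel)
      = (\<integral>z. of_real (sqrt (2 * pi) ^ CARD('n) / s ^ CARD('n)) * (u (x - s *\<^sub>R z) * of_real (gauss z)) \<partial>lborel)"
    by (intro Bochner_Integration.integral_cong) (use s in \<open>auto simp: fw\<close>)
  also have "(s ^ CARD('n)) *\<^sub>R \<dots>
      = of_real (sqrt (2 * pi) ^ CARD('n)) * (\<integral>z. u (x - s *\<^sub>R z) * of_real (gauss z) \<partial>lborel)"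
    unfolding integral_mult_right_zero using s by (simp add: scaleR_conv_of_real field_simps)
  finally show "(\<integral>\<xi>. fourier u \<xi> * (exp (\<i> * of_real (x \<bullet> \<xi>)) * of_real (gauss (s *\<^sub>R \<xi>))) \<partial>lborel)
       = of_real (sqrt (2 * pi) ^ CARD('n)) * (\<integral>z. u (x - s *\<^sub>R z) * of_real (gauss z) \<partial>lborel)"
    unfolding w_def .
qed

lemma gauss_average_limit:
  fixes c :: "'a::euclidean_space \<Rightarrow> complex"
  assumes cont: "continuous_on UNIV c" and B: "\<And>x. norm (c x) \<le> B"
    and s: "s \<longlonglongrightarrow> 0"
  shows "(\<lambda>k. \<integral>z. c (x - s k *\<^sub>R z) * of_real (gauss z) \<partial>lborel)
      \<longlonglongrightarrow> c x * of_real (sqrt (2 * pi) ^ DIM('a))"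
proof -
  have [measurable]: "c \<in> borel_measurable borel" by (rule borel_measurable_continuous_onI[OF cont])
  have "(\<lambda>k. \<integral>z. c (x - s k *\<^sub>R z) * of_real (gauss z) \<partial>lborel) \<longlonglongrightarrow> (\<integral>(z::'a). c x * of_real (gauss z) \<partial>lborel)"
  proof (rule integral_dominated_convergence[where w="\<lambda>z. B * gauss z"])
    show "integrable lborel (\<lambda>z::'a. B * gauss z)" by (intro integrable_mult_right gauss_integrable)
    show "AE z in lborel. (\<lambda>k. c (x - s k *\<^sub>R z) * of_real (gauss z)) \<longlonglongrightarrow> c x * of_real (gauss z)"
    proof (intro AE_I2 tendsto_mult tendsto_const)
      fix z
      have "(\<lambda>k. x - s k *\<^sub>R z) \<longlonglongrightarrow> x - 0 *\<^sub>R z" by (intro tendsto_intros s)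
      then have "(\<lambda>k. x - s k *\<^sub>R z) \<longlonglongrightarrow> x" by simp
      moreover have "isCont c x" using cont by (simp add: continuous_on_eq_continuous_at)
      ultimately show "(\<lambda>k. c (x - s k *\<^sub>R z)) \<longlonglongrightarrow> c x" by (rule isCont_tendsto_compose[rotated])
    qed
    show "AE z in lborel. norm (c (x - s k *\<^sub>R z) * of_real (gauss z)) \<le> B * gauss z" for k
      by (intro AE_I2) (auto simp: norm_mult intro!: mult_right_mono B less_imp_le[OF gauss_pos])
  qed measurable
  also have "(\<integral>(z::'a). c x * of_real (gauss z) \<partial>lborel) = c x * of_real (\<integral>(z::'a). gauss z \<partial>lborel)"
    by simp
  finally show ?thesis unfolding gauss_integral .
qed

lemma shrinking_scale: "(\<lambda>k. 1 / real (Suc k)) \<longlonglongrightarrow> 0"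
  using LIMSEQ_inverse_real_of_nat by (simp add: inverse_eq_divide)

lemma gauss_scale_limit: "(\<lambda>k. gauss ((1 / real (Suc k)) *\<^sub>R \<xi>)) \<longlonglongrightarrow> 1"
proof -
  have "(\<lambda>k. (1 / real (Suc k)) *\<^sub>R \<xi>) \<longlonglongrightarrow> 0 *\<^sub>R \<xi>"
    by (intro tendsto_intros shrinking_scale)
  then have "(\<lambda>k. gauss ((1 / real (Suc k)) *\<^sub>R \<xi>)) \<longlonglongrightarrow> gauss (0 *\<^sub>R \<xi>)"
    by (rule isCont_tendsto_compose[OF gauss_isCont])
  then show ?thesis by (simp add: gauss_def)
qed

lemma sqrt_2pi_power: "complex_of_real (sqrt (2 * pi) ^ n) * of_real (sqrt (2 * pi) ^ n) = of_real ((2 * pi) ^ n)"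
  unfolding of_real_mult[symmetric] power_mult_distrib[symmetric] by simp

theorem fourier_inversion:
  fixes u :: "real^'n::finite \<Rightarrow> complex"
  assumes u: "integrable lborel u" and fu: "integrable lborel (fourier u)"
    and cont: "continuous_on UNIV u" and B: "\<And>x. norm (u x) \<le> B"
  shows "inv_fourier (fourier u) x = u x"
proof -
  let ?s = "\<lambda>k. 1 / real (Suc k)"
  note [measurable] = borel_measurable_integrable[OF u] borel_measurable_integrable[OF fu]
  have "(\<lambda>k. \<integral>\<xi>. fourier u \<xi> * (exp (\<i> * of_real (x \<bullet> \<xi>)) * of_real (gauss (?s k *\<^sub>R \<xi>))) \<partial>lborel)
      \<longlonglongrightarrow> (\<integral>\<xi>. fourier u \<xi> * (exp (\<i> * of_real (x \<bullet> \<xi>)) * of_real 1) \<partial>lborel)"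
  proof (rule integral_dominated_convergence[where w="\<lambda>\<xi>. norm (fourier u \<xi>)"])
    show "AE \<xi> in lborel. (\<lambda>k. fourier u \<xi> * (exp (\<i> * of_real (x \<bullet> \<xi>)) * of_real (gauss (?s k *\<^sub>R \<xi>))))
        \<longlonglongrightarrow> fourier u \<xi> * (exp (\<i> * of_real (x \<bullet> \<xi>)) * of_real 1)"
      by (intro AE_I2 tendsto_intros gauss_scale_limit)
    show "AE \<xi> in lborel. norm (fourier u \<xi> * (exp (\<i> * of_real (x \<bullet> \<xi>)) * of_real (gauss (?s k *\<^sub>R \<xi>))))
        \<le> norm (fourier u \<xi>)" for k
      by (intro AE_I2) (simp add: norm_mult mult_left_le gauss_le_1 less_imp_le[OF gauss_pos])
  qed (use fu in \<open>measurable, auto\<close>)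
  moreover have "(\<lambda>k. \<integral>\<xi>. fourier u \<xi> * (exp (\<i> * of_real (x \<bullet> \<xi>)) * of_real (gauss (?s k *\<^sub>R \<xi>))) \<partial>lborel)
      \<longlonglongrightarrow> of_real (sqrt (2 * pi) ^ CARD('n)) * (u x * of_real (sqrt (2 * pi) ^ CARD('n)))"
  proof -
    have "(\<integral>\<xi>. fourier u \<xi> * (exp (\<i> * of_real (x \<bullet> \<xi>)) * of_real (gauss (?s k *\<^sub>R \<xi>))) \<partial>lborel)
        = of_real (sqrt (2 * pi) ^ CARD('n)) * (\<integral>z. u (x - ?s k *\<^sub>R z) * of_real (gauss z) \<partial>lborel)" for k
      by (rule damped_inversion(1)[OF u]) simp
    then show ?thesis
      using gauss_average_limit[OF cont B shrinking_scale, of x]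
      by (simp only: DIM_cart DIM_real mult_1_right) (intro tendsto_mult tendsto_const)
  qed
  ultimately have "(\<integral>\<xi>. fourier u \<xi> * (exp (\<i> * of_real (x \<bullet> \<xi>)) * of_real 1) \<partial>lborel)
      = of_real (sqrt (2 * pi) ^ CARD('n)) * (u x * of_real (sqrt (2 * pi) ^ CARD('n)))"
    by (rule LIMSEQ_unique)
  also have "\<dots> = of_real ((2 * pi) ^ CARD('n)) * u x"
    unfolding sqrt_2pi_power[symmetric] by (simp add: mult_ac)
  finally have "(\<integral>\<xi>. exp (\<i> * of_real (x \<bullet> \<xi>)) * fourier u \<xi> \<partial>lborel) = of_real ((2 * pi) ^ CARD('n)) * u x"
    by (simp add: mult.commute)
  then show ?thesis unfolding inv_fourier_def by simp
qed

lemma iexp_remainder: "norm (exp (- \<i> * complex_of_real t) - 1 - (- \<i> * of_real t)) \<le> t\<^sup>2 / 2"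
proof -
  have "{..1::nat} = {0, 1}" by auto
  then show ?thesis using iexp_approx1[of "-t" 1] by (simp add: numeral_2_eq_2 algebra_simps)
qed

text \<open>Differentiation under the integral sign, with an explicit quadratic remainder that the second
  moment of \<open>g\<close> controls.\<close>

lemma fourier_has_derivative:
  fixes g :: "real^'n::finite \<Rightarrow> complex"
  assumes g: "g \<in> schwartz"
  shows "(fourier g has_derivative
     (\<lambda>h. \<integral>x. exp (- \<i> * of_real (x \<bullet> \<xi>)) * (- \<i> * of_real (x \<bullet> h) * g x) \<partial>lborel)) (at \<xi>)"
proof -
  note [measurable] = schwartz_measurable[OF g]
  define e where "e x = exp (- \<i> * complex_of_real (x \<bullet> \<xi>))" for x
  have ne [simp]: "norm (e x) = 1" for x by (simp add: e_def)
  have [measurable]: "e \<in> borel_measurable borel" unfolding e_def by measurable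
  define m where "m k = (\<integral>x. norm x ^ k * norm (g x) \<partial>lborel)" for k
  have iD: "integrable lborel (\<lambda>x. e x * (- \<i> * of_real (x \<bullet> h) * g x))" for h
  proof (rule Bochner_Integration.integrable_bound[OF integrable_mult_right[OF schwartz_moment_integrable[OF g, of 1], of "norm h"]])
    show "AE x in lborel. norm (e x * (- \<i> * of_real (x \<bullet> h) * g x)) \<le> norm (norm h * (norm x ^ 1 * norm (g x)))"
    proof (intro AE_I2)
      fix x
      have "\<bar>x \<bullet> h\<bar> * norm (g x) \<le> (norm x * norm h) * norm (g x)"
        by (intro mult_right_mono Cauchy_Schwarz_ineq2) auto
      then show "norm (e x * (- \<i> * of_real (x \<bullet> h) * g x)) \<le> norm (norm h * (norm x ^ 1 * norm (g x)))"
        by (simp add: norm_mult mult_ac)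
    qed
  qed measurable
  define D where "D h = (\<integral>x. e x * (- \<i> * of_real (x \<bullet> h) * g x) \<partial>lborel)" for h
  have bl: "bounded_linear D"
  proof (rule bounded_linear_intro[where K="m 1"])
    show "D (a + b) = D a + D b" for a b
      unfolding D_def Bochner_Integration.integral_add[OF iD iD, symmetric]
      by (intro Bochner_Integration.integral_cong) (auto simp: inner_add_right algebra_simps)
    show "D (r *\<^sub>R a) = r *\<^sub>R D a" for r a
      unfolding D_def integral_scaleR_right[symmetric]
      by (intro Bochner_Integration.integral_cong)
         (auto simp: inner_scaleR_right scaleR_conv_of_real[of _ "_::complex"] mult_ac)
    show "norm (D h) \<le> norm h * m 1" for h
    proof -
      have "norm (D h) \<le> (\<integral>x. norm (e x * (- \<i> * of_real (x \<bullet> h) * g x)) \<partial>lborel)"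
        unfolding D_def by (rule integral_norm_bound)
      also have "\<dots> \<le> (\<integral>x. norm h * (norm x ^ 1 * norm (g x)) \<partial>lborel)"
      proof (rule integral_mono)
        show "integrable lborel (\<lambda>x. norm (e x * (- \<i> * of_real (x \<bullet> h) * g x)))"
          using iD by (rule integrable_norm)
        show "integrable lborel (\<lambda>x. norm h * (norm x ^ 1 * norm (g x)))"
          by (intro integrable_mult_right schwartz_moment_integrable g)
        fix x
        have "\<bar>x \<bullet> h\<bar> * norm (g x) \<le> (norm x * norm h) * norm (g x)"
          by (intro mult_right_mono Cauchy_Schwarz_ineq2) auto
        then show "norm (e x * (- \<i> * of_real (x \<bullet> h) * g x)) \<le> norm h * (norm x ^ 1 * norm (g x))"
          by (simp add: norm_mult mult_ac)
      qed
      also have "\<dots> = norm h * m 1" unfolding m_def by simp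
      finally show ?thesis .
    qed
  qed
  have rem: "norm (fourier g y - fourier g \<xi> - D (y - \<xi>)) / norm (y - \<xi>) \<le> m 2 * norm (y - \<xi>)" for y
  proof -
    have i1: "integrable lborel (\<lambda>x. exp (- \<i> * of_real (x \<bullet> z)) * g x)" for z
      by (rule fourier_integrand[OF schwartz_integrable[OF g]])
    have "fourier g y - fourier g \<xi> - D (y - \<xi>)
        = (\<integral>x. exp (- \<i> * of_real (x \<bullet> y)) * g x - exp (- \<i> * of_real (x \<bullet> \<xi>)) * g x
            - e x * (- \<i> * of_real (x \<bullet> (y - \<xi>)) * g x) \<partial>lborel)"
      unfolding fourier_def D_def using i1 iD by simp
    also have "\<dots> = (\<integral>x. e x * ((exp (- \<i> * of_real (x \<bullet> (y - \<xi>))) - 1 - (- \<i> * of_real (x \<bullet> (y - \<xi>)))) * g x) \<partial>lborel)"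
    proof (intro Bochner_Integration.integral_cong refl)
      fix x
      have "- \<i> * complex_of_real (x \<bullet> y) = - \<i> * of_real (x \<bullet> \<xi>) + - \<i> * of_real (x \<bullet> (y - \<xi>))"
        by (simp add: inner_diff_right algebra_simps)
      then have "exp (- \<i> * complex_of_real (x \<bullet> y)) = e x * exp (- \<i> * of_real (x \<bullet> (y - \<xi>)))"
        unfolding e_def by (simp only: exp_add)
      then show "exp (- \<i> * of_real (x \<bullet> y)) * g x - exp (- \<i> * of_real (x \<bullet> \<xi>)) * g x
            - e x * (- \<i> * of_real (x \<bullet> (y - \<xi>)) * g x)
          = e x * ((exp (- \<i> * of_real (x \<bullet> (y - \<xi>))) - 1 - (- \<i> * of_real (x \<bullet> (y - \<xi>)))) * g x)"
        by (simp add: e_def[of x] algebra_simps)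
    qed
    also have "norm \<dots> \<le> (\<integral>x. (norm (y - \<xi>))\<^sup>2 * (norm x ^ 2 * norm (g x)) \<partial>lborel)"
    proof (rule order_trans[OF integral_norm_bound integral_mono'])
      show "integrable lborel (\<lambda>x. (norm (y - \<xi>))\<^sup>2 * (norm x ^ 2 * norm (g x)))"
        by (intro integrable_mult_right schwartz_moment_integrable g)
      fix x
      have "norm (exp (- \<i> * complex_of_real (x \<bullet> (y - \<xi>))) - 1 - (- \<i> * of_real (x \<bullet> (y - \<xi>)))) \<le> (x \<bullet> (y - \<xi>))\<^sup>2 / 2"
        by (rule iexp_remainder)
      also have "\<dots> \<le> \<bar>x \<bullet> (y - \<xi>)\<bar>\<^sup>2" by simp
      also have "\<dots> \<le> (norm x * norm (y - \<xi>))\<^sup>2" by (intro power_mono Cauchy_Schwarz_ineq2) auto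
      finally have "norm (exp (- \<i> * complex_of_real (x \<bullet> (y - \<xi>))) - 1 - (- \<i> * of_real (x \<bullet> (y - \<xi>)))) * norm (g x)
          \<le> (norm x * norm (y - \<xi>))\<^sup>2 * norm (g x)" by (intro mult_right_mono) auto
      then show "norm (e x * ((exp (- \<i> * of_real (x \<bullet> (y - \<xi>))) - 1 - (- \<i> * of_real (x \<bullet> (y - \<xi>)))) * g x))
          \<le> (norm (y - \<xi>))\<^sup>2 * (norm x ^ 2 * norm (g x))"
        by (simp add: norm_mult power_mult_distrib mult_ac)
    qed auto
    also have "\<dots> = (norm (y - \<xi>))\<^sup>2 * m 2" unfolding m_def by simp
    finally have "norm (fourier g y - fourier g \<xi> - D (y - \<xi>)) / norm (y - \<xi>) \<le> (norm (y - \<xi>))\<^sup>2 * m 2 / norm (y - \<xi>)"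
      by (intro divide_right_mono) auto
    then show ?thesis by (cases "y = \<xi>") (auto simp: power2_eq_square mult.commute)
  qed
  have "(fourier g has_derivative D) (at \<xi>)"
  proof (rule has_derivativeI_sandwich[OF zero_less_one bl rem])
    have "((\<lambda>y. m 2 * norm (y - \<xi>)) \<longlongrightarrow> m 2 * norm (\<xi> - \<xi>)) (at \<xi>)"
      by (intro tendsto_intros)
    then show "((\<lambda>y. m 2 * norm (y - \<xi>)) \<longlongrightarrow> 0) (at \<xi>)" by simp
  qed
  then show ?thesis unfolding D_def e_def .
qed

lemma partial_fourier:
  assumes "g \<in> schwartz"
  shows "partial i (fourier g) = fourier (\<lambda>x. - \<i> * (of_real (x $ i) * g x))"
  by (rule ext, subst partial_eqI[OF fourier_has_derivative[OF assms]])
     (simp add: fourier_def inner_axis mult.assoc)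

text \<open>Translation invariance: the integral of \<open>g(x + e\<^sub>i) - g(x)\<close> vanishes, and by the fundamental theorem
  of calculus and Fubini's theorem it is also the integral of the derivative.\<close>

lemma integral_partial_zero:
  fixes g :: "real^'n::finite \<Rightarrow> complex"
  assumes d: "g differentiable_on UNIV" and c: "continuous_on UNIV (partial i g)"
    and ig: "integrable lborel g" and ip: "integrable lborel (partial i g)"
  shows "(\<integral>x. partial i g x \<partial>lborel) = 0"
proof -
  let ?e = "axis i 1 :: real^'n"
  have [measurable]: "partial i g \<in> borel_measurable borel" "g \<in> borel_measurable borel"
    using borel_measurable_integrable[OF ip] borel_measurable_integrable[OF ig] by auto
  have line: "(\<integral>s. indicator {0..1} s *\<^sub>R partial i g (x + s *\<^sub>R ?e) \<partial>lborel) = g (x + ?e) - g x" for x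
  proof -
    have "(\<integral>s. indicator {0..1} s *\<^sub>R partial i g (x + s *\<^sub>R ?e) \<partial>lborel) = g (x + 1 *\<^sub>R ?e) - g (x + 0 *\<^sub>R ?e)"
    proof (rule integral_FTC_atLeastAtMost)
      fix s :: real
      have 1: "((\<lambda>s. x + s *\<^sub>R ?e) has_derivative (\<lambda>h. h *\<^sub>R ?e)) (at s)"
        by (auto intro!: derivative_eq_intros)
      have "((\<lambda>s. g (x + s *\<^sub>R ?e)) has_derivative (\<lambda>h. frechet_derivative g (at (x + s *\<^sub>R ?e)) (h *\<^sub>R ?e))) (at s)"
        by (rule has_derivative_compose[OF 1 differentiable_on_UNIV_has_derivative[OF d]])
      moreover have "frechet_derivative g (at (x + s *\<^sub>R ?e)) (h *\<^sub>R ?e) = h *\<^sub>R partial i g (x + s *\<^sub>R ?e)" for h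
        unfolding partial_def
        using has_derivative_linear[OF differentiable_on_UNIV_has_derivative[OF d]]
        by (rule linear_cmul)
      ultimately have "((\<lambda>s. g (x + s *\<^sub>R ?e)) has_vector_derivative partial i g (x + s *\<^sub>R ?e)) (at s)"
        unfolding has_vector_derivative_def by simp
      then show "((\<lambda>s. g (x + s *\<^sub>R ?e)) has_vector_derivative partial i g (x + s *\<^sub>R ?e)) (at s within {0..1})"
        by (rule has_vector_derivative_at_within)
    next
      show "continuous_on {0..1} (\<lambda>s. partial i g (x + s *\<^sub>R ?e))"
        by (intro continuous_on_compose2[OF c] continuous_intros) auto
    qed simp
    then show ?thesis by simp
  qed
  have tr: "(\<integral>x. partial i g (x + s *\<^sub>R ?e) \<partial>lborel) = (\<integral>x. partial i g x \<partial>lborel)"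
    "integrable lborel (\<lambda>x. partial i g (x + s *\<^sub>R ?e))" for s
    using integral_translate[of "partial i g" "s *\<^sub>R ?e"] ip by auto
  have trn: "(\<integral>x. norm (partial i g (x + s *\<^sub>R ?e)) \<partial>lborel) = (\<integral>x. norm (partial i g x) \<partial>lborel)" for s
    using integral_translate(2)[of "\<lambda>x. norm (partial i g x)" "s *\<^sub>R ?e"] by simp
  have int: "integrable (lborel \<Otimes>\<^sub>M lborel) (\<lambda>(s, x). indicator {0..1} s *\<^sub>R partial i g (x + s *\<^sub>R ?e))"
  proof (rule lborel_pair.Fubini_integrable)
    have "integrable lborel (\<lambda>s::real. indicator {0..1} s * (\<integral>x. norm (partial i g x) \<partial>lborel))"
      by (intro integrable_mult_left) (simp add: integrable_indicator_iff)
    then show "integrable lborel (\<lambda>s. \<integral>x. norm (case (s, x) of (s, x) \<Rightarrow> indicator {0..1} s *\<^sub>R partial i g (x + s *\<^sub>R ?e)) \<partial>lborel)"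
      by (simp add: trn)
    show "AE s in lborel. integrable lborel (\<lambda>x. case (s, x) of (s, x) \<Rightarrow> indicator {0..1} s *\<^sub>R partial i g (x + s *\<^sub>R ?e))"
      using tr(2) by (intro AE_I2) (simp add: integrable_scaleR_right)
  qed measurable
  have ind: "(\<integral>s. indicator {0..1::real} s *\<^sub>R c \<partial>lborel) = c" for c :: complex
    by (subst integral_scaleR_left) (auto simp: integrable_indicator_iff)
  have "(\<integral>s. (\<integral>x. indicator {0..1} s *\<^sub>R partial i g (x + s *\<^sub>R ?e) \<partial>lborel) \<partial>lborel)
      = (\<integral>s. indicator {0..1::real} s *\<^sub>R (\<integral>x. partial i g x \<partial>lborel) \<partial>lborel)"
    by (simp only: integral_scaleR_right tr(1))
  also have "\<dots> = (\<integral>x. partial i g x \<partial>lborel)"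
    by (rule ind)
  finally have "(\<integral>x. partial i g x \<partial>lborel)
      = (\<integral>s. (\<integral>x. indicator {0..1} s *\<^sub>R partial i g (x + s *\<^sub>R ?e) \<partial>lborel) \<partial>lborel)" ..
  also have "\<dots> = (\<integral>x. (\<integral>s. indicator {0..1} s *\<^sub>R partial i g (x + s *\<^sub>R ?e) \<partial>lborel) \<partial>lborel)"
    using lborel_pair.Fubini_integral[OF int] by simp
  also have "\<dots> = (\<integral>x. g (x + ?e) \<partial>lborel) - (\<integral>x. g x \<partial>lborel)"
    unfolding line using ig integral_translate(1)[of g ?e] by simp
  also have "\<dots> = 0" using integral_translate(2)[of g ?e] by simp
  finally show ?thesis .
qed

text \<open>Integration by parts, obtained by applying \<open>integral_partial_zero\<close> to the product of \<open>g\<close> and the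
  exponential.\<close>

lemma fourier_partial:
  fixes g :: "real^'n::finite \<Rightarrow> complex"
  assumes g: "g \<in> schwartz"
  shows "fourier (partial i g) \<xi> = \<i> * of_real (\<xi> $ i) * fourier g \<xi>"
proof -
  let ?E = "\<lambda>x. exp (- \<i> * complex_of_real (x \<bullet> \<xi>))"
  have d: "((\<lambda>x. ?E x * g x) has_derivative (\<lambda>h. ?E x * frechet_derivative g (at x) h
      + (?E x * (- \<i> * of_real (h \<bullet> \<xi>))) * g x)) (at x)" for x
  proof (rule has_derivative_mult)
    have "bounded_linear (\<lambda>x::real^'n. - \<i> * complex_of_real (x \<bullet> \<xi>))"
      by (intro bounded_linear_compose[OF bounded_linear_mult_right]
          bounded_linear_compose[OF bounded_linear_of_real bounded_linear_inner_left])
    from has_derivative_compose[OF bounded_linear_imp_has_derivative[OF this, of "at x"]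
        DERIV_exp[unfolded has_field_derivative_def]]
    show "(?E has_derivative (\<lambda>h. ?E x * (- \<i> * of_real (h \<bullet> \<xi>)))) (at x)" .
  qed (rule smooth_has_derivative[OF schwartz_smooth[OF g]])
  have p: "partial i (\<lambda>x. ?E x * g x) = (\<lambda>x. ?E x * partial i g x - \<i> * of_real (\<xi> $ i) * (?E x * g x))"
    by (rule ext, subst partial_eqI[OF d]) (simp add: partial_def inner_axis inner_commute algebra_simps)
  have i1: "integrable lborel (\<lambda>x. ?E x * g x)"
    by (rule fourier_integrand[OF schwartz_integrable[OF g]])
  have i2: "integrable lborel (\<lambda>x. ?E x * partial i g x)"
    by (rule fourier_integrand[OF schwartz_integrable[OF schwartz_partial[OF g]]])
  have "(\<integral>x. partial i (\<lambda>x. ?E x * g x) x \<partial>lborel) = 0"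
  proof (rule integral_partial_zero)
    show "(\<lambda>x. ?E x * g x) differentiable_on UNIV"
      unfolding differentiable_on_def differentiable_def using d by blast
    show "continuous_on UNIV (partial i (\<lambda>x. ?E x * g x))"
      unfolding p by (intro continuous_intros schwartz_continuous g schwartz_partial)
    show "integrable lborel (partial i (\<lambda>x. ?E x * g x))"
      unfolding p by (intro Bochner_Integration.integrable_diff integrable_mult_right i1 i2)
  qed (rule i1)
  then have "fourier (partial i g) \<xi> - \<i> * of_real (\<xi> $ i) * fourier g \<xi> = 0"
    unfolding p fourier_def using i1 i2 by simp
  then show ?thesis by simp
qed

lemma fourier_bounded_by_powers:
  assumes g: "g \<in> schwartz"
  shows "\<exists>B. \<forall>\<xi>. \<bar>\<xi> $ i\<bar> ^ m * norm (fourier g \<xi>) \<le> B"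
proof -
  have s: "(partial i ^^ k) g \<in> schwartz" for k
    by (induction k) (use g schwartz_partial in auto)
  have "fourier ((partial i ^^ m) g) \<xi> = (\<i> * of_real (\<xi> $ i)) ^ m * fourier g \<xi>" for \<xi>
    by (induction m) (auto simp: fourier_partial s mult.assoc)
  then have "norm (fourier ((partial i ^^ m) g) \<xi>) = \<bar>\<xi> $ i\<bar> ^ m * norm (fourier g \<xi>)" for \<xi>
    by (simp add: norm_mult norm_power)
  then show ?thesis using norm_fourier_le[of "(partial i ^^ m) g"] by metis
qed

lemma norm_power_le_sum_components:
  fixes x :: "real^'n::finite"
  shows "norm x ^ m \<le> real CARD('n) ^ m * (\<Sum>i\<in>UNIV. \<bar>x $ i\<bar> ^ m)"
proof -
  define M where "M = Max (range (\<lambda>i. \<bar>x $ i\<bar>))"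
  have "M \<in> range (\<lambda>i. \<bar>x $ i\<bar>)" unfolding M_def by (rule Max_in) auto
  then obtain j where j: "M = \<bar>x $ j\<bar>" by auto
  have le: "\<bar>x $ i\<bar> \<le> M" for i unfolding M_def by (rule Max_ge) auto
  have "norm x \<le> (\<Sum>i\<in>UNIV. \<bar>x $ i\<bar>)" by (rule norm_le_l1_cart)
  also have "\<dots> \<le> real CARD('n) * M" using sum_bounded_above[of UNIV "\<lambda>i. \<bar>x $ i\<bar>" M] le by simp
  finally have "norm x ^ m \<le> (real CARD('n) * M) ^ m" by (intro power_mono) auto
  also have "\<dots> = real CARD('n) ^ m * \<bar>x $ j\<bar> ^ m" unfolding j by (simp add: power_mult_distrib)
  also have "\<bar>x $ j\<bar> ^ m \<le> (\<Sum>i\<in>UNIV. \<bar>x $ i\<bar> ^ m)" by (rule member_le_sum) auto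
  finally show ?thesis by (simp add: mult_left_mono)
qed

lemma schwartz_fourier:
  assumes "g \<in> schwartz"
  shows "fourier g \<in> schwartz"
proof (rule schwartz_coinduct[where X="fourier ` schwartz"])
  fix h :: "real^'a \<Rightarrow> complex" and i m
  assume "h \<in> fourier ` schwartz"
  then obtain g where h: "h = fourier g" and g: "g \<in> schwartz" by auto
  show "h differentiable_on UNIV"
    unfolding h differentiable_on_def differentiable_def using fourier_has_derivative[OF g] by blast
  show "partial i h \<in> fourier ` schwartz"
    unfolding h partial_fourier[OF g] by (intro imageI schwartz_cmult schwartz_mult_coord g)
  have "\<forall>i. \<exists>B. \<forall>\<xi>. \<bar>\<xi> $ i\<bar> ^ m * norm (fourier g \<xi>) \<le> B"
    using fourier_bounded_by_powers[OF g] by blast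
  then obtain B where B: "\<And>i \<xi>. \<bar>\<xi> $ i\<bar> ^ m * norm (fourier g \<xi>) \<le> B i" by metis
  have "norm x ^ m * norm (h x) \<le> real CARD('a) ^ m * (\<Sum>i\<in>UNIV. B i)" for x
  proof -
    have "norm x ^ m * norm (h x) \<le> real CARD('a) ^ m * (\<Sum>i\<in>UNIV. \<bar>x $ i\<bar> ^ m) * norm (h x)"
      by (intro mult_right_mono norm_power_le_sum_components) auto
    also have "\<dots> = real CARD('a) ^ m * (\<Sum>i\<in>UNIV. \<bar>x $ i\<bar> ^ m * norm (h x))"
      by (simp add: sum_distrib_right mult.assoc)
    also have "\<dots> \<le> real CARD('a) ^ m * (\<Sum>i\<in>UNIV. B i)"
      unfolding h by (intro mult_left_mono sum_mono B) auto
    finally show ?thesis .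
  qed
  then show "bounded (range (\<lambda>x. norm x ^ m * norm (h x)))"
    by (auto simp: bounded_iff abs_mult intro!: exI[of _ "real CARD('a) ^ m * (\<Sum>i\<in>UNIV. B i)"])
qed (rule imageI[OF assms])

lemma inv_fourier_eq_fourier:
  fixes g :: "real^'n::finite \<Rightarrow> complex"
  shows "inv_fourier g x = of_real (1 / (2 * pi) ^ CARD('n)) * fourier g (- x)"
  unfolding inv_fourier_def fourier_def by (simp add: inner_commute)

lemma schwartz_inv_fourier: "g \<in> schwartz \<Longrightarrow> inv_fourier g \<in> schwartz"
  unfolding inv_fourier_eq_fourier[abs_def]
  by (intro schwartz_cmult schwartz_reflect[of "fourier g"] schwartz_fourier)

lemma inv_fourier_fourier:
  assumes "g \<in> schwartz"
  shows "inv_fourier (fourier g) = g"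
proof
  fix x
  obtain B where "\<And>x. norm (g x) \<le> B" using schwartz_norm_bounded[OF assms] by blast
  then show "inv_fourier (fourier g) x = g x"
    by (intro fourier_inversion schwartz_integrable schwartz_fourier schwartz_continuous assms)
qed

lemma fourier_inv_fourier:
  assumes g: "g \<in> schwartz"
  shows "fourier (inv_fourier g) = g"
proof
  fix x
  have m: "(\<lambda>y. exp (- \<i> * complex_of_real (y \<bullet> x)) * fourier g (- y)) \<in> borel_measurable borel"
    using schwartz_measurable[OF schwartz_fourier[OF g]] by measurable
  have "fourier (inv_fourier g) x = of_real (1 / (2 * pi) ^ CARD('a)) * (\<integral>y. exp (- \<i> * complex_of_real (y \<bullet> x)) * fourier g (- y) \<partial>lborel)"
    unfolding inv_fourier_eq_fourier[abs_def] fourier_cmult by (simp add: fourier_def)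
  also have "(\<integral>y. exp (- \<i> * complex_of_real (y \<bullet> x)) * fourier g (- y) \<partial>lborel)
      = (\<integral>y. exp (\<i> * complex_of_real (x \<bullet> y)) * fourier g y \<partial>lborel)"
    using integral_reflect(2)[OF m] by (simp add: inner_commute)
  finally have "fourier (inv_fourier g) x = inv_fourier (fourier g) x" unfolding inv_fourier_def .
  then show "fourier (inv_fourier g) x = g x" by (simp add: inv_fourier_fourier[OF g])
qed

section \<open>Plancherel's inequality and uniqueness\<close>

lemma cnj_measurable [measurable (raw)]:
  "f \<in> borel_measurable M \<Longrightarrow> (\<lambda>x. cnj (f x)) \<in> borel_measurable M"
  by (rule measurable_compose[OF _ borel_measurable_continuous_onI[OF continuous_on_cnj[OF continuous_on_id]]])

lemma norm_integral_le_nn_integral: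
  fixes f :: "'a \<Rightarrow> 'b::{banach, second_countable_topology}"
  shows "ennreal (norm (\<integral>x. f x \<partial>M)) \<le> (\<integral>\<^sup>+x. ennreal (norm (f x)) \<partial>M)"
  by (cases "integrable M f") (simp_all add: integral_norm_bound_ennreal not_integrable_integral_eq)

text \<open>By the multiplication formula and \<open>damped_inversion\<close>, the damped integral equals the pairing of \<open>u\<close> with its own
  Gaussian average; \<open>2xy \<le> x\<^sup>2 + y\<^sup>2\<close> and translation invariance bound it by the square integral of \<open>u\<close>, for
  every width of the Gaussian.\<close>

lemma damped_plancherel:
  fixes u :: "real^'n::finite \<Rightarrow> complex"
  assumes u: "integrable lborel u" and u2: "integrable lborel (\<lambda>x. (norm (u x))\<^sup>2)" and s: "0 < s"
  shows "(\<integral>\<^sup>+\<xi>. ennreal ((norm (fourier u \<xi>))\<^sup>2 * gauss (s *\<^sub>R \<xi>)) \<partial>lborel)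
       \<le> ennreal ((2 * pi) ^ CARD('n) * (\<integral>x. (norm (u x))\<^sup>2 \<partial>lborel))"
proof -
  note [measurable] = borel_measurable_integrable[OF u]
  define a where "a = sqrt (2 * pi) ^ CARD('n)"
  have a0: "0 \<le> a" by (simp add: a_def)
  define U where "U = (\<integral>x. (norm (u x))\<^sup>2 \<partial>lborel)"
  have U0: "0 \<le> U" unfolding U_def by (intro integral_nonneg_AE) auto
  define w where "w \<xi> = cnj (fourier u \<xi>) * complex_of_real (gauss (s *\<^sub>R \<xi>))" for \<xi>
  have [measurable]: "w \<in> borel_measurable borel" unfolding w_def by measurable
  have gs: "integrable lborel (\<lambda>\<xi>::real^'n. complex_of_real (gauss (s *\<^sub>R \<xi>)))"
    using damped_inversion(2)[OF u s, of 0] by simp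
  have w: "integrable lborel w"
  proof (rule Bochner_Integration.integrable_bound[OF bounded_fourier_integrable[OF u gs]])
    show "AE \<xi> in lborel. norm (w \<xi>) \<le> norm (fourier u \<xi> * complex_of_real (gauss (s *\<^sub>R \<xi>)))"
      by (simp add: w_def norm_mult)
  qed measurable
  have fw: "fourier w x = cnj (of_real a * (\<integral>z. u (x - s *\<^sub>R z) * of_real (gauss z) \<partial>lborel))" for x
  proof -
    have "fourier w x = (\<integral>\<xi>. cnj (fourier u \<xi> * (exp (\<i> * of_real (x \<bullet> \<xi>)) * of_real (gauss (s *\<^sub>R \<xi>)))) \<partial>lborel)"
      unfolding fourier_def[of w] w_def
      by (intro Bochner_Integration.integral_cong) (auto simp: exp_cnj inner_commute mult_ac)
    also have "\<dots> = cnj (\<integral>\<xi>. fourier u \<xi> * (exp (\<i> * of_real (x \<bullet> \<xi>)) * of_real (gauss (s *\<^sub>R \<xi>))) \<partial>lborel)"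
      by (rule Bochner_Integration.integral_cnj)
    finally show ?thesis unfolding damped_inversion(1)[OF u s] a_def .
  qed
  have nn: "(\<integral>\<^sup>+(z::real^'n). ennreal (gauss z) \<partial>lborel) = ennreal a"
  proof -
    have "integrable lborel (gauss :: real^'n \<Rightarrow> real)" by (rule gauss_integrable)
    from nn_integral_eq_integral[OF this] show ?thesis
      unfolding a_def using gauss_integral[where 'a="real^'n"] by (simp add: less_imp_le[OF gauss_pos])
  qed
  \<comment> \<open>The factor \<open>1/2\<close> of this inequality is kept symbolic, which stops the simplifier from rewriting the
    extended nonnegative reals that contain it.\<close>
  define H :: real where "H = 1/2"
  have H0 [simp]: "0 \<le> H" by (simp add: H_def)
  have nU: "(\<integral>\<^sup>+x. ennreal ((norm (u x))\<^sup>2) \<partial>lborel) = ennreal U"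
    unfolding U_def by (rule nn_integral_eq_integral[OF u2]) auto
  have nfw: "ennreal (norm (fourier w x)) \<le> ennreal a * (\<integral>\<^sup>+z. ennreal (norm (u (x - s *\<^sub>R z)) * gauss z) \<partial>lborel)" for x
  proof -
    have "ennreal (norm (fourier w x)) = ennreal a * ennreal (norm (\<integral>z. u (x - s *\<^sub>R z) * of_real (gauss z) \<partial>lborel))"
      unfolding fw using a0 by (simp add: norm_mult ennreal_mult')
    also have "\<dots> \<le> ennreal a * (\<integral>\<^sup>+z. ennreal (norm (u (x - s *\<^sub>R z) * of_real (gauss z))) \<partial>lborel)"
      by (intro mult_left_mono norm_integral_le_nn_integral) simp
    finally show ?thesis by (simp add: norm_mult)
  qed
  have int: "integrable lborel (\<lambda>\<xi>. (norm (fourier u \<xi>))\<^sup>2 * gauss (s *\<^sub>R \<xi>))"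
    and eq: "complex_of_real (\<integral>\<xi>. (norm (fourier u \<xi>))\<^sup>2 * gauss (s *\<^sub>R \<xi>) \<partial>lborel) = (\<integral>\<xi>. fourier u \<xi> * w \<xi> \<partial>lborel)"
  proof -
    have e: "fourier u \<xi> * w \<xi> = complex_of_real ((norm (fourier u \<xi>))\<^sup>2 * gauss (s *\<^sub>R \<xi>))" for \<xi>
      unfolding w_def of_real_mult complex_norm_square by (simp add: mult.assoc)
    show "integrable lborel (\<lambda>\<xi>. (norm (fourier u \<xi>))\<^sup>2 * gauss (s *\<^sub>R \<xi>))"
      using bounded_fourier_integrable[OF u w] unfolding e complex_of_real_integrable_eq .
    show "complex_of_real (\<integral>\<xi>. (norm (fourier u \<xi>))\<^sup>2 * gauss (s *\<^sub>R \<xi>) \<partial>lborel) = (\<integral>\<xi>. fourier u \<xi> * w \<xi> \<partial>lborel)"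
      unfolding e integral_complex_of_real ..
  qed
  define I where "I = (\<integral>\<xi>. (norm (fourier u \<xi>))\<^sup>2 * gauss (s *\<^sub>R \<xi>) \<partial>lborel)"
  have I0: "0 \<le> I" unfolding I_def
    by (intro integral_nonneg_AE AE_I2 mult_nonneg_nonneg) (auto intro: less_imp_le gauss_pos)
  have "ennreal I = ennreal (norm (\<integral>x. u x * fourier w x \<partial>lborel))"
    using arg_cong[OF eq, of norm] I0 unfolding fourier_swap[OF u w] I_def by simp
  also have "\<dots> \<le> (\<integral>\<^sup>+x. ennreal (norm (u x * fourier w x)) \<partial>lborel)"
    by (rule norm_integral_le_nn_integral)
  also have "\<dots> \<le> (\<integral>\<^sup>+x. ennreal a * (\<integral>\<^sup>+z. ennreal (norm (u x)) * ennreal (norm (u (x - s *\<^sub>R z)) * gauss z) \<partial>lborel) \<partial>lborel)"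
  proof (rule nn_integral_mono)
    fix x
    have "ennreal (norm (u x * fourier w x)) = ennreal (norm (u x)) * ennreal (norm (fourier w x))"
      by (simp add: norm_mult ennreal_mult)
    also have "\<dots> \<le> ennreal (norm (u x)) * (ennreal a * (\<integral>\<^sup>+z. ennreal (norm (u (x - s *\<^sub>R z)) * gauss z) \<partial>lborel))"
      by (intro mult_left_mono nfw) simp
    also have "\<dots> = ennreal a * (\<integral>\<^sup>+z. ennreal (norm (u x)) * ennreal (norm (u (x - s *\<^sub>R z)) * gauss z) \<partial>lborel)"
      by (simp add: nn_integral_cmult mult_ac)
    finally show "ennreal (norm (u x * fourier w x))
        \<le> ennreal a * (\<integral>\<^sup>+z. ennreal (norm (u x)) * ennreal (norm (u (x - s *\<^sub>R z)) * gauss z) \<partial>lborel)" .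
  qed
  also have "\<dots> \<le> (\<integral>\<^sup>+x. ennreal a * (\<integral>\<^sup>+z. ennreal (H * (norm (u x))\<^sup>2) * ennreal (gauss z)
      + ennreal (H * (norm (u (x - s *\<^sub>R z)))\<^sup>2) * ennreal (gauss z) \<partial>lborel) \<partial>lborel)"
  proof (intro nn_integral_mono mult_left_mono)
    fix x z
    have "norm (u x) * norm (u (x - s *\<^sub>R z)) \<le> H * (norm (u x))\<^sup>2 + H * (norm (u (x - s *\<^sub>R z)))\<^sup>2"
      using sum_squares_bound[of "norm (u x)" "norm (u (x - s *\<^sub>R z))"] by (simp add: H_def)
    then have "norm (u x) * norm (u (x - s *\<^sub>R z)) * gauss z
        \<le> (H * (norm (u x))\<^sup>2 + H * (norm (u (x - s *\<^sub>R z)))\<^sup>2) * gauss z"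
      by (intro mult_right_mono) (auto intro: less_imp_le gauss_pos)
    then have "ennreal (norm (u x) * (norm (u (x - s *\<^sub>R z)) * gauss z))
        \<le> ennreal (H * (norm (u x))\<^sup>2 * gauss z + H * (norm (u (x - s *\<^sub>R z)))\<^sup>2 * gauss z)"
      by (intro ennreal_leI) (simp add: algebra_simps)
    then show "ennreal (norm (u x)) * ennreal (norm (u (x - s *\<^sub>R z)) * gauss z)
        \<le> ennreal (H * (norm (u x))\<^sup>2) * ennreal (gauss z)
          + ennreal (H * (norm (u (x - s *\<^sub>R z)))\<^sup>2) * ennreal (gauss z)"
      using gauss_pos[of z] by (simp add: ennreal_mult[symmetric] ennreal_plus[symmetric] less_imp_le del: ennreal_plus)
  qed simp
  also have "\<dots> = ennreal a * ((\<integral>\<^sup>+x. (\<integral>\<^sup>+(z::real^'n). ennreal (H * (norm (u x))\<^sup>2) * ennreal (gauss z) \<partial>lborel) \<partial>lborel)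
      + (\<integral>\<^sup>+x. (\<integral>\<^sup>+z. ennreal (H * (norm (u (x - s *\<^sub>R z)))\<^sup>2) * ennreal (gauss z) \<partial>lborel) \<partial>lborel))"
    by (simp add: nn_integral_cmult nn_integral_add)
  also have "(\<integral>\<^sup>+x. (\<integral>\<^sup>+(z::real^'n). ennreal (H * (norm (u x))\<^sup>2) * ennreal (gauss z) \<partial>lborel) \<partial>lborel)
      = ennreal H * ennreal U * ennreal a"
    by (simp add: nn_integral_cmult nn_integral_multc nn nU ennreal_mult')
  also have "(\<integral>\<^sup>+x. (\<integral>\<^sup>+z. ennreal (H * (norm (u (x - s *\<^sub>R z)))\<^sup>2) * ennreal (gauss z) \<partial>lborel) \<partial>lborel)
      = (\<integral>\<^sup>+z. (\<integral>\<^sup>+x. ennreal (H * (norm (u (x - s *\<^sub>R z)))\<^sup>2) * ennreal (gauss z) \<partial>lborel) \<partial>lborel)"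
    by (rule lborel_pair.Fubini') measurable
  also have "\<dots> = (\<integral>\<^sup>+(z::real^'n). ennreal H * ennreal U * ennreal (gauss z) \<partial>lborel)"
  proof (rule nn_integral_cong)
    fix z :: "real^'n"
    have "(\<integral>\<^sup>+x. ennreal ((norm (u (x - s *\<^sub>R z)))\<^sup>2) \<partial>lborel) = ennreal U"
      using nn_integral_affine[where c=1 and t="- (s *\<^sub>R z)" and f="\<lambda>x. ennreal ((norm (u x))\<^sup>2)"] nU
      by simp
    then show "(\<integral>\<^sup>+x. ennreal (H * (norm (u (x - s *\<^sub>R z)))\<^sup>2) * ennreal (gauss z) \<partial>lborel)
        = ennreal H * ennreal U * ennreal (gauss z)"
      by (simp add: nn_integral_cmult nn_integral_multc ennreal_mult')
  qed
  also have "\<dots> = ennreal H * ennreal U * ennreal a" by (simp add: nn_integral_cmult nn)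
  also have "ennreal a * (ennreal H * ennreal U * ennreal a + ennreal H * ennreal U * ennreal a)
      = ennreal (a * (H * U * a + H * U * a))"
  proof -
    have n: "0 \<le> H * U * a" using a0 U0 by simp
    have "ennreal H * ennreal U * ennreal a = ennreal (H * U * a)"
      using a0 U0 by (simp only: ennreal_mult mult_nonneg_nonneg H0)
    then show ?thesis
      using a0 n by (simp only: ennreal_plus[symmetric] ennreal_mult[symmetric] add_nonneg_nonneg)
  qed
  also have "a * (H * U * a + H * U * a) = (2 * pi) ^ CARD('n) * U"
  proof -
    have "a * a = (2 * pi) ^ CARD('n)"
      unfolding a_def power_mult_distrib[symmetric] by simp
    moreover have "a * (H * U * a + H * U * a) = (a * a) * U" unfolding H_def by simp
    ultimately show ?thesis by simp
  qed
  finally have le: "ennreal I \<le> ennreal ((2 * pi) ^ CARD('n) * U)" .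
  have "(\<integral>\<^sup>+\<xi>. ennreal ((norm (fourier u \<xi>))\<^sup>2 * gauss (s *\<^sub>R \<xi>)) \<partial>lborel) = ennreal I"
    unfolding I_def
    by (rule nn_integral_eq_integral[OF int], intro AE_I2 mult_nonneg_nonneg) (auto intro: less_imp_le gauss_pos)
  then show ?thesis using le unfolding U_def by simp
qed

text \<open>The damping is removed by Fatou's lemma, whence an inequality; it makes the transform continuous
  for the \<open>L\<^sup>2\<close> norm.\<close>

theorem plancherel_inequality:
  fixes u :: "real^'n::finite \<Rightarrow> complex"
  assumes u: "integrable lborel u" and u2: "integrable lborel (\<lambda>x. (norm (u x))\<^sup>2)"
  shows "integrable lborel (\<lambda>\<xi>. (norm (fourier u \<xi>))\<^sup>2)"
    and "(\<integral>\<xi>. (norm (fourier u \<xi>))\<^sup>2 \<partial>lborel) \<le> (2 * pi) ^ CARD('n) * (\<integral>x. (norm (u x))\<^sup>2 \<partial>lborel)"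
proof -
  note [measurable] = borel_measurable_integrable[OF u]
  let ?B = "(2 * pi) ^ CARD('n) * (\<integral>x. (norm (u x))\<^sup>2 \<partial>lborel)"
  let ?s = "\<lambda>k. 1 / real (Suc k)"
  have B0: "0 \<le> ?B" by (intro mult_nonneg_nonneg integral_nonneg_AE) auto
  have "(\<integral>\<^sup>+\<xi>. ennreal ((norm (fourier u \<xi>))\<^sup>2) \<partial>lborel)
      = (\<integral>\<^sup>+\<xi>. liminf (\<lambda>k. ennreal ((norm (fourier u \<xi>))\<^sup>2 * gauss (?s k *\<^sub>R \<xi>))) \<partial>lborel)"
  proof (rule nn_integral_cong)
    fix \<xi>
    have "(\<lambda>k. ennreal ((norm (fourier u \<xi>))\<^sup>2 * gauss (?s k *\<^sub>R \<xi>))) \<longlonglongrightarrow> ennreal ((norm (fourier u \<xi>))\<^sup>2 * 1)"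
      by (intro tendsto_ennrealI tendsto_mult tendsto_const gauss_scale_limit)
    from lim_imp_Liminf[OF sequentially_bot this]
    show "ennreal ((norm (fourier u \<xi>))\<^sup>2) = liminf (\<lambda>k. ennreal ((norm (fourier u \<xi>))\<^sup>2 * gauss (?s k *\<^sub>R \<xi>)))"
      by simp
  qed
  also have "\<dots> \<le> liminf (\<lambda>k. \<integral>\<^sup>+\<xi>. ennreal ((norm (fourier u \<xi>))\<^sup>2 * gauss (?s k *\<^sub>R \<xi>)) \<partial>lborel)"
    by (rule nn_integral_liminf) measurable
  also have "\<dots> \<le> ennreal ?B"
  proof (rule Liminf_le)
    show "\<forall>\<^sub>F k in sequentially. (\<integral>\<^sup>+\<xi>. ennreal ((norm (fourier u \<xi>))\<^sup>2 * gauss (?s k *\<^sub>R \<xi>)) \<partial>lborel) \<le> ennreal ?B"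
      by (intro always_eventually allI damped_plancherel[OF u u2]) simp
  qed simp
  finally have le: "(\<integral>\<^sup>+\<xi>. ennreal ((norm (fourier u \<xi>))\<^sup>2) \<partial>lborel) \<le> ennreal ?B" .
  show i: "integrable lborel (\<lambda>\<xi>. (norm (fourier u \<xi>))\<^sup>2)"
    unfolding integrable_iff_bounded using le by (auto simp: le_less_trans)
  show "(\<integral>\<xi>. (norm (fourier u \<xi>))\<^sup>2 \<partial>lborel) \<le> ?B"
    using le B0 unfolding nn_integral_eq_integral[OF i, simplified] by (simp add: ennreal_le_iff)
qed

lemma L2_pairing_limit:
  fixes f :: "nat \<Rightarrow> 'a \<Rightarrow> complex"
  assumes m: "\<And>j. f j \<in> borel_measurable M" "g \<in> borel_measurable M" "\<phi> \<in> borel_measurable M"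
    and d: "\<And>j. integrable M (\<lambda>x. (norm (f j x - g x))\<^sup>2)"
    and lim: "(\<lambda>j. \<integral>x. (norm (f j x - g x))\<^sup>2 \<partial>M) \<longlonglongrightarrow> 0"
    and \<phi>: "integrable M (\<lambda>x. (norm (\<phi> x))\<^sup>2)"
    and g: "integrable M (\<lambda>x. g x * \<phi> x)"
  shows "\<And>j. integrable M (\<lambda>x. f j x * \<phi> x)"
    and "(\<lambda>j. \<integral>x. f j x * \<phi> x \<partial>M) \<longlonglongrightarrow> (\<integral>x. g x * \<phi> x \<partial>M)"
proof -
  have m': "(\<lambda>x. f j x - g x) \<in> borel_measurable M" for j using m by measurable
  note cs = square_integrable_mult_complex[OF m' m(3) d \<phi>]
  show i: "integrable M (\<lambda>x. f j x * \<phi> x)" for j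
    using Bochner_Integration.integrable_add[OF cs(1)[of j] g] by (simp add: algebra_simps)
  have "(\<lambda>j. sqrt (\<integral>x. (norm (f j x - g x))\<^sup>2 \<partial>M) * sqrt (\<integral>x. (norm (\<phi> x))\<^sup>2 \<partial>M)) \<longlonglongrightarrow> sqrt 0 * sqrt (\<integral>x. (norm (\<phi> x))\<^sup>2 \<partial>M)"
    by (intro tendsto_intros lim)
  then have z: "(\<lambda>j. sqrt (\<integral>x. (norm (f j x - g x))\<^sup>2 \<partial>M) * sqrt (\<integral>x. (norm (\<phi> x))\<^sup>2 \<partial>M)) \<longlonglongrightarrow> 0" by simp
  have "(\<lambda>j. (\<integral>x. f j x * \<phi> x \<partial>M) - (\<integral>x. g x * \<phi> x \<partial>M)) \<longlonglongrightarrow> 0"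
  proof (rule Lim_null_comparison[OF _ z], intro always_eventually allI)
    fix j
    have "(\<integral>x. f j x * \<phi> x \<partial>M) - (\<integral>x. g x * \<phi> x \<partial>M) = (\<integral>x. (f j x - g x) * \<phi> x \<partial>M)"
      using i g by (simp add: left_diff_distrib)
    then show "norm ((\<integral>x. f j x * \<phi> x \<partial>M) - (\<integral>x. g x * \<phi> x \<partial>M))
        \<le> sqrt (\<integral>x. (norm (f j x - g x))\<^sup>2 \<partial>M) * sqrt (\<integral>x. (norm (\<phi> x))\<^sup>2 \<partial>M)"
      using cs(2)[of j] by simp
  qed
  then show "(\<lambda>j. \<integral>x. f j x * \<phi> x \<partial>M) \<longlonglongrightarrow> (\<integral>x. g x * \<phi> x \<partial>M)"
    by (simp add: LIM_zero_iff)
qed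

text \<open>The transposed Fourier transform of a square integrable function: truncations to balls are
  integrable, and their transforms are Cauchy by Plancherel's inequality.\<close>

theorem L2_fourier:
  fixes G :: "real^'n::finite \<Rightarrow> complex"
  assumes m [measurable]: "G \<in> borel_measurable borel" and G: "integrable lborel (\<lambda>x. (norm (G x))\<^sup>2)"
  shows "\<exists>k\<in>borel_measurable borel. integrable lborel (\<lambda>\<xi>. (norm (k \<xi>))\<^sup>2) \<and>
    (\<forall>\<phi>\<in>schwartz. (\<integral>x. G x * fourier \<phi> x \<partial>lborel) = (\<integral>\<xi>. k \<xi> * \<phi> \<xi> \<partial>lborel))"
proof -
  define T where "T j x = indicator (cball 0 (real j)) x *\<^sub>R G x" for j x
  have [measurable]: "T j \<in> borel_measurable borel" for j
    unfolding T_def by (intro borel_measurable_scaleR borel_measurable_indicator) auto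
  have iT2: "integrable lborel (\<lambda>x. (norm (T j x))\<^sup>2)" for j
    by (rule Bochner_Integration.integrable_bound[OF G]) (auto simp: T_def indicator_def)
  have iT: "integrable lborel (T j)" for j
  proof (rule Bochner_Integration.integrable_bound[OF Bochner_Integration.integrable_add[OF _ G]])
    show "integrable lborel (\<lambda>x::real^'n. indicator (cball 0 (real j)) x :: real)"
      using emeasure_lborel_cball_finite[of "0::real^'n" "real j"] by (simp add: integrable_indicator_iff)
    show "AE x in lborel. norm (T j x) \<le> norm (indicator (cball 0 (real j)) x + (norm (G x))\<^sup>2)"
    proof (intro AE_I2)
      fix x
      have "2 * norm (G x) \<le> 1 + (norm (G x))\<^sup>2"
        using sum_squares_bound[of 1 "norm (G x)"] by simp
      then have "norm (G x) \<le> 1 + (norm (G x))\<^sup>2"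
        using norm_ge_zero[of "G x"] by linarith
      then show "norm (T j x) \<le> norm (indicator (cball 0 (real j)) x + (norm (G x))\<^sup>2)"
        by (auto simp: T_def indicator_def)
    qed
  qed measurable
  have iD: "integrable lborel (\<lambda>x. (norm (T j x - G x))\<^sup>2)" for j
    by (rule Bochner_Integration.integrable_bound[OF G]) (auto simp: T_def indicator_def)
  have D0: "(\<lambda>j. \<integral>x. (norm (T j x - G x))\<^sup>2 \<partial>lborel) \<longlonglongrightarrow> 0"
  proof -
    have "(\<lambda>j. \<integral>x. (norm (T j x - G x))\<^sup>2 \<partial>lborel) \<longlonglongrightarrow> (\<integral>(x::real^'n). 0 \<partial>lborel)"
    proof (rule integral_dominated_convergence[where w="\<lambda>x. (norm (G x))\<^sup>2"])
      show "AE x in lborel. (\<lambda>j. (norm (T j x - G x))\<^sup>2) \<longlonglongrightarrow> 0"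
      proof (intro AE_I2 tendsto_eventually)
        fix x :: "real^'n"
        obtain J :: nat where J: "norm x \<le> real J" using real_arch_simple by blast
        show "\<forall>\<^sub>F j in sequentially. (norm (T j x - G x))\<^sup>2 = 0"
          using eventually_ge_at_top[of J]
          by eventually_elim (use J in \<open>auto simp: T_def indicator_def\<close>)
      qed
      show "AE x in lborel. norm ((norm (T j x - G x))\<^sup>2) \<le> (norm (G x))\<^sup>2" for j
        by (auto simp: T_def indicator_def)
      show "(\<lambda>x. (norm (T j x - G x))\<^sup>2) \<in> borel_measurable lborel" for j by measurable
    qed (use G in simp_all)
    then show ?thesis by simp
  qed
  let ?f = "\<lambda>j. fourier (T j)"
  have f2: "integrable lborel (\<lambda>\<xi>. (norm (?f j \<xi>))\<^sup>2)" for j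
    by (rule plancherel_inequality(1)[OF iT iT2])
  have cauchy: "\<exists>N. \<forall>m\<ge>N. \<forall>k\<ge>N. (\<integral>\<xi>. norm (?f m \<xi> - ?f k \<xi>) powr 2 \<partial>lborel) < e" if e: "0 < e" for e
  proof -
    let ?c = "(2 * pi) ^ CARD('n)"
    have c: "0 < ?c" by simp
    obtain N where N: "(\<integral>x. (norm (T N x - G x))\<^sup>2 \<partial>lborel) < e / ?c"
    proof -
      have "eventually (\<lambda>j. (\<integral>x. (norm (T j x - G x))\<^sup>2 \<partial>lborel) < e / ?c) sequentially"
        by (rule order_tendstoD(2)[OF D0]) (use e c in simp)
      then show ?thesis using that eventually_happens[of _ sequentially] by auto
    qed
    have "(\<integral>\<xi>. norm (?f m \<xi> - ?f k \<xi>) powr 2 \<partial>lborel) < e" if mk: "N \<le> m" "N \<le> k" for m k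
    proof -
      have iM: "integrable lborel (\<lambda>x. T m x - T k x)" by (intro Bochner_Integration.integrable_diff iT)
      have iM2: "integrable lborel (\<lambda>x. (norm (T m x - T k x))\<^sup>2)"
        by (rule Bochner_Integration.integrable_bound[OF G]) (auto simp: T_def indicator_def)
      have "(\<integral>\<xi>. norm (?f m \<xi> - ?f k \<xi>) powr 2 \<partial>lborel)
          = (\<integral>\<xi>. (norm (fourier (\<lambda>x. T m x - T k x) \<xi>))\<^sup>2 \<partial>lborel)"
        by (simp add: fourier_diff[OF iT iT])
      also have "\<dots> \<le> ?c * (\<integral>x. (norm (T m x - T k x))\<^sup>2 \<partial>lborel)"
        by (rule plancherel_inequality(2)[OF iM iM2])
      also have "\<dots> \<le> ?c * (\<integral>x. (norm (T N x - G x))\<^sup>2 \<partial>lborel)"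
      proof (intro mult_left_mono integral_mono iM2 iD)
        fix x
        show "(norm (T m x - T k x))\<^sup>2 \<le> (norm (T N x - G x))\<^sup>2"
          using mk by (auto simp: T_def indicator_def)
      qed simp
      also have "\<dots> < e" using N c by (simp add: field_simps)
      finally show ?thesis .
    qed
    then show ?thesis by blast
  qed
  from Lp_complete[of 2 ?f lborel, OF _ _ _ cauchy] f2
  obtain k where k: "k \<in> borel_measurable lborel" "integrable lborel (\<lambda>\<xi>. norm (k \<xi>) powr 2)"
    "\<And>j. integrable lborel (\<lambda>\<xi>. norm (?f j \<xi> - k \<xi>) powr 2)"
    "(\<lambda>j. \<integral>\<xi>. norm (?f j \<xi> - k \<xi>) powr 2 \<partial>lborel) \<longlonglongrightarrow> 0"
    by auto
  have "(\<integral>x. G x * fourier \<phi> x \<partial>lborel) = (\<integral>\<xi>. k \<xi> * \<phi> \<xi> \<partial>lborel)" if \<phi>: "\<phi> \<in> schwartz" for \<phi>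
  proof (rule LIMSEQ_unique)
    note [measurable] = schwartz_measurable[OF \<phi>] schwartz_measurable[OF schwartz_fourier[OF \<phi>]]
    have p2: "integrable lborel (\<lambda>x. (norm (\<phi> x))\<^sup>2)" "integrable lborel (\<lambda>x. (norm (fourier \<phi> x))\<^sup>2)"
      using \<phi> by (auto intro: schwartz_square_integrable schwartz_fourier)
    show "(\<lambda>j. \<integral>x. T j x * fourier \<phi> x \<partial>lborel) \<longlonglongrightarrow> (\<integral>x. G x * fourier \<phi> x \<partial>lborel)"
      by (rule L2_pairing_limit(2)[OF _ _ _ iD D0 p2(2) square_integrable_mult_complex(1)[OF _ _ G p2(2)]]) measurable
    have "(\<lambda>j. \<integral>\<xi>. ?f j \<xi> * \<phi> \<xi> \<partial>lborel) \<longlonglongrightarrow> (\<integral>\<xi>. k \<xi> * \<phi> \<xi> \<partial>lborel)"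
      using k by (intro L2_pairing_limit(2)[OF _ _ _ _ _ p2(1) square_integrable_mult_complex(1)[OF _ _ _ p2(1)]])
        (auto)
    then show "(\<lambda>j. \<integral>x. T j x * fourier \<phi> x \<partial>lborel) \<longlonglongrightarrow> (\<integral>\<xi>. k \<xi> * \<phi> \<xi> \<partial>lborel)"
      unfolding fourier_swap[OF iT schwartz_integrable[OF \<phi>]] .
  qed
  then show ?thesis using k by (intro bexI[of _ k]) auto
qed

text \<open>Gaussians times polynomials, closed under all the operations that differentiation needs.\<close>

inductive_set gauss_class :: "real \<Rightarrow> real^'n::finite \<Rightarrow> (real^'n \<Rightarrow> complex) set" for c a where
  base: "(\<lambda>x. of_real (gauss (c *\<^sub>R (x - a)))) \<in> gauss_class c a"
| coord: "g \<in> gauss_class c a \<Longrightarrow> (\<lambda>x. of_real (x $ j) * g x) \<in> gauss_class c a"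
| lincomb: "g \<in> gauss_class c a \<Longrightarrow> h \<in> gauss_class c a \<Longrightarrow> (\<lambda>x. r * g x + h x) \<in> gauss_class c a"

lemma gauss_decay:
  assumes c: "c \<noteq> 0"
  shows "\<exists>B. \<forall>x. norm x ^ m * gauss (c *\<^sub>R (x - a)) \<le> B"
proof (cases m)
  case 0
  then show ?thesis using gauss_le_1 by auto
next
  case (Suc k)
  define b where "b = c\<^sup>2 / (2 * real m)"
  have b: "0 < b" unfolding b_def using c Suc by simp
  define K where "K = 1 + norm a + 1 / b"
  have K: "1 \<le> K" "1 / b \<le> K" unfolding K_def using b by auto
  have "norm x ^ m * gauss (c *\<^sub>R (x - a)) \<le> (2 * K) ^ m" for x
  proof -
    define t where "t = norm (x - a)"
    have t0: "0 \<le> t" by (simp add: t_def)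
    have "norm x \<le> norm a + t" unfolding t_def using norm_triangle_ineq[of a "x - a"] by simp
    also have "\<dots> \<le> norm a + (1 + t\<^sup>2)"
      using sum_squares_bound[of 1 t] t0 by simp
    also have "\<dots> \<le> 2 * K * (1 + b * t\<^sup>2)"
    proof -
      have "t\<^sup>2 \<le> K * (b * t\<^sup>2)"
        using mult_right_mono[OF K(2), of "b * t\<^sup>2"] b by simp
      moreover have "norm a + 1 \<le> K" unfolding K_def using b by simp
      moreover have "0 \<le> K * (b * t\<^sup>2)" using K b by simp
      ultimately show ?thesis using K(1) by (simp add: algebra_simps)
    qed
    also have "\<dots> \<le> 2 * K * exp (b * t\<^sup>2)"
      using K exp_ge_add_one_self[of "b * t\<^sup>2"] by (intro mult_left_mono) auto
    finally have "norm x ^ m \<le> (2 * K * exp (b * t\<^sup>2)) ^ m" by (intro power_mono) auto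
    also have "\<dots> = (2 * K) ^ m * exp (real m * (b * t\<^sup>2))"
      by (simp add: power_mult_distrib exp_of_nat_mult)
    also have "real m * (b * t\<^sup>2) = c\<^sup>2 * t\<^sup>2 / 2" unfolding b_def using Suc by (simp add: field_simps)
    finally have "norm x ^ m * gauss (c *\<^sub>R (x - a)) \<le> (2 * K) ^ m * exp (c\<^sup>2 * t\<^sup>2 / 2) * gauss (c *\<^sub>R (x - a))"
      by (intro mult_right_mono) (auto intro: less_imp_le gauss_pos)
    also have "\<dots> = (2 * K) ^ m * exp (c\<^sup>2 * t\<^sup>2 / 2 + - (c\<^sup>2 * t\<^sup>2 / 2))"
      by (simp add: gauss_def t_def power_mult_distrib exp_add[symmetric] mult.assoc)
    finally show ?thesis by simp
  qed
  then show ?thesis by blast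
qed

lemma gauss_schwartz:
  fixes a :: "real^'n::finite"
  assumes c: "c \<noteq> 0"
  shows "(\<lambda>x. of_real (gauss (c *\<^sub>R (x - a)))) \<in> schwartz"
proof (rule schwartz_coinduct[where X="gauss_class c a"])
  show "(\<lambda>x. of_real (gauss (c *\<^sub>R (x - a)))) \<in> gauss_class c a" by (rule gauss_class.base)
next
  have main: "\<exists>D. \<forall>x. (g has_derivative D x) (at x) \<and> (\<forall>i. (\<lambda>x. D x (axis i 1)) \<in> gauss_class c a)"
    if "g \<in> gauss_class c a" for g
    using that
  proof induction
    case base
    let ?G = "\<lambda>x. complex_of_real (gauss (c *\<^sub>R (x - a)))"
    let ?D = "\<lambda>x h. complex_of_real (- (c\<^sup>2 * ((x - a) \<bullet> h)) * gauss (c *\<^sub>R (x - a)))"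
    have e: "gauss (c *\<^sub>R (x - a)) = exp (- (c\<^sup>2 * ((x - a) \<bullet> (x - a))) / 2)" for x
      by (simp add: gauss_def power_mult_distrib power2_norm_eq_inner)
    have "((\<lambda>x. - (c\<^sup>2 * ((x - a) \<bullet> (x - a))) / 2) has_derivative (\<lambda>h. - (c\<^sup>2 * ((x - a) \<bullet> h)))) (at x)" for x
      by (auto intro!: derivative_eq_intros simp: fun_eq_iff inner_commute field_simps)
    from has_derivative_exp[OF this]
    have d: "(?G has_derivative ?D x) (at x)" for x
      unfolding e by (intro bounded_linear.has_derivative[OF bounded_linear_of_real])
    have "(\<lambda>x. ?D x (axis i 1)) \<in> gauss_class c a" for i
    proof -
      have "(\<lambda>x. of_real (c\<^sup>2 * (a $ i) - 1) * ?G x + ?G x) \<in> gauss_class c a"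
        by (intro gauss_class.lincomb gauss_class.base)
      then have "(\<lambda>x. of_real (- c\<^sup>2) * (of_real (x $ i) * ?G x) + (of_real (c\<^sup>2 * (a $ i) - 1) * ?G x + ?G x)) \<in> gauss_class c a"
        by (intro gauss_class.lincomb gauss_class.coord gauss_class.base)
      also have "(\<lambda>x. of_real (- c\<^sup>2) * (of_real (x $ i) * ?G x) + (of_real (c\<^sup>2 * (a $ i) - 1) * ?G x + ?G x))
          = (\<lambda>x. ?D x (axis i 1))"
        by (auto simp: inner_axis fun_eq_iff algebra_simps)
      finally show ?thesis .
    qed
    then show ?case using d by (intro exI[of _ ?D] allI conjI)
  next
    case (coord g j)
    then obtain D where D: "\<And>x. (g has_derivative D x) (at x)" "\<And>i. (\<lambda>x. D x (axis i 1)) \<in> gauss_class c a"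
      by blast
    have bl: "bounded_linear (\<lambda>x::real^'n. of_real (x $ j) :: complex)"
      by (intro bounded_linear_compose[OF bounded_linear_of_real bounded_linear_vec_nth])
    have "((\<lambda>x. of_real (x $ j) * g x) has_derivative (\<lambda>h. of_real (x $ j) * D x h + of_real (h $ j) * g x)) (at x)" for x
      by (intro has_derivative_mult D bounded_linear_imp_has_derivative bl)
    moreover have "(\<lambda>x. of_real (x $ j) * D x (axis i 1) + of_real (axis i 1 $ j) * g x) \<in> gauss_class c a" for i
      using gauss_class.lincomb[OF coord(1) gauss_class.coord[OF D(2)]] by (simp add: add.commute)
    ultimately show ?case
      by (intro exI[of _ "\<lambda>x h. of_real (x $ j) * D x h + of_real (h $ j) * g x"] allI conjI)
  next
    case (lincomb g h r)
    then obtain D E where D: "\<And>x. (g has_derivative D x) (at x)" "\<And>i. (\<lambda>x. D x (axis i 1)) \<in> gauss_class c a"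
      and E: "\<And>x. (h has_derivative E x) (at x)" "\<And>i. (\<lambda>x. E x (axis i 1)) \<in> gauss_class c a"
      by blast
    have "((\<lambda>x. r * g x + h x) has_derivative (\<lambda>k. r * D x k + E x k)) (at x)" for x
      by (intro has_derivative_add has_derivative_mult_right D E)
    moreover have "(\<lambda>x. r * D x (axis i 1) + E x (axis i 1)) \<in> gauss_class c a" for i
      by (intro gauss_class.lincomb D E)
    ultimately show ?case by (intro exI[of _ "\<lambda>x k. r * D x k + E x k"] allI conjI)
  qed
  fix g i assume g: "g \<in> gauss_class c a"
  from main[OF g] obtain D where D: "\<And>x. (g has_derivative D x) (at x)" "\<And>i. (\<lambda>x. D x (axis i 1)) \<in> gauss_class c a"
    by blast
  show "g differentiable_on UNIV" unfolding differentiable_on_def differentiable_def using D by blast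
  have "partial i g = (\<lambda>x. D x (axis i 1))" by (intro ext partial_eqI D)
  then show "partial i g \<in> gauss_class c a" using D by simp
next
  fix g :: "real^'n \<Rightarrow> complex" and m assume "g \<in> gauss_class c a"
  then have "\<forall>m. \<exists>B. \<forall>x. norm x ^ m * norm (g x) \<le> B"
  proof induction
    case base
    then show ?case using gauss_decay[OF c, of _ a] by simp
  next
    case (coord g j)
    show ?case
    proof
      fix m
      obtain B where B: "\<And>x. norm x ^ Suc m * norm (g x) \<le> B" using coord.IH by blast
      have "norm x ^ m * norm (of_real (x $ j) * g x) \<le> B" for x
      proof -
        have "norm x ^ m * norm (of_real (x $ j) * g x) \<le> norm x ^ m * (norm x * norm (g x))"
          by (auto simp: norm_mult intro!: mult_left_mono mult_right_mono component_le_norm_cart)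
        also have "\<dots> \<le> B" using B[of x] by (simp add: mult_ac)
        finally show ?thesis .
      qed
      then show "\<exists>B. \<forall>x. norm x ^ m * norm (of_real (x $ j) * g x) \<le> B" by blast
    qed
  next
    case (lincomb g h r)
    show ?case
    proof
      fix m
      obtain B C where B: "\<And>x. norm x ^ m * norm (g x) \<le> B" and C: "\<And>x. norm x ^ m * norm (h x) \<le> C"
        using lincomb.IH by blast
      have "norm x ^ m * norm (r * g x + h x) \<le> norm r * B + C" for x
      proof -
        have "norm x ^ m * norm (r * g x + h x) \<le> norm x ^ m * (norm r * norm (g x) + norm (h x))"
          using norm_triangle_ineq[of "r * g x" "h x"] by (intro mult_left_mono) (auto simp: norm_mult)
        also have "\<dots> = norm r * (norm x ^ m * norm (g x)) + norm x ^ m * norm (h x)" by (simp add: algebra_simps)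
        also have "\<dots> \<le> norm r * B + C" by (intro add_mono mult_left_mono B C) auto
        finally show ?thesis .
      qed
      then show "\<exists>B. \<forall>x. norm x ^ m * norm (r * g x + h x) \<le> B" by blast
    qed
  qed
  then obtain B where "\<And>x. norm x ^ m * norm (g x) \<le> B" by blast
  then show "bounded (range (\<lambda>x. norm x ^ m * norm (g x)))"
    by (auto simp: bounded_iff abs_mult intro!: exI[of _ B])
qed

text \<open>A continuous weight \<open>c\<close> is a limit of superpositions of concentrating Gaussians, so a function
  orthogonal to all Schwartz functions is orthogonal to every such \<open>c\<close>; approximating the
  conjugate sign of the function by continuous weights finishes the proof.\<close>

theorem schwartz_orthogonal_imp_zero:
  fixes k :: "real^'n::finite \<Rightarrow> complex"
  assumes m [measurable]: "k \<in> borel_measurable borel"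
    and i: "\<And>\<phi>. \<phi> \<in> schwartz \<Longrightarrow> integrable lborel (\<lambda>x. k x * \<phi> x)"
    and z: "\<And>\<phi>. \<phi> \<in> schwartz \<Longrightarrow> (\<integral>x. k x * \<phi> x \<partial>lborel) = 0"
  shows "AE x in lborel. k x = 0"
proof -
  have gs: "(\<lambda>x. complex_of_real (gauss x)) \<in> (schwartz :: (real^'n \<Rightarrow> complex) set)"
    using gauss_schwartz[of 1 0] by simp
  \<comment> \<open>Multiplication by a Gaussian makes the unknown integrable and preserves the orthogonality.\<close>
  define w where "w x = k x * of_real (gauss x)" for x
  have w: "integrable lborel w" unfolding w_def[abs_def] by (rule i[OF gs])
  have [measurable]: "w \<in> borel_measurable borel" unfolding w_def[abs_def] by measurable
  have gauss_orth: "(\<integral>y. complex_of_real (gauss ((1/s) *\<^sub>R (a - y))) * w y \<partial>lborel) = 0" if "0 < s" for s a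
  proof -
    have "(\<lambda>y. complex_of_real (gauss y) * of_real (gauss ((-1/s) *\<^sub>R (y - a)))) \<in> schwartz"
      using that by (intro schwartz_mult gs gauss_schwartz) auto
    from z[OF this] have "(\<integral>y. k y * (complex_of_real (gauss y) * of_real (gauss ((-1/s) *\<^sub>R (y - a)))) \<partial>lborel) = 0" .
    moreover have "(-1/s) *\<^sub>R (y - a) = (1/s) *\<^sub>R (a - y)" for y by (simp add: algebra_simps)
    ultimately show ?thesis by (simp add: w_def mult_ac)
  qed
  have weight: "(\<integral>y. c y * w y \<partial>lborel) = 0"
    if c: "continuous_on UNIV c" "integrable lborel c" "\<And>x. norm (c x) \<le> B" for c B
  proof -
    have [measurable]: "c \<in> borel_measurable borel" by (rule borel_measurable_continuous_onI[OF c(1)])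
    let ?s = "\<lambda>j. 1 / real (Suc j)"
    let ?a = "complex_of_real (sqrt (2 * pi) ^ CARD('n))"
    have B0: "0 \<le> B" using c(3)[of 0] norm_ge_zero order_trans by blast
    \<comment> \<open>The averages in the dominated limit below are superpositions of Gaussians, hence orthogonal to \<open>w\<close>.\<close>
    have av: "(\<integral>y. (\<integral>z. c (y - s *\<^sub>R z) * of_real (gauss z) \<partial>lborel) * w y \<partial>lborel) = 0" if s: "0 < s" for s
    proof -
      let ?K = "\<lambda>a y. complex_of_real (gauss ((1/s) *\<^sub>R (a - y)))"
      have K: "(\<lambda>(a, y). ?K a y) \<in> borel_measurable (lborel \<Otimes>\<^sub>M lborel)" by measurable
      have "(\<integral>y. (\<integral>a. c a * ?K a y \<partial>lborel) * w y \<partial>lborel) = (\<integral>a. c a * (\<integral>y. ?K a y * w y \<partial>lborel) \<partial>lborel)"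
        by (rule fubini_bounded_kernel(2)[OF c(2) w K, of 1, symmetric]) (simp add: gauss_le_1)
      also have "\<dots> = 0" by (simp add: gauss_orth[OF s])
      finally have zero: "(\<integral>y. (\<integral>a. c a * ?K a y \<partial>lborel) * w y \<partial>lborel) = 0" .
      have sub: "(\<integral>a. c a * ?K a y \<partial>lborel) = of_real (s ^ CARD('n)) * (\<integral>z. c (y - s *\<^sub>R z) * of_real (gauss z) \<partial>lborel)" for y
      proof -
        have "gauss (- z) = gauss z" for z :: "real^'n" by (simp add: gauss_def)
        then show ?thesis
          using integral_affine(2)[where c="-s" and t=y and f="\<lambda>a. c a * ?K a y"] s
          by (simp add: scaleR_conv_of_real[of _ "_::complex"])
      qed
      have "of_real (s ^ CARD('n)) * (\<integral>y. (\<integral>z. c (y - s *\<^sub>R z) * of_real (gauss z) \<partial>lborel) * w y \<partial>lborel) = 0"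
        using zero unfolding sub mult.assoc integral_mult_right_zero .
      then show ?thesis using s by simp
    qed
    have "(\<lambda>j. \<integral>y. (\<integral>z. c (y - ?s j *\<^sub>R z) * of_real (gauss z) \<partial>lborel) * w y \<partial>lborel) \<longlonglongrightarrow> (\<integral>y. (c y * ?a) * w y \<partial>lborel)"
    proof (rule integral_dominated_convergence[where w="\<lambda>y. B * (sqrt (2 * pi) ^ CARD('n)) * norm (w y)"])
      show "integrable lborel (\<lambda>y. B * (sqrt (2 * pi) ^ CARD('n)) * norm (w y))"
        by (intro integrable_mult_right integrable_norm w)
      show "AE y in lborel. (\<lambda>j. (\<integral>z. c (y - ?s j *\<^sub>R z) * of_real (gauss z) \<partial>lborel) * w y) \<longlonglongrightarrow> (c y * ?a) * w y"
        using gauss_average_limit[OF c(1,3) shrinking_scale]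
        by (intro AE_I2 tendsto_mult tendsto_const) simp
      show "AE y in lborel. norm ((\<integral>z. c (y - ?s j *\<^sub>R z) * of_real (gauss z) \<partial>lborel) * w y)
          \<le> B * (sqrt (2 * pi) ^ CARD('n)) * norm (w y)" for j
      proof (intro AE_I2)
        fix y
        have "norm (\<integral>z. c (y - ?s j *\<^sub>R z) * of_real (gauss z) \<partial>lborel) \<le> (\<integral>(z::real^'n). B * gauss z \<partial>lborel)"
        proof (rule order_trans[OF integral_norm_bound integral_mono'])
          show "integrable lborel (\<lambda>z::real^'n. B * gauss z)" by (intro integrable_mult_right gauss_integrable)
        qed (use c(3) B0 in \<open>auto simp: norm_mult intro!: mult_right_mono mult_nonneg_nonneg less_imp_le[OF gauss_pos]\<close>)
        then have "norm (\<integral>z. c (y - ?s j *\<^sub>R z) * of_real (gauss z) \<partial>lborel) \<le> B * sqrt (2 * pi) ^ CARD('n)"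
          unfolding integral_mult_right_zero gauss_integral by simp
        then show "norm ((\<integral>z. c (y - ?s j *\<^sub>R z) * of_real (gauss z) \<partial>lborel) * w y)
            \<le> B * (sqrt (2 * pi) ^ CARD('n)) * norm (w y)"
          by (simp only: norm_mult) (intro mult_right_mono, auto)
      qed
    qed measurable
    moreover have "(\<integral>y. (\<integral>z. c (y - ?s j *\<^sub>R z) * of_real (gauss z) \<partial>lborel) * w y \<partial>lborel) = 0" for j
      by (rule av) simp
    ultimately have "(\<lambda>j. 0) \<longlonglongrightarrow> (\<integral>y. (c y * ?a) * w y \<partial>lborel)" by (simp only:)
    from LIMSEQ_unique[OF this tendsto_const] have "(\<integral>y. (c y * ?a) * w y \<partial>lborel) = 0" .
    then have "(\<integral>y. ?a * (c y * w y) \<partial>lborel) = 0" by (simp add: mult_ac)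
    then show ?thesis unfolding integral_mult_right_zero by simp
  qed
  \<comment> \<open>The conjugate sign \<open>\<sigma>\<close> of \<open>w\<close> is a pointwise limit almost everywhere of continuous \<open>g\<^sub>j\<close>; cutting them
    off at modulus one gives weights \<open>h\<^sub>j\<close> that are bounded uniformly.\<close>
  define \<sigma> where "\<sigma> x = cnj (sgn (w x))" for x
  have \<sigma>1: "norm (\<sigma> x) \<le> 1" for x by (simp add: \<sigma>_def norm_sgn)
  have [measurable]: "\<sigma> \<in> borel_measurable borel"
    unfolding \<sigma>_def sgn_div_norm by measurable
  have "\<sigma> \<in> borel_measurable lebesgue" by (intro measurable_completion) simp
  from lebesgue_measurable_imp_measurable_on[OF this, of UNIV]
  have "\<exists>N g. negligible N \<and> (\<forall>j. continuous_on UNIV (g j)) \<and> (\<forall>x. x \<notin> N \<longrightarrow> (\<lambda>j. g j x) \<longlonglongrightarrow> \<sigma> x)"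
    unfolding measurable_on_def by simp
  then obtain N g where N: "negligible N" and g: "\<And>j. continuous_on UNIV (g j)"
    "\<And>x. x \<notin> N \<Longrightarrow> (\<lambda>j. g j x) \<longlonglongrightarrow> \<sigma> x"
    by blast
  have "N \<in> null_sets (completion lborel)" using N by (simp add: negligible_iff_null_sets)
  from AE_not_in[OF this] have aeN: "AE x in lborel. x \<notin> N" by (simp add: AE_completion_iff)
  define h where "h j x = (1 / max 1 (norm (g j x))) *\<^sub>R g j x" for j x
  have hc: "continuous_on UNIV (h j)" for j
    unfolding h_def by (intro continuous_intros g(1)) auto
  have h1: "norm (h j x) \<le> 1" for j x
  proof -
    have "norm (h j x) = norm (g j x) / max 1 (norm (g j x))" unfolding h_def by simp
    also have "\<dots> \<le> 1" by (subst pos_divide_le_eq) auto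
    finally show ?thesis .
  qed
  have hl: "(\<lambda>j. h j x) \<longlonglongrightarrow> \<sigma> x" if "x \<notin> N" for x
  proof -
    have "(\<lambda>j. h j x) \<longlonglongrightarrow> (1 / max 1 (norm (\<sigma> x))) *\<^sub>R \<sigma> x"
      unfolding h_def by (intro tendsto_intros g(2) that) auto
    then show ?thesis using \<sigma>1[of x] by (simp add: max_def split: if_splits)
  qed
  have [measurable]: "h j \<in> borel_measurable borel" for j by (rule borel_measurable_continuous_onI[OF hc])
  have zero: "(\<integral>y. (of_real (gauss y) * h j y) * w y \<partial>lborel) = 0" for j
  proof (rule weight[where c="\<lambda>y. of_real (gauss y) * h j y" and B=1])
    show "continuous_on UNIV (\<lambda>y. of_real (gauss y) * h j y)"
      by (rule continuous_on_mult[OF continuous_on_of_real[OF gauss_continuous] hc])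
    show "norm (of_real (gauss y) * h j y) \<le> 1" for y
      using h1[of j y] gauss_le_1[of y] gauss_pos[of y] by (simp add: norm_mult mult_le_one)
    show "integrable lborel (\<lambda>y. of_real (gauss y) * h j y)"
    proof (rule Bochner_Integration.integrable_bound[OF gauss_integrable])
      show "AE x in lborel. norm (complex_of_real (gauss x) * h j x) \<le> norm (gauss x)"
        using h1[of j] by (intro AE_I2) (simp add: norm_mult mult_left_le less_imp_le[OF gauss_pos])
    qed measurable
  qed
  have "(\<lambda>j. \<integral>y. (of_real (gauss y) * h j y) * w y \<partial>lborel) \<longlonglongrightarrow> (\<integral>y. (of_real (gauss y) * \<sigma> y) * w y \<partial>lborel)"
  proof (rule integral_dominated_convergence[where w="\<lambda>y. norm (w y)"])
    show "integrable lborel (\<lambda>y. norm (w y))" by (intro integrable_norm w)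
    show "AE y in lborel. (\<lambda>j. (of_real (gauss y) * h j y) * w y) \<longlonglongrightarrow> (of_real (gauss y) * \<sigma> y) * w y"
      using aeN
    proof eventually_elim
      case (elim y)
      show ?case by (intro tendsto_mult tendsto_const hl elim)
    qed
    show "AE y in lborel. norm ((of_real (gauss y) * h j y) * w y) \<le> norm (w y)" for j
    proof (intro AE_I2)
      fix y
      have "gauss y * norm (h j y) \<le> 1" using h1[of j y] gauss_le_1[of y] gauss_pos[of y] by (simp add: mult_le_one)
      then have "gauss y * norm (h j y) * norm (w y) \<le> 1 * norm (w y)" by (intro mult_right_mono) auto
      then show "norm ((of_real (gauss y) * h j y) * w y) \<le> norm (w y)" by (simp add: norm_mult)
    qed
  qed measurable
  then have "(\<integral>y. (of_real (gauss y) * \<sigma> y) * w y \<partial>lborel) = 0"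
    unfolding zero using LIMSEQ_unique tendsto_const by blast
  moreover have "(of_real (gauss y) * \<sigma> y) * w y = complex_of_real (gauss y * norm (w y))" for y
  proof -
    have "cnj (sgn (w y)) * w y = of_real (norm (w y))"
      by (cases "w y = 0") (simp_all add: sgn_div_norm scaleR_conv_of_real complex_norm_square[symmetric]
          mult.commute[of "cnj _"] power2_eq_square divide_simps flip: of_real_mult)
    then show ?thesis by (simp add: \<sigma>_def mult.assoc)
  qed
  ultimately have "(\<integral>y. complex_of_real (gauss y * norm (w y)) \<partial>lborel) = 0" by (simp only:)
  then have "(\<integral>y. gauss y * norm (w y) \<partial>lborel) = 0" unfolding integral_complex_of_real by (simp only: of_real_eq_0_iff)
  moreover have "integrable lborel (\<lambda>y. gauss y * norm (w y))"
  proof (rule Bochner_Integration.integrable_bound[OF w])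
    show "AE x in lborel. norm (gauss x * norm (w x)) \<le> norm (w x)"
      by (intro AE_I2) (simp add: abs_mult mult_left_le_one_le gauss_le_1 less_imp_le[OF gauss_pos])
  qed measurable
  ultimately have "AE y in lborel. gauss y * norm (w y) = 0"
    by (subst integral_nonneg_eq_0_iff_AE[symmetric]) (auto intro!: AE_I2 mult_nonneg_nonneg less_imp_le[OF gauss_pos])
  then show ?thesis
  proof eventually_elim
    case (elim x)
    then show ?case using gauss_pos[of x] by (auto simp: w_def)
  qed
qed

section \<open>Weak compactness in a semi-inner product space\<close>

lemma diagonal_convergent:
  fixes x :: "nat \<Rightarrow> nat \<Rightarrow> real"
  assumes "\<And>k. bounded (range (x k))"
  shows "\<exists>r. strict_mono r \<and> (\<forall>k. convergent (\<lambda>N. x k (r N)))"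
proof -
  interpret subseqs "\<lambda>k s. convergent (\<lambda>N. x k (s N))"
  proof
    fix k and s :: "nat \<Rightarrow> nat"
    have "bounded (range (\<lambda>N. x k (s N)))"
      by (rule bounded_subset[OF assms[of k]]) auto
    from bounded_imp_convergent_subsequence[OF this]
    show "\<exists>r'. strict_mono r' \<and> convergent (\<lambda>N. x k ((s \<circ> r') N))"
      by (auto simp: convergent_def o_def)
  qed
  have "convergent (\<lambda>N. x k (diagseq N))" for k
  proof -
    have "convergent (\<lambda>N. x k ((diagseq \<circ> (+) (Suc k)) N))"
    proof (rule diagseq_holds)
      fix r s :: "nat \<Rightarrow> nat" and n
      assume "strict_mono r" "convergent (\<lambda>N. x n (s N))"
      then show "convergent (\<lambda>N. x n ((s \<circ> r) N))"
        using convergent_subseq_convergent[of "\<lambda>N. x n (s N)" r] by (simp add: o_def)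
    qed
    then have "convergent (\<lambda>N. x k (diagseq (N + Suc k)))" by (simp add: add.commute)
    then obtain L where "(\<lambda>N. x k (diagseq (N + Suc k))) \<longlonglongrightarrow> L" using convergentD by blast
    then have "(\<lambda>N. x k (diagseq N)) \<longlonglongrightarrow> L" by (rule LIMSEQ_offset)
    then show ?thesis by (rule convergentI)
  qed
  then show ?thesis using subseq_diagseq by blast
qed

text \<open>The parallelogram law compares two vectors with their midpoint, so stability under midpoints is
  the form of convexity that fits the minimising argument below.\<close>

inductive_set midpoint_hull :: "(nat \<Rightarrow> 'x \<Rightarrow> real) \<Rightarrow> nat \<Rightarrow> ('x \<Rightarrow> real) set"
  for \<theta> m where
    base: "m \<le> N \<Longrightarrow> \<theta> N \<in> midpoint_hull \<theta> m"
  | mid: "u \<in> midpoint_hull \<theta> m \<Longrightarrow> v \<in> midpoint_hull \<theta> m \<Longrightarrow>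
      (\<lambda>x. 1/2 * u x + 1/2 * v x) \<in> midpoint_hull \<theta> m"

lemma midpoint_hull_mono:
  assumes "m \<le> k" "u \<in> midpoint_hull \<theta> k"
  shows "u \<in> midpoint_hull \<theta> m"
  using assms(2)
proof induction
  case (base N)
  then show ?case using assms(1) by (intro midpoint_hull.base) simp
qed (rule midpoint_hull.mid)

text \<open>A real vector space of functions with a symmetric positive semidefinite form. It may be degenerate
  and the space incomplete, so the results below produce approximations rather than limits.\<close>

locale semi_inner =
  fixes S :: "('x \<Rightarrow> real) set" and ip :: "('x \<Rightarrow> real) \<Rightarrow> ('x \<Rightarrow> real) \<Rightarrow> real"
  assumes lincomb: "\<And>u v a b. u \<in> S \<Longrightarrow> v \<in> S \<Longrightarrow> (\<lambda>x. a * u x + b * v x) \<in> S"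
    and ip_lin: "\<And>u v w a b. u \<in> S \<Longrightarrow> v \<in> S \<Longrightarrow> w \<in> S \<Longrightarrow>
      ip (\<lambda>x. a * u x + b * v x) w = a * ip u w + b * ip v w"
    and ip_sym: "\<And>u v. u \<in> S \<Longrightarrow> v \<in> S \<Longrightarrow> ip u v = ip v u"
    and ip_pos: "\<And>u. u \<in> S \<Longrightarrow> 0 \<le> ip u u"
begin

lemma diff_in: "u \<in> S \<Longrightarrow> v \<in> S \<Longrightarrow> (\<lambda>x. u x - v x) \<in> S"
  using lincomb[of u v 1 "-1"] by simp

lemma ip_expand:
  assumes "u \<in> S" "v \<in> S"
  shows "ip (\<lambda>x. a * u x + b * v x) (\<lambda>x. a * u x + b * v x)
       = a\<^sup>2 * ip u u + 2 * a * b * ip u v + b\<^sup>2 * ip v v"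
proof -
  let ?w = "\<lambda>x. a * u x + b * v x"
  have w: "?w \<in> S" by (rule lincomb[OF assms])
  have "ip u ?w = a * ip u u + b * ip u v" "ip v ?w = a * ip u v + b * ip v v"
    using ip_sym[OF assms(1) w] ip_sym[OF assms(2) w] ip_lin[OF assms assms(1)] ip_lin[OF assms assms(2)]
      ip_sym[OF assms] by auto
  then show ?thesis unfolding ip_lin[OF assms w] by (simp add: power2_eq_square algebra_simps)
qed

lemma ip_diff_left: "u \<in> S \<Longrightarrow> v \<in> S \<Longrightarrow> w \<in> S \<Longrightarrow> ip (\<lambda>x. u x - v x) w = ip u w - ip v w"
  using ip_lin[of u v w 1 "-1"] by simp

lemma ip_diff_right: "u \<in> S \<Longrightarrow> v \<in> S \<Longrightarrow> w \<in> S \<Longrightarrow> ip w (\<lambda>x. u x - v x) = ip w u - ip w v"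
  using ip_diff_left[of u v w] ip_sym diff_in by metis

lemma ip_diff_expand:
  "u \<in> S \<Longrightarrow> v \<in> S \<Longrightarrow> ip (\<lambda>x. u x - v x) (\<lambda>x. u x - v x) = ip u u - 2 * ip u v + ip v v"
  using ip_expand[of u v 1 "-1"] by simp

text \<open>Evaluate at the minimiser \<open>t = - d/q\<close>; for \<open>q = 0\<close> a nonzero slope would violate the lower bound at
  a suitable \<open>t\<close>. With \<open>e\<close> the squared norm of a vector this is the Cauchy-Schwarz inequality, and with small \<open>e\<close> it says
  that a near-minimiser nearly satisfies the Euler-Lagrange equation.\<close>

lemma quadratic_lower_bound:
  fixes q d e :: real
  assumes "0 \<le> q" and h: "\<And>t. - e \<le> t\<^sup>2 * q + 2 * t * d"
  shows "d\<^sup>2 \<le> e * q"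
proof (cases "q = 0")
  case True
  have "d = 0"
  proof (rule ccontr)
    assume "d \<noteq> 0"
    then show False using h[of "- (\<bar>e\<bar> + 1) / (2 * d)"] True by (simp add: abs_if split: if_splits)
  qed
  then show ?thesis using True by simp
next
  case False
  then have q: "0 < q" using assms(1) by simp
  have "(- d / q)\<^sup>2 * q + 2 * (- d / q) * d = - (d\<^sup>2 / q)"
    using q by (simp add: power2_eq_square field_simps)
  then have "d\<^sup>2 / q \<le> e" using h[of "- d / q"] by simp
  then show ?thesis using q by (simp add: pos_divide_le_eq)
qed

lemma ip_cauchy_schwarz:
  assumes "u \<in> S" "v \<in> S"
  shows "(ip u v)\<^sup>2 \<le> ip u u * ip v v"
proof (rule quadratic_lower_bound)
  show "0 \<le> ip v v" by (rule ip_pos[OF assms(2)])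
  show "- ip u u \<le> t\<^sup>2 * ip v v + 2 * t * ip u v" for t
    using ip_pos[OF lincomb[OF assms, of 1 t]] ip_expand[OF assms, of 1 t] by simp
qed

lemma abs_ip_le: "u \<in> S \<Longrightarrow> v \<in> S \<Longrightarrow> \<bar>ip u v\<bar> \<le> sqrt (ip u u) * sqrt (ip v v)"
  using real_sqrt_le_mono[OF ip_cauchy_schwarz[of u v]] by (simp add: real_sqrt_mult)

lemma midpoint_hull_in:
  assumes "\<And>N. \<theta> N \<in> S" "u \<in> midpoint_hull \<theta> m" shows "u \<in> S"
  using assms(2) by induction (rule assms(1), rule lincomb)

text \<open>Near-minimisers of the norm on the hulls of the tails form a Cauchy sequence, by the
  parallelogram law: this extracts a strongly convergent sequence from a merely bounded one.\<close>

lemma mazur: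
  assumes \<theta>: "\<And>N. \<theta> N \<in> S" and bdd: "\<And>N. ip (\<theta> N) (\<theta> N) \<le> M"
  shows "\<exists>\<psi>. (\<forall>m. \<psi> m \<in> midpoint_hull \<theta> m) \<and>
    (\<forall>e>0. \<exists>N. \<forall>m\<ge>N. \<forall>k\<ge>N. ip (\<lambda>x. \<psi> m x - \<psi> k x) (\<lambda>x. \<psi> m x - \<psi> k x) < e)"
proof -
  note inS = midpoint_hull_in[OF \<theta>]
  \<comment> \<open>The distance of the origin to the hull of the \<open>m\<close>-th tail, squared: it increases with \<open>m\<close> and is bounded.\<close>
  define d where "d m = Inf ((\<lambda>u. ip u u) ` midpoint_hull \<theta> m)" for m
  have bb: "bdd_below ((\<lambda>u. ip u u) ` midpoint_hull \<theta> m)" for m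
    using ip_pos[OF inS] by (auto intro!: bdd_belowI2)
  have ne: "midpoint_hull \<theta> m \<noteq> {}" for m using midpoint_hull.base[of m m \<theta>] by auto
  have d_le: "d m \<le> ip u u" if "u \<in> midpoint_hull \<theta> m" for m u
    unfolding d_def by (rule cINF_lower[OF bb that])
  have mono: "d m \<le> d k" if "m \<le> k" for m k
    unfolding d_def using midpoint_hull_mono[OF that]
    by (intro cInf_superset_mono bb) (use ne in auto)
  have "d m \<le> M" for m using d_le[OF midpoint_hull.base[of m m \<theta>]] bdd[of m] by simp
  moreover have "incseq d" using mono by (simp add: incseq_def)
  ultimately obtain L where "d \<longlonglongrightarrow> L" using incseq_convergent[of d M] by blast
  then have "convergent d" by (rule convergentI)
  then have Cd: "Cauchy d" by (simp add: Cauchy_convergent_iff)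
  have "\<exists>u\<in>midpoint_hull \<theta> m. ip u u < d m + 1 / real (Suc m)" for m
    using cINF_less_iff[OF ne bb, of m "d m + 1 / real (Suc m)"] unfolding d_def by simp
  then obtain \<psi> where \<psi>: "\<And>m. \<psi> m \<in> midpoint_hull \<theta> m" "\<And>m. ip (\<psi> m) (\<psi> m) < d m + 1 / real (Suc m)"
    by metis
  have est: "ip (\<lambda>x. \<psi> m x - \<psi> k x) (\<lambda>x. \<psi> m x - \<psi> k x) \<le> 2 * (d k - d m) + 4 / real (Suc m)"
    if "m \<le> k" for m k
  proof -
    have k: "\<psi> k \<in> midpoint_hull \<theta> m" by (rule midpoint_hull_mono[OF that \<psi>(1)])
    have "d m \<le> ip (\<lambda>x. 1/2 * \<psi> m x + 1/2 * \<psi> k x) (\<lambda>x. 1/2 * \<psi> m x + 1/2 * \<psi> k x)"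
      by (intro d_le midpoint_hull.mid \<psi>(1) k)
    also have "\<dots> = 1/4 * ip (\<psi> m) (\<psi> m) + 1/2 * ip (\<psi> m) (\<psi> k) + 1/4 * ip (\<psi> k) (\<psi> k)"
      using ip_expand[OF inS[OF \<psi>(1)] inS[OF \<psi>(1)], of "1/2" m "1/2" k] by (simp add: power2_eq_square)
    finally have "4 * d m \<le> ip (\<psi> m) (\<psi> m) + 2 * ip (\<psi> m) (\<psi> k) + ip (\<psi> k) (\<psi> k)" by simp
    moreover have "1 / real (Suc k) \<le> 1 / real (Suc m)" using that by (simp add: frac_le)
    ultimately show ?thesis
      using ip_diff_expand[OF inS[OF \<psi>(1)[of m]] inS[OF \<psi>(1)[of k]]] \<psi>(2)[of m] \<psi>(2)[of k] by simp
  qed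
  have "\<exists>N. \<forall>m\<ge>N. \<forall>k\<ge>N. ip (\<lambda>x. \<psi> m x - \<psi> k x) (\<lambda>x. \<psi> m x - \<psi> k x) < e" if e: "0 < e" for e
  proof -
    obtain N1 where N1: "\<And>m k. m \<ge> N1 \<Longrightarrow> k \<ge> N1 \<Longrightarrow> \<bar>d k - d m\<bar> < e / 4"
      using Cd e unfolding Cauchy_def dist_real_def by (meson divide_pos_pos zero_less_numeral)
    obtain N2 where N2: "8 / e < real N2" using reals_Archimedean2 by blast
    have small: "4 / real (Suc m) < e / 2" if "N2 \<le> m" for m
    proof -
      have "8 / e < real (Suc m)" using N2 that by linarith
      then show ?thesis using e by (simp add: field_simps)
    qed
    have main: "ip (\<lambda>x. \<psi> m x - \<psi> k x) (\<lambda>x. \<psi> m x - \<psi> k x) < e" if "m \<le> k" "N1 + N2 \<le> m" for m k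
      using est[OF that(1)] N1[of m k] small[of m] that by (simp add: abs_if split: if_splits)
    have "ip (\<lambda>x. \<psi> m x - \<psi> k x) (\<lambda>x. \<psi> m x - \<psi> k x) < e" if "N1 + N2 \<le> m" "N1 + N2 \<le> k" for m k
    proof (cases "m \<le> k")
      case False
      have "ip (\<lambda>x. \<psi> m x - \<psi> k x) (\<lambda>x. \<psi> m x - \<psi> k x) = ip (\<lambda>x. \<psi> k x - \<psi> m x) (\<lambda>x. \<psi> k x - \<psi> m x)"
        using ip_diff_expand[OF inS[OF \<psi>(1)[of m]] inS[OF \<psi>(1)[of k]]]
          ip_diff_expand[OF inS[OF \<psi>(1)[of k]] inS[OF \<psi>(1)[of m]]]
          ip_sym[OF inS[OF \<psi>(1)[of m]] inS[OF \<psi>(1)[of k]]] by simp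
      then show ?thesis using main[of k m] False that by simp
    qed (use main that in auto)
    then show ?thesis by blast
  qed
  then show ?thesis using \<psi>(1) by blast
qed

text \<open>An approximate Riesz representation: completeness is replaced by a near-minimiser of
  the functional \<open>\<parallel>u\<parallel>\<^sup>2 - 2 l(u)\<close>, which represents \<open>l\<close> up to any prescribed error.\<close>

lemma approximate_riesz:
  assumes l: "\<And>u v a b. u \<in> S \<Longrightarrow> v \<in> S \<Longrightarrow> l (\<lambda>x. a * u x + b * v x) = a * l u + b * l v"
    and bdd: "\<And>u. u \<in> S \<Longrightarrow> \<bar>l u\<bar> \<le> C * sqrt (ip u u)"
    and e: "0 < e" and ne: "S \<noteq> {}"
  shows "\<exists>r\<in>S. \<forall>u\<in>S. \<bar>l u - ip u r\<bar> \<le> e * sqrt (ip u u)"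
proof -
  define J where "J u = ip u u - 2 * l u" for u
  have bb: "bdd_below (J ` S)"
  proof (rule bdd_belowI2)
    fix u assume u: "u \<in> S"
    have "0 \<le> (sqrt (ip u u) - C)\<^sup>2" by simp
    then have "- C\<^sup>2 \<le> ip u u - 2 * (C * sqrt (ip u u))"
      using ip_pos[OF u] by (simp add: power2_diff mult_ac)
    then show "- C\<^sup>2 \<le> J u" unfolding J_def using bdd[OF u] by linarith
  qed
  have "\<exists>r\<in>S. J r < Inf (J ` S) + e\<^sup>2"
    using cINF_less_iff[OF ne bb, of "Inf (J ` S) + e\<^sup>2"] e by simp
  then obtain r where r: "r \<in> S" "J r < Inf (J ` S) + e\<^sup>2" by blast
  show ?thesis
  proof (intro bexI[OF _ r(1)] ballI)
    fix u assume u: "u \<in> S"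
    have "(ip r u - l u)\<^sup>2 \<le> e\<^sup>2 * ip u u"
    proof (rule quadratic_lower_bound[OF ip_pos[OF u]])
      fix t
      have "Inf (J ` S) \<le> J (\<lambda>x. 1 * r x + t * u x)"
        by (rule cINF_lower[OF bb lincomb[OF r(1) u]])
      also have "\<dots> = J r + t\<^sup>2 * ip u u + 2 * t * (ip r u - l u)"
        unfolding J_def ip_expand[OF r(1) u] l[OF r(1) u] by (simp add: algebra_simps)
      finally show "- e\<^sup>2 \<le> t\<^sup>2 * ip u u + 2 * t * (ip r u - l u)" using r(2) by linarith
    qed
    from real_sqrt_le_mono[OF this] show "\<bar>l u - ip u r\<bar> \<le> e * sqrt (ip u u)"
      using e ip_sym[OF r(1) u] by (simp add: real_sqrt_mult abs_minus_commute)
  qed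
qed

text \<open>Hence testing a bounded sequence against a dense family decides its behaviour under all
  bounded functionals.\<close>

lemma weakly_cauchy:
  assumes \<theta>: "\<And>N. \<theta> N \<in> S" and bdd: "\<And>N. ip (\<theta> N) (\<theta> N) \<le> M"
    and e: "\<And>k. e k \<in> S"
    and dense: "\<And>v \<epsilon>. v \<in> S \<Longrightarrow> 0 < \<epsilon> \<Longrightarrow> \<exists>k. ip (\<lambda>x. v x - e k x) (\<lambda>x. v x - e k x) < \<epsilon>"
    and conv: "\<And>k. convergent (\<lambda>N. ip (\<theta> N) (e k))"
    and l: "\<And>u v a b. u \<in> S \<Longrightarrow> v \<in> S \<Longrightarrow> l (\<lambda>x. a * u x + b * v x) = a * l u + b * l v"
    and lb: "\<And>u. u \<in> S \<Longrightarrow> \<bar>l u\<bar> \<le> C * sqrt (ip u u)"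
  shows "convergent (\<lambda>N. l (\<theta> N))"
proof -
  have M: "sqrt (ip (\<theta> N) (\<theta> N)) \<le> sqrt \<bar>M\<bar>" for N using bdd[of N] by simp
  have "Cauchy (\<lambda>N. l (\<theta> N))"
  proof (rule CauchyI)
    fix \<epsilon> :: real assume \<epsilon>: "0 < \<epsilon>"
    define q where "q = sqrt \<bar>M\<bar> + 1"
    have q: "0 < q" unfolding q_def by (simp add: add_nonneg_pos)
    \<comment> \<open>The difference of two values of \<open>l\<close> is split into five parts of size \<open>\<epsilon>/5\<close>: on each side, from \<open>l\<close> to the approximate
      representative \<open>r\<close> and from \<open>r\<close> to the dense vector \<open>e k\<close>, and one comparison of two indices.\<close>
    define \<delta> where "\<delta> = \<epsilon> / (5 * q)"
    have \<delta>: "0 < \<delta>" unfolding \<delta>_def using \<epsilon> q by simp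
    have "\<delta> * sqrt \<bar>M\<bar> \<le> \<delta> * q" using \<delta> unfolding q_def by (intro mult_left_mono) auto
    also have "\<dots> = \<epsilon> / 5" unfolding \<delta>_def using q by simp
    finally have \<delta>M: "\<delta> * sqrt \<bar>M\<bar> \<le> \<epsilon> / 5" .
    obtain r where r: "r \<in> S" "\<And>u. u \<in> S \<Longrightarrow> \<bar>l u - ip u r\<bar> \<le> \<delta> * sqrt (ip u u)"
      using approximate_riesz[OF l lb \<delta>] e by blast
    obtain k where k: "ip (\<lambda>x. r x - e k x) (\<lambda>x. r x - e k x) < \<delta>\<^sup>2"
      using dense[OF r(1), of "\<delta>\<^sup>2"] \<delta> by auto
    have near: "\<bar>l (\<theta> N) - ip (\<theta> N) (e k)\<bar> \<le> 2 * \<epsilon> / 5" for N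
    proof -
      have "\<bar>ip (\<theta> N) r - ip (\<theta> N) (e k)\<bar> = \<bar>ip (\<theta> N) (\<lambda>x. r x - e k x)\<bar>"
        using ip_diff_right[OF r(1) e \<theta>] by simp
      also have "\<dots> \<le> sqrt (ip (\<theta> N) (\<theta> N)) * sqrt (ip (\<lambda>x. r x - e k x) (\<lambda>x. r x - e k x))"
        by (rule abs_ip_le[OF \<theta> diff_in[OF r(1) e]])
      also have "\<dots> \<le> sqrt \<bar>M\<bar> * \<delta>"
        using real_sqrt_less_mono[OF k] \<delta> M[of N] ip_pos[OF diff_in[OF r(1) e]] ip_pos[OF \<theta>]
        by (intro mult_mono) auto
      finally have 1: "\<bar>ip (\<theta> N) r - ip (\<theta> N) (e k)\<bar> \<le> \<epsilon> / 5" using \<delta>M by (simp add: mult.commute)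
      have "\<bar>l (\<theta> N) - ip (\<theta> N) r\<bar> \<le> \<delta> * sqrt (ip (\<theta> N) (\<theta> N))" by (rule r(2)[OF \<theta>])
      also have "\<dots> \<le> \<delta> * sqrt \<bar>M\<bar>" using M[of N] \<delta> by (intro mult_left_mono) auto
      finally have "\<bar>l (\<theta> N) - ip (\<theta> N) r\<bar> \<le> \<epsilon> / 5" using \<delta>M by simp
      then show ?thesis using 1 by linarith
    qed
    have "Cauchy (\<lambda>N. ip (\<theta> N) (e k))" using conv[of k] by (simp add: Cauchy_convergent_iff)
    then obtain N0 where N0: "\<And>m n. m \<ge> N0 \<Longrightarrow> n \<ge> N0 \<Longrightarrow> \<bar>ip (\<theta> m) (e k) - ip (\<theta> n) (e k)\<bar> < \<epsilon> / 5"
      using \<epsilon> unfolding Cauchy_def dist_real_def by (meson divide_pos_pos zero_less_numeral)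
    have "norm (l (\<theta> m) - l (\<theta> n)) < \<epsilon>" if "N0 \<le> m" "N0 \<le> n" for m n
    proof -
      have "\<bar>l (\<theta> m) - l (\<theta> n)\<bar> \<le> \<bar>l (\<theta> m) - ip (\<theta> m) (e k)\<bar> + \<bar>ip (\<theta> m) (e k) - ip (\<theta> n) (e k)\<bar>
          + \<bar>l (\<theta> n) - ip (\<theta> n) (e k)\<bar>" by linarith
      also have "\<dots> < \<epsilon>" using near[of m] near[of n] N0[OF that] \<epsilon> by linarith
      finally show ?thesis by simp
    qed
    then show "\<exists>N0. \<forall>m\<ge>N0. \<forall>n\<ge>N0. norm (l (\<theta> m) - l (\<theta> n)) < \<epsilon>" by blast
  qed
  then show ?thesis by (simp add: Cauchy_convergent_iff)
qed

end

section \<open>Zeros of outward pointing fields\<close>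

text \<open>The index range \<open>{..n}\<close> and the value \<open>0\<close> beyond it follow the encoding of \<open>nsphere n\<close>.\<close>

definition unit_vector :: "nat \<Rightarrow> (nat \<Rightarrow> real) \<Rightarrow> nat \<Rightarrow> real" where
  "unit_vector n v = (\<lambda>k. if k \<le> n then v k / sqrt (\<Sum>j\<le>n. (v j)\<^sup>2) else 0)"

lemma unit_vector_continuous:
  assumes c: "\<And>k. k \<le> n \<Longrightarrow> continuous_map X euclideanreal (\<lambda>z. V z k)"
    and nz: "\<And>z. z \<in> topspace X \<Longrightarrow> \<exists>k\<le>n. V z k \<noteq> 0"
  shows "continuous_map X (nsphere n) (\<lambda>z. unit_vector n (V z))"
proof -
  have pos: "0 < (\<Sum>j\<le>n. (V z j)\<^sup>2)" if z: "z \<in> topspace X" for z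
  proof -
    obtain k where k: "k \<le> n" "V z k \<noteq> 0" using nz[OF z] by blast
    have "0 < (V z k)\<^sup>2" using k by simp
    also have "\<dots> \<le> (\<Sum>j\<le>n. (V z j)\<^sup>2)" by (rule member_le_sum) (use k in auto)
    finally show ?thesis .
  qed
  then have nz': "(\<Sum>j\<le>n. (V z j)\<^sup>2) \<noteq> 0" if "z \<in> topspace X" for z
    using that by force
  have "continuous_map X euclideanreal (\<lambda>z. unit_vector n (V z) k)" for k
  proof (cases "k \<le> n")
    case True
    have "continuous_map X euclideanreal (\<lambda>z. V z k / sqrt (\<Sum>j\<le>n. (V z j)\<^sup>2))"
      by (intro continuous_map_real_divide continuous_map_sqrt continuous_map_sum continuous_map_real_pow c True)
         (use nz' in auto)
    then show ?thesis using True by (simp add: unit_vector_def)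
  qed (simp add: unit_vector_def)
  moreover have "(\<Sum>i\<le>n. (unit_vector n (V z) i)\<^sup>2) = 1" if "z \<in> topspace X" for z
    using pos[OF that] nz'[OF that]
    by (simp add: unit_vector_def power_divide sum_divide_distrib[symmetric])
  ultimately show ?thesis
    unfolding nsphere continuous_map_in_subtopology continuous_map_componentwise_UNIV
    by (simp add: image_subset_iff Pi_iff unit_vector_def)
qed

text \<open>Suppose there is no zero. Normalised on the sphere of radius \<open>\<rho>\<close>, the field is then homotopic to a constant, by shrinking
  the radius to zero, and to the identity, along the segment from \<open>c\<close> to the field at \<open>c\<close>, which avoids the
  origin because the field points outward. So the sphere would be contractible.\<close>

lemma outward_field_has_zero:
  fixes P :: "(nat \<Rightarrow> real) \<Rightarrow> nat \<Rightarrow> real"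
  assumes cont: "\<And>k. k < N \<Longrightarrow> continuous_map (powertop_real UNIV) euclideanreal (\<lambda>c. P c k)"
    and \<rho>: "0 < \<rho>"
    and out: "\<And>c. (\<forall>i\<ge>N. c i = 0) \<Longrightarrow> (\<Sum>i<N. (c i)\<^sup>2) = \<rho>\<^sup>2 \<Longrightarrow> 0 < (\<Sum>k<N. P c k * c k)"
  shows "\<exists>c. (\<forall>i\<ge>N. c i = 0) \<and> (\<forall>k<N. P c k = 0)"
proof (cases N)
  case 0
  then show ?thesis by (intro exI[of _ "\<lambda>_. 0"]) simp
next
  case (Suc n)
  show ?thesis
  proof (rule ccontr)
    assume none: "\<not> ?thesis"
    let ?X = "prod_topology (top_of_set {0..1::real}) (nsphere n)"
    have sph: "(\<forall>i\<ge>N. c i = 0) \<and> (\<Sum>i<N. (c i)\<^sup>2) = 1" if "c \<in> topspace (nsphere n)" for c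
      using that Suc unfolding nsphere by (auto simp: lessThan_Suc_atMost Suc_le_eq)
    have c1: "continuous_map ?X euclideanreal (\<lambda>z. fst z)"
      using continuous_map_fst[of "top_of_set {0..1::real}" "nsphere n"]
      by (auto simp: continuous_map_in_subtopology o_def)
    have c2: "continuous_map ?X euclideanreal (\<lambda>z. snd z k)" for k
    proof -
      have "continuous_map (nsphere n) euclideanreal (\<lambda>c. c k)"
        unfolding nsphere
        by (intro continuous_map_from_subtopology continuous_map_product_projection) auto
      from continuous_map_compose[OF continuous_map_snd this] show ?thesis by (simp add: o_def)
    qed
    have cP: "continuous_map ?X euclideanreal (\<lambda>z. P (\<lambda>i. g z * snd z i) k)"
      if "continuous_map ?X euclideanreal g" "k \<le> n" for g k
    proof -
      have "continuous_map ?X (powertop_real UNIV) (\<lambda>z i. g z * snd z i)"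
        unfolding continuous_map_componentwise_UNIV
        by (intro allI continuous_map_real_mult that c2)
      moreover have "continuous_map (powertop_real UNIV) euclideanreal (\<lambda>c. P c k)"
        using cont that Suc by simp
      ultimately have "continuous_map ?X euclideanreal ((\<lambda>c. P c k) \<circ> (\<lambda>z i. g z * snd z i))"
        by (rule continuous_map_compose)
      then show ?thesis by (simp add: o_def)
    qed
    let ?f = "\<lambda>c. unit_vector n (P (\<lambda>i. \<rho> * c i))"
    \<comment> \<open>Shrinking the radius.\<close>
    have h1: "homotopic_with (\<lambda>_. True) (nsphere n) (nsphere n)
        (\<lambda>c. unit_vector n (P (\<lambda>i. 0))) ?f"
    proof -
      let ?h = "\<lambda>z. unit_vector n (P (\<lambda>i. (fst z * \<rho>) * snd z i))"
      have "continuous_map ?X (nsphere n) ?h"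
      proof (rule unit_vector_continuous)
        show "continuous_map ?X euclideanreal (\<lambda>z. P (\<lambda>i. (fst z * \<rho>) * snd z i) k)" if "k \<le> n" for k
          by (rule cP[OF _ that]) (intro continuous_map_real_mult c1, simp)
        fix z assume z: "z \<in> topspace ?X"
        then have out0: "\<forall>i\<ge>N. (fst z * \<rho>) * snd z i = 0"
          using sph[of "snd z"] by (auto simp: topspace_prod_topology)
        have "\<not> (\<forall>k<N. P (\<lambda>i. (fst z * \<rho>) * snd z i) k = 0)"
        proof
          assume "\<forall>k<N. P (\<lambda>i. (fst z * \<rho>) * snd z i) k = 0"
          with out0 have "\<exists>c. (\<forall>i\<ge>N. c i = 0) \<and> (\<forall>k<N. P c k = 0)"
            by (intro exI[of _ "\<lambda>i. (fst z * \<rho>) * snd z i"] conjI)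
          with none show False by (rule notE)
        qed
        then show "\<exists>k\<le>n. P (\<lambda>i. (fst z * \<rho>) * snd z i) k \<noteq> 0"
          unfolding Suc less_Suc_eq_le by simp
      qed
      then show ?thesis unfolding homotopic_with_def by (intro exI[of _ ?h]) simp
    qed
    \<comment> \<open>The segment: at a zero, the inner product with \<open>c\<close> would vanish, but it is positive.\<close>
    have h2: "homotopic_with (\<lambda>_. True) (nsphere n) (nsphere n) (\<lambda>c. unit_vector n c) ?f"
    proof -
      let ?h = "\<lambda>z. unit_vector n (\<lambda>k. (1 - fst z) * snd z k + fst z * P (\<lambda>i. \<rho> * snd z i) k)"
      have "continuous_map ?X (nsphere n) ?h"
      proof (rule unit_vector_continuous)
        show "continuous_map ?X euclideanreal (\<lambda>z. (1 - fst z) * snd z k + fst z * P (\<lambda>i. \<rho> * snd z i) k)"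
          if "k \<le> n" for k
          by (intro continuous_map_add continuous_map_real_mult continuous_map_diff c1 c2 cP that) simp_all
        fix z assume z: "z \<in> topspace ?X"
        then have t: "0 \<le> fst z" "fst z \<le> 1" and s: "\<forall>i\<ge>N. snd z i = 0" "(\<Sum>i<N. (snd z i)\<^sup>2) = 1"
          using sph[of "snd z"] by (auto simp: topspace_prod_topology)
        have "(\<Sum>i<N. (\<rho> * snd z i)\<^sup>2) = \<rho>\<^sup>2"
          using s(2) by (simp add: power_mult_distrib sum_distrib_left[symmetric])
        then have "0 < (\<Sum>k<N. P (\<lambda>i. \<rho> * snd z i) k * (\<rho> * snd z k))"
          using s(1) by (intro out) auto
        also have "\<dots> = \<rho> * (\<Sum>k<N. P (\<lambda>i. \<rho> * snd z i) k * snd z k)"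
          by (simp add: sum_distrib_left mult_ac)
        finally have p: "0 < (\<Sum>k<N. P (\<lambda>i. \<rho> * snd z i) k * snd z k)"
          using \<rho> by (simp add: zero_less_mult_iff)
        show "\<exists>k\<le>n. (1 - fst z) * snd z k + fst z * P (\<lambda>i. \<rho> * snd z i) k \<noteq> 0"
        proof (rule ccontr)
          assume "\<not> ?thesis"
          then have "(1 - fst z) * snd z k + fst z * P (\<lambda>i. \<rho> * snd z i) k = 0" if "k < N" for k
            using that Suc by auto
          then have "(\<Sum>k<N. ((1 - fst z) * snd z k + fst z * P (\<lambda>i. \<rho> * snd z i) k) * snd z k) = 0"
            by simp
          moreover have "(\<Sum>k<N. ((1 - fst z) * snd z k + fst z * P (\<lambda>i. \<rho> * snd z i) k) * snd z k)
              = (1 - fst z) * (\<Sum>k<N. (snd z k)\<^sup>2) + fst z * (\<Sum>k<N. P (\<lambda>i. \<rho> * snd z i) k * snd z k)"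
            by (simp add: sum_distrib_left sum.distrib[symmetric] power2_eq_square algebra_simps)
          ultimately have "(1 - fst z) + fst z * (\<Sum>k<N. P (\<lambda>i. \<rho> * snd z i) k * snd z k) = 0"
            using s(2) by simp
          moreover have "0 < (1 - fst z) + fst z * (\<Sum>k<N. P (\<lambda>i. \<rho> * snd z i) k * snd z k)"
            using t p by (cases "fst z = 0") (auto intro!: add_nonneg_pos)
          ultimately show False by simp
        qed
      qed
      then show ?thesis unfolding homotopic_with_def by (intro exI[of _ ?h]) simp
    qed
    have "unit_vector n c = c" if "c \<in> topspace (nsphere n)" for c
      using sph[OF that] Suc by (auto simp: unit_vector_def lessThan_Suc_atMost fun_eq_iff not_le Suc_le_eq)
    then have "homotopic_with (\<lambda>_. True) (nsphere n) (nsphere n) id ?f"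
      by (intro homotopic_with_eq[OF h2]) auto
    from homotopic_with_trans[OF this homotopic_with_symD[OF h1]]
    have "contractible_space (nsphere n)" unfolding contractible_space_def by blast
    then show False using non_contractible_space_nsphere by blast
  qed
qed

section \<open>The homogeneous Sobolev form on test functions\<close>

text \<open>The Fourier transform of \<open>(-\<Delta>)\<close> to the power \<open>s/2\<close> applied to \<open>u\<close>.\<close>

definition freq :: "real \<Rightarrow> (real^'n::finite \<Rightarrow> real) \<Rightarrow> real^'n \<Rightarrow> complex" where
  "freq s u \<xi> = of_real (norm \<xi> powr s) * fourier (\<lambda>x. of_real (u x)) \<xi>"

text \<open>The inner product of the homogeneous Sobolev space of order \<open>s\<close>; the constant normalises it to the
  \<open>L\<^sup>2\<close> inner product for \<open>s = 0\<close>. It is stated as a real part to live in the reals; for real functions the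
  integral is real anyway (\<open>hip_complex\<close>).\<close>

definition hip :: "real \<Rightarrow> (real^'n::finite \<Rightarrow> real) \<Rightarrow> (real^'n \<Rightarrow> real) \<Rightarrow> real" where
  "hip s u v = 1 / (2 * pi) ^ CARD('n) * Re (\<integral>\<xi>. freq s u \<xi> * cnj (freq s v \<xi>) \<partial>lborel)"

lemma test_integrable: "u \<in> test_functions \<Longrightarrow> integrable lborel (\<lambda>x. complex_of_real (u x))"
  by (rule schwartz_integrable[OF test_schwartz])

lemma test_integrable_real: "u \<in> test_functions \<Longrightarrow> integrable lborel u"
  using test_integrable[of u] by (simp only: complex_of_real_integrable_eq)

lemma test_measurable: "u \<in> test_functions \<Longrightarrow> u \<in> borel_measurable borel"
  by (rule borel_measurable_continuous_onI[OF test_continuous])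

lemma schwartz_ft: "u \<in> test_functions \<Longrightarrow> fourier (\<lambda>x. complex_of_real (u x)) \<in> schwartz"
  by (rule schwartz_fourier[OF test_schwartz])

lemma powr_square_le: "0 \<le> s \<Longrightarrow> s \<le> 1 \<Longrightarrow> 0 \<le> x \<Longrightarrow> (x powr s)\<^sup>2 \<le> 1 + x\<^sup>2" for x s :: real
proof -
  assume a: "0 \<le> s" "s \<le> 1" "0 \<le> x"
  show ?thesis
  proof (cases "x \<le> 1")
    case True
    then have "x powr s \<le> 1 powr s" using a by (intro powr_mono2) auto
    then have "(x powr s)\<^sup>2 \<le> 1\<^sup>2" by (intro power_mono) auto
    moreover have "0 \<le> x\<^sup>2" by simp
    ultimately show ?thesis unfolding power_one by linarith
  next
    case False
    then have "x powr s \<le> x powr 1" using a by (intro powr_mono) auto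
    then have "(x powr s)\<^sup>2 \<le> x\<^sup>2" using False by (intro power_mono) auto
    then show ?thesis by simp
  qed
qed

lemma weighted_schwartz_square_integrable:
  assumes s: "0 \<le> s" "s \<le> 1" and g: "g \<in> schwartz"
  shows "integrable lborel (\<lambda>\<xi>. (norm (of_real (norm \<xi> powr s) * g \<xi>))\<^sup>2)"
proof -
  note [measurable] = schwartz_measurable[OF g]
  show ?thesis
  proof (rule Bochner_Integration.integrable_bound[OF Bochner_Integration.integrable_add[OF
        schwartz_square_moment_integrable[OF g, of 0] schwartz_square_moment_integrable[OF g, of 2]]])
    show "AE \<xi> in lborel. norm ((norm (of_real (norm \<xi> powr s) * g \<xi>))\<^sup>2)
        \<le> norm (norm \<xi> ^ 0 * (norm (g \<xi>))\<^sup>2 + norm \<xi> ^ 2 * (norm (g \<xi>))\<^sup>2)"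
    proof (intro AE_I2)
      fix \<xi>
      have "(norm \<xi> powr s)\<^sup>2 * (norm (g \<xi>))\<^sup>2 \<le> (1 + (norm \<xi>)\<^sup>2) * (norm (g \<xi>))\<^sup>2"
        by (intro mult_right_mono powr_square_le s) auto
      then show "norm ((norm (of_real (norm \<xi> powr s) * g \<xi>))\<^sup>2)
          \<le> norm (norm \<xi> ^ 0 * (norm (g \<xi>))\<^sup>2 + norm \<xi> ^ 2 * (norm (g \<xi>))\<^sup>2)"
        by (simp add: norm_mult power_mult_distrib algebra_simps)
    qed
  qed measurable
qed

lemma freq_measurable: "u \<in> test_functions \<Longrightarrow> freq s u \<in> borel_measurable borel"
proof -
  assume "u \<in> test_functions"
  then have [measurable]: "fourier (\<lambda>x. complex_of_real (u x)) \<in> borel_measurable borel"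
    by (rule schwartz_measurable[OF schwartz_ft])
  show ?thesis unfolding freq_def by measurable
qed

lemma freq_square_integrable:
  "0 \<le> s \<Longrightarrow> s \<le> 1 \<Longrightarrow> u \<in> test_functions \<Longrightarrow> integrable lborel (\<lambda>\<xi>. (norm (freq s u \<xi>))\<^sup>2)"
  unfolding freq_def by (rule weighted_schwartz_square_integrable[OF _ _ schwartz_ft])

lemma freq_lincomb:
  assumes "u \<in> test_functions" "v \<in> test_functions"
  shows "freq s (\<lambda>x. a * u x + b * v x) \<xi> = of_real a * freq s u \<xi> + of_real b * freq s v \<xi>"
proof -
  have "fourier (\<lambda>x. complex_of_real (a * u x + b * v x)) \<xi>
      = fourier (\<lambda>x. of_real a * complex_of_real (u x) + of_real b * complex_of_real (v x)) \<xi>" by simp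
  also have "\<dots> = of_real a * fourier (\<lambda>x. complex_of_real (u x)) \<xi> + of_real b * fourier (\<lambda>x. complex_of_real (v x)) \<xi>"
    by (rule fourier_lincomb[OF test_integrable[OF assms(1)] test_integrable[OF assms(2)]])
  finally show ?thesis unfolding freq_def by (simp add: algebra_simps)
qed

lemma freq_pair_integrable:
  assumes "0 \<le> s" "s \<le> 1" "u \<in> test_functions" "v \<in> test_functions"
  shows "integrable lborel (\<lambda>\<xi>. freq s u \<xi> * cnj (freq s v \<xi>))"
proof -
  have [measurable]: "freq s v \<in> borel_measurable borel" "freq s u \<in> borel_measurable borel"
    by (rule freq_measurable, rule assms)+
  show ?thesis
    by (rule square_integrable_mult_complex(1)) (use freq_square_integrable[OF assms(1,2)] assms in auto)
qed

lemma hip_self: "hip s u u = 1 / (2 * pi) ^ CARD('n) * (\<integral>\<xi>. (norm (freq s u \<xi>))\<^sup>2 \<partial>lborel)"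
  for u :: "real^'n::finite \<Rightarrow> real"
  unfolding hip_def complex_norm_square[symmetric] by (simp flip: of_real_power)

theorem semi_inner_hip:
  assumes s: "0 \<le> s" "s \<le> 1"
  shows "semi_inner (test_functions :: (real^'n::finite \<Rightarrow> real) set) (hip s)"
proof
  fix u v w :: "real^'n \<Rightarrow> real" and a b :: real
  assume u: "u \<in> test_functions" and v: "v \<in> test_functions"
  show "(\<lambda>x. a * u x + b * v x) \<in> test_functions" by (rule test_lincomb[OF u v])
  have "(\<integral>\<xi>. freq s u \<xi> * cnj (freq s v \<xi>) \<partial>lborel) = (\<integral>\<xi>. cnj (freq s v \<xi> * cnj (freq s u \<xi>)) \<partial>lborel)"
    by (intro Bochner_Integration.integral_cong) (auto simp: mult.commute)
  also have "\<dots> = cnj (\<integral>\<xi>. freq s v \<xi> * cnj (freq s u \<xi>) \<partial>lborel)"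
    by (rule Bochner_Integration.integral_cnj)
  finally show "hip s u v = hip s v u" unfolding hip_def by simp
  show "0 \<le> hip s u u" unfolding hip_self by (intro mult_nonneg_nonneg integral_nonneg_AE) auto
  assume w: "w \<in> test_functions"
  have "(\<integral>\<xi>. freq s (\<lambda>x. a * u x + b * v x) \<xi> * cnj (freq s w \<xi>) \<partial>lborel)
      = (\<integral>\<xi>. of_real a * (freq s u \<xi> * cnj (freq s w \<xi>)) + of_real b * (freq s v \<xi> * cnj (freq s w \<xi>)) \<partial>lborel)"
    unfolding freq_lincomb[OF u v] by (intro Bochner_Integration.integral_cong) (auto simp: algebra_simps)
  also have "\<dots> = of_real a * (\<integral>\<xi>. freq s u \<xi> * cnj (freq s w \<xi>) \<partial>lborel)
      + of_real b * (\<integral>\<xi>. freq s v \<xi> * cnj (freq s w \<xi>) \<partial>lborel)"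
    using freq_pair_integrable[OF s u w] freq_pair_integrable[OF s v w] by simp
  finally show "hip s (\<lambda>x. a * u x + b * v x) w = a * hip s u w + b * hip s v w"
    unfolding hip_def by (simp add: algebra_simps)
qed

text \<open>\<open>|\<xi>|\<^sup>2\<^sup>s \<le> 1 + |\<xi>|\<^sup>2\<close> for \<open>s \<le> 1\<close>, and \<open>\<xi>\<^sub>i\<close> times the transform is the transform of a derivative.
  Approximation in \<open>C\<^sup>1\<close> on a fixed ball is thereby approximation for \<open>hip\<close>.\<close>

lemma hip_le_H1:
  fixes u :: "real^'n::finite \<Rightarrow> real"
  assumes s: "0 \<le> s" "s \<le> 1" and u: "u \<in> test_functions"
  shows "hip s u u \<le> (\<integral>x. (u x)\<^sup>2 \<partial>lborel) + (\<Sum>i\<in>UNIV. \<integral>x. (partial i u x)\<^sup>2 \<partial>lborel)"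
proof -
  let ?U = "\<lambda>x. complex_of_real (u x)"
  let ?c = "(2 * pi) ^ CARD('n)"
  have U: "?U \<in> schwartz" by (rule test_schwartz[OF u])
  have pU: "partial i ?U = (\<lambda>x. of_real (partial i u x))" for i
    using u by (intro partial_bounded_linear bounded_linear_of_real smooth_differentiable) (simp add: test_functions_def)
  have pl: "(\<integral>\<xi>. (norm (fourier g \<xi>))\<^sup>2 \<partial>lborel) \<le> ?c * (\<integral>x. (norm (g x))\<^sup>2 \<partial>lborel)"
    "integrable lborel (\<lambda>\<xi>. (norm (fourier g \<xi>))\<^sup>2)" if "g \<in> schwartz" for g :: "real^'n \<Rightarrow> complex"
    using plancherel_inequality[OF schwartz_integrable[OF that] schwartz_square_integrable[OF that]] by auto
  have pt: "(norm (freq s u \<xi>))\<^sup>2 \<le> (norm (fourier ?U \<xi>))\<^sup>2 + (\<Sum>i\<in>UNIV. (norm (fourier (partial i ?U) \<xi>))\<^sup>2)" for \<xi>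
  proof -
    have "(norm (freq s u \<xi>))\<^sup>2 = (norm \<xi> powr s)\<^sup>2 * (norm (fourier ?U \<xi>))\<^sup>2"
      unfolding freq_def by (simp add: norm_mult power_mult_distrib)
    also have "\<dots> \<le> (1 + (norm \<xi>)\<^sup>2) * (norm (fourier ?U \<xi>))\<^sup>2"
      by (intro mult_right_mono powr_square_le s) auto
    also have "(norm \<xi>)\<^sup>2 = (\<Sum>i\<in>UNIV. (\<xi> $ i)\<^sup>2)"
      by (simp add: norm_vec_def L2_set_def sum_nonneg)
    also have "(1 + (\<Sum>i\<in>UNIV. (\<xi> $ i)\<^sup>2)) * (norm (fourier ?U \<xi>))\<^sup>2
        = (norm (fourier ?U \<xi>))\<^sup>2 + (\<Sum>i\<in>UNIV. (norm (fourier (partial i ?U) \<xi>))\<^sup>2)"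
      unfolding fourier_partial[OF U] by (simp add: norm_mult power_mult_distrib distrib_right sum_distrib_right)
    finally show ?thesis .
  qed
  have "(\<integral>\<xi>. (norm (freq s u \<xi>))\<^sup>2 \<partial>lborel)
      \<le> (\<integral>\<xi>. (norm (fourier ?U \<xi>))\<^sup>2 + (\<Sum>i\<in>UNIV. (norm (fourier (partial i ?U) \<xi>))\<^sup>2) \<partial>lborel)"
    by (intro integral_mono freq_square_integrable s u Bochner_Integration.integrable_add
        Bochner_Integration.integrable_sum pl U schwartz_partial pt)
  also have "\<dots> = (\<integral>\<xi>. (norm (fourier ?U \<xi>))\<^sup>2 \<partial>lborel) + (\<Sum>i\<in>UNIV. \<integral>\<xi>. (norm (fourier (partial i ?U) \<xi>))\<^sup>2 \<partial>lborel)"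
    using pl(2)[OF U] pl(2)[OF schwartz_partial[OF U]] by simp
  also have "\<dots> \<le> ?c * (\<integral>x. (norm (?U x))\<^sup>2 \<partial>lborel) + (\<Sum>i\<in>UNIV. ?c * (\<integral>x. (norm (partial i ?U x))\<^sup>2 \<partial>lborel))"
    by (intro add_mono sum_mono pl U schwartz_partial)
  also have "\<dots> = ?c * ((\<integral>x. (u x)\<^sup>2 \<partial>lborel) + (\<Sum>i\<in>UNIV. \<integral>x. (partial i u x)\<^sup>2 \<partial>lborel))"
    unfolding pU by (simp add: sum_distrib_left distrib_left)
  finally show ?thesis unfolding hip_self by (simp add: field_simps)
qed

section \<open>Low and high frequencies\<close>

text \<open>The part of \<open>u\<close> with frequencies in the ball of radius \<open>R\<close>.\<close>

definition low :: "real \<Rightarrow> (real^'n::finite \<Rightarrow> real) \<Rightarrow> real^'n \<Rightarrow> real" where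
  "low R u x = Re (of_real (1 / (2 * pi) ^ CARD('n)) * (\<integral>\<xi>. exp (\<i> * of_real (x \<bullet> \<xi>)) *
     (indicator (cball 0 R) \<xi> *\<^sub>R fourier (\<lambda>x. of_real (u x)) \<xi>) \<partial>lborel))"

lemma indicator_fourier_integrable:
  assumes u: "u \<in> test_functions" and [measurable]: "S \<in> sets borel"
  shows "integrable lborel (\<lambda>\<xi>. indicator S \<xi> *\<^sub>R fourier (\<lambda>x. complex_of_real (u x)) \<xi>)"
    and "integrable lborel (\<lambda>\<xi>. (norm (indicator S \<xi> *\<^sub>R fourier (\<lambda>x. complex_of_real (u x)) \<xi>))\<^sup>2)"
    and "integrable lborel (\<lambda>\<xi>. exp (\<i> * of_real (x \<bullet> \<xi>)) * (indicator S \<xi> *\<^sub>R fourier (\<lambda>x. complex_of_real (u x)) \<xi>))"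
proof -
  have [measurable]: "fourier (\<lambda>x. complex_of_real (u x)) \<in> borel_measurable borel"
    by (rule schwartz_measurable[OF schwartz_ft[OF u]])
  have [measurable]: "(\<lambda>\<xi>. indicator S \<xi> :: real) \<in> borel_measurable borel" by measurable
  note i = schwartz_integrable[OF schwartz_ft[OF u]]
  show "integrable lborel (\<lambda>\<xi>. indicator S \<xi> *\<^sub>R fourier (\<lambda>x. complex_of_real (u x)) \<xi>)"
    by (rule Bochner_Integration.integrable_bound[OF i]) (auto simp: indicator_def)
  show "integrable lborel (\<lambda>\<xi>. (norm (indicator S \<xi> *\<^sub>R fourier (\<lambda>x. complex_of_real (u x)) \<xi>))\<^sup>2)"
    by (rule Bochner_Integration.integrable_bound[OF schwartz_square_integrable[OF schwartz_ft[OF u]]])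
       (auto simp: indicator_def)
  show "integrable lborel (\<lambda>\<xi>. exp (\<i> * of_real (x \<bullet> \<xi>)) * (indicator S \<xi> *\<^sub>R fourier (\<lambda>x. complex_of_real (u x)) \<xi>))"
    by (rule Bochner_Integration.integrable_bound[OF i]) (auto simp: indicator_def norm_mult)
qed

lemma low_measurable:
  assumes u: "u \<in> test_functions"
  shows "low R u \<in> borel_measurable borel"
proof -
  have [measurable]: "fourier (\<lambda>x. complex_of_real (u x)) \<in> borel_measurable borel"
    by (rule schwartz_measurable[OF schwartz_ft[OF u]])
  have [measurable]: "(\<lambda>\<xi>. indicator (cball 0 R) \<xi> :: real) \<in> borel_measurable borel"
    by (intro borel_measurable_indicator) simp
  show ?thesis unfolding low_def by measurable
qed

lemma low_lincomb:
  assumes u: "u \<in> test_functions" and v: "v \<in> test_functions"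
  shows "low R (\<lambda>x. a * u x + b * v x) x = a * low R u x + b * low R v x"
proof -
  let ?I = "\<lambda>u \<xi>. exp (\<i> * of_real (x \<bullet> \<xi>)) * (indicator (cball 0 R) \<xi> *\<^sub>R fourier (\<lambda>x. complex_of_real (u x)) \<xi>)"
  have f: "fourier (\<lambda>x. complex_of_real (a * u x + b * v x)) \<xi>
      = of_real a * fourier (\<lambda>x. complex_of_real (u x)) \<xi> + of_real b * fourier (\<lambda>x. complex_of_real (v x)) \<xi>" for \<xi>
    using fourier_lincomb[OF test_integrable[OF u] test_integrable[OF v], of "of_real a" "of_real b"] by simp
  have "(\<integral>\<xi>. ?I (\<lambda>x. a * u x + b * v x) \<xi> \<partial>lborel) = (\<integral>\<xi>. of_real a * ?I u \<xi> + of_real b * ?I v \<xi> \<partial>lborel)"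
    unfolding f by (intro Bochner_Integration.integral_cong) (auto simp: algebra_simps)
  also have "\<dots> = of_real a * (\<integral>\<xi>. ?I u \<xi> \<partial>lborel) + of_real b * (\<integral>\<xi>. ?I v \<xi> \<partial>lborel)"
  proof -
    have i: "integrable lborel (?I u)" "integrable lborel (?I v)"
      by (intro indicator_fourier_integrable(3) u v, simp)+
    show ?thesis
      unfolding Bochner_Integration.integral_add[OF integrable_mult_right[OF i(1)] integrable_mult_right[OF i(2)]]
        integral_mult_right_zero ..
  qed
  finally show ?thesis unfolding low_def by (simp add: algebra_simps)
qed

text \<open>The remainder is an inverse Fourier transform of the high frequencies, so Plancherel's inequality
  applies to it.\<close>

lemma high_bound:
  fixes u :: "real^'n::finite \<Rightarrow> real"
  assumes u: "u \<in> test_functions"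
  shows "integrable lborel (\<lambda>x. (u x - low R u x)\<^sup>2)"
    and "(\<integral>x. (u x - low R u x)\<^sup>2 \<partial>lborel)
      \<le> 1 / (2 * pi) ^ CARD('n) * (\<integral>\<xi>. (norm (indicator (- cball 0 R) \<xi> *\<^sub>R fourier (\<lambda>x. complex_of_real (u x)) \<xi>))\<^sup>2 \<partial>lborel)"
proof -
  let ?U = "fourier (\<lambda>x. complex_of_real (u x))"
  define c where "c = 1 / (2 * pi) ^ CARD('n)"
  have c: "0 < c" "c * (2 * pi) ^ CARD('n) = 1" unfolding c_def by auto
  define v where "v \<xi> = indicator (- cball 0 R) \<xi> *\<^sub>R ?U \<xi>" for \<xi>
  have v: "integrable lborel v" "integrable lborel (\<lambda>\<xi>. (norm (v \<xi>))\<^sup>2)"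
    unfolding v_def using indicator_fourier_integrable[OF u, of "- cball 0 R"] by auto
  note [measurable] = borel_measurable_integrable[OF v(1)] low_measurable[OF u] test_measurable[OF u]
  have split: "u x - low R u x = Re (of_real c * fourier v (- x))" for x
  proof -
    let ?E = "\<lambda>\<xi>. exp (\<i> * complex_of_real (x \<bullet> \<xi>))"
    have i1: "integrable lborel (\<lambda>\<xi>. ?E \<xi> * (indicator (cball 0 R) \<xi> *\<^sub>R ?U \<xi>))"
      by (rule indicator_fourier_integrable(3)[OF u]) simp
    have i2: "integrable lborel (\<lambda>\<xi>. ?E \<xi> * v \<xi>)"
      unfolding v_def by (rule indicator_fourier_integrable(3)[OF u]) simp
    have "complex_of_real (u x) = inv_fourier ?U x"
      using inv_fourier_fourier[OF test_schwartz[OF u]] by metis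
    also have "\<dots> = of_real c * (\<integral>\<xi>. ?E \<xi> * (indicator (cball 0 R) \<xi> *\<^sub>R ?U \<xi>) + ?E \<xi> * v \<xi> \<partial>lborel)"
      unfolding inv_fourier_def c_def
      by (intro arg_cong2[of _ _ _ _ "(*)"] Bochner_Integration.integral_cong) (auto simp: v_def indicator_def)
    also have "\<dots> = of_real c * (\<integral>\<xi>. ?E \<xi> * (indicator (cball 0 R) \<xi> *\<^sub>R ?U \<xi>) \<partial>lborel) + of_real c * (\<integral>\<xi>. ?E \<xi> * v \<xi> \<partial>lborel)"
      unfolding Bochner_Integration.integral_add[OF i1 i2] by (simp add: distrib_left)
    also have "(\<integral>\<xi>. ?E \<xi> * v \<xi> \<partial>lborel) = fourier v (- x)"
      unfolding fourier_def by (simp add: inner_commute)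
    finally have "Re (complex_of_real (u x)) = Re (of_real c * (\<integral>\<xi>. ?E \<xi> * (indicator (cball 0 R) \<xi> *\<^sub>R ?U \<xi>) \<partial>lborel)
        + of_real c * fourier v (- x))" by (rule arg_cong)
    then show ?thesis unfolding low_def c_def by simp
  qed
  note pl = plancherel_inequality[OF v]
  have refl: "integrable lborel (\<lambda>x. (norm (fourier v (- x)))\<^sup>2)"
    "(\<integral>x. (norm (fourier v (- x)))\<^sup>2 \<partial>lborel) = (\<integral>x. (norm (fourier v x))\<^sup>2 \<partial>lborel)"
    using integral_reflect[of "\<lambda>x. (norm (fourier v x))\<^sup>2"] pl(1) by auto
  have le: "(u x - low R u x)\<^sup>2 \<le> c\<^sup>2 * (norm (fourier v (- x)))\<^sup>2" for x
  proof -
    have "\<bar>u x - low R u x\<bar> \<le> norm (of_real c * fourier v (- x))" unfolding split by (rule abs_Re_le_cmod)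
    then have "\<bar>u x - low R u x\<bar>\<^sup>2 \<le> (norm (of_real c * fourier v (- x)))\<^sup>2" by (intro power_mono) auto
    then show ?thesis by (simp add: norm_mult power_mult_distrib)
  qed
  show i: "integrable lborel (\<lambda>x. (u x - low R u x)\<^sup>2)"
    by (rule Bochner_Integration.integrable_bound[OF integrable_mult_right[OF refl(1), of "c\<^sup>2"]])
       (use le in auto)
  have "(\<integral>x. (u x - low R u x)\<^sup>2 \<partial>lborel) \<le> (\<integral>x. c\<^sup>2 * (norm (fourier v (- x)))\<^sup>2 \<partial>lborel)"
    by (intro integral_mono i integrable_mult_right refl le)
  also have "\<dots> = c\<^sup>2 * (\<integral>x. (norm (fourier v x))\<^sup>2 \<partial>lborel)" using refl by simp
  also have "\<dots> \<le> c\<^sup>2 * ((2 * pi) ^ CARD('n) * (\<integral>\<xi>. (norm (v \<xi>))\<^sup>2 \<partial>lborel))"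
    by (intro mult_left_mono pl) auto
  also have "\<dots> = (c * (2 * pi) ^ CARD('n)) * (c * (\<integral>\<xi>. (norm (v \<xi>))\<^sup>2 \<partial>lborel))"
    by (simp add: power2_eq_square mult_ac)
  finally show "(\<integral>x. (u x - low R u x)\<^sup>2 \<partial>lborel)
      \<le> 1 / (2 * pi) ^ CARD('n) * (\<integral>\<xi>. (norm (indicator (- cball 0 R) \<xi> *\<^sub>R ?U \<xi>))\<^sup>2 \<partial>lborel)"
    unfolding c(2) by (simp add: c_def v_def)
qed

lemma high_bound_hip:
  fixes u :: "real^'n::finite \<Rightarrow> real"
  assumes s: "0 \<le> s" "s \<le> 1" and u: "u \<in> test_functions" and R: "0 < R"
  shows "(\<integral>x. (u x - low R u x)\<^sup>2 \<partial>lborel) \<le> R powr (- 2 * s) * hip s u u"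
proof -
  let ?U = "fourier (\<lambda>x. complex_of_real (u x))"
  have "(\<integral>\<xi>. (norm (indicator (- cball 0 R) \<xi> *\<^sub>R ?U \<xi>))\<^sup>2 \<partial>lborel)
      \<le> (\<integral>\<xi>. R powr (- 2 * s) * (norm (freq s u \<xi>))\<^sup>2 \<partial>lborel)"
  proof (intro integral_mono integrable_mult_right freq_square_integrable s u indicator_fourier_integrable(2))
    fix \<xi> :: "real^'n"
    show "(norm (indicator (- cball 0 R) \<xi> *\<^sub>R ?U \<xi>))\<^sup>2 \<le> R powr (- 2 * s) * (norm (freq s u \<xi>))\<^sup>2"
    proof (cases "\<xi> \<in> cball 0 R")
      case False
      then have l: "R \<le> norm \<xi>" by simp
      have "1 = R powr (- 2 * s) * (R powr s)\<^sup>2"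
        using R by (simp add: power2_eq_square powr_add[symmetric])
      also have "\<dots> \<le> R powr (- 2 * s) * (norm \<xi> powr s)\<^sup>2"
        using l R s by (intro mult_left_mono power_mono powr_mono2) auto
      finally have "1 * (norm (?U \<xi>))\<^sup>2 \<le> R powr (- 2 * s) * (norm \<xi> powr s)\<^sup>2 * (norm (?U \<xi>))\<^sup>2"
        by (intro mult_right_mono) auto
      then show ?thesis using False by (simp add: freq_def norm_mult power_mult_distrib mult.assoc)
    qed simp
  qed simp
  also have "\<dots> = R powr (- 2 * s) * (\<integral>\<xi>. (norm (freq s u \<xi>))\<^sup>2 \<partial>lborel)" by simp
  finally have "1 / (2 * pi) ^ CARD('n) * (\<integral>\<xi>. (norm (indicator (- cball 0 R) \<xi> *\<^sub>R ?U \<xi>))\<^sup>2 \<partial>lborel)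
      \<le> 1 / (2 * pi) ^ CARD('n) * (R powr (- 2 * s) * (\<integral>\<xi>. (norm (freq s u \<xi>))\<^sup>2 \<partial>lborel))"
    by (intro mult_left_mono) auto
  with high_bound(2)[OF u, of R] show ?thesis unfolding hip_self by simp
qed

text \<open>Writing the transform as \<open>|\<xi>|\<^sup>-\<^sup>s\<close> times the weighted one, the Cauchy-Schwarz inequality leaves the integral of
  \<open>|\<xi>|\<^sup>-\<^sup>2\<^sup>s\<close> over the ball of radius \<open>R\<close>, which scales like the power \<open>n - 2s\<close> of \<open>R\<close>.\<close>

lemma low_bound:
  fixes s :: real
  assumes s: "0 < s" "s \<le> 1" "2 * s < CARD('n)"
  shows "\<exists>K>0. \<forall>u\<in>(test_functions :: (real^'n::finite \<Rightarrow> real) set). \<forall>R>0. \<forall>x.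
     \<bar>low R u x\<bar> \<le> K * R powr ((CARD('n) - 2 * s) / 2) * sqrt (hip s u u)"
proof -
  let ?n = "real CARD('n)"
  obtain C where C: "0 \<le> C" "\<And>R. 0 < R \<Longrightarrow> integrable lborel (\<lambda>x::real^'n. indicator (cball 0 R) x * norm x powr (- (2 * s)))"
     "\<And>R. 0 < R \<Longrightarrow> (\<integral>(x::real^'n). indicator (cball 0 R) x * norm x powr (- (2 * s)) \<partial>lborel) = C * R powr (?n - 2 * s)"
    using norm_powr_ball[of "2 * s", where 'a="real^'n"] s by auto
  define c where "c = 1 / (2 * pi) ^ CARD('n)"
  have c: "0 < c" unfolding c_def by simp
  \<comment> \<open>The summand \<open>1\<close> only makes the constant positive.\<close>
  define K where "K = sqrt c * sqrt C + 1"
  have "\<bar>low R u x\<bar> \<le> K * R powr ((?n - 2 * s) / 2) * sqrt (hip s u u)"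
    if u: "u \<in> test_functions" and R: "0 < R" for u :: "real^'n \<Rightarrow> real" and R x
  proof -
    let ?U = "fourier (\<lambda>x. complex_of_real (u x))"
    let ?f = "\<lambda>\<xi>::real^'n. indicator (cball 0 R) \<xi> * norm \<xi> powr (- s)"
    let ?g = "\<lambda>\<xi>. norm (freq s u \<xi>)"
    have [measurable]: "freq s u \<in> borel_measurable borel" by (rule freq_measurable[OF u])
    have fm: "?f \<in> borel_measurable lborel"
      by (simp, intro borel_measurable_times borel_measurable_indicator) auto
    have f2: "(norm (?f \<xi>))\<^sup>2 = indicator (cball 0 R) \<xi> * norm \<xi> powr (- (2 * s))" for \<xi>
      by (cases "\<xi> = 0") (auto simp: indicator_def power2_eq_square powr_add[symmetric])
    have cs: "integrable lborel (\<lambda>\<xi>. norm (?f \<xi>) * norm (?g \<xi>))"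
      "(\<integral>\<xi>. norm (?f \<xi>) * norm (?g \<xi>) \<partial>lborel) \<le> sqrt (\<integral>\<xi>. (norm (?f \<xi>))\<^sup>2 \<partial>lborel) * sqrt (\<integral>\<xi>. (norm (?g \<xi>))\<^sup>2 \<partial>lborel)"
    proof -
      have "integrable lborel (\<lambda>\<xi>. (norm (?f \<xi>))\<^sup>2)" unfolding f2 by (rule C(2)[OF R])
      moreover have "integrable lborel (\<lambda>\<xi>. (norm (?g \<xi>))\<^sup>2)"
        using freq_square_integrable[of s u] s u by simp
      ultimately show "integrable lborel (\<lambda>\<xi>. norm (?f \<xi>) * norm (?g \<xi>))"
        "(\<integral>\<xi>. norm (?f \<xi>) * norm (?g \<xi>) \<partial>lborel) \<le> sqrt (\<integral>\<xi>. (norm (?f \<xi>))\<^sup>2 \<partial>lborel) * sqrt (\<integral>\<xi>. (norm (?g \<xi>))\<^sup>2 \<partial>lborel)"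
        using square_integrable_mult[OF fm, of ?g] by auto
    qed
    have nz: "AE \<xi>::real^'n in lborel. \<xi> \<noteq> 0" by (rule AE_lborel_singleton)
    have "\<bar>low R u x\<bar> \<le> c * norm (\<integral>\<xi>. exp (\<i> * of_real (x \<bullet> \<xi>)) * (indicator (cball 0 R) \<xi> *\<^sub>R ?U \<xi>) \<partial>lborel)"
      unfolding low_def c_def[symmetric]
      by (rule order_trans[OF abs_Re_le_cmod]) (use c in \<open>simp add: norm_mult\<close>)
    also have "norm (\<integral>\<xi>. exp (\<i> * of_real (x \<bullet> \<xi>)) * (indicator (cball 0 R) \<xi> *\<^sub>R ?U \<xi>) \<partial>lborel)
        \<le> (\<integral>\<xi>. norm (?f \<xi>) * norm (?g \<xi>) \<partial>lborel)"
    proof (rule order_trans[OF integral_norm_bound integral_mono_AE])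
      show "integrable lborel (\<lambda>\<xi>. norm (exp (\<i> * of_real (x \<bullet> \<xi>)) * (indicator (cball 0 R) \<xi> *\<^sub>R ?U \<xi>)))"
        by (rule integrable_norm[OF indicator_fourier_integrable(3)[OF u]]) simp
      show "AE \<xi> in lborel. norm (exp (\<i> * of_real (x \<bullet> \<xi>)) * (indicator (cball 0 R) \<xi> *\<^sub>R ?U \<xi>)) \<le> norm (?f \<xi>) * norm (?g \<xi>)"
        using nz
      proof eventually_elim
        case (elim \<xi>)
        have one: "norm \<xi> powr (- s) * norm \<xi> powr s = 1" using elim by (simp add: powr_add[symmetric])
        have e: "norm \<xi> powr (- s) * (norm \<xi> powr s * norm (?U \<xi>)) = norm (?U \<xi>)"
          unfolding mult.assoc[symmetric] one by simp
        show ?case by (auto simp: freq_def norm_mult indicator_def e)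
      qed
    qed (rule cs(1))
    also have "\<dots> \<le> sqrt (C * R powr (?n - 2 * s)) * sqrt (hip s u u / c)"
      using cs(2) c unfolding f2 C(3)[OF R] hip_self c_def[symmetric] by simp
    also have "c * (sqrt (C * R powr (?n - 2 * s)) * sqrt (hip s u u / c))
        = (sqrt c * sqrt C) * R powr ((?n - 2 * s) / 2) * sqrt (hip s u u)"
    proof -
      have "sqrt (R powr (?n - 2 * s)) = R powr ((?n - 2 * s) / 2)"
        using R by (simp add: powr_half_sqrt[symmetric] powr_powr)
      moreover have "c / sqrt c = sqrt c" using c by (simp add: real_div_sqrt)
      moreover have "c * sqrt (hip s u u / c) = c / sqrt c * sqrt (hip s u u)" by (simp add: real_sqrt_divide)
      ultimately show ?thesis by (simp add: real_sqrt_mult mult_ac)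
    qed
    also have "\<dots> \<le> K * R powr ((?n - 2 * s) / 2) * sqrt (hip s u u)"
    proof -
      have "0 \<le> hip s u u" unfolding hip_self by (intro mult_nonneg_nonneg integral_nonneg_AE) auto
      then show ?thesis unfolding K_def by (intro mult_right_mono) auto
    qed
    finally show ?thesis using c by (simp add: mult_left_mono)
  qed
  moreover have "0 < K" unfolding K_def using c C by (simp add: add_nonneg_pos)
  ultimately show ?thesis by (intro exI[of _ K] conjI ballI allI impI)
qed

section \<open>The Sobolev inequality\<close>

lemma ennreal_mult3:
  "0 \<le> x \<Longrightarrow> 0 \<le> y \<Longrightarrow> 0 \<le> z \<Longrightarrow> ennreal x * (ennreal y * ennreal z) = ennreal (x * y * z)"
  by (simp add: ennreal_mult mult.assoc)

lemma nn_integral_powr_interval: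
  assumes "- 1 < q" "0 \<le> a"
  shows "(\<integral>\<^sup>+t. indicator {0..a} t * ennreal (t powr q) \<partial>lborel) = ennreal (a powr (q + 1) / (q + 1))"
proof -
  have "((\<lambda>t. t powr q) has_integral (a powr (q + 1) / (q + 1))) {0..a}"
    by (rule has_integral_powr_from_0[OF assms])
  then have "((\<lambda>t. if t \<in> {0..a} then t powr q else 0) has_integral (a powr (q + 1) / (q + 1))) UNIV"
    by (simp only: has_integral_restrict_UNIV)
  then have "(\<integral>\<^sup>+t. ennreal (if t \<in> {0..a} then t powr q else 0) \<partial>lborel) = ennreal (a powr (q + 1) / (q + 1))"
    by (intro nn_integral_has_integral_lborel) auto
  moreover have "(\<integral>\<^sup>+t. indicator {0..a} t * ennreal (t powr q) \<partial>lborel)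
      = (\<integral>\<^sup>+t. ennreal (if t \<in> {0..a} then t powr q else 0) \<partial>lborel)"
    by (intro nn_integral_cong) (simp add: indicator_def)
  ultimately show ?thesis by simp
qed

text \<open>The proof of Chemin and Xu. The measure of the set where \<open>|u| \<ge> t\<close> only sees the frequencies above a
  threshold \<open>R(t)\<close>, because those below contribute at most \<open>t/2\<close> everywhere. Integrating over \<open>t\<close> against \<open>t\<^sup>p\<^sup>-\<^sup>1\<close>
  and exchanging the order of integration leaves, at each frequency \<open>\<xi>\<close>, an integral over the levels \<open>t \<le> \<Lambda>(\<xi>)\<close> for which
  \<open>\<xi>\<close> is above the threshold, and the value of \<open>p\<close> is the one for which this gives the weight \<open>|\<xi>|\<^sup>2\<^sup>s\<close>.\<close>

theorem sobolev_inequality: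
  fixes s :: real
  assumes s: "0 < s" "s \<le> 1" "2 * s < CARD('n)"
  defines "p \<equiv> 2 * real CARD('n) / (real CARD('n) - 2 * s)"
  shows "\<exists>C\<ge>0. \<forall>u\<in>(test_functions :: (real^'n::finite \<Rightarrow> real) set).
    (\<integral>\<^sup>+x. ennreal (\<bar>u x\<bar> powr p) \<partial>lborel) \<le> ennreal (C * hip s u u powr (p / 2))"
proof -
  define n where "n = real CARD('n)"
  define a where "a = (n - 2 * s) / 2"
  have a: "0 < a" unfolding a_def n_def using s by simp
  have p2: "p - 2 = 2 * s / a" and p: "2 < p"
  proof -
    have "n - 2 * s \<noteq> 0" using a unfolding a_def by simp
    then show "p - 2 = 2 * s / a" unfolding p_def a_def n_def[symmetric] by (simp add: field_simps)
    moreover have "0 < 2 * s / a" using s a by simp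
    ultimately show "2 < p" by simp
  qed
  obtain K where KL: "0 < K \<and> (\<forall>u\<in>(test_functions :: (real^'n \<Rightarrow> real) set). \<forall>R>0. \<forall>x.
     \<bar>low R u x\<bar> \<le> K * R powr ((CARD('n) - 2 * s) / 2) * sqrt (hip s u u))"
    using low_bound[where 'n='n, OF s] ..
  then have K: "0 < K" by (rule conjunct1)
  have low: "\<bar>low R u x\<bar> \<le> K * R powr a * sqrt (hip s u u)"
    if "u \<in> test_functions" "0 < R" for u :: "real^'n \<Rightarrow> real" and R x
    unfolding a_def n_def by (rule conjunct2[OF KL, rule_format, OF that])
  define c where "c = 1 / (2 * pi) ^ CARD('n)"
  have c: "0 < c" unfolding c_def by simp
  define C where "C = p * 4 / (p - 2) * (2 * K) powr (p - 2)"
  have "(\<integral>\<^sup>+x. ennreal (\<bar>u x\<bar> powr p) \<partial>lborel) \<le> ennreal (C * hip s u u powr (p / 2))"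
    if u: "u \<in> test_functions" for u :: "real^'n \<Rightarrow> real"
  proof (cases "hip s u u = 0")
    case True
    then have z: "u x = u x - low R u x" if "0 < R" for R x using low[OF u that, of x] by simp
    have "(\<integral>x. (u x)\<^sup>2 \<partial>lborel) \<le> 0"
      using high_bound_hip[of s u 1] s u z[of 1] True by simp
    moreover have "0 \<le> (\<integral>x. (u x)\<^sup>2 \<partial>lborel)" by (intro integral_nonneg_AE) auto
    moreover have "integrable lborel (\<lambda>x. (u x)\<^sup>2)" using high_bound(1)[OF u, of 1] z[of 1] by simp
    ultimately have "AE x in lborel. (u x)\<^sup>2 = 0"
      by (subst integral_nonneg_eq_0_iff_AE[symmetric]) auto
    then have "(\<integral>\<^sup>+x. ennreal (\<bar>u x\<bar> powr p) \<partial>lborel) = (\<integral>\<^sup>+(x::real^'n). 0 \<partial>lborel)"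
      by (intro nn_integral_cong_AE) (auto elim!: eventually_mono)
    then show ?thesis by simp
  next
    case False
    let ?U = "fourier (\<lambda>x. complex_of_real (u x))"
    note [measurable] = test_measurable[OF u] schwartz_measurable[OF schwartz_ft[OF u]] low_measurable[OF u]
    have E: "0 < hip s u u"
      using False semi_inner.ip_pos[OF semi_inner_hip u, of s] s by simp
    \<comment> \<open>\<open>\<Lambda>(\<xi>) = B |\<xi>|\<^sup>a\<close> inverts the threshold: \<open>R(t)\<close> is the radius with \<open>\<Lambda> = t\<close>, and \<open>B\<close> is chosen to make
      \<open>low_bound\<close> read \<open>t/2\<close> at that radius.\<close>
    define B where "B = 2 * K * sqrt (hip s u u)"
    have B: "0 < B" unfolding B_def using K E by simp
    define \<Lambda> where "\<Lambda> \<xi> = B * norm \<xi> powr a" for \<xi> :: "real^'n"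
    have \<Lambda>0: "0 \<le> \<Lambda> \<xi>" for \<xi> unfolding \<Lambda>_def using B by simp
    have [measurable]: "\<Lambda> \<in> borel_measurable borel" unfolding \<Lambda>_def by measurable
    have m1 [measurable]: "(\<lambda>(x, t). indicator {0..\<bar>u x\<bar>} t :: ennreal) \<in> borel_measurable (lborel \<Otimes>\<^sub>M lborel)"
      unfolding indicator_def atLeastAtMost_iff by measurable
    have m2 [measurable]: "(\<lambda>(\<xi>, t). indicator {0..\<Lambda> \<xi>} t :: ennreal) \<in> borel_measurable (lborel \<Otimes>\<^sub>M lborel)"
      unfolding indicator_def atLeastAtMost_iff by measurable
    \<comment> \<open>Chebyshev's inequality for the high part at level \<open>t/2\<close>, multiplied by \<open>t\<^sup>p\<^sup>-\<^sup>1\<close>.\<close>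
    have level: "ennreal (t powr (p - 1)) * (\<integral>\<^sup>+x. indicator {0..\<bar>u x\<bar>} t \<partial>lborel)
        \<le> (\<integral>\<^sup>+\<xi>. indicator {0..\<Lambda> \<xi>} t * ennreal (4 * c * t powr (p - 3) * (norm (?U \<xi>))\<^sup>2) \<partial>lborel)" for t
    proof (cases "0 < t")
      case False
      then show ?thesis
      proof (cases "t = 0")
        case False
        with \<open>\<not> 0 < t\<close> show ?thesis by (simp add: indicator_def)
      qed simp
    next
      case t: True
      define R where "R = (t / B) powr (1 / a)"
      have R: "0 < R" unfolding R_def using t B by simp
      have Ra: "R powr a = t / B" unfolding R_def using a t B by (simp add: powr_powr)
      have lowR: "\<bar>low R u x\<bar> \<le> t / 2" for x
        using low[OF u R, of x] K E unfolding Ra B_def by (simp add: field_simps)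
      have ind: "indicator {0..\<bar>u x\<bar>} t \<le> ennreal (4 / t\<^sup>2 * (u x - low R u x)\<^sup>2)" for x
      proof (cases "t \<le> \<bar>u x\<bar>")
        case True
        then have "t / 2 \<le> \<bar>u x - low R u x\<bar>" using lowR[of x] by linarith
        then have "(t / 2)\<^sup>2 \<le> \<bar>u x - low R u x\<bar>\<^sup>2" using t by (intro power_mono) auto
        then have "1 \<le> 4 / t\<^sup>2 * (u x - low R u x)\<^sup>2" using t by (simp add: field_simps power2_eq_square)
        then show ?thesis using t True by (simp add: indicator_def)
      qed (simp add: indicator_def)
      have hR: "t \<le> \<Lambda> \<xi>" if "\<xi> \<notin> cball 0 R" for \<xi>
      proof -
        have "R powr a \<le> norm \<xi> powr a" using that R a by (intro powr_mono2) auto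
        then show ?thesis unfolding Ra \<Lambda>_def using B by (simp add: field_simps)
      qed
      have "(\<integral>\<^sup>+x. indicator {0..\<bar>u x\<bar>} t \<partial>lborel) \<le> (\<integral>\<^sup>+x. ennreal (4 / t\<^sup>2 * (u x - low R u x)\<^sup>2) \<partial>lborel)"
        by (intro nn_integral_mono ind)
      also have "\<dots> = ennreal (\<integral>x. 4 / t\<^sup>2 * (u x - low R u x)\<^sup>2 \<partial>lborel)"
        by (intro nn_integral_eq_integral integrable_mult_right high_bound(1)[OF u]) auto
      also have "\<dots> \<le> ennreal (4 / t\<^sup>2 * (c * (\<integral>\<xi>. (norm (indicator (- cball 0 R) \<xi> *\<^sub>R ?U \<xi>))\<^sup>2 \<partial>lborel)))"
        unfolding integral_mult_right_zero c_def by (intro ennreal_leI mult_left_mono high_bound(2)[OF u]) simp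
      also have "\<dots> = ennreal (4 / t\<^sup>2 * c) * ennreal (\<integral>\<xi>. (norm (indicator (- cball 0 R) \<xi> *\<^sub>R ?U \<xi>))\<^sup>2 \<partial>lborel)"
        using c by (simp add: ennreal_mult'[symmetric] mult.assoc)
      also have "ennreal (\<integral>\<xi>. (norm (indicator (- cball 0 R) \<xi> *\<^sub>R ?U \<xi>))\<^sup>2 \<partial>lborel)
          = (\<integral>\<^sup>+\<xi>. ennreal ((norm (indicator (- cball 0 R) \<xi> *\<^sub>R ?U \<xi>))\<^sup>2) \<partial>lborel)"
        by (rule nn_integral_eq_integral[OF indicator_fourier_integrable(2)[OF u], symmetric]) auto
      finally have "ennreal (t powr (p - 1)) * (\<integral>\<^sup>+x. indicator {0..\<bar>u x\<bar>} t \<partial>lborel)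
          \<le> ennreal (t powr (p - 1)) * (ennreal (4 / t\<^sup>2 * c) * (\<integral>\<^sup>+\<xi>. ennreal ((norm (indicator (- cball 0 R) \<xi> *\<^sub>R ?U \<xi>))\<^sup>2) \<partial>lborel))"
        by (intro mult_left_mono) auto
      also have "\<dots> = (\<integral>\<^sup>+\<xi>. ennreal (t powr (p - 1)) * (ennreal (4 / t\<^sup>2 * c) * ennreal ((norm (indicator (- cball 0 R) \<xi> *\<^sub>R ?U \<xi>))\<^sup>2)) \<partial>lborel)"
      proof -
        have "(\<lambda>\<xi>. ennreal ((norm (indicator (- cball 0 R) \<xi> *\<^sub>R ?U \<xi>))\<^sup>2)) \<in> borel_measurable lborel"
          using borel_measurable_integrable[OF indicator_fourier_integrable(2)[OF u, of "- cball 0 R"]] by simp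
        then show ?thesis by (simp add: nn_integral_cmult)
      qed
      also have "\<dots> \<le> (\<integral>\<^sup>+\<xi>. indicator {0..\<Lambda> \<xi>} t * ennreal (4 * c * t powr (p - 3) * (norm (?U \<xi>))\<^sup>2) \<partial>lborel)"
      proof (rule nn_integral_mono)
        fix \<xi> :: "real^'n"
        have e: "t powr (p - 1) * (4 / t\<^sup>2 * c) = 4 * c * t powr (p - 3)"
        proof -
          have "t powr (p - 1) = t powr (p - 3) * t\<^sup>2"
            using t powr_add[of t "p - 3" 2] by simp
          then show ?thesis using t by simp
        qed
        show "ennreal (t powr (p - 1)) * (ennreal (4 / t\<^sup>2 * c) * ennreal ((norm (indicator (- cball 0 R) \<xi> *\<^sub>R ?U \<xi>))\<^sup>2))
            \<le> indicator {0..\<Lambda> \<xi>} t * ennreal (4 * c * t powr (p - 3) * (norm (?U \<xi>))\<^sup>2)"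
        proof (cases "\<xi> \<in> cball 0 R")
          case False
          have "ennreal (t powr (p - 1)) * (ennreal (4 / t\<^sup>2 * c) * ennreal ((norm (?U \<xi>))\<^sup>2))
              = ennreal (t powr (p - 1) * (4 / t\<^sup>2 * c) * (norm (?U \<xi>))\<^sup>2)"
            by (rule ennreal_mult3) (use c in auto)
          then show ?thesis using False hR[OF False] t unfolding e by simp
        qed simp
      qed
      finally show ?thesis .
    qed
    \<comment> \<open>The layer cake formula \<open>|u|\<^sup>p = p \<integral> t\<^sup>p\<^sup>-\<^sup>1 dt\<close> over \<open>0 \<le> t \<le> |u|\<close>.\<close>
    have "(\<integral>\<^sup>+x. ennreal (\<bar>u x\<bar> powr p) \<partial>lborel)
        = (\<integral>\<^sup>+x. ennreal p * (\<integral>\<^sup>+t. indicator {0..\<bar>u x\<bar>} t * ennreal (t powr (p - 1)) \<partial>lborel) \<partial>lborel)"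
      using p by (simp add: nn_integral_powr_interval ennreal_mult'[symmetric])
    also have "\<dots> = ennreal p * (\<integral>\<^sup>+x. (\<integral>\<^sup>+t. indicator {0..\<bar>u x\<bar>} t * ennreal (t powr (p - 1)) \<partial>lborel) \<partial>lborel)"
      by (rule nn_integral_cmult) measurable
    also have "(\<integral>\<^sup>+x. (\<integral>\<^sup>+t. indicator {0..\<bar>u x\<bar>} t * ennreal (t powr (p - 1)) \<partial>lborel) \<partial>lborel)
        = (\<integral>\<^sup>+t. (\<integral>\<^sup>+x. indicator {0..\<bar>u x\<bar>} t * ennreal (t powr (p - 1)) \<partial>lborel) \<partial>lborel)"
      by (rule lborel_pair.Fubini'[symmetric]) measurable
    also have "\<dots> = (\<integral>\<^sup>+t. ennreal (t powr (p - 1)) * (\<integral>\<^sup>+x. indicator {0..\<bar>u x\<bar>} t \<partial>lborel) \<partial>lborel)"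
    proof (rule nn_integral_cong)
      fix t :: real
      have "(\<lambda>x. indicator {0..\<bar>u x\<bar>} t :: ennreal) \<in> borel_measurable lborel"
        unfolding indicator_def atLeastAtMost_iff by measurable
      from nn_integral_multc[OF this]
      show "(\<integral>\<^sup>+x. indicator {0..\<bar>u x\<bar>} t * ennreal (t powr (p - 1)) \<partial>lborel)
          = ennreal (t powr (p - 1)) * (\<integral>\<^sup>+x. indicator {0..\<bar>u x\<bar>} t \<partial>lborel)"
        by (simp only: mult.commute[of "ennreal _"])
    qed
    also have "\<dots> \<le> (\<integral>\<^sup>+t. (\<integral>\<^sup>+\<xi>. indicator {0..\<Lambda> \<xi>} t * ennreal (4 * c * t powr (p - 3) * (norm (?U \<xi>))\<^sup>2) \<partial>lborel) \<partial>lborel)"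
      by (intro nn_integral_mono level)
    also have "\<dots> = (\<integral>\<^sup>+\<xi>. (\<integral>\<^sup>+t. indicator {0..\<Lambda> \<xi>} t * ennreal (4 * c * t powr (p - 3) * (norm (?U \<xi>))\<^sup>2) \<partial>lborel) \<partial>lborel)"
      by (rule lborel_pair.Fubini') measurable
    also have "\<dots> = (\<integral>\<^sup>+\<xi>. ennreal (4 * c / (p - 2) * B powr (p - 2) * (norm (freq s u \<xi>))\<^sup>2) \<partial>lborel)"
    proof (rule nn_integral_cong)
      fix \<xi> :: "real^'n"
      have "(\<integral>\<^sup>+t. indicator {0..\<Lambda> \<xi>} t * ennreal (4 * c * t powr (p - 3) * (norm (?U \<xi>))\<^sup>2) \<partial>lborel)
          = (\<integral>\<^sup>+t. ennreal (4 * c * (norm (?U \<xi>))\<^sup>2) * (indicator {0..\<Lambda> \<xi>} t * ennreal (t powr (p - 3))) \<partial>lborel)"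
        using c by (intro nn_integral_cong) (simp add: ennreal_mult' mult_ac)
      also have "\<dots> = ennreal (4 * c * (norm (?U \<xi>))\<^sup>2) * ennreal (\<Lambda> \<xi> powr (p - 3 + 1) / (p - 3 + 1))"
        using p by (subst nn_integral_cmult) (auto simp: nn_integral_powr_interval \<Lambda>0)
      also have "\<dots> = ennreal (4 * c * (norm (?U \<xi>))\<^sup>2 * (\<Lambda> \<xi> powr (p - 2) / (p - 2)))"
      proof -
        have "p - 3 + 1 = p - 2" by simp
        then show ?thesis using c p by (simp only:) (rule ennreal_mult[symmetric], auto)
      qed
      also have "\<Lambda> \<xi> powr (p - 2) = B powr (p - 2) * (norm \<xi> powr s)\<^sup>2"
      proof -
        have "\<Lambda> \<xi> powr (p - 2) = B powr (p - 2) * (norm \<xi> powr a) powr (p - 2)"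
          unfolding \<Lambda>_def using B by (simp add: powr_mult)
        also have "(norm \<xi> powr a) powr (p - 2) = norm \<xi> powr (2 * s)"
          unfolding powr_powr p2 using a by simp
        also have "\<dots> = (norm \<xi> powr s)\<^sup>2" by (simp add: power2_eq_square powr_add[symmetric])
        finally show ?thesis .
      qed
      also have "4 * c * (norm (?U \<xi>))\<^sup>2 * (B powr (p - 2) * (norm \<xi> powr s)\<^sup>2 / (p - 2))
          = 4 * c / (p - 2) * B powr (p - 2) * (norm (freq s u \<xi>))\<^sup>2"
        by (simp add: freq_def norm_mult power_mult_distrib)
      finally show "(\<integral>\<^sup>+t. indicator {0..\<Lambda> \<xi>} t * ennreal (4 * c * t powr (p - 3) * (norm (?U \<xi>))\<^sup>2) \<partial>lborel)
          = ennreal (4 * c / (p - 2) * B powr (p - 2) * (norm (freq s u \<xi>))\<^sup>2)" .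
    qed
    also have "\<dots> = ennreal (\<integral>\<xi>. 4 * c / (p - 2) * B powr (p - 2) * (norm (freq s u \<xi>))\<^sup>2 \<partial>lborel)"
      using p c s u
      by (intro nn_integral_eq_integral integrable_mult_right freq_square_integrable AE_I2 mult_nonneg_nonneg) auto
    also have "(\<integral>\<xi>. 4 * c / (p - 2) * B powr (p - 2) * (norm (freq s u \<xi>))\<^sup>2 \<partial>lborel)
        = 4 / (p - 2) * B powr (p - 2) * hip s u u"
      unfolding integral_mult_right_zero hip_self c_def[symmetric] by simp
    also have "ennreal p * ennreal (4 / (p - 2) * B powr (p - 2) * hip s u u)
        = ennreal (p * 4 / (p - 2) * B powr (p - 2) * hip s u u)"
      using p by (subst ennreal_mult'[symmetric]) (auto simp: mult_ac)
    also have "p * 4 / (p - 2) * B powr (p - 2) * hip s u u = C * hip s u u powr (p / 2)"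
    proof -
      have "B powr (p - 2) = (2 * K) powr (p - 2) * sqrt (hip s u u) powr (p - 2)"
        unfolding B_def using K E by (simp add: powr_mult)
      also have "sqrt (hip s u u) powr (p - 2) = hip s u u powr ((p - 2) / 2)"
        using E by (simp add: powr_half_sqrt[symmetric] powr_powr)
      finally have b: "B powr (p - 2) = (2 * K) powr (p - 2) * hip s u u powr ((p - 2) / 2)" .
      have "hip s u u powr ((p - 2) / 2) * hip s u u = hip s u u powr ((p - 2) / 2 + 1)"
        using E by (simp add: powr_add)
      also have "(p - 2) / 2 + 1 = p / 2" by (simp add: field_simps)
      finally have d: "hip s u u powr ((p - 2) / 2) * hip s u u = hip s u u powr (p / 2)" .
      show ?thesis unfolding b C_def d[symmetric] by (simp add: mult.assoc)
    qed
    finally show ?thesis by (simp add: mult_left_mono)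
  qed
  moreover have "0 \<le> C" unfolding C_def using p by simp
  ultimately show ?thesis by (intro exI[of _ C] conjI ballI)
qed

section \<open>Local compactness\<close>

lemma hip_diff_le:
  fixes u v :: "real^'n::finite \<Rightarrow> real"
  assumes s: "0 \<le> s" "s \<le> 1" and u: "u \<in> test_functions" and v: "v \<in> test_functions"
  shows "hip s (\<lambda>x. u x - v x) (\<lambda>x. u x - v x) \<le> 2 * hip s u u + 2 * hip s v v"
proof -
  interpret semi_inner "test_functions :: (real^'n \<Rightarrow> real) set" "hip s" by (rule semi_inner_hip[OF s])
  have "0 \<le> hip s (\<lambda>x. 1 * u x + 1 * v x) (\<lambda>x. 1 * u x + 1 * v x)"
    by (rule ip_pos[OF lincomb[OF u v]])
  then show ?thesis unfolding ip_expand[OF u v] ip_diff_expand[OF u v] by simp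
qed

text \<open>The high frequencies of a bounded sequence are uniformly small in \<open>L\<^sup>2\<close>. Its low frequencies converge
  pointwise, because their value at a point is a bounded functional, and they are uniformly bounded; so they converge in \<open>L\<^sup>2\<close> on balls by
  dominated convergence. The conclusion is stated as a Cauchy condition, as no limit function is at hand yet.\<close>

theorem rellich:
  fixes \<theta> :: "nat \<Rightarrow> real^'n::finite \<Rightarrow> real" and s :: real
  assumes s: "0 < s" "s \<le> 1" "2 * s < CARD('n)" and \<theta>: "\<And>N. \<theta> N \<in> test_functions"
    and bdd: "\<And>N. hip s (\<theta> N) (\<theta> N) \<le> M"
    and weak: "\<And>l C. (\<And>u v a b. u \<in> test_functions \<Longrightarrow> v \<in> test_functions \<Longrightarrow>
        l (\<lambda>x. a * u x + b * v x) = a * l u + b * l v) \<Longrightarrow>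
      (\<And>u. u \<in> test_functions \<Longrightarrow> \<bar>l u\<bar> \<le> C * sqrt (hip s u u)) \<Longrightarrow> convergent (\<lambda>N. l (\<theta> N))"
    and e: "0 < e"
  shows "\<exists>N0. \<forall>m\<ge>N0. \<forall>k\<ge>N0. (\<integral>x. indicator (cball 0 \<rho>) x * (\<theta> m x - \<theta> k x)\<^sup>2 \<partial>lborel) < e"
proof -
  have M0: "0 \<le> M"
    using bdd[of 0] semi_inner.ip_pos[OF semi_inner_hip \<theta>, of s 0] s by simp
  \<comment> \<open>The radius \<open>R\<close> is chosen to make the high frequencies of a difference, of squared norm at most \<open>4M\<close>,
    contribute at most \<open>e/2\<close> after doubling; the low ones contribute at most \<open>e/4\<close> for each of the two indices.\<close>
  define X where "X = 16 * M / e + 1"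
  have X: "1 \<le> X" "16 * M / e \<le> X" unfolding X_def using M0 e by auto
  define R where "R = X powr (1 / (2 * s))"
  have R: "0 < R" unfolding R_def using X by simp
  have RX: "R powr (- 2 * s) = 1 / X"
    unfolding R_def using X s by (simp add: powr_powr powr_minus_divide)
  have XM: "8 * M / X \<le> e / 2"
  proof -
    have "16 * M \<le> X * e" using X(2) e by (simp add: pos_divide_le_eq)
    then show ?thesis using X(1) by (simp add: pos_divide_le_eq mult.commute)
  qed
  obtain K where KL: "0 < K \<and> (\<forall>u\<in>(test_functions :: (real^'n \<Rightarrow> real) set). \<forall>R>0. \<forall>x.
     \<bar>low R u x\<bar> \<le> K * R powr ((CARD('n) - 2 * s) / 2) * sqrt (hip s u u))"
    using low_bound[where 'n='n, OF s] ..
  define B where "B = K * R powr ((CARD('n) - 2 * s) / 2)"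
  have B0: "0 \<le> B" unfolding B_def using KL by simp
  have lb: "\<bar>low R u x\<bar> \<le> B * sqrt (hip s u u)" if "u \<in> test_functions" for u :: "real^'n \<Rightarrow> real" and x
    unfolding B_def by (rule conjunct2[OF KL, rule_format, OF that R])
  have conv: "convergent (\<lambda>N. low R (\<theta> N) x)" for x
    by (rule weak[OF low_lincomb lb])
  define L where "L x = lim (\<lambda>N. low R (\<theta> N) x)" for x
  have L: "(\<lambda>N. low R (\<theta> N) x) \<longlonglongrightarrow> L x" for x
    using conv[of x] unfolding L_def by (simp add: convergent_LIMSEQ_iff)
  note [measurable] = low_measurable[OF \<theta>] test_measurable[OF \<theta>]
  have [measurable]: "L \<in> borel_measurable borel" unfolding L_def by measurable
  have [measurable]: "(\<lambda>x::real^'n. indicator (cball 0 \<rho>) x :: real) \<in> borel_measurable borel"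
    by (intro borel_measurable_indicator) simp
  let ?B = "B * sqrt M"
  have lN: "\<bar>low R (\<theta> N) x\<bar> \<le> ?B" for N x
  proof -
    have "B * sqrt (hip s (\<theta> N) (\<theta> N)) \<le> B * sqrt M" using bdd[of N] B0 by (intro mult_left_mono) auto
    then show ?thesis using lb[OF \<theta>, of N x] by linarith
  qed
  have LB: "\<bar>L x\<bar> \<le> ?B" for x
    by (rule LIMSEQ_le_const2[OF tendsto_rabs[OF L]]) (use lN in blast)
  let ?I = "indicator (cball 0 \<rho>) :: real^'n \<Rightarrow> real"
  have iI: "integrable lborel ?I"
    using emeasure_lborel_cball_finite[of "0::real^'n" \<rho>] by (simp add: integrable_indicator_iff)
  have dB: "(low R (\<theta> N) x - L x)\<^sup>2 \<le> (2 * ?B)\<^sup>2" for N x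
  proof -
    have "\<bar>low R (\<theta> N) x - L x\<bar> \<le> 2 * ?B" using lN[of N x] LB[of x] by linarith
    then have "\<bar>low R (\<theta> N) x - L x\<bar>\<^sup>2 \<le> (2 * ?B)\<^sup>2" by (intro power_mono) auto
    then show ?thesis by simp
  qed
  have iL: "integrable lborel (\<lambda>x. ?I x * (low R (\<theta> N) x - L x)\<^sup>2)" for N
  proof (rule Bochner_Integration.integrable_bound[OF integrable_mult_right[OF iI, of "(2 * ?B)\<^sup>2"]])
    show "AE x in lborel. norm (?I x * (low R (\<theta> N) x - L x)\<^sup>2) \<le> norm ((2 * ?B)\<^sup>2 * ?I x)"
      using dB[of N] by (intro AE_I2) (simp add: indicator_def)
  qed measurable
  have "(\<lambda>N. \<integral>x. ?I x * (low R (\<theta> N) x - L x)\<^sup>2 \<partial>lborel) \<longlonglongrightarrow> (\<integral>(x::real^'n). 0 \<partial>lborel)"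
  proof (rule integral_dominated_convergence[where w="\<lambda>x. (2 * ?B)\<^sup>2 * ?I x"])
    show "AE x in lborel. (\<lambda>N. ?I x * (low R (\<theta> N) x - L x)\<^sup>2) \<longlonglongrightarrow> 0"
    proof (intro AE_I2)
      fix x
      have "(\<lambda>N. ?I x * (low R (\<theta> N) x - L x)\<^sup>2) \<longlonglongrightarrow> ?I x * (L x - L x)\<^sup>2"
        by (intro tendsto_mult tendsto_power tendsto_diff tendsto_const L)
      then show "(\<lambda>N. ?I x * (low R (\<theta> N) x - L x)\<^sup>2) \<longlonglongrightarrow> 0" by simp
    qed
    show "AE x in lborel. norm (?I x * (low R (\<theta> N) x - L x)\<^sup>2) \<le> (2 * ?B)\<^sup>2 * ?I x" for N
      using dB[of N] by (intro AE_I2) (simp add: indicator_def)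
    show "integrable lborel (\<lambda>x. (2 * ?B)\<^sup>2 * ?I x)" by (rule integrable_mult_right[OF iI])
    show "(\<lambda>x. ?I x * (low R (\<theta> N) x - L x)\<^sup>2) \<in> borel_measurable lborel" for N by measurable
  qed simp
  then have "(\<lambda>N. \<integral>x. ?I x * (low R (\<theta> N) x - L x)\<^sup>2 \<partial>lborel) \<longlonglongrightarrow> 0" by simp
  then have "\<forall>\<^sub>F N in sequentially. (\<integral>x. ?I x * (low R (\<theta> N) x - L x)\<^sup>2 \<partial>lborel) < e / 16"
    by (rule order_tendstoD) (use e in simp)
  then obtain N0 where N0: "\<And>N. N0 \<le> N \<Longrightarrow> (\<integral>x. ?I x * (low R (\<theta> N) x - L x)\<^sup>2 \<partial>lborel) < e / 16"
    unfolding eventually_sequentially by blast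
  have "(\<integral>x. ?I x * (\<theta> m x - \<theta> k x)\<^sup>2 \<partial>lborel) < e" if mk: "N0 \<le> m" "N0 \<le> k" for m k
  proof -
    let ?w = "\<lambda>x. \<theta> m x - \<theta> k x"
    have w: "?w \<in> test_functions" by (rule test_diff[OF \<theta> \<theta>])
    have lw: "low R ?w x = low R (\<theta> m) x - low R (\<theta> k) x" for x
      using low_lincomb[OF \<theta> \<theta>, of R 1 m "-1" k x] by simp
    have w2: "integrable lborel (\<lambda>x. ?I x * (?w x)\<^sup>2)"
    proof -
      have "integrable lborel (\<lambda>x. ?w x * ?w x)" by (rule test_integrable_real[OF test_mult[OF w w]])
      from integrable_real_mult_indicator[OF _ this, of "cball 0 \<rho>"]
      show ?thesis by (simp add: power2_eq_square mult.commute)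
    qed
    have pt: "?I x * (?w x)\<^sup>2 \<le> 4 * (?I x * (low R (\<theta> m) x - L x)\<^sup>2) + 4 * (?I x * (low R (\<theta> k) x - L x)\<^sup>2)
        + 2 * (?w x - low R ?w x)\<^sup>2" for x
    proof -
      have 1: "(a + b)\<^sup>2 \<le> 2 * a\<^sup>2 + 2 * b\<^sup>2" for a b :: real
        using sum_squares_bound[of a b] by (simp add: power2_sum)
      have "(?w x)\<^sup>2 \<le> 2 * (low R ?w x)\<^sup>2 + 2 * (?w x - low R ?w x)\<^sup>2"
        using 1[of "low R ?w x" "?w x - low R ?w x"] by simp
      moreover have "(low R ?w x)\<^sup>2 \<le> 2 * (low R (\<theta> m) x - L x)\<^sup>2 + 2 * (low R (\<theta> k) x - L x)\<^sup>2"
        using 1[of "low R (\<theta> m) x - L x" "- (low R (\<theta> k) x - L x)"] unfolding lw by (simp add: power2_commute)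
      ultimately have "(?w x)\<^sup>2 \<le> 4 * (low R (\<theta> m) x - L x)\<^sup>2 + 4 * (low R (\<theta> k) x - L x)\<^sup>2 + 2 * (?w x - low R ?w x)\<^sup>2"
        by linarith
      then show ?thesis by (simp add: indicator_def)
    qed
    have "(\<integral>x. ?I x * (?w x)\<^sup>2 \<partial>lborel) \<le> (\<integral>x. 4 * (?I x * (low R (\<theta> m) x - L x)\<^sup>2) + 4 * (?I x * (low R (\<theta> k) x - L x)\<^sup>2)
        + 2 * (?w x - low R ?w x)\<^sup>2 \<partial>lborel)"
      by (intro integral_mono w2 Bochner_Integration.integrable_add integrable_mult_right iL high_bound(1)[OF w] pt)
    also have "\<dots> = 4 * (\<integral>x. ?I x * (low R (\<theta> m) x - L x)\<^sup>2 \<partial>lborel) + 4 * (\<integral>x. ?I x * (low R (\<theta> k) x - L x)\<^sup>2 \<partial>lborel)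
        + 2 * (\<integral>x. (?w x - low R ?w x)\<^sup>2 \<partial>lborel)"
      using iL high_bound(1)[OF w, of R] by simp
    also have "\<dots> < 4 * (e / 16) + 4 * (e / 16) + 2 * (4 * M / X)"
    proof -
      have "(\<integral>x. (?w x - low R ?w x)\<^sup>2 \<partial>lborel) \<le> 1 / X * hip s ?w ?w"
        using high_bound_hip[OF _ _ w R, of s] s unfolding RX by simp
      also have "\<dots> \<le> 1 / X * (4 * M)"
        using hip_diff_le[OF _ _ \<theta> \<theta>, of s m k] bdd[of m] bdd[of k] s X by (intro mult_left_mono) auto
      finally show ?thesis using N0[OF mk(1)] N0[OF mk(2)] by simp
    qed
    also have "\<dots> \<le> e" using XM by simp
    finally show ?thesis .
  qed
  then show ?thesis by blast
qed

section \<open>A countable dense family of test functions\<close>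

lemma test_uniformly_continuous:
  assumes g: "g \<in> test_functions" and e: "0 < e"
  shows "\<exists>d>0. \<forall>x y. dist x y < d \<longrightarrow> \<bar>g x - g y\<bar> < e"
proof -
  obtain R :: nat where R: "support g \<subseteq> cball 0 (real R)" using test_support_ball[OF g] by blast
  have "uniformly_continuous_on (cball 0 (real R + 1)) g"
    by (intro compact_uniformly_continuous continuous_on_subset[OF test_continuous[OF g]]) auto
  then obtain d where d: "0 < d" "\<And>x y. x \<in> cball 0 (real R + 1) \<Longrightarrow> y \<in> cball 0 (real R + 1) \<Longrightarrow> dist x y < d \<Longrightarrow> dist (g x) (g y) < e"
    unfolding uniformly_continuous_on_def using e by (metis dist_commute)
  have "\<bar>g x - g y\<bar> < e" if xy: "dist x y < min d 1" for x y
  proof (cases "x \<in> cball 0 (real R) \<or> y \<in> cball 0 (real R)")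
    case True
    have "norm x \<le> norm y + dist x y" "norm y \<le> norm x + dist x y"
      using norm_triangle_ineq2[of x y] norm_triangle_ineq2[of y x] by (auto simp: dist_norm norm_minus_commute)
    then have "x \<in> cball 0 (real R + 1)" "y \<in> cball 0 (real R + 1)" using True xy by auto
    then show ?thesis using d(2)[of x y] xy by (simp add: dist_real_def)
  next
    case False
    then have "x \<notin> support g" "y \<notin> support g" using R by auto
    then show ?thesis using e by (simp add: not_in_support)
  qed
  then show ?thesis using d(1) by (intro exI[of _ "min d 1"]) auto
qed

lemma floor_close: "\<lfloor>real (Suc m) * a\<rfloor> = \<lfloor>real (Suc m) * b\<rfloor> \<Longrightarrow> \<bar>a - b\<bar> \<le> 1 / real (Suc m)"
proof -
  assume "\<lfloor>real (Suc m) * a\<rfloor> = \<lfloor>real (Suc m) * b\<rfloor>"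
  then have "\<bar>real (Suc m) * a - real (Suc m) * b\<bar> < 1" by linarith
  then have "\<bar>real (Suc m) * (a - b)\<bar> < 1" by (simp add: right_diff_distrib)
  then have "real (Suc m) * \<bar>a - b\<bar> < 1" by (simp add: abs_mult)
  then show ?thesis by (simp add: field_simps)
qed

text \<open>A test function is determined, up to a small error in the function and its gradient, by finitely
  many integers: its quantised values on a finite net fine enough for its modulus of continuity.\<close>

definition equicontinuous_at_scale ::
  "nat \<Rightarrow> nat \<Rightarrow> nat \<Rightarrow> (real^'n::finite \<Rightarrow> real) \<Rightarrow> bool" where
  "equicontinuous_at_scale R m j \<phi> \<longleftrightarrow> \<phi> \<in> test_functions \<and> support \<phi> \<subseteq> cball 0 (real R) \<and>
     (\<forall>x y. dist x y < 1 / real (Suc j) \<longrightarrow> \<bar>\<phi> x - \<phi> y\<bar> \<le> 1 / real (Suc m) \<and>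
        (\<forall>i. \<bar>partial i \<phi> x - partial i \<phi> y\<bar> \<le> 1 / real (Suc m)))"

definition quantised ::
  "nat \<Rightarrow> 'n list \<Rightarrow> (real^'n) list \<Rightarrow> (real^'n::finite \<Rightarrow> real) \<Rightarrow> int list \<times> int list list" where
  "quantised m is xs \<phi> = (map (\<lambda>y. \<lfloor>real (Suc m) * \<phi> y\<rfloor>) xs,
     map (\<lambda>i. map (\<lambda>y. \<lfloor>real (Suc m) * partial i \<phi> y\<rfloor>) xs) is)"

lemma exists_scale:
  assumes \<phi>: "\<phi> \<in> test_functions" and R: "support \<phi> \<subseteq> cball 0 (real R)"
  shows "\<exists>j. equicontinuous_at_scale R m j \<phi>"
proof -
  have e: "0 < 1 / real (Suc m)" by simp
  obtain d0 where d0: "d0 > 0" "\<And>x y. dist x y < d0 \<Longrightarrow> \<bar>\<phi> x - \<phi> y\<bar> < 1 / real (Suc m)"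
    using test_uniformly_continuous[OF \<phi> e] by blast
  have "\<forall>i. \<exists>d>0. \<forall>x y. dist x y < d \<longrightarrow> \<bar>partial i \<phi> x - partial i \<phi> y\<bar> < 1 / real (Suc m)"
    using test_uniformly_continuous[OF test_partial[OF \<phi>] e] by blast
  then obtain d where d: "\<And>i. 0 < d i"
    "\<And>i x y. dist x y < d i \<Longrightarrow> \<bar>partial i \<phi> x - partial i \<phi> y\<bar> < 1 / real (Suc m)" by metis
  define D where "D = min d0 (Min (range d))"
  have "Min (range d) \<in> range d" by (rule Min_in) auto
  then have D: "0 < D" unfolding D_def using d0(1) d(1) by auto
  have Dd: "D \<le> d i" for i unfolding D_def by (simp add: min.coboundedI2)
  obtain j where j: "1 / real (Suc j) < D" using D nat_approx_posE by blast
  have "equicontinuous_at_scale R m j \<phi>"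
    unfolding equicontinuous_at_scale_def
  proof (intro conjI allI impI \<phi> R)
    fix x y :: "real^'a" assume "dist x y < 1 / real (Suc j)"
    then have xy: "dist x y < D" using j by linarith
    then show "\<bar>\<phi> x - \<phi> y\<bar> \<le> 1 / real (Suc m)" using d0(2)[of x y] unfolding D_def by simp
    fix i show "\<bar>partial i \<phi> x - partial i \<phi> y\<bar> \<le> 1 / real (Suc m)"
      using d(2)[of x y i] xy Dd[of i] by simp
  qed
  then show ?thesis by blast
qed

theorem test_dense_sequence:
  "\<exists>e::nat \<Rightarrow> real^'n::finite \<Rightarrow> real. (\<forall>k. e k \<in> test_functions) \<and>
    (\<forall>\<phi>\<in>test_functions. \<exists>R::nat. \<forall>\<epsilon>>0. \<exists>k. support \<phi> \<subseteq> cball 0 (real R) \<and> support (e k) \<subseteq> cball 0 (real R) \<and>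
      (\<forall>x. \<bar>\<phi> x - e k x\<bar> \<le> \<epsilon>) \<and> (\<forall>i x. \<bar>partial i \<phi> x - partial i (e k) x\<bar> \<le> \<epsilon>))"
proof -
  obtain "is" :: "'n list" where "is": "set is = UNIV" using finite_list[of "UNIV :: 'n set"] by auto
  have "\<exists>xs :: (real^'n) list. cball 0 (real R) \<subseteq> (\<Union>y\<in>set xs. ball y (1 / real (Suc j)))" for R j
  proof -
    have "compact (cball (0::real^'n) (real R))" by simp
    then obtain F :: "(real^'n) set" where F: "finite F" "cball 0 (real R) \<subseteq> (\<Union>y\<in>F. ball y (1 / real (Suc j)))"
      unfolding compact_eq_totally_bounded by (metis of_nat_0_less_iff zero_less_Suc zero_less_divide_1_iff)
    then show ?thesis using finite_list[OF F(1)] by auto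
  qed
  then obtain net :: "nat \<Rightarrow> nat \<Rightarrow> (real^'n) list" where
    net: "\<And>R j. cball 0 (real R) \<subseteq> (\<Union>y\<in>set (net R j). ball y (1 / real (Suc j)))" by metis
  \<comment> \<open>One representative for each code \<open>c\<close> that occurs; all parameters range over a countable type.\<close>
  define pick where "pick = (\<lambda>(R, m, j, c). if \<exists>\<phi> :: real^'n \<Rightarrow> real. equicontinuous_at_scale R m j \<phi> \<and> quantised m is (net R j) \<phi> = c
     then (SOME \<phi>. equicontinuous_at_scale R m j \<phi> \<and> quantised m is (net R j) \<phi> = c) else (\<lambda>x. 0))"
  define e where "e k = pick (from_nat k)" for k
  have pick: "equicontinuous_at_scale R m j (pick (R, m, j, c)) \<and> quantised m is (net R j) (pick (R, m, j, c)) = c"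
    if "\<exists>\<phi> :: real^'n \<Rightarrow> real. equicontinuous_at_scale R m j \<phi> \<and> quantised m is (net R j) \<phi> = c" for R m j c
    using someI_ex[OF that] that unfolding pick_def by simp
  have "pick z \<in> test_functions" for z
  proof -
    obtain R m j c where z: "z = (R, m, j, c)" by (cases z) auto
    show ?thesis
    proof (cases "\<exists>\<phi> :: real^'n \<Rightarrow> real. equicontinuous_at_scale R m j \<phi> \<and> quantised m is (net R j) \<phi> = c")
      case True
      from pick[OF True] show ?thesis unfolding z equicontinuous_at_scale_def by blast
    next
      case False
      then have "pick (R, m, j, c) = (\<lambda>x. 0)" unfolding pick_def prod.case by (rule if_not_P)
      then show ?thesis unfolding z by (simp only: test_zero)
    qed
  qed
  then have eT: "e k \<in> test_functions" for k unfolding e_def by blast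
  have dense: "\<exists>R::nat. \<forall>\<epsilon>>0. \<exists>k. support \<phi> \<subseteq> cball 0 (real R) \<and> support (e k) \<subseteq> cball 0 (real R) \<and>
      (\<forall>x. \<bar>\<phi> x - e k x\<bar> \<le> \<epsilon>) \<and> (\<forall>i x. \<bar>partial i \<phi> x - partial i (e k) x\<bar> \<le> \<epsilon>)"
    if \<phi>: "\<phi> \<in> test_functions" for \<phi> :: "real^'n \<Rightarrow> real"
  proof -
    obtain R :: nat where R: "support \<phi> \<subseteq> cball 0 (real R)" using test_support_ball[OF \<phi>] by blast
    show ?thesis
    proof (rule exI[of _ R], intro allI impI)
      fix \<epsilon> :: real assume \<epsilon>: "0 < \<epsilon>"
      obtain m where m: "1 / real (Suc m) < \<epsilon> / 3" using \<epsilon> nat_approx_posE[of "\<epsilon> / 3"] by auto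
      obtain j where j: "equicontinuous_at_scale R m j \<phi>" using exists_scale[OF \<phi> R] by blast
      let ?c = "quantised m is (net R j) \<phi>"
      define \<psi> where "\<psi> = pick (R, m, j, ?c)"
      have \<psi>: "equicontinuous_at_scale R m j \<psi>" "quantised m is (net R j) \<psi> = ?c"
        using pick[of R m j ?c] j unfolding \<psi>_def by blast+
      have k: "e (to_nat (R, m, j, ?c)) = \<psi>" unfolding e_def \<psi>_def by simp
      have s\<psi>: "support \<psi> \<subseteq> cball 0 (real R)" using \<psi>(1) unfolding equicontinuous_at_scale_def by blast
      have net0: "\<lfloor>real (Suc m) * \<psi> y\<rfloor> = \<lfloor>real (Suc m) * \<phi> y\<rfloor>" if "y \<in> set (net R j)" for y
        using \<psi>(2) that unfolding quantised_def by auto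
      have neti: "\<lfloor>real (Suc m) * partial i \<psi> y\<rfloor> = \<lfloor>real (Suc m) * partial i \<phi> y\<rfloor>" if "y \<in> set (net R j)" for i y
        using \<psi>(2) that "is" unfolding quantised_def by auto
      have close: "\<bar>\<phi> x - \<psi> x\<bar> \<le> \<epsilon> \<and> (\<forall>i. \<bar>partial i \<phi> x - partial i \<psi> x\<bar> \<le> \<epsilon>)" for x
      proof (cases "x \<in> cball 0 (real R)")
        case True
        then obtain y where y: "y \<in> set (net R j)" "dist x y < 1 / real (Suc j)"
          using net[of R j] by (auto simp: dist_commute)
        have a: "\<bar>\<phi> x - \<phi> y\<bar> \<le> 1 / real (Suc m)" "\<bar>partial i \<phi> x - partial i \<phi> y\<bar> \<le> 1 / real (Suc m)"
          "\<bar>\<psi> x - \<psi> y\<bar> \<le> 1 / real (Suc m)" "\<bar>partial i \<psi> x - partial i \<psi> y\<bar> \<le> 1 / real (Suc m)" for i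
          using j \<psi>(1) y(2) unfolding equicontinuous_at_scale_def by blast+
        have b: "\<bar>\<psi> y - \<phi> y\<bar> \<le> 1 / real (Suc m)" "\<bar>partial i \<psi> y - partial i \<phi> y\<bar> \<le> 1 / real (Suc m)" for i
          by (rule floor_close, rule net0[OF y(1)], rule floor_close, rule neti[OF y(1)])
        show ?thesis
        proof (intro conjI allI)
          show "\<bar>\<phi> x - \<psi> x\<bar> \<le> \<epsilon>" using a(1,3) b(1) m by linarith
          show "\<bar>partial i \<phi> x - partial i \<psi> x\<bar> \<le> \<epsilon>" for i using a(2)[of i] a(4)[of i] b(2)[of i] m by linarith
        qed
      next
        case False
        then have x: "x \<notin> support \<phi>" "x \<notin> support \<psi>" using R s\<psi> by auto
        then show ?thesis using \<epsilon> by (simp add: not_in_support partial_zero_outside_support)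
      qed
      show "\<exists>k. support \<phi> \<subseteq> cball 0 (real R) \<and> support (e k) \<subseteq> cball 0 (real R) \<and>
          (\<forall>x. \<bar>\<phi> x - e k x\<bar> \<le> \<epsilon>) \<and> (\<forall>i x. \<bar>partial i \<phi> x - partial i (e k) x\<bar> \<le> \<epsilon>)"
        by (rule exI[of _ "to_nat (R, m, j, ?c)"]) (use R s\<psi> close in \<open>simp add: k\<close>)
    qed
  qed
  show ?thesis using eT dense by (intro exI[of _ e] conjI allI ballI)
qed

section \<open>The force as a bounded functional\<close>

text \<open>With \<open>h\<close> the transform of \<open>f\<close>, the function \<open>k = |\<xi>|\<^sup>-\<^sup>s h\<close> agrees with the transform of the square integrable
  function representing the fractional derivative of order \<open>-s\<close> of \<open>f\<close>, hence is square integrable; then \<open>f(\<phi>)\<close> pairs \<open>k\<close> with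
  \<open>|\<xi>|\<^sup>s\<close> times the inverse transform of \<open>\<phi>\<close>.\<close>

theorem Hdot_dual_bound:
  fixes f :: "'n::finite distr"
  assumes f: "f \<in> Hdot (- s)" and s: "0 \<le> s" "s \<le> 1"
  shows "\<exists>M\<ge>0. \<forall>\<phi>\<in>schwartz. norm (f \<phi>) \<le> M * sqrt (\<integral>\<xi>. (norm (of_real (norm \<xi> powr s) * inv_fourier \<phi> \<xi>))\<^sup>2 \<partial>lborel)"
proof -
  define h where "h = fourier_function f"
  from f have fd: "frac_lap_defined (- s) f" and "\<exists>G\<in>Lp 2. \<forall>\<phi>\<in>schwartz. frac_lap (- s) f \<phi> = distr_of G \<phi>"
    unfolding Hdot_def by auto
  then obtain G where G: "G \<in> Lp 2" "\<And>\<phi>. \<phi> \<in> schwartz \<Longrightarrow> frac_lap (- s) f \<phi> = distr_of G \<phi>" by blast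
  have hf: "has_fourier_function f h"
    using fd someI_ex[of "has_fourier_function f"] unfolding frac_lap_defined_def h_def fourier_function_def by blast
  then have hm [measurable]: "h \<in> borel_measurable borel" unfolding has_fourier_function_def by blast
  define k where "k \<xi> = of_real (norm \<xi> powr - s) * h \<xi>" for \<xi>
  have [measurable]: "k \<in> borel_measurable borel" unfolding k_def[abs_def] by measurable
  have ik: "integrable lborel (\<lambda>\<xi>. k \<xi> * \<psi> \<xi>)" if "\<psi> \<in> schwartz" for \<psi>
    using fd that unfolding frac_lap_defined_def k_def h_def by blast
  have Gm: "G \<in> borel_measurable borel" and G2: "integrable lborel (\<lambda>x. (norm (G x))\<^sup>2)"
    using G(1) unfolding Lp_def by auto
  obtain k' where k'm [measurable]: "k' \<in> borel_measurable borel" and k'2: "integrable lborel (\<lambda>\<xi>. (norm (k' \<xi>))\<^sup>2)"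
    and k'G: "\<And>\<phi>. \<phi> \<in> schwartz \<Longrightarrow> (\<integral>x. G x * fourier \<phi> x \<partial>lborel) = (\<integral>\<xi>. k' \<xi> * \<phi> \<xi> \<partial>lborel)"
    using L2_fourier[OF Gm G2] by blast
  have ik': "integrable lborel (\<lambda>\<xi>. k' \<xi> * \<psi> \<xi>)" if "\<psi> \<in> schwartz" for \<psi>
    by (rule square_integrable_mult_complex(1)[OF _ _ k'2 schwartz_square_integrable[OF that]])
       (use schwartz_measurable[OF that] in auto)
  have "AE \<xi> in lborel. k \<xi> - k' \<xi> = 0"
  proof (rule schwartz_orthogonal_imp_zero)
    fix \<psi> :: "real^'n \<Rightarrow> complex" assume \<psi>: "\<psi> \<in> schwartz"
    show "integrable lborel (\<lambda>\<xi>. (k \<xi> - k' \<xi>) * \<psi> \<xi>)"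
      using ik[OF \<psi>] ik'[OF \<psi>] by (simp add: left_diff_distrib)
    have "(\<integral>\<xi>. k \<xi> * inv_fourier (fourier \<psi>) \<xi> \<partial>lborel) = (\<integral>x. G x * fourier \<psi> x \<partial>lborel)"
      using G(2)[OF schwartz_fourier[OF \<psi>]] unfolding frac_lap_def distr_of_def k_def h_def .
    then have "(\<integral>\<xi>. k \<xi> * \<psi> \<xi> \<partial>lborel) = (\<integral>\<xi>. k' \<xi> * \<psi> \<xi> \<partial>lborel)"
      unfolding k'G[OF \<psi>] inv_fourier_fourier[OF \<psi>] .
    then show "(\<integral>\<xi>. (k \<xi> - k' \<xi>) * \<psi> \<xi> \<partial>lborel) = 0"
      using ik[OF \<psi>] ik'[OF \<psi>] by (simp add: left_diff_distrib)
  qed measurable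
  then have kk': "AE \<xi> in lborel. k \<xi> = k' \<xi>" by eventually_elim simp
  have nz: "AE \<xi>::real^'n in lborel. \<xi> \<noteq> 0" by (rule AE_lborel_singleton)
  have "norm (f \<phi>) \<le> sqrt (\<integral>\<xi>. (norm (k' \<xi>))\<^sup>2 \<partial>lborel) * sqrt (\<integral>\<xi>. (norm (of_real (norm \<xi> powr s) * inv_fourier \<phi> \<xi>))\<^sup>2 \<partial>lborel)"
    if \<phi>: "\<phi> \<in> schwartz" for \<phi>
  proof -
    have i\<phi>: "inv_fourier \<phi> \<in> schwartz" by (rule schwartz_inv_fourier[OF \<phi>])
    have [measurable]: "inv_fourier \<phi> \<in> borel_measurable borel" by (rule schwartz_measurable[OF i\<phi>])
    have "f \<phi> = f (fourier (inv_fourier \<phi>))" by (simp only: fourier_inv_fourier[OF \<phi>])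
    also have "\<dots> = (\<integral>\<xi>. h \<xi> * inv_fourier \<phi> \<xi> \<partial>lborel)"
      using hf i\<phi> unfolding has_fourier_function_def by blast
    also have "\<dots> = (\<integral>\<xi>. k' \<xi> * (of_real (norm \<xi> powr s) * inv_fourier \<phi> \<xi>) \<partial>lborel)"
    proof (rule integral_cong_AE)
      show "AE \<xi> in lborel. h \<xi> * inv_fourier \<phi> \<xi> = k' \<xi> * (of_real (norm \<xi> powr s) * inv_fourier \<phi> \<xi>)"
        using nz kk'
      proof eventually_elim
        case (elim \<xi>)
        have "norm \<xi> powr - s * norm \<xi> powr s = 1" using elim by (simp add: powr_add[symmetric])
        then have one: "complex_of_real (norm \<xi> powr - s) * of_real (norm \<xi> powr s) = 1"
          by (simp flip: of_real_mult)
        have "k' \<xi> * (of_real (norm \<xi> powr s) * inv_fourier \<phi> \<xi>)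
            = (complex_of_real (norm \<xi> powr - s) * of_real (norm \<xi> powr s)) * (h \<xi> * inv_fourier \<phi> \<xi>)"
          using elim(2) unfolding k_def by (metis (no_types) mult.assoc mult.commute)
        then show ?case unfolding one mult_1_left by (rule sym)
      qed
    qed measurable
    finally show ?thesis
      using square_integrable_mult_complex(2)[OF _ _ k'2 weighted_schwartz_square_integrable[OF s i\<phi>]] by simp
  qed
  then show ?thesis by (intro exI[of _ "sqrt (\<integral>\<xi>. (norm (k' \<xi>))\<^sup>2 \<partial>lborel)"] conjI ballI) auto
qed

lemma Hdot_dual_bound_test:
  fixes f :: "'n::finite distr"
  assumes f: "f \<in> Hdot (- s)" and s: "0 \<le> s" "s \<le> 1"
  shows "\<exists>M\<ge>0. \<forall>\<phi>\<in>test_functions. norm (f (\<lambda>x. of_real (\<phi> x))) \<le> M * sqrt (hip s \<phi> \<phi>)"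
proof -
  obtain M where M: "M \<ge> 0 \<and> (\<forall>\<phi>\<in>schwartz. norm (f \<phi>) \<le> M * sqrt (\<integral>\<xi>. (norm (of_real (norm \<xi> powr s) * inv_fourier \<phi> \<xi>))\<^sup>2 \<partial>lborel))"
    using Hdot_dual_bound[OF assms] ..
  define c where "c = 1 / (2 * pi) ^ CARD('n)"
  have c: "0 < c" unfolding c_def by simp
  have "norm (f (\<lambda>x. of_real (\<phi> x))) \<le> (M * sqrt c) * sqrt (hip s \<phi> \<phi>)"
    if \<phi>: "\<phi> \<in> test_functions" for \<phi> :: "real^'n \<Rightarrow> real"
  proof -
    let ?\<phi> = "\<lambda>x. complex_of_real (\<phi> x)"
    note [measurable] = freq_measurable[OF \<phi>, of s]
    have e: "of_real (norm \<xi> powr s) * inv_fourier ?\<phi> \<xi> = of_real c * freq s \<phi> (- \<xi>)" for \<xi>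
      unfolding inv_fourier_eq_fourier freq_def c_def by simp
    have "(\<integral>\<xi>. (norm (of_real (norm \<xi> powr s) * inv_fourier ?\<phi> \<xi>))\<^sup>2 \<partial>lborel) = (\<integral>\<xi>. c\<^sup>2 * (norm (freq s \<phi> (- \<xi>)))\<^sup>2 \<partial>lborel)"
      unfolding e by (simp add: norm_mult power_mult_distrib)
    also have "\<dots> = c\<^sup>2 * (\<integral>\<xi>. (norm (freq s \<phi> \<xi>))\<^sup>2 \<partial>lborel)"
      using integral_reflect(2)[of "\<lambda>\<xi>. (norm (freq s \<phi> \<xi>))\<^sup>2"] by simp
    also have "\<dots> = c * hip s \<phi> \<phi>" unfolding hip_self c_def[symmetric] by (simp add: power2_eq_square)
    finally have "sqrt (\<integral>\<xi>. (norm (of_real (norm \<xi> powr s) * inv_fourier ?\<phi> \<xi>))\<^sup>2 \<partial>lborel) = sqrt c * sqrt (hip s \<phi> \<phi>)"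
      by (simp add: real_sqrt_mult)
    then show ?thesis using conjunct2[OF M, rule_format, OF test_schwartz[OF \<phi>]] by (simp add: mult.assoc)
  qed
  then show ?thesis using M c by (intro exI[of _ "M * sqrt c"] conjI ballI) auto
qed

section \<open>Limits of test functions in the homogeneous Sobolev space\<close>

lemma sobolev_inequality_integral:
  fixes s :: real
  assumes s: "0 < s" "s \<le> 1" "2 * s < CARD('n)"
  defines "p \<equiv> 2 * real CARD('n) / (real CARD('n) - 2 * s)"
  shows "2 < p"
    and "\<exists>C\<ge>0. \<forall>u\<in>(test_functions :: (real^'n::finite \<Rightarrow> real) set). integrable lborel (\<lambda>x. \<bar>u x\<bar> powr p) \<and>
      (\<integral>x. \<bar>u x\<bar> powr p \<partial>lborel) \<le> C * hip s u u powr (p / 2)"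
proof -
  have d: "0 < real CARD('n) - 2 * s" using s by simp
  then show "2 < p" unfolding p_def using s by (simp add: pos_less_divide_eq)
  obtain C where C: "C \<ge> 0 \<and> (\<forall>u\<in>(test_functions :: (real^'n \<Rightarrow> real) set).
    (\<integral>\<^sup>+x. ennreal (\<bar>u x\<bar> powr p) \<partial>lborel) \<le> ennreal (C * hip s u u powr (p / 2)))"
    using sobolev_inequality[where 'n='n, OF s] unfolding p_def ..
  have "integrable lborel (\<lambda>x. \<bar>u x\<bar> powr p) \<and> (\<integral>x. \<bar>u x\<bar> powr p \<partial>lborel) \<le> C * hip s u u powr (p / 2)"
    if u: "u \<in> test_functions" for u :: "real^'n \<Rightarrow> real"
  proof -
    note [measurable] = test_measurable[OF u]
    have le: "(\<integral>\<^sup>+x. ennreal (\<bar>u x\<bar> powr p) \<partial>lborel) \<le> ennreal (C * hip s u u powr (p / 2))"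
      by (rule conjunct2[OF C, rule_format, OF u])
    have i: "integrable lborel (\<lambda>x. \<bar>u x\<bar> powr p)"
      unfolding integrable_iff_bounded using le by (auto simp: le_less_trans)
    have "ennreal (\<integral>x. \<bar>u x\<bar> powr p \<partial>lborel) \<le> ennreal (C * hip s u u powr (p / 2))"
      using le nn_integral_eq_integral[OF i] by simp
    then show ?thesis using i C by (simp add: ennreal_le_iff)
  qed
  then show "\<exists>C\<ge>0. \<forall>u\<in>(test_functions :: (real^'n \<Rightarrow> real) set). integrable lborel (\<lambda>x. \<bar>u x\<bar> powr p) \<and>
      (\<integral>x. \<bar>u x\<bar> powr p \<partial>lborel) \<le> C * hip s u u powr (p / 2)"
    using C by (intro exI[of _ C] conjI ballI) auto
qed

text \<open>Splitting at a level \<open>\<eta>\<close>: this embeds \<open>L\<^sup>q\<close> locally into \<open>L\<^sup>r\<close>, with a small constant in front of the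
  part that does not tend to zero, and replaces Hoelder's inequality below.\<close>

lemma le_threshold_plus_power:
  fixes a \<eta> q r :: real
  assumes "0 \<le> a" "0 < \<eta>" "r \<le> q" "0 < r"
  shows "a powr r \<le> \<eta> powr r + \<eta> powr (r - q) * a powr q"
proof (cases "a \<le> \<eta>")
  case True
  then have "a powr r \<le> \<eta> powr r" using assms by (intro powr_mono2) auto
  then show ?thesis by (simp add: add_increasing2)
next
  case False
  then have "a powr r = a powr (r - q) * a powr q" by (simp add: powr_add[symmetric])
  also have "\<dots> \<le> \<eta> powr (r - q) * a powr q"
    using False assms by (intro mult_right_mono powr_mono2') auto
  finally show ?thesis by (simp add: add_increasing)
qed

lemma Lp_times_schwartz_integrable:
  fixes \<theta> :: "real^'n::finite \<Rightarrow> real"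
  assumes p: "1 < p" and \<theta>: "\<theta> \<in> Lp p" and g: "integrable lborel g" "\<And>x. norm (g x) \<le> B"
  shows "integrable lborel (\<lambda>x. complex_of_real (\<theta> x) * g x)"
    and "0 < \<eta> \<Longrightarrow> norm (\<integral>x. complex_of_real (\<theta> x) * g x \<partial>lborel)
      \<le> \<eta> * (\<integral>x. norm (g x) \<partial>lborel) + \<eta> powr (1 - p) * B * (\<integral>x. \<bar>\<theta> x\<bar> powr p \<partial>lborel)"
proof -
  have [measurable]: "\<theta> \<in> borel_measurable borel" "g \<in> borel_measurable borel"
    and i: "integrable lborel (\<lambda>x. \<bar>\<theta> x\<bar> powr p)"
    using \<theta> borel_measurable_integrable[OF g(1)] unfolding Lp_def by auto
  have B0: "0 \<le> B" using g(2)[of 0] norm_ge_zero order_trans by blast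
  have pt: "norm (complex_of_real (\<theta> x) * g x) \<le> \<eta> * norm (g x) + \<eta> powr (1 - p) * B * \<bar>\<theta> x\<bar> powr p"
    if \<eta>: "0 < \<eta>" for \<eta> x
  proof -
    have "\<bar>\<theta> x\<bar> \<le> \<eta> + \<eta> powr (1 - p) * \<bar>\<theta> x\<bar> powr p"
      using le_threshold_plus_power[of "\<bar>\<theta> x\<bar>" \<eta> 1 p] p \<eta> by simp
    then have "\<bar>\<theta> x\<bar> * norm (g x) \<le> (\<eta> + \<eta> powr (1 - p) * \<bar>\<theta> x\<bar> powr p) * norm (g x)"
      by (intro mult_right_mono) auto
    also have "\<dots> \<le> \<eta> * norm (g x) + \<eta> powr (1 - p) * \<bar>\<theta> x\<bar> powr p * B"
      unfolding distrib_right by (intro add_left_mono mult_left_mono g(2)) auto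
    finally show ?thesis by (simp add: norm_mult mult_ac)
  qed
  have ib: "integrable lborel (\<lambda>x. \<eta> * norm (g x) + \<eta> powr (1 - p) * B * \<bar>\<theta> x\<bar> powr p)" for \<eta>
    by (intro Bochner_Integration.integrable_add integrable_mult_right integrable_norm g i)
  show i2: "integrable lborel (\<lambda>x. complex_of_real (\<theta> x) * g x)"
  proof (rule Bochner_Integration.integrable_bound[OF ib[of 1]])
    show "AE x in lborel. norm (complex_of_real (\<theta> x) * g x)
        \<le> norm (1 * norm (g x) + 1 powr (1 - p) * B * \<bar>\<theta> x\<bar> powr p)"
      using pt[of 1] by (intro AE_I2) (auto intro: order_trans[OF _ abs_ge_self])
  qed measurable
  assume \<eta>: "0 < \<eta>"
  have "norm (\<integral>x. complex_of_real (\<theta> x) * g x \<partial>lborel) \<le> (\<integral>x. norm (complex_of_real (\<theta> x) * g x) \<partial>lborel)"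
    by (rule integral_norm_bound)
  also have "\<dots> \<le> (\<integral>x. \<eta> * norm (g x) + \<eta> powr (1 - p) * B * \<bar>\<theta> x\<bar> powr p \<partial>lborel)"
    by (intro integral_mono integrable_norm i2 ib pt \<eta>)
  also have "\<dots> = \<eta> * (\<integral>x. norm (g x) \<partial>lborel) + \<eta> powr (1 - p) * B * (\<integral>x. \<bar>\<theta> x\<bar> powr p \<partial>lborel)"
    using g(1) i by simp
  finally show "norm (\<integral>x. complex_of_real (\<theta> x) * g x \<partial>lborel)
      \<le> \<eta> * (\<integral>x. norm (g x) \<partial>lborel) + \<eta> powr (1 - p) * B * (\<integral>x. \<bar>\<theta> x\<bar> powr p \<partial>lborel)" .
qed

text \<open>A bound \<open>\<eta> a + K(\<eta>) x\<close> with \<open>\<eta>\<close> at our disposal tends to zero with \<open>x\<close>.\<close>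

lemma tendsto_zero_split:
  fixes y x :: "nat \<Rightarrow> real"
  assumes b: "\<And>\<eta> k. 0 < \<eta> \<Longrightarrow> \<bar>y k\<bar> \<le> \<eta> * a + K \<eta> * x k" and x: "x \<longlonglongrightarrow> 0" and a: "0 \<le> a"
  shows "y \<longlonglongrightarrow> 0"
proof (rule LIMSEQ_I)
  fix e :: real assume e: "0 < e"
  define q where "q = a + 1"
  have q: "0 < q" "a \<le> q" unfolding q_def using a by auto
  define \<eta> where "\<eta> = e / (2 * q)"
  have \<eta>: "0 < \<eta>" unfolding \<eta>_def using e q by simp
  have "\<eta> * a \<le> \<eta> * q" using \<eta> q by (intro mult_left_mono) auto
  also have "\<dots> = e / 2" unfolding \<eta>_def using q by simp
  finally have 1: "\<eta> * a \<le> e / 2" .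
  have "(\<lambda>k. K \<eta> * x k) \<longlonglongrightarrow> K \<eta> * 0" by (intro tendsto_intros x)
  then have "\<forall>\<^sub>F k in sequentially. K \<eta> * x k < e / 2"
    by (intro order_tendstoD(2)) (use e in auto)
  then obtain N where N: "\<And>k. N \<le> k \<Longrightarrow> K \<eta> * x k < e / 2" unfolding eventually_sequentially by blast
  have "norm (y k - 0) < e" if "N \<le> k" for k using b[OF \<eta>, of k] 1 N[OF that] by simp
  then show "\<exists>no. \<forall>k\<ge>no. norm (y k - 0) < e" by blast
qed

text \<open>Near the origin the weight is integrable because \<open>2s < n\<close>, elsewhere it is at most one.\<close>

lemma negative_weight_square_integrable:
  fixes g :: "real^'n::finite \<Rightarrow> complex" and s :: real
  assumes s: "0 < s" "2 * s < CARD('n)" and g: "g \<in> schwartz"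
  shows "integrable lborel (\<lambda>\<xi>. (norm (of_real (norm \<xi> powr - s) * g \<xi>))\<^sup>2)"
proof -
  note [measurable] = schwartz_measurable[OF g]
  obtain B where B: "0 \<le> B" "\<And>x. norm (g x) \<le> B" using schwartz_norm_bounded[OF g] by blast
  have i: "integrable lborel (\<lambda>x::real^'n. indicator (cball 0 1) x * norm x powr (- (2 * s)))"
    using norm_powr_ball[of "2 * s", where 'a="real^'n"] s by auto
  show ?thesis
  proof (rule Bochner_Integration.integrable_bound[OF Bochner_Integration.integrable_add[OF
        integrable_mult_right[OF i, of "B\<^sup>2"] schwartz_square_integrable[OF g]]])
    show "AE \<xi> in lborel. norm ((norm (of_real (norm \<xi> powr - s) * g \<xi>))\<^sup>2)
        \<le> norm (B\<^sup>2 * (indicator (cball 0 1) \<xi> * norm \<xi> powr (- (2 * s))) + (norm (g \<xi>))\<^sup>2)"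
    proof (intro AE_I2)
      fix \<xi> :: "real^'n"
      have w: "(norm \<xi> powr - s)\<^sup>2 = norm \<xi> powr (- (2 * s))"
        by (cases "\<xi> = 0") (auto simp: power2_eq_square powr_add[symmetric])
      have e: "(norm (of_real (norm \<xi> powr - s) * g \<xi>))\<^sup>2 = norm \<xi> powr (- (2 * s)) * (norm (g \<xi>))\<^sup>2"
        by (simp add: norm_mult power_mult_distrib w)
      have "norm \<xi> powr (- (2 * s)) * (norm (g \<xi>))\<^sup>2
          \<le> B\<^sup>2 * (indicator (cball 0 1) \<xi> * norm \<xi> powr (- (2 * s))) + (norm (g \<xi>))\<^sup>2"
      proof (cases "norm \<xi> \<le> 1")
        case True
        have "(norm (g \<xi>))\<^sup>2 \<le> B\<^sup>2" using B by (intro power_mono) auto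
        then have "norm \<xi> powr (- (2 * s)) * (norm (g \<xi>))\<^sup>2 \<le> norm \<xi> powr (- (2 * s)) * B\<^sup>2"
          by (intro mult_left_mono) auto
        then show ?thesis using True by (simp add: mult.commute add_increasing2)
      next
        case False
        then have "norm \<xi> powr (- (2 * s)) \<le> 1 powr (- (2 * s))" using s by (intro powr_mono2') auto
        then have "norm \<xi> powr (- (2 * s)) * (norm (g \<xi>))\<^sup>2 \<le> 1 * (norm (g \<xi>))\<^sup>2"
          by (intro mult_right_mono) auto
        then show ?thesis using False by simp
      qed
      then show "norm ((norm (of_real (norm \<xi> powr - s) * g \<xi>))\<^sup>2)
          \<le> norm (B\<^sup>2 * (indicator (cball 0 1) \<xi> * norm \<xi> powr (- (2 * s))) + (norm (g \<xi>))\<^sup>2)"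
        unfolding e by simp
    qed
  qed measurable
qed

lemma tempered_Lp:
  fixes \<theta> :: "real^'n::finite \<Rightarrow> real"
  assumes p: "1 < p" and \<theta>: "\<theta> \<in> Lp p"
  shows "tempered (distr_of (\<lambda>x. complex_of_real (\<theta> x)))"
proof -
  let ?N = "2 * CARD('n)"
  let ?d = "\<lambda>x::real^'n. 1 / (1 + norm x) ^ ?N"
  have [measurable]: "\<theta> \<in> borel_measurable borel" and i: "integrable lborel (\<lambda>x. \<bar>\<theta> x\<bar> powr p)"
    using \<theta> unfolding Lp_def by auto
  have int: "integrable lborel (\<lambda>x. complex_of_real (\<theta> x) * \<phi> x)" if \<phi>: "\<phi> \<in> schwartz" for \<phi>
  proof -
    obtain B where "\<And>x. norm (\<phi> x) \<le> B" using schwartz_norm_bounded[OF \<phi>] by blast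
    then show ?thesis by (rule Lp_times_schwartz_integrable(1)[OF p \<theta> schwartz_integrable[OF \<phi>]])
  qed
  have d0: "0 \<le> ?d x" "?d x \<le> 1" for x :: "real^'n"
  proof -
    have q: "0 \<le> 1 / X \<and> 1 / X \<le> 1" if "1 \<le> X" for X :: real using that by simp
    have "1 \<le> (1 + norm x) ^ ?N" by (rule one_le_power) simp
    from q[OF this] show "0 \<le> ?d x" "?d x \<le> 1" by (rule conjunct1, rule conjunct2)
  qed
  have id: "integrable lborel (\<lambda>x. \<bar>\<theta> x\<bar> * ?d x)"
  proof (rule Bochner_Integration.integrable_bound[OF Bochner_Integration.integrable_add[OF integrable_decay i]])
    show "AE x::real^'n in lborel. norm (\<bar>\<theta> x\<bar> * ?d x) \<le> norm (1 / (1 + norm x) ^ (2 * DIM(real^'n)) + \<bar>\<theta> x\<bar> powr p)"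
    proof (intro AE_I2)
      fix x :: "real^'n"
      have "\<bar>\<theta> x\<bar> \<le> 1 + \<bar>\<theta> x\<bar> powr p"
        using le_threshold_plus_power[of "\<bar>\<theta> x\<bar>" 1 1 p] p by simp
      then have "\<bar>\<theta> x\<bar> * ?d x \<le> (1 + \<bar>\<theta> x\<bar> powr p) * ?d x" by (rule mult_right_mono[OF _ d0(1)])
      also have "\<dots> \<le> ?d x + \<bar>\<theta> x\<bar> powr p * 1"
        unfolding distrib_right by (intro add_mono mult_left_mono d0(2)) auto
      finally show "norm (\<bar>\<theta> x\<bar> * ?d x) \<le> norm (1 / (1 + norm x) ^ (2 * DIM(real^'n)) + \<bar>\<theta> x\<bar> powr p)"
        using d0(1)[of x] by simp
    qed
  qed measurable
  define C where "C = (\<integral>x. \<bar>\<theta> x\<bar> * ?d x \<partial>lborel)"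
  have "norm (distr_of (\<lambda>x. complex_of_real (\<theta> x)) \<phi>) \<le> C * schwartz_seminorm ?N \<phi>" if \<phi>: "\<phi> \<in> schwartz" for \<phi>
  proof -
    have "norm (distr_of (\<lambda>x. complex_of_real (\<theta> x)) \<phi>) \<le> (\<integral>x. norm (complex_of_real (\<theta> x) * \<phi> x) \<partial>lborel)"
      unfolding distr_of_def by (rule integral_norm_bound)
    also have "\<dots> \<le> (\<integral>x. schwartz_seminorm ?N \<phi> * (\<bar>\<theta> x\<bar> * ?d x) \<partial>lborel)"
    proof (intro integral_mono integrable_norm int \<phi> integrable_mult_right id)
      fix x :: "real^'n"
      have "0 < (1 + norm x) ^ ?N" by (intro zero_less_power) (simp add: add_pos_nonneg)
      then have "norm (\<phi> x) \<le> schwartz_seminorm ?N \<phi> * ?d x"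
        using schwartz_seminorm_bound[OF \<phi>, of x ?N] by (simp add: field_simps)
      then have "\<bar>\<theta> x\<bar> * norm (\<phi> x) \<le> \<bar>\<theta> x\<bar> * (schwartz_seminorm ?N \<phi> * ?d x)" by (intro mult_left_mono) auto
      then show "norm (complex_of_real (\<theta> x) * \<phi> x) \<le> schwartz_seminorm ?N \<phi> * (\<bar>\<theta> x\<bar> * ?d x)"
        by (simp add: norm_mult mult_ac)
    qed
    also have "\<dots> = C * schwartz_seminorm ?N \<phi>" unfolding C_def by (simp only: integral_mult_right_zero mult.commute)
    finally show ?thesis .
  qed
  moreover have "distr_of (\<lambda>x. complex_of_real (\<theta> x)) (\<lambda>x. a * \<phi> x + b * \<psi> x)
      = a * distr_of (\<lambda>x. complex_of_real (\<theta> x)) \<phi> + b * distr_of (\<lambda>x. complex_of_real (\<theta> x)) \<psi>"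
    if "\<phi> \<in> schwartz" "\<psi> \<in> schwartz" for \<phi> \<psi> a b
  proof -
    have "(\<integral>x. complex_of_real (\<theta> x) * (a * \<phi> x + b * \<psi> x) \<partial>lborel)
        = (\<integral>x. a * (complex_of_real (\<theta> x) * \<phi> x) + b * (complex_of_real (\<theta> x) * \<psi> x) \<partial>lborel)"
      by (intro Bochner_Integration.integral_cong) (auto simp: algebra_simps)
    then show ?thesis unfolding distr_of_def using int[OF that(1)] int[OF that(2)] by simp
  qed
  ultimately show ?thesis unfolding tempered_def by blast
qed

lemma freq_reflect: "freq s u (- \<xi>) = cnj (freq s u \<xi>)"
  unfolding freq_def by (simp add: fourier_real_reflect)

text \<open>Reflection symmetry of the transforms of real functions makes the form real.\<close>

lemma hip_complex:
  fixes u v :: "real^'n::finite \<Rightarrow> real"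
  assumes "u \<in> test_functions" "v \<in> test_functions"
  shows "complex_of_real (hip s u v) = of_real (1 / (2 * pi) ^ CARD('n)) * (\<integral>\<xi>. freq s u \<xi> * cnj (freq s v \<xi>) \<partial>lborel)"
proof -
  have [measurable]: "freq s v \<in> borel_measurable borel" "freq s u \<in> borel_measurable borel"
    by (rule freq_measurable, rule assms)+
  let ?I = "\<integral>\<xi>. freq s u \<xi> * cnj (freq s v \<xi>) \<partial>lborel"
  have "?I = (\<integral>\<xi>. freq s u (- \<xi>) * cnj (freq s v (- \<xi>)) \<partial>lborel)"
    by (rule integral_reflect(2)[of "\<lambda>\<xi>. freq s u \<xi> * cnj (freq s v \<xi>)", symmetric]) measurable
  also have "\<dots> = (\<integral>\<xi>. cnj (freq s u \<xi> * cnj (freq s v \<xi>)) \<partial>lborel)"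
    unfolding freq_reflect by simp
  also have "\<dots> = cnj ?I" by (rule Bochner_Integration.integral_cnj)
  finally have "Im ?I = 0" by (simp add: complex_eq_iff)
  then have "of_real (Re ?I) = ?I" by (simp add: complex_eq_iff)
  then show ?thesis unfolding hip_def of_real_mult by (simp only:)
qed

text \<open>The Fourier transform of a distribution is an arbitrary choice of representative; all of them agree
  almost everywhere.\<close>

lemma fourier_function_unique:
  assumes "has_fourier_function T h"
  shows "has_fourier_function T (fourier_function T)" "AE \<xi> in lborel. fourier_function T \<xi> = h \<xi>"
proof -
  let ?F = "fourier_function T"
  show F: "has_fourier_function T ?F"
    unfolding fourier_function_def by (rule someI[of "has_fourier_function T", OF assms])
  have [measurable]: "?F \<in> borel_measurable borel" "h \<in> borel_measurable borel"
    using F assms unfolding has_fourier_function_def by auto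
  have "AE \<xi> in lborel. ?F \<xi> - h \<xi> = 0"
  proof (rule schwartz_orthogonal_imp_zero)
    fix \<psi> :: "real^'a \<Rightarrow> complex" assume \<psi>: "\<psi> \<in> schwartz"
    have i: "integrable lborel (\<lambda>\<xi>. ?F \<xi> * \<psi> \<xi>)" "integrable lborel (\<lambda>\<xi>. h \<xi> * \<psi> \<xi>)"
      and e: "(\<integral>\<xi>. ?F \<xi> * \<psi> \<xi> \<partial>lborel) = (\<integral>\<xi>. h \<xi> * \<psi> \<xi> \<partial>lborel)"
      using F assms \<psi> unfolding has_fourier_function_def by auto
    show "integrable lborel (\<lambda>\<xi>. (?F \<xi> - h \<xi>) * \<psi> \<xi>)" using i by (simp add: left_diff_distrib)
    show "(\<integral>\<xi>. (?F \<xi> - h \<xi>) * \<psi> \<xi> \<partial>lborel) = 0" using i e by (simp add: left_diff_distrib)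
  qed measurable
  then show "AE \<xi> in lborel. ?F \<xi> = h \<xi>" by eventually_elim simp
qed

text \<open>Sobolev's inequality gives a limit in \<open>L\<^sup>p\<close>, completeness of \<open>L\<^sup>2\<close> a limit of the weighted
  transforms, and passing to the limit in the exchange formula for the Fourier transform ties
  the two together.\<close>

theorem Hdot_limit:
  fixes \<psi> :: "nat \<Rightarrow> real^'n::finite \<Rightarrow> real" and s :: real
  assumes s: "0 < s" "s \<le> 1" "2 * s < CARD('n)" and \<psi>: "\<And>k. \<psi> k \<in> test_functions"
    and cauchy: "\<And>e. 0 < e \<Longrightarrow> \<exists>N. \<forall>m\<ge>N. \<forall>k\<ge>N. hip s (\<lambda>x. \<psi> m x - \<psi> k x) (\<lambda>x. \<psi> m x - \<psi> k x) < e"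
  defines "p \<equiv> 2 * real CARD('n) / (real CARD('n) - 2 * s)"
  shows "\<exists>\<theta>\<in>Hdot_fun s. (\<lambda>k. \<integral>x. \<bar>\<psi> k x - \<theta> x\<bar> powr p \<partial>lborel) \<longlonglongrightarrow> 0 \<and>
    (\<forall>\<phi>\<in>test_functions. \<exists>l. (\<lambda>k. hip s (\<psi> k) \<phi>) \<longlonglongrightarrow> l \<and>
      frac_lap (2 * s) (distr_of (\<lambda>x. of_real (\<theta> x))) (\<lambda>x. of_real (\<phi> x)) = of_real l)"
proof -
  note p2 = sobolev_inequality_integral(1)[where 'n='n, OF s, folded p_def]
  obtain C where C: "C \<ge> 0 \<and> (\<forall>u\<in>(test_functions :: (real^'n \<Rightarrow> real) set). integrable lborel (\<lambda>x. \<bar>u x\<bar> powr p) \<and>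
      (\<integral>x. \<bar>u x\<bar> powr p \<partial>lborel) \<le> C * hip s u u powr (p / 2))"
    using sobolev_inequality_integral(2)[where 'n='n, OF s, folded p_def] ..
  note Ci = conjunct1[OF conjunct2[OF C, rule_format]] and Cb = conjunct2[OF conjunct2[OF C, rule_format]]
  define c where "c = 1 / (2 * pi) ^ CARD('n)"
  have c: "0 < c" unfolding c_def by simp
  have hip0: "0 \<le> hip s u u" if "u \<in> test_functions" for u :: "real^'n \<Rightarrow> real"
    using semi_inner.ip_pos[OF semi_inner_hip that, of s] s by simp
  note m\<psi> [measurable] = test_measurable[OF \<psi>] freq_measurable[OF \<psi>]
  have p0: "0 < p" using p2 by simp
  have LpC: "\<exists>N. \<forall>m\<ge>N. \<forall>k\<ge>N. (\<integral>x. norm (\<psi> m x - \<psi> k x) powr p \<partial>lborel) < e" if e: "0 < e" for e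
  proof -
    define d where "d = (e / (C + 1)) powr (2 / p)"
    have C1: "0 < C + 1" using C by simp
    have d: "0 < d" unfolding d_def using e C1 by simp
    have dp: "d powr (p / 2) = e / (C + 1)" unfolding d_def using p2 e C1 by (simp add: powr_powr)
    obtain N where N: "\<And>m k. N \<le> m \<Longrightarrow> N \<le> k \<Longrightarrow> hip s (\<lambda>x. \<psi> m x - \<psi> k x) (\<lambda>x. \<psi> m x - \<psi> k x) < d"
      using cauchy[OF d] by blast
    have "(\<integral>x. norm (\<psi> m x - \<psi> k x) powr p \<partial>lborel) < e" if mk: "N \<le> m" "N \<le> k" for m k
    proof -
      let ?w = "\<lambda>x. \<psi> m x - \<psi> k x"
      have w: "?w \<in> test_functions" by (rule test_diff[OF \<psi> \<psi>])
      have "(\<integral>x. norm (?w x) powr p \<partial>lborel) \<le> C * hip s ?w ?w powr (p / 2)" using Cb[OF w] by simp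
      also have "\<dots> \<le> C * (e / (C + 1))"
        unfolding dp[symmetric] using C N[OF mk] hip0[OF w] p2 by (intro mult_left_mono powr_mono2) auto
      also have "\<dots> < e" using C1 e by (simp add: field_simps)
      finally show ?thesis .
    qed
    then show ?thesis by blast
  qed
  have "\<exists>g\<in>borel_measurable lborel. integrable lborel (\<lambda>x. norm (g x) powr p) \<and>
     (\<forall>k. integrable lborel (\<lambda>x. norm (\<psi> k x - g x) powr p)) \<and>
     (\<lambda>k. \<integral>x. norm (\<psi> k x - g x) powr p \<partial>lborel) \<longlonglongrightarrow> 0"
    by (rule Lp_complete[OF p0 _ _ LpC]) (use Ci[OF \<psi>] in auto)
  then obtain \<theta> where \<theta>m: "\<theta> \<in> borel_measurable borel" and \<theta>p: "integrable lborel (\<lambda>x. norm (\<theta> x) powr p)"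
    and \<theta>k: "\<And>k. integrable lborel (\<lambda>x. norm (\<psi> k x - \<theta> x) powr p)"
    and \<theta>l: "(\<lambda>k. \<integral>x. norm (\<psi> k x - \<theta> x) powr p \<partial>lborel) \<longlonglongrightarrow> 0" by auto
  note [measurable] = \<theta>m
  have \<theta>Lp: "\<theta> \<in> Lp p" unfolding Lp_def using \<theta>m \<theta>p by simp
  have diffLp: "(\<lambda>x. \<psi> k x - \<theta> x) \<in> Lp p" for k unfolding Lp_def using \<theta>k by simp
  let ?F = "\<lambda>k. freq s (\<psi> k)"
  have fdiff: "freq s (\<lambda>x. \<psi> m x - \<psi> k x) \<xi> = ?F m \<xi> - ?F k \<xi>" for m k \<xi>
    using freq_lincomb[OF \<psi> \<psi>, of s 1 m "-1" k \<xi>] by simp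
  have F2: "integrable lborel (\<lambda>\<xi>. (norm (?F k \<xi>))\<^sup>2)" for k
    using freq_square_integrable[OF _ _ \<psi>, of s k] s by simp
  have L2C: "\<exists>N. \<forall>m\<ge>N. \<forall>k\<ge>N. (\<integral>\<xi>. norm (?F m \<xi> - ?F k \<xi>) powr 2 \<partial>lborel) < e" if e: "0 < e" for e
  proof -
    obtain N where N: "\<And>m k. N \<le> m \<Longrightarrow> N \<le> k \<Longrightarrow> hip s (\<lambda>x. \<psi> m x - \<psi> k x) (\<lambda>x. \<psi> m x - \<psi> k x) < c * e"
      using cauchy[of "c * e"] c e by auto
    have "(\<integral>\<xi>. norm (?F m \<xi> - ?F k \<xi>) powr 2 \<partial>lborel) < e" if "N \<le> m" "N \<le> k" for m k
      using N[OF that] c unfolding hip_self fdiff c_def[symmetric] by simp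
    then show ?thesis by blast
  qed
  have "\<exists>g\<in>borel_measurable lborel. integrable lborel (\<lambda>x. norm (g x) powr 2) \<and>
     (\<forall>k. integrable lborel (\<lambda>x. norm (?F k x - g x) powr 2)) \<and>
     (\<lambda>k. \<integral>x. norm (?F k x - g x) powr 2 \<partial>lborel) \<longlonglongrightarrow> 0"
    by (rule Lp_complete[OF _ _ _ L2C]) (use F2 in auto)
  then obtain g where gm: "g \<in> borel_measurable borel" and g2: "integrable lborel (\<lambda>x. (norm (g x))\<^sup>2)"
    and gk: "\<And>k. integrable lborel (\<lambda>x. (norm (?F k x - g x))\<^sup>2)"
    and gl: "(\<lambda>k. \<integral>x. (norm (?F k x - g x))\<^sup>2 \<partial>lborel) \<longlonglongrightarrow> 0" by auto
  note [measurable] = gm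
  have nz: "AE \<xi>::real^'n in lborel. \<xi> \<noteq> 0" by (rule AE_lborel_singleton)
  have pairing: "(\<lambda>k. \<integral>\<xi>. ?F k \<xi> * \<phi> \<xi> \<partial>lborel) \<longlonglongrightarrow> (\<integral>\<xi>. g \<xi> * \<phi> \<xi> \<partial>lborel)"
    and gint: "integrable lborel (\<lambda>\<xi>. g \<xi> * \<phi> \<xi>)"
    if "\<phi> \<in> borel_measurable borel" "integrable lborel (\<lambda>\<xi>. (norm (\<phi> \<xi>))\<^sup>2)" for \<phi>
  proof -
    have m: "\<phi> \<in> borel_measurable lborel" "g \<in> borel_measurable lborel" "\<And>k. ?F k \<in> borel_measurable lborel"
      using that by auto
    show i: "integrable lborel (\<lambda>\<xi>. g \<xi> * \<phi> \<xi>)" by (rule square_integrable_mult_complex(1)[OF m(2,1) g2 that(2)])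
    show "(\<lambda>k. \<integral>\<xi>. ?F k \<xi> * \<phi> \<xi> \<partial>lborel) \<longlonglongrightarrow> (\<integral>\<xi>. g \<xi> * \<phi> \<xi> \<partial>lborel)"
      by (rule L2_pairing_limit(2)[OF m(3,2,1) gk gl that(2) i])
  qed
  let ?T = "distr_of (\<lambda>x. complex_of_real (\<theta> x))"
  \<comment> \<open>\<open>g\<close> is the limit of the weighted transforms, and \<open>h\<close> undoes the weight.\<close>
  define h where "h \<xi> = of_real (norm \<xi> powr - s) * g \<xi>" for \<xi>
  have [measurable]: "h \<in> borel_measurable borel" unfolding h_def[abs_def] by measurable
  have hT: "has_fourier_function ?T h"
    unfolding has_fourier_function_def
  proof (intro conjI ballI)
    fix \<phi> :: "real^'n \<Rightarrow> complex" assume \<phi>: "\<phi> \<in> schwartz"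
    note [measurable] = schwartz_measurable[OF \<phi>]
    let ?\<phi> = "\<lambda>\<xi>. of_real (norm \<xi> powr - s) * \<phi> \<xi>"
    have \<phi>2: "?\<phi> \<in> borel_measurable borel" "integrable lborel (\<lambda>\<xi>. (norm (?\<phi> \<xi>))\<^sup>2)"
      by measurable (rule negative_weight_square_integrable[OF s(1,3) \<phi>])
    have e: "h \<xi> * \<phi> \<xi> = g \<xi> * ?\<phi> \<xi>" for \<xi> unfolding h_def by (simp add: mult_ac)
    show "integrable lborel (\<lambda>\<xi>. h \<xi> * \<phi> \<xi>)" unfolding e by (rule gint[OF \<phi>2])
    have f\<phi>: "fourier \<phi> \<in> schwartz" by (rule schwartz_fourier[OF \<phi>])
    obtain B where B: "0 \<le> B" "\<And>x. norm (fourier \<phi> x) \<le> B" using schwartz_norm_bounded[OF f\<phi>] by blast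
    have ex: "(\<integral>\<xi>. ?F k \<xi> * ?\<phi> \<xi> \<partial>lborel) = (\<integral>x. of_real (\<psi> k x) * fourier \<phi> x \<partial>lborel)" for k
    proof -
      have [measurable]: "fourier (\<lambda>x. complex_of_real (\<psi> k x)) \<in> borel_measurable borel"
        by (rule schwartz_measurable[OF schwartz_ft[OF \<psi>]])
      have "(\<integral>\<xi>. ?F k \<xi> * ?\<phi> \<xi> \<partial>lborel) = (\<integral>\<xi>. fourier (\<lambda>x. complex_of_real (\<psi> k x)) \<xi> * \<phi> \<xi> \<partial>lborel)"
      proof (rule integral_cong_AE)
        show "AE \<xi> in lborel. ?F k \<xi> * ?\<phi> \<xi> = fourier (\<lambda>x. complex_of_real (\<psi> k x)) \<xi> * \<phi> \<xi>"
          using nz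
        proof eventually_elim
          case (elim \<xi>)
          have "norm \<xi> powr s * norm \<xi> powr - s = 1" using elim by (simp add: powr_add[symmetric])
          then have one: "complex_of_real (norm \<xi> powr s) * of_real (norm \<xi> powr - s) = 1"
            by (simp flip: of_real_mult)
          have "?F k \<xi> * ?\<phi> \<xi> = (complex_of_real (norm \<xi> powr s) * of_real (norm \<xi> powr - s))
              * (fourier (\<lambda>x. complex_of_real (\<psi> k x)) \<xi> * \<phi> \<xi>)"
            unfolding freq_def by (simp only: mult_ac)
          then show ?case unfolding one by simp
        qed
      qed measurable
      also have "\<dots> = (\<integral>x. of_real (\<psi> k x) * fourier \<phi> x \<partial>lborel)"
        by (rule fourier_swap[OF test_integrable[OF \<psi>] schwartz_integrable[OF \<phi>]])
      finally show ?thesis .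
    qed
    have "(\<lambda>k. \<integral>x. of_real (\<psi> k x) * fourier \<phi> x \<partial>lborel) \<longlonglongrightarrow> (\<integral>\<xi>. h \<xi> * \<phi> \<xi> \<partial>lborel)"
      using pairing[OF \<phi>2] unfolding ex e .
    moreover have "(\<lambda>k. \<integral>x. of_real (\<psi> k x) * fourier \<phi> x \<partial>lborel) \<longlonglongrightarrow> (\<integral>x. of_real (\<theta> x) * fourier \<phi> x \<partial>lborel)"
    proof -
      have p1: "1 < p" using p2 by simp
      note i1 = Lp_times_schwartz_integrable(1)[OF p1 diffLp schwartz_integrable[OF f\<phi>] B(2)]
      note i2 = Lp_times_schwartz_integrable(1)[OF p1 \<theta>Lp schwartz_integrable[OF f\<phi>] B(2)]
      have d: "(\<integral>x. of_real (\<psi> k x) * fourier \<phi> x \<partial>lborel) - (\<integral>x. of_real (\<theta> x) * fourier \<phi> x \<partial>lborel)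
          = (\<integral>x. complex_of_real (\<psi> k x - \<theta> x) * fourier \<phi> x \<partial>lborel)" for k
      proof -
        have "(\<integral>x. of_real (\<psi> k x) * fourier \<phi> x \<partial>lborel)
            = (\<integral>x. complex_of_real (\<psi> k x - \<theta> x) * fourier \<phi> x + of_real (\<theta> x) * fourier \<phi> x \<partial>lborel)"
          by (intro Bochner_Integration.integral_cong) (auto simp: algebra_simps)
        then show ?thesis using i1[of k] i2 by simp
      qed
      have "(\<lambda>k. norm (\<integral>x. complex_of_real (\<psi> k x - \<theta> x) * fourier \<phi> x \<partial>lborel)) \<longlonglongrightarrow> 0"
      proof (rule tendsto_zero_split[where a="\<integral>x. norm (fourier \<phi> x) \<partial>lborel" and K="\<lambda>\<eta>. \<eta> powr (1 - p) * B"])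
        show "\<bar>norm (\<integral>x. complex_of_real (\<psi> k x - \<theta> x) * fourier \<phi> x \<partial>lborel)\<bar>
            \<le> \<eta> * (\<integral>x. norm (fourier \<phi> x) \<partial>lborel) + \<eta> powr (1 - p) * B * (\<integral>x. norm (\<psi> k x - \<theta> x) powr p \<partial>lborel)"
          if "0 < \<eta>" for \<eta> k
          using Lp_times_schwartz_integrable(2)[OF p1 diffLp schwartz_integrable[OF f\<phi>] B(2) that, of k] by simp
      qed (use \<theta>l in \<open>auto intro!: integral_nonneg_AE\<close>)
      then show ?thesis unfolding d[symmetric] by (simp add: tendsto_norm_zero_iff LIM_zero_iff)
    qed
    ultimately show "?T (fourier \<phi>) = (\<integral>\<xi>. h \<xi> * \<phi> \<xi> \<partial>lborel)"
      unfolding distr_of_def by (rule LIMSEQ_unique[symmetric])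
  qed measurable
  let ?H = "fourier_function ?T"
  have [measurable]: "?H \<in> borel_measurable borel"
    using fourier_function_unique(1)[OF hT] unfolding has_fourier_function_def by blast
  have HT: "AE \<xi> in lborel. ?H \<xi> = h \<xi>" by (rule fourier_function_unique(2)[OF hT])
  have wH: "AE \<xi> in lborel. of_real (norm \<xi> powr t) * ?H \<xi> * \<phi> \<xi> = g \<xi> * (of_real (norm \<xi> powr (t - s)) * \<phi> \<xi>)" for t \<phi>
    using nz HT
  proof eventually_elim
    case (elim \<xi>)
    have "norm \<xi> powr t * norm \<xi> powr - s = norm \<xi> powr (t - s)" by (simp add: powr_add[symmetric])
    then have one: "complex_of_real (norm \<xi> powr t) * of_real (norm \<xi> powr - s) = of_real (norm \<xi> powr (t - s))"
      by (simp flip: of_real_mult)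
    show ?case unfolding elim(2) h_def one[symmetric] by (simp only: mult_ac)
  qed
  have w0: "AE \<xi> in lborel. of_real (norm \<xi> powr s) * ?H \<xi> * \<phi> \<xi> = g \<xi> * \<phi> \<xi>" for \<phi>
    using wH[of s \<phi>] nz by eventually_elim simp
  have defd: "frac_lap_defined s ?T"
    unfolding frac_lap_defined_def
  proof (intro conjI ballI)
    show "tempered ?T" by (rule tempered_Lp[OF _ \<theta>Lp]) (use p2 in simp)
    show "\<exists>h. has_fourier_function ?T h" using hT by blast
    fix \<phi> :: "real^'n \<Rightarrow> complex" assume \<phi>: "\<phi> \<in> schwartz"
    note [measurable] = schwartz_measurable[OF \<phi>]
    have "integrable lborel (\<lambda>\<xi>. g \<xi> * \<phi> \<xi>)"
      by (rule gint[OF schwartz_measurable[OF \<phi>] schwartz_square_integrable[OF \<phi>]])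
    then show "integrable lborel (\<lambda>\<xi>. of_real (norm \<xi> powr s) * ?H \<xi> * \<phi> \<xi>)"
      by (subst integrable_cong_AE[OF _ _ w0]) measurable
  qed
  have "\<exists>G\<in>Lp 2. \<forall>\<phi>\<in>schwartz. frac_lap s ?T \<phi> = distr_of G \<phi>"
  proof -
    \<comment> \<open>The inverse transform is the reflected transform up to the factor \<open>c\<close>, which \<open>G0\<close> absorbs.\<close>
    define G0 where "G0 \<xi> = of_real c * g (- \<xi>)" for \<xi>
    have [measurable]: "G0 \<in> borel_measurable borel" unfolding G0_def[abs_def] by measurable
    have G02: "integrable lborel (\<lambda>\<xi>. (norm (G0 \<xi>))\<^sup>2)"
      using integral_reflect(1)[of "\<lambda>\<xi>. (norm (g \<xi>))\<^sup>2"] g2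
      unfolding G0_def by (simp add: norm_mult power_mult_distrib)
    obtain k where k: "k \<in> borel_measurable borel" "integrable lborel (\<lambda>\<xi>. (norm (k \<xi>))\<^sup>2)"
      "\<And>\<phi>. \<phi> \<in> schwartz \<Longrightarrow> (\<integral>x. G0 x * fourier \<phi> x \<partial>lborel) = (\<integral>\<xi>. k \<xi> * \<phi> \<xi> \<partial>lborel)"
      using L2_fourier[OF _ G02] by auto
    have "frac_lap s ?T \<phi> = distr_of k \<phi>" if \<phi>: "\<phi> \<in> schwartz" for \<phi>
    proof -
      note [measurable] = schwartz_measurable[OF schwartz_inv_fourier[OF \<phi>]] schwartz_measurable[OF schwartz_fourier[OF \<phi>]]
      have "frac_lap s ?T \<phi> = (\<integral>\<xi>. g \<xi> * inv_fourier \<phi> \<xi> \<partial>lborel)"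
        unfolding frac_lap_def by (rule integral_cong_AE[OF _ _ w0]) measurable
      also have "\<dots> = (\<integral>\<xi>. g (- \<xi>) * inv_fourier \<phi> (- \<xi>) \<partial>lborel)"
        by (rule integral_reflect(2)[of "\<lambda>\<xi>. g \<xi> * inv_fourier \<phi> \<xi>", symmetric]) measurable
      also have "\<dots> = (\<integral>\<xi>. G0 \<xi> * fourier \<phi> \<xi> \<partial>lborel)"
        unfolding inv_fourier_eq_fourier G0_def c_def by (intro Bochner_Integration.integral_cong) auto
      finally show ?thesis unfolding k(3)[OF \<phi>] distr_of_def .
    qed
    moreover have "k \<in> Lp 2" unfolding Lp_def using k by simp
    ultimately show ?thesis by blast
  qed
  with defd have "?T \<in> Hdot s" unfolding Hdot_def by blast
  with \<theta>Lp have \<theta>H: "\<theta> \<in> Hdot_fun s" unfolding Hdot_fun_def p_def by blast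
  have "\<exists>l. (\<lambda>k. hip s (\<psi> k) \<phi>) \<longlonglongrightarrow> l \<and> frac_lap (2 * s) ?T (\<lambda>x. of_real (\<phi> x)) = of_real l"
    if \<phi>: "\<phi> \<in> test_functions" for \<phi> :: "real^'n \<Rightarrow> real"
  proof -
    let ?\<phi> = "\<lambda>x. complex_of_real (\<phi> x)"
    note [measurable] = freq_measurable[OF \<phi>, of s] schwartz_measurable[OF schwartz_inv_fourier[OF test_schwartz[OF \<phi>]]]
    have inv: "of_real (norm \<xi> powr s) * inv_fourier ?\<phi> \<xi> = of_real c * cnj (freq s \<phi> \<xi>)" for \<xi>
      unfolding inv_fourier_eq_fourier fourier_real_reflect freq_def c_def by simp
    define X where "X = frac_lap (2 * s) ?T ?\<phi>"
    have "X = (\<integral>\<xi>. g \<xi> * (of_real (norm \<xi> powr (2 * s - s)) * inv_fourier ?\<phi> \<xi>) \<partial>lborel)"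
      unfolding X_def frac_lap_def by (rule integral_cong_AE[OF _ _ wH]) measurable
    also have "\<dots> = (\<integral>\<xi>. g \<xi> * (of_real c * cnj (freq s \<phi> \<xi>)) \<partial>lborel)" using inv by simp
    finally have X: "X = (\<integral>\<xi>. g \<xi> * (of_real c * cnj (freq s \<phi> \<xi>)) \<partial>lborel)" .
    have "(\<lambda>k. \<integral>\<xi>. ?F k \<xi> * (of_real c * cnj (freq s \<phi> \<xi>)) \<partial>lborel) \<longlonglongrightarrow> X"
      unfolding X
    proof (rule pairing)
      show "integrable lborel (\<lambda>\<xi>. (norm (of_real c * cnj (freq s \<phi> \<xi>)))\<^sup>2)"
        using freq_square_integrable[OF _ _ \<phi>, of s] s by (simp add: norm_mult power_mult_distrib)
    qed measurable
    moreover have "(\<integral>\<xi>. ?F k \<xi> * (of_real c * cnj (freq s \<phi> \<xi>)) \<partial>lborel) = of_real (hip s (\<psi> k) \<phi>)" for k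
    proof -
      have "(\<integral>\<xi>. ?F k \<xi> * (of_real c * cnj (freq s \<phi> \<xi>)) \<partial>lborel) = (\<integral>\<xi>. of_real c * (?F k \<xi> * cnj (freq s \<phi> \<xi>)) \<partial>lborel)"
        by (intro Bochner_Integration.integral_cong) (auto simp: mult_ac)
      then show ?thesis unfolding hip_complex[OF \<psi> \<phi>] c_def integral_mult_right_zero by simp
    qed
    ultimately have lim: "(\<lambda>k. complex_of_real (hip s (\<psi> k) \<phi>)) \<longlonglongrightarrow> X" by simp
    from tendsto_Re[OF this] have re: "(\<lambda>k. hip s (\<psi> k) \<phi>) \<longlonglongrightarrow> Re X" by simp
    then have "(\<lambda>k. complex_of_real (hip s (\<psi> k) \<phi>)) \<longlonglongrightarrow> of_real (Re X)" by (rule tendsto_of_real)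
    from LIMSEQ_unique[OF lim this] re show ?thesis unfolding X_def by blast
  qed
  with \<theta>H \<theta>l show ?thesis by (intro bexI[of _ \<theta>] conjI ballI) auto
qed

section \<open>Galerkin approximation\<close>

context semi_inner
begin

lemma functional_sum:
  fixes e :: "nat \<Rightarrow> 'x \<Rightarrow> real" and c :: "nat \<Rightarrow> real" and N :: nat
  assumes l: "\<And>u v a b. u \<in> S \<Longrightarrow> v \<in> S \<Longrightarrow> l (\<lambda>x. a * u x + b * v x) = a * l u + b * (l v :: real)"
    and e: "\<And>k. e k \<in> S"
  shows "(\<lambda>x. \<Sum>j<N. c j * e j x) \<in> S" and "l (\<lambda>x. \<Sum>j<N. c j * e j x) = (\<Sum>j<N. c j * l (e j))"
proof (induction N)
  case 0
  show "(\<lambda>x. \<Sum>j<0. c j * e j x) \<in> S" using lincomb[OF e e, of 0 0 0 0] by simp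
  show "l (\<lambda>x. \<Sum>j<0. c j * e j x) = (\<Sum>j<0. c j * l (e j))" using l[OF e e, of 0 0 0 0] by simp
next
  case (Suc N)
  show "(\<lambda>x. \<Sum>j<Suc N. c j * e j x) \<in> S" using lincomb[OF Suc(1) e, of 1 "c N" N] by simp
  show "l (\<lambda>x. \<Sum>j<Suc N. c j * e j x) = (\<Sum>j<Suc N. c j * l (e j))"
    using l[OF Suc(1) e, of 1 "c N" N] Suc(2) by simp
qed

lemma ip_lin_right:
  "u \<in> S \<Longrightarrow> v \<in> S \<Longrightarrow> w \<in> S \<Longrightarrow> ip w (\<lambda>x. a * u x + b * v x) = a * ip w u + b * ip w v"
  using ip_lin[of u v w a b] ip_sym[of w "\<lambda>x. a * u x + b * v x"] ip_sym[of w u] ip_sym[of w v] lincomb[of u v a b]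
  by simp

text \<open>Let \<open>P\<close> be the residual of the equation, as a function of the coefficients \<open>c\<close>. Pairing it with \<open>c\<close> gives
  the energy, since \<open>b\<close> vanishes on the diagonal. The added \<open>\<epsilon> c\<close> makes the field \<open>P\<close> outward pointing on large
  spheres even when the \<open>e\<^sub>k\<close> are linearly dependent; at a zero the energy identity bounds \<open>\<epsilon> |c|\<^sup>2\<close> by \<open>M\<^sup>2\<close>, so that
  the error \<open>\<epsilon> c\<close> in the equation is of size \<open>\<surd>\<epsilon>\<close>.\<close>

theorem galerkin:
  fixes e :: "nat \<Rightarrow> 'x \<Rightarrow> real" and N :: nat
  assumes e: "\<And>k. e k \<in> S"
    and b1: "\<And>u v w \<phi> a c. u \<in> S \<Longrightarrow> v \<in> S \<Longrightarrow> w \<in> S \<Longrightarrow> \<phi> \<in> S \<Longrightarrow> b (\<lambda>x. a * u x + c * v x) w \<phi> = a * b u w \<phi> + c * (b v w \<phi> :: real)"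
    and b2: "\<And>u v w \<phi> a c. u \<in> S \<Longrightarrow> v \<in> S \<Longrightarrow> w \<in> S \<Longrightarrow> \<phi> \<in> S \<Longrightarrow> b w (\<lambda>x. a * u x + c * v x) \<phi> = a * b w u \<phi> + c * b w v \<phi>"
    and b3: "\<And>u v w \<phi> a c. u \<in> S \<Longrightarrow> v \<in> S \<Longrightarrow> w \<in> S \<Longrightarrow> \<phi> \<in> S \<Longrightarrow> b w \<phi> (\<lambda>x. a * u x + c * v x) = a * b w \<phi> u + c * b w \<phi> v"
    and b0: "\<And>u. u \<in> S \<Longrightarrow> b u u u = 0"
    and F: "\<And>u v a c. u \<in> S \<Longrightarrow> v \<in> S \<Longrightarrow> F (\<lambda>x. a * u x + c * v x) = a * F u + c * F v"
    and Fb: "\<And>u. u \<in> S \<Longrightarrow> \<bar>F u\<bar> \<le> M * sqrt (ip u u)"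
    and M: "0 \<le> M" and \<epsilon>: "0 < \<epsilon>"
  shows "\<exists>\<theta>\<in>S. ip \<theta> \<theta> \<le> M\<^sup>2 \<and> (\<forall>k<N. \<bar>ip \<theta> (e k) - b \<theta> \<theta> (e k) - F (e k)\<bar> \<le> sqrt \<epsilon> * M)"
proof -
  define \<Theta> where "\<Theta> c = (\<lambda>x. \<Sum>j<N. c j * e j x)" for c :: "nat \<Rightarrow> real"
  have \<Theta>: "\<Theta> c \<in> S" for c unfolding \<Theta>_def by (rule functional_sum(1)[OF F e])
  define P where "P c k = ip (\<Theta> c) (e k) - b (\<Theta> c) (\<Theta> c) (e k) - F (e k) + \<epsilon> * c k" for c k
  have ipe: "ip (\<Theta> c) w = (\<Sum>j<N. c j * ip (e j) w)" if "w \<in> S" for c w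
    unfolding \<Theta>_def by (rule functional_sum(2)[OF ip_lin[OF _ _ that] e])
  have be: "b (\<Theta> c) (\<Theta> c) \<phi> = (\<Sum>i<N. c i * (\<Sum>j<N. c j * b (e i) (e j) \<phi>))" if "\<phi> \<in> S" for c \<phi>
  proof -
    have "b (\<Theta> c) (\<Theta> c) \<phi> = (\<Sum>i<N. c i * b (e i) (\<Theta> c) \<phi>)"
      unfolding \<Theta>_def[of c]
      by (rule functional_sum(2)[of "\<lambda>u. b u (\<lambda>x. \<Sum>j<N. c j * e j x) \<phi>", OF b1[OF _ _ \<Theta>[unfolded \<Theta>_def] that] e])
    moreover have "b (e i) (\<Theta> c) \<phi> = (\<Sum>j<N. c j * b (e i) (e j) \<phi>)" for i
      unfolding \<Theta>_def by (rule functional_sum(2)[OF b2[OF _ _ e that] e])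
    ultimately show ?thesis by simp
  qed
  have energy: "(\<Sum>k<N. P c k * c k) = ip (\<Theta> c) (\<Theta> c) - F (\<Theta> c) + \<epsilon> * (\<Sum>k<N. (c k)\<^sup>2)" for c
  proof -
    have 1: "ip (\<Theta> c) (\<Theta> c) = (\<Sum>k<N. c k * ip (\<Theta> c) (e k))"
      by (subst (2) \<Theta>_def, rule functional_sum(2)[OF ip_lin_right[OF _ _ \<Theta>] e])
    have 2: "b (\<Theta> c) (\<Theta> c) (\<Theta> c) = (\<Sum>k<N. c k * b (\<Theta> c) (\<Theta> c) (e k))"
      by (subst (3) \<Theta>_def, rule functional_sum(2)[OF b3[OF _ _ \<Theta> \<Theta>] e])
    have 3: "F (\<Theta> c) = (\<Sum>k<N. c k * F (e k))"
      unfolding \<Theta>_def by (rule functional_sum(2)[OF F e])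
    have "(\<Sum>k<N. P c k * c k) = (\<Sum>k<N. c k * ip (\<Theta> c) (e k)) - (\<Sum>k<N. c k * b (\<Theta> c) (\<Theta> c) (e k))
        - (\<Sum>k<N. c k * F (e k)) + \<epsilon> * (\<Sum>k<N. (c k)\<^sup>2)"
      unfolding P_def by (simp add: sum_subtractf[symmetric] sum.distrib[symmetric] sum_distrib_left power2_eq_square algebra_simps)
    then show ?thesis using b0[OF \<Theta>[of c]] unfolding 1 2 3 by simp
  qed
  have Fq: "F (\<Theta> c) \<le> M * sqrt (ip (\<Theta> c) (\<Theta> c))" for c using Fb[OF \<Theta>, of c] by linarith
  have sq: "sqrt (ip (\<Theta> c) (\<Theta> c)) ^ 2 = ip (\<Theta> c) (\<Theta> c)" for c using ip_pos[OF \<Theta>] by simp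
  have young: "M * q \<le> q\<^sup>2 + M\<^sup>2 / 4" for q :: real
    using zero_le_power2[of "q - M / 2"] by (simp add: power2_diff power_divide mult_ac)
  \<comment> \<open>On this sphere \<open>\<epsilon> |c|\<^sup>2 = (M + 1)\<^sup>2\<close> exceeds the loss \<open>M\<^sup>2/4\<close> in Young's inequality.\<close>
  define \<rho> where "\<rho> = (M + 1) / sqrt \<epsilon>"
  have \<rho>: "0 < \<rho>" unfolding \<rho>_def using M \<epsilon> by simp
  have \<epsilon>\<rho>: "\<epsilon> * \<rho>\<^sup>2 = (M + 1)\<^sup>2" unfolding \<rho>_def using \<epsilon> by (simp add: power_divide)
  have "\<exists>c. (\<forall>i\<ge>N. c i = 0) \<and> (\<forall>k<N. P c k = 0)"
  proof (rule outward_field_has_zero[OF _ \<rho>])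
    fix k assume "k < N"
    have pr: "continuous_map (powertop_real UNIV) euclideanreal (\<lambda>c. c j)" for j :: nat
      by (rule continuous_map_product_projection) simp
    show "continuous_map (powertop_real UNIV) euclideanreal (\<lambda>c. P c k)"
      unfolding P_def ipe[OF e] be[OF e]
      by (intro continuous_map_add continuous_map_diff continuous_map_sum continuous_map_real_mult pr) simp_all
  next
    fix c :: "nat \<Rightarrow> real" assume "(\<Sum>i<N. (c i)\<^sup>2) = \<rho>\<^sup>2"
    then have "(\<Sum>k<N. P c k * c k) = ip (\<Theta> c) (\<Theta> c) - F (\<Theta> c) + (M + 1)\<^sup>2"
      unfolding energy using \<epsilon>\<rho> by simp
    moreover have "M\<^sup>2 / 4 < (M + 1)\<^sup>2" using M by (simp add: power2_eq_square algebra_simps add_pos_nonneg)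
    ultimately show "0 < (\<Sum>k<N. P c k * c k)"
      using Fq[of c] young[of "sqrt (ip (\<Theta> c) (\<Theta> c))"] sq[of c] by linarith
  qed
  then obtain c where c: "\<And>k. k < N \<Longrightarrow> P c k = 0" by blast
  define q where "q = sqrt (ip (\<Theta> c) (\<Theta> c))"
  have q0: "0 \<le> q" unfolding q_def using ip_pos[OF \<Theta>] by simp
  define C2 where "C2 = (\<Sum>k<N. (c k)\<^sup>2)"
  have C0: "0 \<le> C2" unfolding C2_def by (intro sum_nonneg) simp
  have en: "q\<^sup>2 + \<epsilon> * C2 \<le> M * q"
    using energy[of c] c Fq[of c] sq[of c] unfolding q_def C2_def by simp
  have qM: "q \<le> M"
  proof (cases "q = 0")
    case False
    have "q * q \<le> M * q" using en \<epsilon> C0 by (simp add: power2_eq_square add_increasing2 order_trans[rotated])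
    then show ?thesis using False q0 by simp
  qed (use M in simp)
  have C2M: "\<epsilon> * C2 \<le> M\<^sup>2"
  proof -
    have "M * q \<le> M * M" using qM M by (intro mult_left_mono) auto
    then show ?thesis using en zero_le_power2[of q] unfolding power2_eq_square[of M] by linarith
  qed
  show ?thesis
  proof (intro bexI[OF _ \<Theta>[of c]] conjI allI impI)
    have "q\<^sup>2 \<le> M\<^sup>2" using qM q0 by (intro power_mono) auto
    then show "ip (\<Theta> c) (\<Theta> c) \<le> M\<^sup>2" using sq[of c] unfolding q_def by simp
    fix k assume k: "k < N"
    have "(c k)\<^sup>2 \<le> C2" unfolding C2_def by (rule member_le_sum) (use k in auto)
    then have "\<epsilon> * (c k)\<^sup>2 \<le> M\<^sup>2" using C2M \<epsilon> by (meson mult_left_mono less_imp_le order_trans)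
    then have "sqrt (\<epsilon> * (c k)\<^sup>2) \<le> sqrt (M\<^sup>2)" by (rule real_sqrt_le_mono)
    then have "sqrt \<epsilon> * \<bar>c k\<bar> \<le> M" using M by (simp add: real_sqrt_mult)
    then have "sqrt \<epsilon> * (sqrt \<epsilon> * \<bar>c k\<bar>) \<le> sqrt \<epsilon> * M" using \<epsilon> by (intro mult_left_mono) auto
    then have "\<epsilon> * \<bar>c k\<bar> \<le> sqrt \<epsilon> * M" using \<epsilon> by (simp add: mult.assoc[symmetric])
    moreover have "ip (\<Theta> c) (e k) - b (\<Theta> c) (\<Theta> c) (e k) - F (e k) = - (\<epsilon> * c k)"
      using c[OF k] unfolding P_def by linarith
    ultimately show "\<bar>ip (\<Theta> c) (e k) - b (\<Theta> c) (\<Theta> c) (e k) - F (e k)\<bar> \<le> sqrt \<epsilon> * M"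
      using \<epsilon> by (simp add: abs_mult)
  qed
qed

text \<open>Averages of values close to the limit are close to the limit.\<close>

lemma hull_functional_limit:
  assumes l: "\<And>u v a b. u \<in> S \<Longrightarrow> v \<in> S \<Longrightarrow> l (\<lambda>x. a * u x + b * v x) = a * l u + b * (l v :: real)"
    and \<theta>: "\<And>N. \<theta> N \<in> S" and lim: "(\<lambda>N. l (\<theta> N)) \<longlonglongrightarrow> L" and \<psi>: "\<And>m. \<psi> m \<in> midpoint_hull \<theta> m"
  shows "(\<lambda>m. l (\<psi> m)) \<longlonglongrightarrow> L"
proof (rule LIMSEQ_I)
  fix e :: real assume e: "0 < e"
  obtain N where N: "\<And>n. N \<le> n \<Longrightarrow> \<bar>l (\<theta> n) - L\<bar> < e"
    using LIMSEQ_D[OF lim e] by auto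
  have "\<bar>l u - L\<bar> < e" if "N \<le> m" "u \<in> midpoint_hull \<theta> m" for u m
    using that(2)
  proof induction
    case (base n)
    then show ?case using N that(1) by simp
  next
    case (mid u v)
    have "u \<in> S" "v \<in> S" using midpoint_hull_in[OF \<theta>] mid.hyps by auto
    then show ?case unfolding l[OF \<open>u \<in> S\<close> \<open>v \<in> S\<close>] using mid.IH by linarith
  qed
  then show "\<exists>no. \<forall>m\<ge>no. norm (l (\<psi> m) - L) < e" using \<psi> by auto
qed

lemma hull_ip_le:
  assumes \<theta>: "\<And>N. \<theta> N \<in> S" and bdd: "\<And>N. ip (\<theta> N) (\<theta> N) \<le> M" and u: "u \<in> midpoint_hull \<theta> m"
  shows "ip u u \<le> M"
  using u
proof induction
  case (mid u v)
  have S: "u \<in> S" "v \<in> S" using midpoint_hull_in[OF \<theta>] mid.hyps by auto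
  have "0 \<le> ip (\<lambda>x. u x - v x) (\<lambda>x. u x - v x)" by (rule ip_pos[OF diff_in[OF S]])
  then have "2 * ip u v \<le> ip u u + ip v v" unfolding ip_diff_expand[OF S] by simp
  then show ?case unfolding ip_expand[OF S] using mid.IH by (simp add: power2_eq_square)
qed (rule bdd)

text \<open>Vectors of norm zero need an argument of their own: their multiples all lie in the unit ball.\<close>

lemma functional_bound_from_unit_ball:
  assumes l: "\<And>u v a b. u \<in> S \<Longrightarrow> v \<in> S \<Longrightarrow> l (\<lambda>x. a * u x + b * v x) = a * l u + b * (l v :: real)"
    and K: "\<And>u. u \<in> S \<Longrightarrow> ip u u \<le> 1 \<Longrightarrow> \<bar>l u\<bar> \<le> K" and u: "u \<in> S"
  shows "\<bar>l u\<bar> \<le> K * sqrt (ip u u)"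
proof -
  have sc: "\<bar>t\<bar> * \<bar>l u\<bar> \<le> K" if "t\<^sup>2 * ip u u \<le> 1" for t
  proof -
    have "ip (\<lambda>x. t * u x + 0 * u x) (\<lambda>x. t * u x + 0 * u x) \<le> 1"
      unfolding ip_expand[OF u u] using that by simp
    from K[OF lincomb[OF u u] this] show ?thesis unfolding l[OF u u] by (simp add: abs_mult)
  qed
  show ?thesis
  proof (cases "ip u u = 0")
    case True
    have "l u = 0"
    proof (rule ccontr)
      assume z: "l u \<noteq> 0"
      have "\<bar>(\<bar>K\<bar> + 1) / l u\<bar> * \<bar>l u\<bar> \<le> K" by (rule sc) (simp add: True)
      then show False using z by (simp add: abs_divide)
    qed
    then show ?thesis using True by simp
  next
    case False
    then have p: "0 < ip u u" using ip_pos[OF u] by simp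
    have "\<bar>1 / sqrt (ip u u)\<bar> * \<bar>l u\<bar> \<le> K" by (rule sc) (use p in \<open>simp add: power_divide\<close>)
    then show ?thesis using p by (simp add: pos_divide_le_eq)
  qed
qed

end

section \<open>The transport form\<close>

definition grad :: "(real^'n::finite \<Rightarrow> real) \<Rightarrow> real^'n \<Rightarrow> real^'n" where
  "grad \<phi> x = (\<chi> i. partial i \<phi> x)"

definition local_energy :: "real \<Rightarrow> (real^'n::finite \<Rightarrow> 'b::real_normed_vector) \<Rightarrow> real" where
  "local_energy \<rho> g = (\<integral>x. indicator (cball 0 \<rho>) x * (norm (g x))\<^sup>2 \<partial>lborel)"

lemma grad_continuous: "\<phi> \<in> test_functions \<Longrightarrow> continuous_on UNIV (grad \<phi>)"
  unfolding grad_def[abs_def] by (intro continuous_on_vec_lambda test_continuous test_partial)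

lemma grad_outside: "x \<notin> support \<phi> \<Longrightarrow> grad \<phi> x = 0"
  unfolding grad_def by (simp add: partial_zero_outside_support vec_eq_iff)

lemma norm_grad_le: "(\<And>i. \<bar>partial i \<phi> x\<bar> \<le> G) \<Longrightarrow> norm (grad \<phi> x) \<le> real CARD('n) * G"
  for \<phi> :: "real^'n::finite \<Rightarrow> real"
  using norm_le_l1_cart[of "grad \<phi> x"] sum_bounded_above[of UNIV "\<lambda>i. \<bar>grad \<phi> x $ i\<bar>" G]
  by (simp add: grad_def)

lemma grad_bounded: "\<phi> \<in> test_functions \<Longrightarrow> \<exists>G\<ge>0. \<forall>x. norm (grad \<phi> x) \<le> G"
proof -
  assume \<phi>: "\<phi> \<in> test_functions"
  have "support (grad \<phi>) \<subseteq> support \<phi>"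
    by (subst support_subset_iff) (simp_all add: grad_outside)
  moreover have "compact (support \<phi>)" using \<phi> by (simp add: test_functions_def)
  ultimately show ?thesis by (rule compact_support_bounded[OF grad_continuous[OF \<phi>] compact_support_mono])
qed

lemma grad_lincomb:
  assumes "\<phi> \<in> test_functions" "\<psi> \<in> test_functions"
  shows "grad (\<lambda>x. a * \<phi> x + b * \<psi> x) x = a *\<^sub>R grad \<phi> x + b *\<^sub>R grad \<psi> x"
proof -
  have d: "\<phi> differentiable_on UNIV" "\<psi> differentiable_on UNIV"
    using assms by (auto simp: test_functions_def smooth_differentiable)
  have "partial i (\<lambda>x. a * \<phi> x + b * \<psi> x) x = a * partial i \<phi> x + b * partial i \<psi> x" for i
    using d by (subst partial_add)
      (auto intro!: derivative_intros simp: partial_bounded_linear[OF bounded_linear_mult_right])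
  then show ?thesis by (simp add: grad_def vec_eq_iff)
qed

lemma local_energy_bound:
  fixes g :: "real^'n::finite \<Rightarrow> 'b::{banach, second_countable_topology}"
  assumes p: "2 < p" and g: "g \<in> Lp p"
  shows "integrable lborel (\<lambda>x. indicator (cball 0 \<rho>) x * (norm (g x))\<^sup>2)"
    and "0 < \<eta> \<Longrightarrow> local_energy \<rho> g \<le> \<eta>\<^sup>2 * measure lborel (cball (0::real^'n) \<rho>) + \<eta> powr (2 - p) * (\<integral>x. norm (g x) powr p \<partial>lborel)"
proof -
  have [measurable]: "g \<in> borel_measurable borel" and i: "integrable lborel (\<lambda>x. norm (g x) powr p)"
    using g unfolding Lp_def by auto
  let ?I = "indicator (cball 0 \<rho>) :: real^'n \<Rightarrow> real"
  have iI: "integrable lborel ?I"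
    using emeasure_lborel_cball_finite[of "0::real^'n" \<rho>] by (simp add: integrable_indicator_iff)
  have [measurable]: "?I \<in> borel_measurable borel" by (intro borel_measurable_indicator) simp
  have pt: "?I x * (norm (g x))\<^sup>2 \<le> \<eta>\<^sup>2 * ?I x + \<eta> powr (2 - p) * norm (g x) powr p" if "0 < \<eta>" for \<eta> x
  proof -
    have "(norm (g x))\<^sup>2 \<le> \<eta>\<^sup>2 + \<eta> powr (2 - p) * norm (g x) powr p"
      using le_threshold_plus_power[of "norm (g x)" \<eta> 2 p] p that by simp
    then show ?thesis by (simp add: indicator_def)
  qed
  have ib: "integrable lborel (\<lambda>x. \<eta>\<^sup>2 * ?I x + \<eta> powr (2 - p) * norm (g x) powr p)" for \<eta>
    by (intro Bochner_Integration.integrable_add integrable_mult_right iI i)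
  show i2: "integrable lborel (\<lambda>x. ?I x * (norm (g x))\<^sup>2)"
  proof (rule Bochner_Integration.integrable_bound[OF ib[of 1]])
    show "AE x in lborel. norm (?I x * (norm (g x))\<^sup>2) \<le> norm (1\<^sup>2 * ?I x + 1 powr (2 - p) * norm (g x) powr p)"
      using pt[of 1] by (intro AE_I2) (auto simp: indicator_def split: if_splits)
  qed measurable
  assume \<eta>: "0 < \<eta>"
  have "local_energy \<rho> g \<le> (\<integral>x. \<eta>\<^sup>2 * ?I x + \<eta> powr (2 - p) * norm (g x) powr p \<partial>lborel)"
    unfolding local_energy_def by (intro integral_mono i2 ib pt \<eta>)
  also have "\<dots> = \<eta>\<^sup>2 * (\<integral>x. ?I x \<partial>lborel) + \<eta> powr (2 - p) * (\<integral>x. norm (g x) powr p \<partial>lborel)"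
    using iI i by simp
  finally show "local_energy \<rho> g \<le> \<eta>\<^sup>2 * measure lborel (cball (0::real^'n) \<rho>) + \<eta> powr (2 - p) * (\<integral>x. norm (g x) powr p \<partial>lborel)"
    by simp
qed

lemma local_energy_nonneg: "0 \<le> local_energy \<rho> g"
  unfolding local_energy_def by (intro integral_nonneg_AE) auto

lemma local_energy_limit:
  fixes g :: "nat \<Rightarrow> real^'n::finite \<Rightarrow> 'b::{banach, second_countable_topology}"
  assumes p: "2 < p" and g: "\<And>k. g k \<in> Lp p" and lim: "(\<lambda>k. \<integral>x. norm (g k x) powr p \<partial>lborel) \<longlonglongrightarrow> 0"
  shows "(\<lambda>k. local_energy \<rho> (g k)) \<longlonglongrightarrow> 0"
proof (rule tendsto_zero_split[OF _ lim, where a="measure lborel (cball (0::real^'n) \<rho>)" and K="\<lambda>\<eta>. sqrt \<eta> powr (2 - p)"])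
  fix \<eta> :: real and k assume "0 < \<eta>"
  then show "\<bar>local_energy \<rho> (g k)\<bar> \<le> \<eta> * measure lborel (cball (0::real^'n) \<rho>) + sqrt \<eta> powr (2 - p) * (\<integral>x. norm (g k x) powr p \<partial>lborel)"
    using local_energy_bound(2)[OF p g, of "sqrt \<eta>" \<rho> k] local_energy_nonneg[of \<rho> "g k"] by simp
qed simp

lemma Lp_lincomb:
  fixes u v :: "real^'n::finite \<Rightarrow> real"
  assumes p: "0 < p" and u: "u \<in> Lp p" and v: "v \<in> Lp p"
  shows "(\<lambda>x. a * u x + b * v x) \<in> Lp p"
proof -
  have [measurable]: "u \<in> borel_measurable borel" "v \<in> borel_measurable borel" using u v unfolding Lp_def by auto
  have s: "integrable lborel (\<lambda>x. norm (c * w x) powr p)" if "w \<in> Lp p" for c and w :: "real^'n \<Rightarrow> real"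
    using that unfolding Lp_def by (simp add: abs_mult powr_mult)
  have "integrable lborel (\<lambda>x. norm (a * u x - (- b) * v x) powr p)"
    by (rule integrable_powr_diff[OF p _ _ s[OF u] s[OF v]]) measurable
  then show ?thesis unfolding Lp_def by simp
qed

text \<open>The velocity \<open>V u\<close> enters through its action on the Lebesgue space in which functions of finite Sobolev
  norm lie. Linearity holds only almost everywhere, as functions stand for their classes.\<close>

locale transport =
  fixes p :: real and V :: "(real^'n::finite \<Rightarrow> real) \<Rightarrow> real^'n \<Rightarrow> real^'n" and CA :: real
  assumes p: "2 < p"
    and V_Lp: "\<And>u. u \<in> Lp p \<Longrightarrow> V u \<in> Lp p"
    and V_bound: "\<And>u. u \<in> Lp p \<Longrightarrow> (\<integral>x. norm (V u x) powr p \<partial>lborel) \<le> CA * (\<integral>x. \<bar>u x\<bar> powr p \<partial>lborel)"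
    and CA: "0 \<le> CA"
    and V_lin: "\<And>u w a b. u \<in> Lp p \<Longrightarrow> w \<in> Lp p \<Longrightarrow>
      AE x in lborel. V (\<lambda>x. a * u x + b * w x) x = a *\<^sub>R V u x + b *\<^sub>R V w x"
    and V_div: "\<And>u \<phi>. u \<in> Lp p \<Longrightarrow> \<phi> \<in> test_functions \<Longrightarrow> (\<integral>x. V u x \<bullet> grad \<phi> x \<partial>lborel) = 0"
    and test_Lp: "\<And>u :: real^'n \<Rightarrow> real. u \<in> test_functions \<Longrightarrow> u \<in> Lp p"
begin

text \<open>The trilinear form of the transport term in divergence form, tested with \<open>\<phi>\<close>.\<close>

definition bform :: "(real^'n \<Rightarrow> real) \<Rightarrow> (real^'n \<Rightarrow> real) \<Rightarrow> (real^'n \<Rightarrow> real) \<Rightarrow> real" where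
  "bform u w \<phi> = (\<integral>x. w x * (V u x \<bullet> grad \<phi> x) \<partial>lborel)"

lemma bform_bound:
  assumes u: "u \<in> Lp p" and w: "w \<in> Lp p" and \<phi>: "\<phi> \<in> test_functions"
    and \<rho>: "support \<phi> \<subseteq> cball 0 \<rho>" and G: "\<And>x. norm (grad \<phi> x) \<le> G"
  shows "integrable lborel (\<lambda>x. w x * (V u x \<bullet> grad \<phi> x))"
    and "\<bar>bform u w \<phi>\<bar> \<le> G * (sqrt (local_energy \<rho> w) * sqrt (local_energy \<rho> (V u)))"
proof -
  have [measurable]: "w \<in> borel_measurable borel" "V u \<in> borel_measurable borel"
    using w V_Lp[OF u] unfolding Lp_def by auto
  have [measurable]: "grad \<phi> \<in> borel_measurable borel"
    by (rule borel_measurable_continuous_onI[OF grad_continuous[OF \<phi>]])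
  let ?I = "indicator (cball 0 \<rho>) :: real^'n \<Rightarrow> real"
  have [measurable]: "?I \<in> borel_measurable borel" by (intro borel_measurable_indicator) simp
  let ?f = "\<lambda>x. ?I x * norm (w x)" and ?g = "\<lambda>x. ?I x * norm (V u x)"
  have f2: "(norm (?f x))\<^sup>2 = ?I x * (norm (w x))\<^sup>2" and g2: "(norm (?g x))\<^sup>2 = ?I x * (norm (V u x))\<^sup>2" for x
    by (auto simp: indicator_def)
  have fi: "integrable lborel (\<lambda>x. (norm (?f x))\<^sup>2)" unfolding f2 by (rule local_energy_bound(1)[OF p w])
  have gi: "integrable lborel (\<lambda>x. (norm (?g x))\<^sup>2)" unfolding g2 by (rule local_energy_bound(1)[OF p V_Lp[OF u]])
  have fm: "?f \<in> borel_measurable lborel" "?g \<in> borel_measurable lborel" by measurable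
  note cs = square_integrable_mult[OF fm fi gi]
  have G0: "0 \<le> G" using G[of 0] norm_ge_zero order_trans by blast
  have pt: "norm (w x * (V u x \<bullet> grad \<phi> x)) \<le> G * (norm (?f x) * norm (?g x))" for x
  proof (cases "x \<in> cball 0 \<rho>")
    case True
    have "\<bar>V u x \<bullet> grad \<phi> x\<bar> \<le> norm (V u x) * norm (grad \<phi> x)" by (rule Cauchy_Schwarz_ineq2)
    also have "\<dots> \<le> norm (V u x) * G" by (intro mult_left_mono G) simp
    finally have "\<bar>w x\<bar> * \<bar>V u x \<bullet> grad \<phi> x\<bar> \<le> \<bar>w x\<bar> * (norm (V u x) * G)" by (intro mult_left_mono) auto
    then show ?thesis using True by (simp add: abs_mult mult_ac)
  next
    case False
    then have "grad \<phi> x = 0" using \<rho> by (intro grad_outside) auto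
    then show ?thesis using G0 by simp
  qed
  show i: "integrable lborel (\<lambda>x. w x * (V u x \<bullet> grad \<phi> x))"
    by (rule Bochner_Integration.integrable_bound[OF integrable_mult_right[OF cs(1), of G]])
       (use pt in \<open>auto intro: order_trans[OF _ abs_ge_self]\<close>)
  have "norm (bform u w \<phi>) \<le> (\<integral>x. norm (w x * (V u x \<bullet> grad \<phi> x)) \<partial>lborel)"
    unfolding bform_def by (rule integral_norm_bound)
  also have "\<dots> \<le> (\<integral>x. G * (norm (?f x) * norm (?g x)) \<partial>lborel)"
    by (intro integral_mono integrable_norm i integrable_mult_right cs(1) pt)
  also have "\<dots> = G * (\<integral>x. norm (?f x) * norm (?g x) \<partial>lborel)" by (rule integral_mult_right_zero)
  also have "\<dots> \<le> G * (sqrt (\<integral>x. (norm (?f x))\<^sup>2 \<partial>lborel) * sqrt (\<integral>x. (norm (?g x))\<^sup>2 \<partial>lborel))"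
    by (intro mult_left_mono cs(2) G0)
  finally show "\<bar>bform u w \<phi>\<bar> \<le> G * (sqrt (local_energy \<rho> w) * sqrt (local_energy \<rho> (V u)))"
    unfolding f2 g2 local_energy_def by simp
qed

lemma bform_integrable:
  assumes u: "u \<in> Lp p" and w: "w \<in> Lp p" and \<phi>: "\<phi> \<in> test_functions"
  shows "integrable lborel (\<lambda>x. w x * (V u x \<bullet> grad \<phi> x))"
proof -
  obtain G where G: "\<And>x. norm (grad \<phi> x) \<le> G" using grad_bounded[OF \<phi>] by blast
  obtain R :: nat where R: "support \<phi> \<subseteq> cball 0 (real R)" using test_support_ball[OF \<phi>] by blast
  show ?thesis by (rule bform_bound(1)[OF u w \<phi> R G])
qed

lemma bform_lin1:
  assumes u: "u \<in> Lp p" and v: "v \<in> Lp p" and w: "w \<in> Lp p" and \<phi>: "\<phi> \<in> test_functions"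
  shows "bform (\<lambda>x. a * u x + b * v x) w \<phi> = a * bform u w \<phi> + b * bform v w \<phi>"
proof -
  have uv: "(\<lambda>x. a * u x + b * v x) \<in> Lp p" using p by (intro Lp_lincomb u v) simp
  note i = bform_integrable[OF u w \<phi>] bform_integrable[OF v w \<phi>] bform_integrable[OF uv w \<phi>]
  have "bform (\<lambda>x. a * u x + b * v x) w \<phi>
      = (\<integral>x. a * (w x * (V u x \<bullet> grad \<phi> x)) + b * (w x * (V v x \<bullet> grad \<phi> x)) \<partial>lborel)"
    unfolding bform_def
  proof (rule integral_cong_AE)
    show "AE x in lborel. w x * (V (\<lambda>x. a * u x + b * v x) x \<bullet> grad \<phi> x)
        = a * (w x * (V u x \<bullet> grad \<phi> x)) + b * (w x * (V v x \<bullet> grad \<phi> x))"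
      using V_lin[OF u v, of a b]
      by eventually_elim (simp add: inner_add_left algebra_simps)
  qed (use i in \<open>auto intro!: borel_measurable_integrable\<close>)
  then show ?thesis unfolding bform_def using i by simp
qed

lemma bform_lin2:
  assumes u: "u \<in> Lp p" and v: "v \<in> Lp p" and w: "w \<in> Lp p" and \<phi>: "\<phi> \<in> test_functions"
  shows "bform w (\<lambda>x. a * u x + b * v x) \<phi> = a * bform w u \<phi> + b * bform w v \<phi>"
proof -
  note i = bform_integrable[OF w u \<phi>] bform_integrable[OF w v \<phi>]
  have "bform w (\<lambda>x. a * u x + b * v x) \<phi>
      = (\<integral>x. a * (u x * (V w x \<bullet> grad \<phi> x)) + b * (v x * (V w x \<bullet> grad \<phi> x)) \<partial>lborel)"
    unfolding bform_def by (intro Bochner_Integration.integral_cong) (auto simp: algebra_simps)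
  then show ?thesis unfolding bform_def using i by simp
qed

lemma bform_lin3:
  assumes u: "u \<in> Lp p" and w: "w \<in> Lp p" and \<phi>: "\<phi> \<in> test_functions" and \<psi>: "\<psi> \<in> test_functions"
  shows "bform u w (\<lambda>x. a * \<phi> x + b * \<psi> x) = a * bform u w \<phi> + b * bform u w \<psi>"
proof -
  note i = bform_integrable[OF u w \<phi>] bform_integrable[OF u w \<psi>]
  have "bform u w (\<lambda>x. a * \<phi> x + b * \<psi> x)
      = (\<integral>x. a * (w x * (V u x \<bullet> grad \<phi> x)) + b * (w x * (V u x \<bullet> grad \<psi> x)) \<partial>lborel)"
    unfolding bform_def grad_lincomb[OF \<phi> \<psi>]
    by (intro Bochner_Integration.integral_cong) (auto simp: inner_add_right algebra_simps)
  then show ?thesis unfolding bform_def using i by simp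
qed

text \<open>\<open>u \<nabla>u = \<nabla>(u\<^sup>2) / 2\<close>, and \<open>u\<^sup>2\<close> is again a test function, orthogonal to divergence free fields. This is
  the cancellation behind the energy bound.\<close>

lemma bform_diag:
  assumes u: "u \<in> test_functions"
  shows "bform u u u = 0"
proof -
  have d: "u differentiable_on UNIV" using u by (simp add: test_functions_def smooth_differentiable)
  have "grad (\<lambda>x. u x * u x) x = (2 * u x) *\<^sub>R grad u x" for x
    by (simp add: grad_def vec_eq_iff partial_mult[OF d d])
  then have "(\<integral>x. V u x \<bullet> ((2 * u x) *\<^sub>R grad u x) \<partial>lborel) = 0"
    using V_div[OF test_Lp[OF u] test_mult[OF u u]] by simp
  then have "(\<integral>x. 2 * (u x * (V u x \<bullet> grad u x)) \<partial>lborel) = 0" by (simp add: mult.assoc)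
  then show ?thesis unfolding integral_mult_right_zero bform_def by simp
qed

lemma Lp_diff: "u \<in> Lp p \<Longrightarrow> w \<in> Lp p \<Longrightarrow> (\<lambda>x. u x - w x) \<in> Lp p" for u w :: "real^'n \<Rightarrow> real"
  using Lp_lincomb[of p u w 1 "-1"] p by simp

end

section \<open>Passing to the limit in the Galerkin scheme\<close>

context transport
begin

lemma local_energy_triangle:
  fixes u v w :: "real^'n \<Rightarrow> real"
  assumes "u \<in> Lp p" "v \<in> Lp p" "w \<in> Lp p"
  shows "local_energy \<rho> (\<lambda>x. u x - w x) \<le> 2 * local_energy \<rho> (\<lambda>x. u x - v x) + 2 * local_energy \<rho> (\<lambda>x. v x - w x)"
proof -
  note i = local_energy_bound(1)[OF p Lp_diff[OF assms(1,3)], of \<rho>] local_energy_bound(1)[OF p Lp_diff[OF assms(1,2)], of \<rho>]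
    local_energy_bound(1)[OF p Lp_diff[OF assms(2,3)], of \<rho>]
  have sq: "(norm (a - c))\<^sup>2 \<le> 2 * (norm (a - b))\<^sup>2 + 2 * (norm (b - c))\<^sup>2" for a b c :: real
    using zero_le_power2[of "(a - b) - (b - c)"] by (simp add: power2_eq_square algebra_simps)
  have "local_energy \<rho> (\<lambda>x. u x - w x)
      \<le> (\<integral>x. 2 * (indicator (cball 0 \<rho>) x * (norm (u x - v x))\<^sup>2) + 2 * (indicator (cball 0 \<rho>) x * (norm (v x - w x))\<^sup>2) \<partial>lborel)"
    unfolding local_energy_def
    by (intro integral_mono i Bochner_Integration.integrable_add integrable_mult_right)
       (use sq in \<open>simp add: indicator_def\<close>)
  also have "\<dots> = 2 * local_energy \<rho> (\<lambda>x. u x - v x) + 2 * local_energy \<rho> (\<lambda>x. v x - w x)"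
    unfolding local_energy_def using i by simp
  finally show ?thesis .
qed

text \<open>The square is convex, so a bound for the distances to the members of a tail passes to their midpoints.\<close>

lemma hull_local_energy_le:
  fixes w :: "real^'n \<Rightarrow> real" and \<theta> :: "nat \<Rightarrow> real^'n \<Rightarrow> real"
  assumes w: "w \<in> Lp p" and \<theta>: "\<And>N. \<theta> N \<in> test_functions"
    and le: "\<And>k. m \<le> k \<Longrightarrow> local_energy \<rho> (\<lambda>x. w x - \<theta> k x) \<le> e" and u: "u \<in> midpoint_hull \<theta> m"
  shows "u \<in> test_functions \<and> local_energy \<rho> (\<lambda>x. w x - u x) \<le> e"
  using u
proof induction
  case (base k)
  then show ?case using \<theta> le by simp
next
  case (mid u v)
  then have t: "u \<in> test_functions" "v \<in> test_functions" by auto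
  have t': "(\<lambda>x. 1/2 * u x + 1/2 * v x) \<in> test_functions" by (rule test_lincomb[OF t])
  note i = local_energy_bound(1)[OF p Lp_diff[OF w test_Lp[OF t'] ], of \<rho>] local_energy_bound(1)[OF p Lp_diff[OF w test_Lp[OF t(1)]], of \<rho>]
    local_energy_bound(1)[OF p Lp_diff[OF w test_Lp[OF t(2)]], of \<rho>]
  have sq: "(norm (a - (1/2 * b + 1/2 * c)))\<^sup>2 \<le> 1/2 * (norm (a - b))\<^sup>2 + 1/2 * (norm (a - c))\<^sup>2" for a b c :: real
    using zero_le_power2[of "b - c"] by (simp add: power2_eq_square algebra_simps)
  have "local_energy \<rho> (\<lambda>x. w x - (1/2 * u x + 1/2 * v x))
      \<le> (\<integral>x. 1/2 * (indicator (cball 0 \<rho>) x * (norm (w x - u x))\<^sup>2) + 1/2 * (indicator (cball 0 \<rho>) x * (norm (w x - v x))\<^sup>2) \<partial>lborel)"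
    unfolding local_energy_def
    by (intro integral_mono i Bochner_Integration.integrable_add integrable_mult_right)
       (use sq in \<open>simp add: indicator_def\<close>)
  also have "\<dots> = 1/2 * local_energy \<rho> (\<lambda>x. w x - u x) + 1/2 * local_energy \<rho> (\<lambda>x. w x - v x)"
    unfolding local_energy_def using i by simp
  also have "\<dots> \<le> e" using mid.IH by simp
  finally show ?case using t' by simp
qed

lemma bform_diff1:
  "u \<in> Lp p \<Longrightarrow> v \<in> Lp p \<Longrightarrow> w \<in> Lp p \<Longrightarrow> \<phi> \<in> test_functions \<Longrightarrow>
    bform (\<lambda>x. u x - v x) w \<phi> = bform u w \<phi> - bform v w \<phi>"
  using bform_lin1[of u v w \<phi> 1 "-1"] by simp

lemma bform_diff2:
  "u \<in> Lp p \<Longrightarrow> v \<in> Lp p \<Longrightarrow> w \<in> Lp p \<Longrightarrow> \<phi> \<in> test_functions \<Longrightarrow>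
    bform w (\<lambda>x. u x - v x) \<phi> = bform w u \<phi> - bform w v \<phi>"
  using bform_lin2[of u v w \<phi> 1 "-1"] by simp

lemma bform_diff3:
  "u \<in> Lp p \<Longrightarrow> w \<in> Lp p \<Longrightarrow> \<phi> \<in> test_functions \<Longrightarrow> \<psi> \<in> test_functions \<Longrightarrow>
    bform u w (\<lambda>x. \<phi> x - \<psi> x) = bform u w \<phi> - bform u w \<psi>"
  using bform_lin3[of u w \<phi> \<psi> 1 "-1"] by simp

end

lemma integral_square_le_of_support:
  fixes g :: "real^'n::finite \<Rightarrow> real"
  assumes b: "\<And>x. \<bar>g x\<bar> \<le> \<delta>" and o: "\<And>x. x \<notin> cball 0 R \<Longrightarrow> g x = 0"
  shows "(\<integral>x. (g x)\<^sup>2 \<partial>lborel) \<le> \<delta>\<^sup>2 * measure lborel (cball (0::real^'n) R)"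
proof -
  have iI: "integrable lborel (indicator (cball 0 R) :: real^'n \<Rightarrow> real)"
    using emeasure_lborel_cball_finite[of "0::real^'n" R] by (simp add: integrable_indicator_iff)
  have "(\<integral>x. (g x)\<^sup>2 \<partial>lborel) \<le> (\<integral>(x::real^'n). \<delta>\<^sup>2 * indicator (cball 0 R) x \<partial>lborel)"
  proof (rule Bochner_Integration.integral_mono')
    show "(g x)\<^sup>2 \<le> \<delta>\<^sup>2 * indicator (cball 0 R) x" for x :: "real^'n"
    proof (cases "x \<in> cball 0 R")
      case True
      have "\<bar>g x\<bar>\<^sup>2 \<le> \<delta>\<^sup>2" using b[of x] by (intro power_mono) auto
      then show ?thesis using True by simp
    qed (simp add: o)
  qed (use iI in auto)
  then show ?thesis using iI by simp
qed

lemma test_dense_sequence_hip: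
  assumes s: "0 \<le> s" "s \<le> 1"
  shows "\<exists>e::nat \<Rightarrow> real^'n::finite \<Rightarrow> real. (\<forall>k. e k \<in> test_functions) \<and>
    (\<forall>\<phi>\<in>test_functions. \<exists>R::nat. \<forall>\<epsilon>>0. \<exists>k. support (\<lambda>x. \<phi> x - e k x) \<subseteq> cball 0 (real R) \<and>
      hip s (\<lambda>x. \<phi> x - e k x) (\<lambda>x. \<phi> x - e k x) < \<epsilon> \<and> (\<forall>x. norm (grad (\<lambda>x. \<phi> x - e k x) x) \<le> \<epsilon>))"
proof -
  obtain e :: "nat \<Rightarrow> real^'n \<Rightarrow> real" where e: "(\<forall>k. e k \<in> test_functions) \<and>
    (\<forall>\<phi>\<in>test_functions. \<exists>R::nat. \<forall>\<epsilon>>0. \<exists>k. support \<phi> \<subseteq> cball 0 (real R) \<and> support (e k) \<subseteq> cball 0 (real R) \<and>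
      (\<forall>x. \<bar>\<phi> x - e k x\<bar> \<le> \<epsilon>) \<and> (\<forall>i x. \<bar>partial i \<phi> x - partial i (e k) x\<bar> \<le> \<epsilon>))"
    using test_dense_sequence ..
  note et = conjunct1[OF e, rule_format]
  have "\<exists>R::nat. \<forall>\<epsilon>>0. \<exists>k. support (\<lambda>x. \<phi> x - e k x) \<subseteq> cball 0 (real R) \<and>
      hip s (\<lambda>x. \<phi> x - e k x) (\<lambda>x. \<phi> x - e k x) < \<epsilon> \<and> (\<forall>x. norm (grad (\<lambda>x. \<phi> x - e k x) x) \<le> \<epsilon>)"
    if \<phi>: "\<phi> \<in> test_functions" for \<phi> :: "real^'n \<Rightarrow> real"
  proof -
    obtain R :: nat where R: "\<forall>\<epsilon>>0. \<exists>k. support \<phi> \<subseteq> cball 0 (real R) \<and> support (e k) \<subseteq> cball 0 (real R) \<and>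
      (\<forall>x. \<bar>\<phi> x - e k x\<bar> \<le> \<epsilon>) \<and> (\<forall>i x. \<bar>partial i \<phi> x - partial i (e k) x\<bar> \<le> \<epsilon>)"
      using conjunct2[OF e, rule_format, OF \<phi>] ..
    define n where "n = real CARD('n)"
    define v where "v = measure lborel (cball (0::real^'n) (real R))"
    define W where "W = n + (1 + n) * v + 1"
    have n0: "0 \<le> n" and v0: "0 \<le> v" unfolding n_def v_def by auto
    have nv: "0 \<le> (1 + n) * v" using n0 v0 by simp
    have W: "0 < W" "n \<le> W" "(1 + n) * v \<le> W" unfolding W_def using n0 nv by auto
    have "\<exists>k. support (\<lambda>x. \<phi> x - e k x) \<subseteq> cball 0 (real R) \<and>
      hip s (\<lambda>x. \<phi> x - e k x) (\<lambda>x. \<phi> x - e k x) < \<epsilon> \<and> (\<forall>x. norm (grad (\<lambda>x. \<phi> x - e k x) x) \<le> \<epsilon>)"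
      if \<epsilon>: "0 < \<epsilon>" for \<epsilon>
    proof -
      define \<delta> where "\<delta> = min 1 (\<epsilon> / (2 * W))"
      have \<delta>: "0 < \<delta>" "\<delta> \<le> 1" unfolding \<delta>_def using \<epsilon> W by auto
      have W\<delta>: "W * \<delta> \<le> \<epsilon> / 2"
      proof -
        have "W * \<delta> \<le> W * (\<epsilon> / (2 * W))" unfolding \<delta>_def using W by (intro mult_left_mono) auto
        then show ?thesis using W by simp
      qed
      obtain k where k: "support \<phi> \<subseteq> cball 0 (real R) \<and> support (e k) \<subseteq> cball 0 (real R) \<and>
        (\<forall>x. \<bar>\<phi> x - e k x\<bar> \<le> \<delta>) \<and> (\<forall>i x. \<bar>partial i \<phi> x - partial i (e k) x\<bar> \<le> \<delta>)"
        using R[rule_format, OF \<delta>(1)] ..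
      note k1 = conjunct1[OF k] and k2 = conjunct1[OF conjunct2[OF k]]
        and k3 = conjunct1[OF conjunct2[OF conjunct2[OF k]], rule_format]
        and k4 = conjunct2[OF conjunct2[OF conjunct2[OF k]], rule_format]
      let ?d = "\<lambda>x. \<phi> x - e k x"
      have dt: "?d \<in> test_functions" by (rule test_diff[OF \<phi> et])
      have sd: "support ?d \<subseteq> cball 0 (real R)"
      proof (subst support_subset_iff)
        show "closed (cball (0::real^'n) (real R))" by simp
        show "\<forall>x. x \<notin> cball 0 (real R) \<longrightarrow> ?d x = 0"
        proof (intro allI impI)
          fix x :: "real^'n" assume "x \<notin> cball 0 (real R)"
          then have o: "x \<notin> support \<phi>" "x \<notin> support (e k)" using k1 k2 by blast+
          show "?d x = 0" using not_in_support[OF o(1)] not_in_support[OF o(2)] by simp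
        qed
      qed
      have gd: "grad ?d x = grad \<phi> x - grad (e k) x" for x
        using grad_lincomb[OF \<phi> et, of 1 "-1" k x] by simp
      have pd: "partial i ?d x = partial i \<phi> x - partial i (e k) x" for i x
        using arg_cong[OF gd[of x], of "\<lambda>z. z $ i"] by (simp add: grad_def)
      have po: "partial i ?d x = 0" if "x \<notin> cball 0 (real R)" for i x
        using sd that by (intro partial_zero_outside_support) auto
      have do: "?d x = 0" if "x \<notin> cball 0 (real R)" for x
      proof -
        have "x \<notin> support ?d" using sd that by blast
        then show ?thesis by (rule not_in_support)
      qed
      have i1: "(\<integral>x. (?d x)\<^sup>2 \<partial>lborel) \<le> \<delta>\<^sup>2 * v"
        unfolding v_def by (rule integral_square_le_of_support[OF k3 do])
      have i2: "(\<integral>x. (partial i ?d x)\<^sup>2 \<partial>lborel) \<le> \<delta>\<^sup>2 * v" for i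
        unfolding v_def by (rule integral_square_le_of_support[OF _ po]) (simp add: pd k4)
      have "hip s ?d ?d \<le> (\<integral>x. (?d x)\<^sup>2 \<partial>lborel) + (\<Sum>i\<in>UNIV. \<integral>x. (partial i ?d x)\<^sup>2 \<partial>lborel)"
        by (rule hip_le_H1[OF s dt])
      also have "\<dots> \<le> \<delta>\<^sup>2 * v + (\<Sum>i\<in>(UNIV::'n set). \<delta>\<^sup>2 * v)"
        by (intro add_mono sum_mono i1 i2)
      also have "\<dots> = \<delta> * \<delta> * ((1 + n) * v)" unfolding n_def by (simp add: power2_eq_square algebra_simps)
      also have "\<dots> \<le> 1 * \<delta> * W" using \<delta> W nv by (intro mult_mono) auto
      also have "\<dots> < \<epsilon>" using W\<delta> \<epsilon> by (simp add: mult.commute)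
      finally have h: "hip s ?d ?d < \<epsilon>" .
      have "norm (grad ?d x) \<le> \<epsilon>" for x
      proof -
        have "norm (grad ?d x) \<le> n * \<delta>" unfolding n_def by (rule norm_grad_le) (use pd k4 in auto)
        also have "\<dots> \<le> W * \<delta>" using W \<delta> by (intro mult_right_mono) auto
        finally show ?thesis using W\<delta> \<epsilon> by linarith
      qed
      with sd h show ?thesis by (intro exI[of _ k] conjI allI)
    qed
    then show ?thesis by (rule exI[of _ R, OF allI, OF impI])
  qed
  with et show ?thesis by (intro exI[of _ e] conjI allI ballI)
qed

text \<open>The force appears as a functional \<open>F\<close> on test functions, bounded by \<open>M\<close> for the form \<open>hip\<close>.\<close>

locale stationary_problem = transport p V CA
  for p :: real and V :: "(real^'n::finite \<Rightarrow> real) \<Rightarrow> real^'n \<Rightarrow> real^'n" and CA :: real +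
  fixes s M :: real and F :: "(real^'n \<Rightarrow> real) \<Rightarrow> real"
  assumes s: "0 < s" "s \<le> 1" "2 * s < CARD('n)"
    and p_eq: "p = 2 * real CARD('n) / (real CARD('n) - 2 * s)"
    and F_lin: "\<And>u v a c. u \<in> test_functions \<Longrightarrow> v \<in> test_functions \<Longrightarrow> F (\<lambda>x. a * u x + c * v x) = a * F u + c * F v"
    and F_bound: "\<And>u. u \<in> test_functions \<Longrightarrow> \<bar>F u\<bar> \<le> M * sqrt (hip s u u)"
    and M: "0 \<le> M"
begin

lemma s_le: "0 \<le> s" "s \<le> 1"
  using s by auto

sublocale semi_inner "test_functions :: (real^'n \<Rightarrow> real) set" "hip s"
  by (rule semi_inner_hip[OF s_le])

text \<open>Convergence under every bounded linear functional, without reference to a limit.\<close>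

definition weakly_convergent :: "(nat \<Rightarrow> real^'n \<Rightarrow> real) \<Rightarrow> bool" where
  "weakly_convergent \<theta> \<longleftrightarrow> (\<forall>l C. (\<forall>u\<in>test_functions. \<forall>v\<in>test_functions. \<forall>a b.
        l (\<lambda>x. a * u x + b * v x) = a * l u + b * (l v :: real)) \<longrightarrow>
      (\<forall>u\<in>test_functions. \<bar>l u\<bar> \<le> C * sqrt (hip s u u)) \<longrightarrow> convergent (\<lambda>N. l (\<theta> N)))"

lemma local_energy_on_balls:
  assumes K: "0 \<le> K"
  shows "\<exists>L\<ge>0. \<forall>u\<in>test_functions. hip s u u \<le> K \<longrightarrow> local_energy \<rho> (V u) \<le> L"
proof -
  obtain C where C: "C \<ge> 0 \<and> (\<forall>u\<in>(test_functions :: (real^'n \<Rightarrow> real) set). integrable lborel (\<lambda>x. \<bar>u x\<bar> powr p) \<and>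
      (\<integral>x. \<bar>u x\<bar> powr p \<partial>lborel) \<le> C * hip s u u powr (p / 2))"
    using sobolev_inequality_integral(2)[where 'n='n, OF s, folded p_eq] ..
  note C0 = conjunct1[OF C] and Cb = conjunct2[OF conjunct2[OF C, rule_format]]
  define L where "L = measure lborel (cball (0::real^'n) \<rho>) + CA * (C * K powr (p / 2))"
  have L0: "0 \<le> L" unfolding L_def using CA C0 by simp
  have "local_energy \<rho> (V u) \<le> L" if u: "u \<in> test_functions" and uK: "hip s u u \<le> K" for u
  proof -
    note uL = test_Lp[OF u]
    have "hip s u u powr (p / 2) \<le> K powr (p / 2)" using uK ip_pos[OF u] p by (intro powr_mono2) auto
    then have "C * hip s u u powr (p / 2) \<le> C * K powr (p / 2)" using C0 by (intro mult_left_mono)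
    then have "(\<integral>x. \<bar>u x\<bar> powr p \<partial>lborel) \<le> C * K powr (p / 2)" using Cb[OF u] by simp
    then have "CA * (\<integral>x. \<bar>u x\<bar> powr p \<partial>lborel) \<le> CA * (C * K powr (p / 2))" using CA by (intro mult_left_mono)
    then show ?thesis
      using local_energy_bound(2)[OF p V_Lp[OF uL], of 1 \<rho>] V_bound[OF uL] unfolding L_def by simp
  qed
  with L0 show ?thesis by (intro exI[of _ L] conjI ballI impI)
qed

context
  fixes \<theta> \<psi> :: "nat \<Rightarrow> real^'n \<Rightarrow> real" and K :: real and \<Theta> :: "real^'n \<Rightarrow> real"
  assumes \<theta>: "\<And>N. \<theta> N \<in> test_functions" and bdd: "\<And>N. hip s (\<theta> N) (\<theta> N) \<le> K"
    and weak: "weakly_convergent \<theta>" and \<psi>: "\<And>m. \<psi> m \<in> midpoint_hull \<theta> m"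
    and \<Theta>: "\<Theta> \<in> Lp p" and lim: "(\<lambda>k. \<integral>x. \<bar>\<psi> k x - \<Theta> x\<bar> powr p \<partial>lborel) \<longlonglongrightarrow> 0"
begin

lemma \<psi>_test: "\<psi> m \<in> test_functions"
  by (rule midpoint_hull_in[OF \<theta> \<psi>])

text \<open>The tail is Cauchy on the ball by \<open>rellich\<close>, so \<open>\<theta> N\<close> is close to every average of later members, in
  particular to \<open>\<psi> m\<close>, and \<open>\<psi> m\<close> is close to \<open>\<Theta>\<close>. This identifies the local limit of \<open>\<theta>\<close> with \<open>\<Theta>\<close>.\<close>

lemma local_energy_converges: "(\<lambda>N. local_energy \<rho> (\<lambda>x. \<theta> N x - \<Theta> x)) \<longlonglongrightarrow> 0"
proof (rule LIMSEQ_I)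
  fix e :: real assume "0 < e"
  then have e: "0 < e / 8" by simp
  have "\<exists>N0. \<forall>m\<ge>N0. \<forall>k\<ge>N0. (\<integral>x. indicator (cball 0 \<rho>) x * (\<theta> m x - \<theta> k x)\<^sup>2 \<partial>lborel) < e / 8"
  proof (rule rellich[OF s \<theta> bdd _ e])
    fix l C
    assume "\<And>u v a b. u \<in> test_functions \<Longrightarrow> v \<in> test_functions \<Longrightarrow>
        l (\<lambda>x. a * u x + b * v x) = a * l u + b * (l v :: real)"
      and "\<And>u :: real^'n \<Rightarrow> real. u \<in> test_functions \<Longrightarrow> \<bar>l u\<bar> \<le> C * sqrt (hip s u u)"
    then show "convergent (\<lambda>N. l (\<theta> N))"
      by (intro weak[unfolded weakly_convergent_def, rule_format, of l C])
  qed
  then obtain N0 where N0: "\<forall>m\<ge>N0. \<forall>k\<ge>N0. (\<integral>x. indicator (cball 0 \<rho>) x * (\<theta> m x - \<theta> k x)\<^sup>2 \<partial>lborel) < e / 8" ..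
  have "(\<lambda>k. local_energy \<rho> (\<lambda>x. \<psi> k x - \<Theta> x)) \<longlonglongrightarrow> 0"
    using lim by (intro local_energy_limit[OF p Lp_diff[OF test_Lp[OF \<psi>_test] \<Theta>]]) simp
  from order_tendstoD(2)[OF this e]
  obtain N1 where N1: "\<And>k. N1 \<le> k \<Longrightarrow> local_energy \<rho> (\<lambda>x. \<psi> k x - \<Theta> x) < e / 8"
    unfolding eventually_sequentially by blast
  define m where "m = max N0 N1"
  have "local_energy \<rho> (\<lambda>x. \<theta> N x - \<Theta> x) < e" if N: "N0 \<le> N" for N
  proof -
    have "local_energy \<rho> (\<lambda>x. \<theta> N x - \<psi> m x) \<le> e / 8"
    proof (rule conjunct2[OF hull_local_energy_le[OF test_Lp[OF \<theta>] \<theta> _ \<psi>]])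
      fix k assume "m \<le> k"
      then have "N0 \<le> k" unfolding m_def by simp
      with N0[rule_format, OF N this] show "local_energy \<rho> (\<lambda>x. \<theta> N x - \<theta> k x) \<le> e / 8"
        unfolding local_energy_def by simp
    qed
    moreover have "local_energy \<rho> (\<lambda>x. \<psi> m x - \<Theta> x) < e / 8" by (rule N1) (simp add: m_def)
    ultimately show ?thesis
      using local_energy_triangle[OF test_Lp[OF \<theta>] test_Lp[OF \<psi>_test] \<Theta>, of \<rho> N m] e by linarith
  qed
  then show "\<exists>no. \<forall>N\<ge>no. norm (local_energy \<rho> (\<lambda>x. \<theta> N x - \<Theta> x) - 0) < e"
    by (intro exI[of _ N0]) (simp add: abs_of_nonneg[OF local_energy_nonneg])
qed

text \<open>The velocity is nonlocal, so \<open>V (\<theta> N)\<close> need not converge strongly even on balls. In \<open>first\<close> it is merely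
  bounded and multiplies a factor that tends to zero; in \<open>second\<close> only weak convergence of \<open>\<theta> N\<close> is used, and the limit is
  identified along the strongly convergent averages \<open>\<psi> m\<close>.\<close>

lemma bform_converges:
  assumes \<phi>: "\<phi> \<in> test_functions"
  shows "(\<lambda>N. bform (\<theta> N) (\<theta> N) \<phi>) \<longlonglongrightarrow> bform \<Theta> \<Theta> \<phi>"
proof -
  obtain G where G: "G \<ge> 0 \<and> (\<forall>x. norm (grad \<phi> x) \<le> G)" using grad_bounded[OF \<phi>] ..
  note G0 = conjunct1[OF G] and Gb = conjunct2[OF G, rule_format]
  obtain R :: nat where R: "support \<phi> \<subseteq> cball 0 (real R)" using test_support_ball[OF \<phi>] by blast
  note bb = bform_bound(2)[OF _ _ \<phi> R Gb]
  have K0: "0 \<le> K" using bdd[of 0] ip_pos[OF \<theta>[of 0]] by simp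
  note \<theta>L = test_Lp[OF \<theta>] and \<psi>L = test_Lp[OF \<psi>_test]
  have first: "(\<lambda>N. bform (\<theta> N) (\<lambda>x. \<theta> N x - \<Theta> x) \<phi>) \<longlonglongrightarrow> 0"
  proof -
    obtain L where L: "L \<ge> 0 \<and> (\<forall>u\<in>test_functions. hip s u u \<le> K \<longrightarrow> local_energy (real R) (V u) \<le> L)"
      using local_energy_on_balls[OF K0] ..
    have "(\<lambda>N. G * (sqrt (local_energy (real R) (\<lambda>x. \<theta> N x - \<Theta> x)) * sqrt L)) \<longlonglongrightarrow> G * (sqrt 0 * sqrt L)"
      by (intro tendsto_intros local_energy_converges)
    then have z: "(\<lambda>N. G * (sqrt (local_energy (real R) (\<lambda>x. \<theta> N x - \<Theta> x)) * sqrt L)) \<longlonglongrightarrow> 0" by simp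
    show ?thesis
    proof (rule Lim_null_comparison[OF _ z], intro always_eventually allI)
      fix N
      have "sqrt (local_energy (real R) (V (\<theta> N))) \<le> sqrt L"
        using conjunct2[OF L, rule_format, OF \<theta> bdd] by simp
      then have "G * (sqrt (local_energy (real R) (\<lambda>x. \<theta> N x - \<Theta> x)) * sqrt (local_energy (real R) (V (\<theta> N))))
          \<le> G * (sqrt (local_energy (real R) (\<lambda>x. \<theta> N x - \<Theta> x)) * sqrt L)"
        using G0 local_energy_nonneg by (intro mult_left_mono) auto
      then show "norm (bform (\<theta> N) (\<lambda>x. \<theta> N x - \<Theta> x) \<phi>) \<le> G * (sqrt (local_energy (real R) (\<lambda>x. \<theta> N x - \<Theta> x)) * sqrt L)"
        using bb[OF \<theta>L Lp_diff[OF \<theta>L \<Theta>], of N N] by simp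
    qed
  qed
  have second: "(\<lambda>N. bform (\<theta> N) \<Theta> \<phi>) \<longlonglongrightarrow> bform \<Theta> \<Theta> \<phi>"
  proof -
    let ?l = "\<lambda>u. bform u \<Theta> \<phi>"
    have lin: "?l (\<lambda>x. a * u x + b * v x) = a * ?l u + b * ?l v" if "u \<in> test_functions" "v \<in> test_functions" for u v a b
      by (rule bform_lin1[OF test_Lp[OF that(1)] test_Lp[OF that(2)] \<Theta> \<phi>])
    obtain L where L: "L \<ge> 0 \<and> (\<forall>u\<in>test_functions. hip s u u \<le> 1 \<longrightarrow> local_energy (real R) (V u) \<le> L)"
      using local_energy_on_balls[of 1] by auto
    define B where "B = G * (sqrt (local_energy (real R) \<Theta>) * sqrt L)"
    have lb: "\<bar>?l u\<bar> \<le> B * sqrt (hip s u u)" if "u \<in> test_functions" for u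
    proof (rule functional_bound_from_unit_ball[OF lin _ that])
      fix u :: "real^'n \<Rightarrow> real" assume u: "u \<in> test_functions" "hip s u u \<le> 1"
      have "sqrt (local_energy (real R) (V u)) \<le> sqrt L"
        using conjunct2[OF L, rule_format, OF u] by simp
      then have "G * (sqrt (local_energy (real R) \<Theta>) * sqrt (local_energy (real R) (V u))) \<le> B"
        unfolding B_def using G0 local_energy_nonneg by (intro mult_left_mono) auto
      then show "\<bar>?l u\<bar> \<le> B" using bb[OF test_Lp[OF u(1)] \<Theta>] by simp
    qed
    have "convergent (\<lambda>N. ?l (\<theta> N))"
      by (intro weak[unfolded weakly_convergent_def, rule_format, of ?l B] lin lb)
    then obtain Y where l\<theta>: "(\<lambda>N. ?l (\<theta> N)) \<longlonglongrightarrow> Y" using convergentD by blast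
    have l\<psi>: "(\<lambda>m. ?l (\<psi> m)) \<longlonglongrightarrow> Y" by (rule hull_functional_limit[of ?l, OF lin \<theta> l\<theta> \<psi>])
    have dL: "(\<lambda>x. \<psi> m x - \<Theta> x) \<in> Lp p" for m by (rule Lp_diff[OF \<psi>L \<Theta>])
    have VL: "(\<lambda>m. \<integral>x. norm (V (\<lambda>x. \<psi> m x - \<Theta> x) x) powr p \<partial>lborel) \<longlonglongrightarrow> 0"
    proof -
      have "(\<lambda>m. CA * (\<integral>x. \<bar>\<psi> m x - \<Theta> x\<bar> powr p \<partial>lborel)) \<longlonglongrightarrow> CA * 0" by (intro tendsto_intros lim)
      then have z: "(\<lambda>m. CA * (\<integral>x. \<bar>\<psi> m x - \<Theta> x\<bar> powr p \<partial>lborel)) \<longlonglongrightarrow> 0" by simp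
      show ?thesis
      proof (rule Lim_null_comparison[OF _ z], intro always_eventually allI)
        fix m
        have "0 \<le> (\<integral>x. norm (V (\<lambda>x. \<psi> m x - \<Theta> x) x) powr p \<partial>lborel)" by (intro integral_nonneg_AE) auto
        then show "norm (\<integral>x. norm (V (\<lambda>x. \<psi> m x - \<Theta> x) x) powr p \<partial>lborel)
            \<le> CA * (\<integral>x. \<bar>\<psi> m x - \<Theta> x\<bar> powr p \<partial>lborel)"
          using V_bound[OF dL, of m] by simp
      qed
    qed
    have "(\<lambda>m. local_energy (real R) (V (\<lambda>x. \<psi> m x - \<Theta> x))) \<longlonglongrightarrow> 0"
      by (rule local_energy_limit[OF p V_Lp[OF dL] VL])
    then have "(\<lambda>m. G * (sqrt (local_energy (real R) \<Theta>) * sqrt (local_energy (real R) (V (\<lambda>x. \<psi> m x - \<Theta> x)))))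
        \<longlonglongrightarrow> G * (sqrt (local_energy (real R) \<Theta>) * sqrt 0)"
      by (intro tendsto_intros)
    then have z: "(\<lambda>m. G * (sqrt (local_energy (real R) \<Theta>) * sqrt (local_energy (real R) (V (\<lambda>x. \<psi> m x - \<Theta> x)))))
        \<longlonglongrightarrow> 0" by simp
    have "(\<lambda>m. bform (\<lambda>x. \<psi> m x - \<Theta> x) \<Theta> \<phi>) \<longlonglongrightarrow> 0"
      by (rule Lim_null_comparison[OF _ z], intro always_eventually allI) (use bb[OF dL \<Theta>] in simp)
    then have "(\<lambda>m. ?l (\<psi> m) - bform \<Theta> \<Theta> \<phi>) \<longlonglongrightarrow> 0"
      unfolding bform_diff1[OF \<psi>L \<Theta> \<Theta> \<phi>] .
    then have "(\<lambda>m. ?l (\<psi> m)) \<longlonglongrightarrow> bform \<Theta> \<Theta> \<phi>" by (rule LIM_zero_cancel)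
    with l\<psi> have "Y = bform \<Theta> \<Theta> \<phi>" by (rule LIMSEQ_unique)
    then show ?thesis using l\<theta> by simp
  qed
  have "bform (\<theta> N) (\<lambda>x. \<theta> N x - \<Theta> x) \<phi> + bform (\<theta> N) \<Theta> \<phi> = bform (\<theta> N) (\<theta> N) \<phi>" for N
    unfolding bform_diff2[OF \<theta>L \<Theta> \<theta>L \<phi>] by simp
  then show ?thesis using tendsto_add[OF first second] by simp
qed

end

lemma galerkin_sequence:
  assumes e: "\<And>k. e k \<in> test_functions"
  shows "\<exists>\<theta>. (\<forall>N. \<theta> N \<in> test_functions \<and> hip s (\<theta> N) (\<theta> N) \<le> M\<^sup>2 \<and>
    (\<forall>k<N. \<bar>hip s (\<theta> N) (e k) - bform (\<theta> N) (\<theta> N) (e k) - F (e k)\<bar> \<le> sqrt (1 / real (Suc N)) * M))"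
proof -
  have "\<exists>\<theta>\<in>test_functions. hip s \<theta> \<theta> \<le> M\<^sup>2 \<and>
    (\<forall>k<N. \<bar>hip s \<theta> (e k) - bform \<theta> \<theta> (e k) - F (e k)\<bar> \<le> sqrt (1 / real (Suc N)) * M)" for N
    by (rule galerkin[of e bform F M "1 / real (Suc N)" N])
       (simp_all add: e bform_lin1 bform_lin2 bform_lin3 bform_diag test_Lp F_lin F_bound M)
  then show ?thesis by (intro choice allI) (simp add: Bex_def)
qed

theorem solution_exists:
  "\<exists>\<Theta>\<in>Hdot_fun s. \<forall>\<phi>\<in>test_functions.
    frac_lap (2 * s) (distr_of (\<lambda>x. of_real (\<Theta> x))) (\<lambda>x. of_real (\<phi> x)) = of_real (bform \<Theta> \<Theta> \<phi> + F \<phi>)"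
proof -
  obtain e :: "nat \<Rightarrow> real^'n \<Rightarrow> real" where e: "(\<forall>k. e k \<in> test_functions) \<and>
    (\<forall>\<phi>\<in>test_functions. \<exists>R::nat. \<forall>\<epsilon>>0. \<exists>k. support (\<lambda>x. \<phi> x - e k x) \<subseteq> cball 0 (real R) \<and>
      hip s (\<lambda>x. \<phi> x - e k x) (\<lambda>x. \<phi> x - e k x) < \<epsilon> \<and> (\<forall>x. norm (grad (\<lambda>x. \<phi> x - e k x) x) \<le> \<epsilon>))"
    using test_dense_sequence_hip[where 'n='n, OF s_le] ..
  note et = conjunct1[OF e, rule_format] and ed = conjunct2[OF e, rule_format]
  obtain \<theta>0 where \<theta>0: "\<forall>N. \<theta>0 N \<in> test_functions \<and> hip s (\<theta>0 N) (\<theta>0 N) \<le> M\<^sup>2 \<and>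
    (\<forall>k<N. \<bar>hip s (\<theta>0 N) (e k) - bform (\<theta>0 N) (\<theta>0 N) (e k) - F (e k)\<bar> \<le> sqrt (1 / real (Suc N)) * M)"
    using galerkin_sequence[OF et] ..
  note t0 = conjunct1[OF spec[OF \<theta>0]] and h0 = conjunct1[OF conjunct2[OF spec[OF \<theta>0]]]
    and g0 = conjunct2[OF conjunct2[OF spec[OF \<theta>0]], rule_format]
  have bd: "bounded (range (\<lambda>N. hip s (\<theta>0 N) (e k)))" for k
  proof (rule boundedI, clarify)
    fix N
    have "sqrt (hip s (\<theta>0 N) (\<theta>0 N)) \<le> M" using real_sqrt_le_mono[OF h0[of N]] M by simp
    then have "sqrt (hip s (\<theta>0 N) (\<theta>0 N)) * sqrt (hip s (e k) (e k)) \<le> M * sqrt (hip s (e k) (e k))"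
      by (intro mult_right_mono) (simp_all add: ip_pos et)
    then show "norm (hip s (\<theta>0 N) (e k)) \<le> M * sqrt (hip s (e k) (e k))"
      using abs_ip_le[OF t0 et, of N k] by simp
  qed
  obtain r where r: "strict_mono r \<and> (\<forall>k. convergent (\<lambda>N. hip s (\<theta>0 (r N)) (e k)))"
    using diagonal_convergent[of "\<lambda>k N. hip s (\<theta>0 N) (e k)", OF bd] ..
  note rm = conjunct1[OF r] and rc = conjunct2[OF r, rule_format]
  define \<theta> where "\<theta> N = \<theta>0 (r N)" for N
  have \<theta>: "\<theta> N \<in> test_functions" and bdd: "hip s (\<theta> N) (\<theta> N) \<le> M\<^sup>2" for N
    unfolding \<theta>_def by (rule t0, rule h0)
  have weak: "weakly_convergent \<theta>"
    unfolding weakly_convergent_def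
  proof (intro allI impI)
    fix l :: "(real^'n \<Rightarrow> real) \<Rightarrow> real" and C
    assume l: "\<forall>u\<in>test_functions. \<forall>v\<in>test_functions. \<forall>a b. l (\<lambda>x. a * u x + b * v x) = a * l u + b * l v"
      and lb: "\<forall>u\<in>test_functions. \<bar>l u\<bar> \<le> C * sqrt (hip s u u)"
    have dense: "\<exists>k. hip s (\<lambda>x. v x - e k x) (\<lambda>x. v x - e k x) < \<epsilon>" if v: "v \<in> test_functions" and \<epsilon>: "0 < \<epsilon>" for v \<epsilon>
      using ed[OF v] \<epsilon> by blast
    show "convergent (\<lambda>N. l (\<theta> N))"
      by (rule weakly_cauchy[OF \<theta> bdd et dense rc[folded \<theta>_def]]) (use l lb in blast)+
  qed
  obtain \<psi> where \<psi>: "(\<forall>m. \<psi> m \<in> midpoint_hull \<theta> m) \<and>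
    (\<forall>e>0. \<exists>N. \<forall>m\<ge>N. \<forall>k\<ge>N. hip s (\<lambda>x. \<psi> m x - \<psi> k x) (\<lambda>x. \<psi> m x - \<psi> k x) < e)"
    using mazur[OF \<theta> bdd] ..
  note \<psi>h = conjunct1[OF \<psi>, rule_format] and \<psi>c = conjunct2[OF \<psi>, rule_format]
  note \<psi>t = midpoint_hull_in[OF \<theta> \<psi>h]
  have \<psi>M: "sqrt (hip s (\<psi> m) (\<psi> m)) \<le> M" for m
    using real_sqrt_le_mono[OF hull_ip_le[OF \<theta> bdd \<psi>h[of m]]] M by simp
  obtain \<Theta> where \<Theta>H: "\<Theta> \<in> Hdot_fun s"
    and \<Theta>l: "(\<lambda>k. \<integral>x. \<bar>\<psi> k x - \<Theta> x\<bar> powr p \<partial>lborel) \<longlonglongrightarrow> 0 \<and>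
    (\<forall>\<phi>\<in>test_functions. \<exists>l. (\<lambda>k. hip s (\<psi> k) \<phi>) \<longlonglongrightarrow> l \<and>
      frac_lap (2 * s) (distr_of (\<lambda>x. of_real (\<Theta> x))) (\<lambda>x. of_real (\<phi> x)) = of_real l)"
    using Hdot_limit[where \<psi>=\<psi>, OF s \<psi>t \<psi>c, folded p_eq] ..
  note lim = conjunct1[OF \<Theta>l] and frac = conjunct2[OF \<Theta>l, rule_format]
  have \<Theta>L: "\<Theta> \<in> Lp p" using \<Theta>H unfolding Hdot_fun_def p_eq by simp
  have eq_e: "l = bform \<Theta> \<Theta> (e k) + F (e k)" if l: "(\<lambda>m. hip s (\<psi> m) (e k)) \<longlonglongrightarrow> l" for k l
  proof -
    obtain L where L: "(\<lambda>N. hip s (\<theta> N) (e k)) \<longlonglongrightarrow> L" using convergentD[OF rc[of k]] unfolding \<theta>_def ..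
    have "(\<lambda>m. hip s (\<psi> m) (e k)) \<longlonglongrightarrow> L"
      by (rule hull_functional_limit[of "\<lambda>u. hip s u (e k)", OF ip_lin[OF _ _ et] \<theta> L \<psi>h])
    then have Ll: "L = l" using l by (rule LIMSEQ_unique)
    have b: "(\<lambda>N. bform (\<theta> N) (\<theta> N) (e k)) \<longlonglongrightarrow> bform \<Theta> \<Theta> (e k)"
      by (rule bform_converges[OF \<theta> bdd weak \<psi>h \<Theta>L lim et])
    have "(\<lambda>N. sqrt (1 / real (Suc N)) * M) \<longlonglongrightarrow> sqrt 0 * M"
      by (intro tendsto_intros LIMSEQ_inverse_real_of_nat[unfolded inverse_eq_divide])
    then have "(\<lambda>N. sqrt (1 / real (Suc N)) * M) \<longlonglongrightarrow> 0" by simp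
    from LIMSEQ_subseq_LIMSEQ[OF this rm]
    have z: "(\<lambda>N. sqrt (1 / real (Suc (r N))) * M) \<longlonglongrightarrow> 0" unfolding o_def .
    have "(\<lambda>N. hip s (\<theta> N) (e k) - bform (\<theta> N) (\<theta> N) (e k) - F (e k)) \<longlonglongrightarrow> 0"
    proof (rule Lim_null_comparison[OF _ z])
      have "norm (hip s (\<theta> N) (e k) - bform (\<theta> N) (\<theta> N) (e k) - F (e k)) \<le> sqrt (1 / real (Suc (r N))) * M"
        if "Suc k \<le> N" for N
      proof -
        have "k < r N" using seq_suble[OF rm, of N] that by linarith
        from g0[OF this] show ?thesis unfolding \<theta>_def by simp
      qed
      then show "\<forall>\<^sub>F N in sequentially. norm (hip s (\<theta> N) (e k) - bform (\<theta> N) (\<theta> N) (e k) - F (e k))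
          \<le> sqrt (1 / real (Suc (r N))) * M"
        unfolding eventually_sequentially by blast
    qed
    moreover have "(\<lambda>N. hip s (\<theta> N) (e k) - bform (\<theta> N) (\<theta> N) (e k) - F (e k)) \<longlonglongrightarrow> l - bform \<Theta> \<Theta> (e k) - F (e k)"
      using L b unfolding Ll by (intro tendsto_intros)
    ultimately have "0 = l - bform \<Theta> \<Theta> (e k) - F (e k)" by (rule LIMSEQ_unique)
    then show ?thesis by simp
  qed
  have eq: "l = bform \<Theta> \<Theta> \<phi> + F \<phi>" if \<phi>: "\<phi> \<in> test_functions" and l: "(\<lambda>m. hip s (\<psi> m) \<phi>) \<longlonglongrightarrow> l" for \<phi> l
  proof -
    obtain R :: nat where R: "\<forall>\<epsilon>>0. \<exists>k. support (\<lambda>x. \<phi> x - e k x) \<subseteq> cball 0 (real R) \<and>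
      hip s (\<lambda>x. \<phi> x - e k x) (\<lambda>x. \<phi> x - e k x) < \<epsilon> \<and> (\<forall>x. norm (grad (\<lambda>x. \<phi> x - e k x) x) \<le> \<epsilon>)"
      using ed[OF \<phi>] ..
    define D where "D = sqrt (local_energy (real R) \<Theta>) * sqrt (local_energy (real R) (V \<Theta>))"
    have D: "0 \<le> D" unfolding D_def by (intro mult_nonneg_nonneg real_sqrt_ge_zero local_energy_nonneg)
    define Z where "Z = \<bar>l - (bform \<Theta> \<Theta> \<phi> + F \<phi>)\<bar>"
    \<comment> \<open>Every term of the equation is continuous in \<open>\<phi>\<close> for the approximation by members of the sequence, in
      which supports stay in one ball.\<close>
    have key: "Z \<le> 2 * M * sqrt \<epsilon> + \<epsilon> * D" if \<epsilon>: "0 < \<epsilon>" for \<epsilon>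
    proof -
      obtain k where k: "support (\<lambda>x. \<phi> x - e k x) \<subseteq> cball 0 (real R) \<and>
        hip s (\<lambda>x. \<phi> x - e k x) (\<lambda>x. \<phi> x - e k x) < \<epsilon> \<and> (\<forall>x. norm (grad (\<lambda>x. \<phi> x - e k x) x) \<le> \<epsilon>)"
        using R[rule_format, OF \<epsilon>] ..
      note k1 = conjunct1[OF k] and k2 = conjunct1[OF conjunct2[OF k]] and k3 = conjunct2[OF conjunct2[OF k], rule_format]
      let ?d = "\<lambda>x. \<phi> x - e k x"
      have dt: "?d \<in> test_functions" by (rule test_diff[OF \<phi> et])
      have sd: "sqrt (hip s ?d ?d) \<le> sqrt \<epsilon>" using k2 by simp
      obtain le where le: "(\<lambda>m. hip s (\<psi> m) (e k)) \<longlonglongrightarrow> le" using frac[OF et[of k]] by blast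
      have "\<bar>l - le\<bar> \<le> M * sqrt \<epsilon>"
      proof (rule LIMSEQ_le_const2[OF tendsto_rabs[OF tendsto_diff[OF l le]]], intro exI allI impI)
        fix m
        have "\<bar>hip s (\<psi> m) ?d\<bar> \<le> sqrt (hip s (\<psi> m) (\<psi> m)) * sqrt (hip s ?d ?d)" by (rule abs_ip_le[OF \<psi>t dt])
        also have "\<dots> \<le> M * sqrt \<epsilon>" using \<psi>M sd M ip_pos[OF dt] by (intro mult_mono) auto
        finally show "\<bar>hip s (\<psi> m) \<phi> - hip s (\<psi> m) (e k)\<bar> \<le> M * sqrt \<epsilon>"
          unfolding ip_diff_right[OF \<phi> et \<psi>t] .
      qed
      moreover have "\<bar>bform \<Theta> \<Theta> \<phi> - bform \<Theta> \<Theta> (e k)\<bar> \<le> \<epsilon> * D"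
        using bform_bound(2)[OF \<Theta>L \<Theta>L dt k1 k3] unfolding bform_diff3[OF \<Theta>L \<Theta>L \<phi> et] D_def .
      moreover have "\<bar>F \<phi> - F (e k)\<bar> \<le> M * sqrt \<epsilon>"
      proof -
        have "F ?d = F \<phi> - F (e k)" using F_lin[OF \<phi> et, of 1 "-1" k] by simp
        moreover have "M * sqrt (hip s ?d ?d) \<le> M * sqrt \<epsilon>" using sd M by (intro mult_left_mono)
        ultimately show ?thesis using F_bound[OF dt] by simp
      qed
      ultimately show ?thesis using eq_e[OF le] unfolding Z_def by linarith
    qed
    have "Z \<le> 0"
    proof (rule tendsto_lowerbound)
      have "((\<lambda>\<epsilon>. 2 * M * sqrt \<epsilon> + \<epsilon> * D) \<longlongrightarrow> 2 * M * sqrt 0 + 0 * D) (at_right 0)"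
        by (intro tendsto_intros)
      then show "((\<lambda>\<epsilon>. 2 * M * sqrt \<epsilon> + \<epsilon> * D) \<longlongrightarrow> 0) (at_right 0)" by simp
      show "\<forall>\<^sub>F \<epsilon> in at_right 0. Z \<le> 2 * M * sqrt \<epsilon> + \<epsilon> * D"
        using eventually_at_right_less[of "0::real"] by eventually_elim (rule key)
    qed simp
    then show ?thesis unfolding Z_def by simp
  qed
  show ?thesis
  proof (intro bexI[OF _ \<Theta>H] ballI)
    fix \<phi> :: "real^'n \<Rightarrow> real" assume \<phi>: "\<phi> \<in> test_functions"
    obtain l where l: "(\<lambda>k. hip s (\<psi> k) \<phi>) \<longlonglongrightarrow> l \<and>
      frac_lap (2 * s) (distr_of (\<lambda>x. of_real (\<Theta> x))) (\<lambda>x. of_real (\<phi> x)) = of_real l" using frac[OF \<phi>] ..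
    show "frac_lap (2 * s) (distr_of (\<lambda>x. of_real (\<Theta> x))) (\<lambda>x. of_real (\<phi> x)) = of_real (bform \<Theta> \<Theta> \<phi> + F \<phi>)"
      using conjunct2[OF l] unfolding eq[OF \<phi> conjunct1[OF l]] .
  qed
qed

end

section \<open>Existence of a stationary solution\<close>

lemma Lp_norm_powr:
  assumes "0 < p" shows "Lp_norm p g powr p = (\<integral>x. norm (g x) powr p \<partial>lborel)"
proof -
  have "0 \<le> (\<integral>x. norm (g x) powr p \<partial>lborel)" by (intro integral_nonneg_AE) auto
  then show ?thesis using assms unfolding Lp_norm_def by (simp add: powr_powr)
qed

theorem theorem1:
  fixes \<alpha> :: real
    and A :: "'n::finite \<Rightarrow> (real^'n \<Rightarrow> real) \<Rightarrow> real^'n \<Rightarrow> real"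
    and f :: "'n distr"
  assumes "CARD('n) \<ge> 2"
    and "0 < \<alpha>" and "\<alpha> < 2"
    and "\<And>i. singular_integral_operator (A i)"
    and "\<And>p. 1 < p \<Longrightarrow> \<exists>C. \<forall>\<theta>\<in>Lp p.
           vec_op A \<theta> \<in> Lp p \<and> Lp_norm p (vec_op A \<theta>) \<le> C * Lp_norm p \<theta>"
    and "\<And>p \<theta> \<phi>. 1 < p \<Longrightarrow> \<theta> \<in> Lp p \<Longrightarrow> \<phi> \<in> test_functions \<Longrightarrow>
           distr_div (vec_op A \<theta>) \<phi> = 0"
    and "f \<in> Hdot (- (\<alpha> / 2))" and "real_distr f"
  shows "\<exists>\<theta>\<in>Hdot_fun (\<alpha> / 2). weak_solution \<alpha> A f \<theta>"
proof -
  define s where "s = \<alpha> / 2"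
  define p where "p = 2 * real CARD('n) / (real CARD('n) - 2 * s)"
  have s: "0 < s" "s \<le> 1" "2 * s < CARD('n)" and \<alpha>: "2 * s = \<alpha>"
    unfolding s_def using assms(1-3) by auto
  have p2: "2 < p" unfolding p_def by (rule sobolev_inequality_integral(1)[OF s])
  then have p1: "1 < p" and p0: "0 < p" by auto
  obtain C where C: "\<forall>\<theta>\<in>Lp p. vec_op A \<theta> \<in> Lp p \<and> Lp_norm p (vec_op A \<theta>) \<le> C * Lp_norm p \<theta>"
    using assms(5)[OF p1] ..
  \<comment> \<open>The constant is made nonnegative before it is raised to the power \<open>p\<close>.\<close>
  define C' where "C' = max C 0"
  let ?F = "\<lambda>\<phi>::real^'n \<Rightarrow> real. Re (f (\<lambda>x. of_real (\<phi> x)))"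
  have fH: "f \<in> Hdot (- s)" using assms(7) unfolding s_def .
  obtain M where M: "M \<ge> 0 \<and> (\<forall>\<phi>\<in>test_functions. norm (f (\<lambda>x. of_real (\<phi> x))) \<le> M * sqrt (hip s \<phi> \<phi>))"
    using Hdot_dual_bound_test[OF fH] s by auto
  have f_lin: "f (\<lambda>x. a * \<phi> x + b * \<psi> x) = a * f \<phi> + b * f \<psi>" if "\<phi> \<in> schwartz" "\<psi> \<in> schwartz" for a b \<phi> \<psi>
    using fH that unfolding Hdot_def frac_lap_defined_def tempered_def by blast
  have div: "(\<integral>x. vec_op A u x \<bullet> grad \<phi> x \<partial>lborel) = 0" if "u \<in> Lp p" "\<phi> \<in> test_functions" for u \<phi>
    using assms(6)[OF p1 that] unfolding distr_div_def grad_def by simp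
  interpret stationary_problem p "vec_op A" "C' powr p" s M ?F
  proof
    show "vec_op A u \<in> Lp p" if "u \<in> Lp p" for u using C that by blast
    show "(\<integral>x. norm (vec_op A u x) powr p \<partial>lborel) \<le> C' powr p * (\<integral>x. \<bar>u x\<bar> powr p \<partial>lborel)" if u: "u \<in> Lp p" for u
    proof -
      have n0: "0 \<le> Lp_norm p u" "0 \<le> Lp_norm p (vec_op A u)" unfolding Lp_norm_def by auto
      have "Lp_norm p (vec_op A u) \<le> C * Lp_norm p u" using C u by blast
      also have "\<dots> \<le> C' * Lp_norm p u" unfolding C'_def using n0 by (intro mult_right_mono) auto
      finally have "Lp_norm p (vec_op A u) powr p \<le> (C' * Lp_norm p u) powr p" using n0 p0 by (intro powr_mono2) auto
      also have "\<dots> = C' powr p * Lp_norm p u powr p" by (rule powr_mult)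
      finally show ?thesis unfolding Lp_norm_powr[OF p0] by simp
    qed
    show "AE x in lborel. vec_op A (\<lambda>x. a * u x + b * w x) x = a *\<^sub>R vec_op A u x + b *\<^sub>R vec_op A w x"
      if u: "u \<in> Lp p" and w: "w \<in> Lp p" for u w :: "real^'n \<Rightarrow> real" and a b
    proof -
      have "AE x in lborel. A i (\<lambda>x. a * u x + b * w x) x = a * A i u x + b * A i w x" for i
        by (rule conjunct1[OF assms(4)[of i, unfolded singular_integral_operator_def], rule_format, OF p1 u w])
      then have "AE x in lborel. \<forall>i\<in>UNIV. A i (\<lambda>x. a * u x + b * w x) x = a * A i u x + b * A i w x"
        by (intro AE_finite_allI) auto
      then show ?thesis by eventually_elim (simp add: vec_op_def vec_eq_iff)
    qed
    show "u \<in> Lp p" if u: "u \<in> test_functions" for u :: "real^'n \<Rightarrow> real"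
      using sobolev_inequality_integral(2)[where 'n='n, OF s, folded p_def] u test_measurable[OF u]
      unfolding Lp_def by auto
    show "?F (\<lambda>x. a * u x + c * v x) = a * ?F u + c * ?F v" if "u \<in> test_functions" "v \<in> test_functions" for u v a c
      using f_lin[OF test_schwartz[OF that(1)] test_schwartz[OF that(2)], of "of_real a" "of_real c"] by simp
    show "\<bar>?F u\<bar> \<le> M * sqrt (hip s u u)" if "u \<in> test_functions" for u
      using conjunct2[OF M, rule_format, OF that] abs_Re_le_cmod order_trans by blast
  qed (use p2 s M div in \<open>auto simp: p_def\<close>)
  obtain \<Theta> where \<Theta>: "\<Theta> \<in> Hdot_fun s"
    and eq: "\<And>\<phi>. \<phi> \<in> test_functions \<Longrightarrow>
      frac_lap (2 * s) (distr_of (\<lambda>x. of_real (\<Theta> x))) (\<lambda>x. of_real (\<phi> x)) = of_real (bform \<Theta> \<Theta> \<phi> + ?F \<phi>)"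
    using solution_exists by blast
  have "weak_solution \<alpha> A f \<Theta>"
    unfolding weak_solution_def
  proof
    fix \<phi> :: "real^'n \<Rightarrow> real" assume \<phi>: "\<phi> \<in> test_functions"
    have "distr_div (\<lambda>x. \<Theta> x *\<^sub>R vec_op A \<Theta> x) \<phi> = - bform \<Theta> \<Theta> \<phi>"
      unfolding distr_div_def bform_def grad_def by simp
    moreover have "f (\<lambda>x. of_real (\<phi> x)) = of_real (?F \<phi>)"
    proof -
      have "f (\<lambda>x. cnj (of_real (\<phi> x))) = cnj (f (\<lambda>x. of_real (\<phi> x)))"
        by (rule assms(8)[unfolded real_distr_def, rule_format, OF test_schwartz[OF \<phi>]])
      then show ?thesis by (simp add: complex_eq_iff)
    qed
    ultimately show "frac_lap \<alpha> (distr_of (\<lambda>x. of_real (\<Theta> x))) (\<lambda>x. of_real (\<phi> x))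
        + of_real (distr_div (\<lambda>x. \<Theta> x *\<^sub>R vec_op A \<Theta> x) \<phi>) - f (\<lambda>x. of_real (\<phi> x)) = 0"
      using eq[OF \<phi>] unfolding \<alpha> by simp
  qed
  with \<Theta> show ?thesis unfolding s_def by blast
qed

end
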